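(* Let $\mathbb{F}_q$ be a finite field and $d,m$ positive integers with $d \mid q-1$, and put $G=G(d,m)=d^{\frac{d(d-1)}{2}}(m+1)^d$. There is an algorithm which, given $G$ vectors $v_1,\ldots,v_G\in\mathbb{F}_q^m$, in time polynomial in $G$ and $\log q$ finds two disjoint subsets $I$ and $J$ of $\{1,\ldots,G\}$ with $I\neq\emptyset$ and nonzero field elements $\gamma_j\in\mathbb{F}_q^*$ ($j\in I\cup J$) such that $\sum_{i\in I}\gamma_i^d v_i=\sum_{j\in J}\gamma_j^d v_j$. *)

theory Defs
  imports Complex_Main "HOL-Algebra.Algebra"
begin

section \<open>Model of computation\<close>

text \<open>
  Algorithms are programs of Neil Jones' language WHILE (Computability and Complexity from a
  Programming Perspective): imperative programs whose variables hold binary trees, with every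
  elementary operation and every test costing one time unit. There is no primitive arithmetic and
  no equality test on trees, and a tree constructor only allocates one cell (trees share subtrees).
  Such programs and Turing machines simulate each other with polynomial overhead, so that
  polynomial time in this model is polynomial time in bit operations.
\<close>

datatype btree = Leaf | Node btree btree

datatype expr = Var nat | LeafE | NodeE expr expr | Left expr | Right expr

datatype prog =
    Skip
  | Assign nat expr
  | Seq prog prog
  | If expr prog prog
  | While expr prog

type_synonym store = "nat \<Rightarrow> btree"

fun left :: "btree \<Rightarrow> btree" where
  "left Leaf = Leaf"
| "left (Node l r) = l"

fun right :: "btree \<Rightarrow> btree" where
  "right Leaf = Leaf"
| "right (Node l r) = r"

fun eval_expr :: "expr \<Rightarrow> store \<Rightarrow> btree" where
  "eval_expr (Var x) s = s x"
| "eval_expr LeafE s = Leaf"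
| "eval_expr (NodeE a b) s = Node (eval_expr a s) (eval_expr b s)"
| "eval_expr (Left a) s = left (eval_expr a s)"
| "eval_expr (Right a) s = right (eval_expr a s)"

fun expr_time :: "expr \<Rightarrow> nat" where
  "expr_time (Var x) = 1"
| "expr_time LeafE = 1"
| "expr_time (NodeE a b) = expr_time a + expr_time b + 1"
| "expr_time (Left a) = expr_time a + 1"
| "expr_time (Right a) = expr_time a + 1"

text \<open>\<open>exec P s t s'\<close>: started in store \<open>s\<close>, program \<open>P\<close> halts after exactly \<open>t\<close>
  time units in store \<open>s'\<close>. In tests, \<open>Leaf\<close> is false and everything else is true.\<close>

inductive exec :: "prog \<Rightarrow> store \<Rightarrow> nat \<Rightarrow> store \<Rightarrow> bool" where
  Skip: "exec Skip s 1 s"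
| Assign: "exec (Assign x e) s (expr_time e + 1) (s(x := eval_expr e s))"
| Seq: "exec P s t s' \<Longrightarrow> exec Q s' t' s'' \<Longrightarrow> exec (Seq P Q) s (t + t') s''"
| IfTrue: "eval_expr e s \<noteq> Leaf \<Longrightarrow> exec P s t s'
    \<Longrightarrow> exec (If e P Q) s (expr_time e + 1 + t) s'"
| IfFalse: "eval_expr e s = Leaf \<Longrightarrow> exec Q s t s'
    \<Longrightarrow> exec (If e P Q) s (expr_time e + 1 + t) s'"
| WhileFalse: "eval_expr e s = Leaf \<Longrightarrow> exec (While e P) s (expr_time e + 1) s"
| WhileTrue: "eval_expr e s \<noteq> Leaf \<Longrightarrow> exec P s t s' \<Longrightarrow> exec (While e P) s' t' s''
    \<Longrightarrow> exec (While e P) s (expr_time e + 1 + t + t') s''"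

lemma exec_deterministic:
  "exec P s t s' \<Longrightarrow> exec P s u s'' \<Longrightarrow> t = u \<and> s' = s''"
proof (induction arbitrary: u s'' rule: exec.induct)
  case (Skip s)
  from Skip.prems show ?case by cases auto
next
  case (Assign x e s)
  from Assign.prems show ?case by cases auto
next
  case (Seq P s t s' Q t' s2)
  from Seq.prems show ?case using Seq.hyps Seq.IH by cases (blast | simp)+
next
  case (IfTrue e s P t s' Q)
  from IfTrue.prems show ?case using IfTrue.hyps IfTrue.IH by cases (blast | simp)+
next
  case (IfFalse e s Q t s' P)
  from IfFalse.prems show ?case using IfFalse.hyps IfFalse.IH by cases (blast | simp)+
next
  case (WhileFalse e s P)
  from WhileFalse.prems show ?case using WhileFalse.hyps by cases (blast | simp)+
next
  case (WhileTrue e s P t s' t' s2)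
  from WhileTrue.prems show ?case using WhileTrue.hyps WhileTrue.IH by cases (blast | simp)+
qed

text \<open>Variable 0 holds the input at the start and the output at the end; all other variables
  are initially \<open>Leaf\<close>.\<close>

definition computes_in :: "prog \<Rightarrow> btree \<Rightarrow> btree \<Rightarrow> nat \<Rightarrow> bool" where
  "computes_in P inp out t \<longleftrightarrow>
     (\<exists>s'. exec P ((\<lambda>_. Leaf)(0 := inp)) t s' \<and> s' 0 = out)"


section \<open>Data encodings\<close>

text \<open>Naturals are encoded in binary, least significant bit first, without leading zeros.\<close>

fun enc_nat :: "nat \<Rightarrow> btree" where
  "enc_nat n = (if n = 0 then Leaf
     else Node (if odd n then Node Leaf Leaf else Leaf) (enc_nat (n div 2)))"

declare enc_nat.simps [simp del]

fun enc_list :: "('a \<Rightarrow> btree) \<Rightarrow> 'a list \<Rightarrow> btree" where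
  "enc_list f [] = Leaf"
| "enc_list f (x # xs) = Node (f x) (enc_list f xs)"

abbreviation enc_elem :: "nat list \<Rightarrow> btree" where
  "enc_elem \<equiv> enc_list enc_nat"


section \<open>Explicitly given finite fields\<close>

text \<open>
  A field of order \<open>p ^ k\<close>, written in coordinates with respect to some basis over its prime
  field: elements are their coordinate vectors in \<open>{0..<p}\<close> and addition is coordinatewise
  modulo \<open>p\<close>; multiplication is arbitrary. The field axioms force \<open>p\<close> to be prime and \<open>k > 0\<close>.
  Up to isomorphism every finite field is of this form, for every choice of basis; the power
  basis gives the usual representation by residues of polynomials modulo an irreducible one.
\<close>

definition explicit_field :: "nat \<Rightarrow> nat \<Rightarrow> nat list ring \<Rightarrow> bool" where
  "explicit_field p k F \<longleftrightarrow>
     field F \<and>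
     carrier F = {xs. length xs = k \<and> set xs \<subseteq> {..<p}} \<and>
     (\<forall>xs\<in>carrier F. \<forall>ys\<in>carrier F. xs \<oplus>\<^bsub>F\<^esub> ys = map2 (\<lambda>a b. (a + b) mod p) xs ys)"

definition unit_coords :: "nat \<Rightarrow> nat \<Rightarrow> nat list" where
  "unit_coords k i = (replicate k 0)[i := 1]"

text \<open>Multiplication is bilinear over the prime field, so the products of the basis vectors
  (the structure constants) determine it; they are how the field is given to an algorithm.\<close>

definition structure_constants :: "nat \<Rightarrow> nat list ring \<Rightarrow> nat list list list" where
  "structure_constants k F =
     map (\<lambda>i. map (\<lambda>j. unit_coords k i \<otimes>\<^bsub>F\<^esub> unit_coords k j) [0..<k]) [0..<k]"

definition enc_field :: "nat \<Rightarrow> nat \<Rightarrow> nat list ring \<Rightarrow> btree" where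
  "enc_field p k F =
     Node (enc_nat p) (enc_list (enc_list enc_elem) (structure_constants k F))"


section \<open>The computational problem\<close>

definition G :: "nat \<Rightarrow> nat \<Rightarrow> nat" where
  "G d m = d ^ (d * (d - 1) div 2) * (m + 1) ^ d"

text \<open>\<open>v i j\<close> is the \<open>j\<close>-th coordinate of the \<open>i\<close>-th vector.\<close>

definition enc_input ::
  "nat \<Rightarrow> nat \<Rightarrow> nat list ring \<Rightarrow> nat \<Rightarrow> nat \<Rightarrow> (nat \<Rightarrow> nat \<Rightarrow> nat list) \<Rightarrow> btree" where
  "enc_input p k F d m v =
     Node (enc_field p k F)
       (Node (enc_nat d)
         (enc_list (enc_list enc_elem)
            (map (\<lambda>i. map (\<lambda>j. v i j) [1..<m + 1]) [1..<G d m + 1])))"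

text \<open>A finite family \<open>(\<gamma> i)\<close>, \<open>i \<in> I\<close>, as the list of pairs of \<open>i\<close> and \<open>\<gamma> i\<close> in increasing
  order of \<open>i\<close>.\<close>

definition enc_family :: "nat set \<Rightarrow> (nat \<Rightarrow> nat list) \<Rightarrow> btree" where
  "enc_family I \<gamma> =
     enc_list (\<lambda>i. Node (enc_nat i) (enc_elem (\<gamma> i))) (sorted_list_of_set I)"

definition enc_output :: "nat set \<Rightarrow> nat set \<Rightarrow> (nat \<Rightarrow> nat list) \<Rightarrow> btree" where
  "enc_output I J \<gamma> = Node (enc_family I \<gamma>) (enc_family J \<gamma>)"

definition is_solution ::
  "nat list ring \<Rightarrow> nat \<Rightarrow> nat \<Rightarrow> (nat \<Rightarrow> nat \<Rightarrow> nat list) \<Rightarrow>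
   nat set \<Rightarrow> nat set \<Rightarrow> (nat \<Rightarrow> nat list) \<Rightarrow> bool" where
  "is_solution F d m v I J \<gamma> \<longleftrightarrow>
     I \<subseteq> {1..G d m} \<and> J \<subseteq> {1..G d m} \<and> I \<inter> J = {} \<and> I \<noteq> {} \<and>
     (\<forall>j\<in>I \<union> J. \<gamma> j \<in> carrier F - {\<zero>\<^bsub>F\<^esub>}) \<and>
     (\<forall>l\<in>{1..m}. (\<Oplus>\<^bsub>F\<^esub>i\<in>I. (\<gamma> i [^]\<^bsub>F\<^esub> d) \<otimes>\<^bsub>F\<^esub> v i l)
               = (\<Oplus>\<^bsub>F\<^esub>j\<in>J. (\<gamma> j [^]\<^bsub>F\<^esub> d) \<otimes>\<^bsub>F\<^esub> v j l))"

end

(* Starting from the G input vectors, perform d rounds of merging.  In round i every group of d^i * m + 1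
   blocks is combined along a linear dependency; each coefficient is written as C!e * g^d for one of at
   most d coset representatives C!e, the factor g is absorbed into the multipliers, and e is added to
   the label of the input vectors concerned.  After d rounds a block gives, for every label in
   {0..<d}^d, a sum U of d-th power multiples of input vectors such that summing C!e * U over the values
   e of any one label position yields 0.  Exchanging two values in a label thus flips a sign, so that among the
   rearrangements of a label with the maximal number of distinct entries the even and the odd ones have
   equal sums.

   Representatives are found without knowing a non-residue.  Write q - 1 = B * D with B prime to d and D
   dividing a power of d.  The elements met so far generate a cyclic group, stored as a tower of
   steps of index at most d, in which sifting decides whether quotients are d-th powers.  If more than
   d representatives seem necessary, one of them has a d-th power outside this group; adjoining it at least
   doubles the group and the rounds are restarted, hence at most log q times. *)
theory Submission
  imports Defs "HOL-Library.Sublist"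
begin

text \<open>A non-residue would give all coset representatives at once, but no deterministic
  polynomial-time search for one is known. So only cosets that occur are named, and they are told
  apart only relative to the group generated so far. The error is one-sided: a returned
  factorization \<open>\<alpha> = C ! e \<otimes> g [^] d\<close> is certified by the computation
  itself, whereas a missed one can only make \<open>C\<close> too long. The \<open>d\<close>-th
  powers have at most \<open>d\<close> cosets, so an overlong \<open>C\<close> proves that something
  was missed.

  Block vectors after \<open>i\<close> rounds have dimension \<open>d ^ i * m\<close>: one
  coordinate for each label of length \<open>i\<close> and each coordinate of the input vectors.
  Hence one more block than that is always dependent, and the product of the numbers
  \<open>d ^ l * m + 1\<close> for \<open>l < d\<close> counts the input vectors that are consumed;
  \<open>G\<close> is an upper bound for it.

  Running time is a second theme. Sizes must be bounded in every state that the loops reach,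
  including those of a run that will be discarded. Therefore weak invariants about shape and
  membership are proved apart from the strong ones about sums.\<close>

abbreviation "enc_vec \<equiv> enc_list enc_elem"
abbreviation "on_fst f \<equiv> %z. f (fst z)"

section \<open>Programs that use a single variable\<close>

abbreviation st :: "btree \<Rightarrow> store" where
 "st x \<equiv> (%_. Leaf)(0 := x)"

text \<open>The final store is again of the form \<open>st y\<close>, with \<open>Leaf\<close> in
  every other variable, so that such runs can be chained by \<open>Seq\<close>.\<close>

definition runs :: "prog \<Rightarrow> btree \<Rightarrow> nat \<Rightarrow> btree \<Rightarrow> bool" where
 "runs P x t y \<longleftrightarrow> exec P (st x) t (st y)"

lemma runs_Assign: "runs (Assign 0 e) x (expr_time e + 1) (eval_expr e (st x))"
 using exec.Assign[of 0 e "st x"] by (simp add: runs_def)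

lemma runs_Assign': "eval_expr e (st x) = y ==> runs (Assign 0 e) x (expr_time e + 1) y"
 using runs_Assign by metis

lemma runs_Seq: "runs P x t y ==> runs Q y u z ==> runs (Seq P Q) x (t + u) z"
 unfolding runs_def by (rule exec.Seq)

lemma runs_WhileFalse: "eval_expr e (st x) = Leaf ==> runs (While e P) x (expr_time e + 1) x"
 unfolding runs_def by (rule exec.WhileFalse)

lemma runs_WhileTrue:
 "eval_expr e (st x) \<noteq> Leaf ==> runs P x t y ==> runs (While e P) y u z
  ==> runs (While e P) x (expr_time e + 1 + t + u) z"
 unfolding runs_def by (rule exec.WhileTrue)

lemma runs_IfTrue:
 "eval_expr e (st x) \<noteq> Leaf ==> runs P x t y ==> runs (If e P Q) x (expr_time e + 1 + t) y"
 unfolding runs_def by (rule exec.IfTrue)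

lemma runs_IfFalse:
 "eval_expr e (st x) = Leaf ==> runs Q x t y ==> runs (If e P Q) x (expr_time e + 1 + t) y"
 unfolding runs_def by (rule exec.IfFalse)

lemma ex_le_runs: "runs P x t y ==> t \<le> u ==> \<exists>t\<le>u. runs P x t y"
 by blast

section \<open>Polynomial bounds and polynomial-time computability, uniform over problem
  instances\<close>

text \<open>The base \<open>N i + 2\<close> is at least 2, so a constant \<open>c\<close> lies below
  the \<open>c\<close>-th power and a sum of two powers is absorbed by one more factor. The exponent
  is chosen before the instance, which makes the bound uniform.\<close>

definition pb :: "('i \<Rightarrow> nat) \<Rightarrow> 'i set \<Rightarrow> ('i \<Rightarrow> nat) \<Rightarrow> bool" where
 "pb N D f \<longleftrightarrow> (\<exists>c. \<forall>i\<in>D. f i \<le> (N i + 2) ^ c)"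

lemma pb_le: "pb N D g ==> (\<And>i. i \<in> D ==> f i \<le> g i) ==> pb N D f"
 unfolding pb_def by (meson order_trans)

lemma pb_const [intro!]: "pb N D (%_. c)"
proof -
 have "c \<le> (N i + 2) ^ c" for i
 proof -
  have "c \<le> 2 ^ c" by (rule less_imp_le, rule less_exp)
  also have "\<dots> \<le> (N i + 2) ^ c" by (rule power_mono) auto
  finally show ?thesis .
 qed
 then show ?thesis unfolding pb_def by blast
qed

lemma pb_N [intro!]: "pb N D N"
 unfolding pb_def by (rule exI[of _ 1]) simp

lemma pb_add [intro!]:
 assumes "pb N D f" "pb N D g" shows "pb N D (%i. f i + g i)"
proof -
 obtain a b where a: "\<forall>i\<in>D. f i \<le> (N i + 2) ^ a" and b: "\<forall>i\<in>D. g i \<le> (N i + 2) ^ b"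
  using assms unfolding pb_def by blast
 have "f i + g i \<le> (N i + 2) ^ (Suc (a + b))" if "i \<in> D" for i
 proof -
  have "(N i + 2) ^ a \<le> (N i + 2) ^ (a + b)" "(N i + 2) ^ b \<le> (N i + 2) ^ (a + b)"
   by (rule power_increasing; simp)+
  then have "f i \<le> (N i + 2) ^ (a + b)" "g i \<le> (N i + 2) ^ (a + b)"
   using a b that by (meson order_trans)+
  then have "f i + g i \<le> 2 * (N i + 2) ^ (a + b)" by simp
  also have "\<dots> \<le> (N i + 2) * (N i + 2) ^ (a + b)" by (intro mult_right_mono) auto
  finally show ?thesis by simp
 qed
 then show ?thesis unfolding pb_def by blast
qed

lemma pb_mult [intro!]:
 assumes "pb N D f" "pb N D g" shows "pb N D (%i. f i * g i)"
proof -
 obtain a b where a: "\<forall>i\<in>D. f i \<le> (N i + 2) ^ a" and b: "\<forall>i\<in>D. g i \<le> (N i + 2) ^ b"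
  using assms unfolding pb_def by blast
 have "\<forall>i\<in>D. f i * g i \<le> (N i + 2) ^ (a + b)"
  using a b by (auto simp: power_add intro!: mult_mono)
 then show ?thesis unfolding pb_def by blast
qed

lemma pb_Suc [intro!]: "pb N D f ==> pb N D (%i. Suc (f i))"
 using pb_add[OF _ pb_const[of N D 1]] by simp

lemma pb_power [intro!]: "pb N D f ==> pb N D (%i. f i ^ c)"
 by (induction c) auto

lemma pb_subset: "pb N D f ==> D' \<subseteq> D ==> pb N D' f"
 unfolding pb_def by blast

lemma pb_reindex: "pb N D f ==> (\<And>z. z \<in> D' ==> h z \<in> D) ==> pb (%z. N (h z)) D' (%z. f (h z))"
 unfolding pb_def by blast

text \<open>\<open>i\<close> ranges over problem instances, \<open>N i\<close> measures their size and \<open>Xi i\<close> is the environment, from which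
 \<open>Y i\<close> is computed in time polynomial in \<open>N i\<close>. The untouched \<open>r\<close> serves as a stack, so that one variable suffices.
 Under iteration the instance is extended by the loop state, hence the pairs \<open>z\<close> with \<open>fst z\<close> the old instance.\<close>

definition pt :: "('i \<Rightarrow> nat) \<Rightarrow> 'i set \<Rightarrow> ('i \<Rightarrow> btree) \<Rightarrow> ('i \<Rightarrow> btree) \<Rightarrow> bool" where
 "pt N D Xi Y \<longleftrightarrow> pb N D (%i. size (Xi i)) \<and> pb N D (%i. size (Y i)) \<and>
   (\<exists>P T. pb N D T \<and> (\<forall>i\<in>D. \<forall>r. \<exists>t\<le>T i. runs P (Node (Xi i) r) t (Node (Y i) r)))"

lemma pt_size: "pt N D Xi Y ==> pb N D (%i. size (Y i))"
 unfolding pt_def by simp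

lemma pt_env_size: "pt N D Xi Y ==> pb N D (%i. size (Xi i))"
 unfolding pt_def by simp

lemma ptI:
 assumes "pb N D (%i. size (Xi i))" "pb N D (%i. size (Y i))" "pb N D T"
  "\<And>i r. i \<in> D ==> \<exists>t\<le>T i. runs P (Node (Xi i) r) t (Node (Y i) r)"
 shows "pt N D Xi Y"
 unfolding pt_def using assms by blast

lemma ptE:
 assumes "pt N D Xi Y"
 obtains P T where "pb N D T" "\<And>i r. i \<in> D ==> \<exists>t\<le>T i. runs P (Node (Xi i) r) t (Node (Y i) r)"
 using assms unfolding pt_def by blast

lemma pt_cong: "pt N D Xi Y ==> (\<And>i. i \<in> D ==> Y i = Y' i) ==> pt N D Xi Y'"
 unfolding pt_def pb_def by simp

lemma pt_sub: "pt N D Xi Y ==> D' \<subseteq> D ==> pt N D' Xi Y"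
 unfolding pt_def by (meson pb_subset subsetD)

text \<open>The program is chosen before the instance, so the program for the instances
  \<open>h z\<close> serves unchanged for the instances \<open>z\<close>. This is how facts about
  outer data are used inside a loop body.\<close>

lemma pt_reindex:
 assumes "pt N D Xi Y" "\<And>z. z \<in> D' ==> h z \<in> D"
 shows "pt (%z. N (h z)) D' (%z. Xi (h z)) (%z. Y (h z))"
proof -
 obtain P T where T: "pb N D T" "\<And>i r. i \<in> D ==> \<exists>t\<le>T i. runs P (Node (Xi i) r) t (Node (Y i) r)"
  by (rule ptE[OF assms(1)]) blast
 show ?thesis
  by (rule ptI[where P = P and T = "%z. T (h z)"], rule pb_reindex[OF pt_env_size[OF assms(1)]],
    rule assms(2), assumption, rule pb_reindex[OF pt_size[OF assms(1)]],
    rule assms(2), assumption, rule pb_reindex[OF T(1)], rule assms(2), assumption, rule T(2), rule assms(2))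
qed

section \<open>Composition, pairing, branching and folding\<close>

lemma pt_comp:
 assumes "pt N D Xi Y" "pt N D Y Z" shows "pt N D Xi Z"
proof -
 obtain P T where T: "pb N D T" "\<And>i r. i \<in> D ==> \<exists>t\<le>T i. runs P (Node (Xi i) r) t (Node (Y i) r)"
  by (rule ptE[OF assms(1)]) blast
 obtain Q U where U: "pb N D U" "\<And>i r. i \<in> D ==> \<exists>t\<le>U i. runs Q (Node (Y i) r) t (Node (Z i) r)"
  by (rule ptE[OF assms(2)]) blast
 show ?thesis
 proof (rule ptI[where P = "Seq P Q" and T = "%i. T i + U i"])
  fix i r assume "i \<in> D"
  then obtain t u where "t \<le> T i" "u \<le> U i" "runs P (Node (Xi i) r) t (Node (Y i) r)"
   "runs Q (Node (Y i) r) u (Node (Z i) r)" using T U by meson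
  then show "\<exists>t\<le>T i + U i. runs (Seq P Q) (Node (Xi i) r) t (Node (Z i) r)"
   by (intro exI[of _ "t + u"]) (auto intro: runs_Seq)
 qed (use T U pt_size[OF assms(2)] pt_env_size[OF assms(1)] in auto)
qed

lemma pt_Assign:
 assumes "\<And>i r. i \<in> D ==> eval_expr e (st (Node (Xi i) r)) = Node (Y i) r"
  and "pb N D (%i. size (Xi i))" and "pb N D (%i. size (Y i))"
 shows "pt N D Xi Y"
proof (rule ptI[where P = "Assign 0 e" and T = "%_. expr_time e + 1"])
 show "\<exists>t\<le>expr_time e + 1. runs (Assign 0 e) (Node (Xi i) r) t (Node (Y i) r)" if "i \<in> D" for i r
  using runs_Assign'[OF assms(1)[OF that]] by blast
qed (use assms in auto)

lemma pt_id: "pb N D (%i. size (Xi i)) ==> pt N D Xi Xi"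
 by (rule pt_Assign[where e = "Var 0"]) auto

lemma pt_self: "pt N D Xi Y ==> pt N D Xi Xi"
 by (rule pt_id[OF pt_env_size])

lemma pt_Leaf: "pt N D Xi Xi ==> pt N D Xi (%_. Leaf)"
 by (rule pt_Assign[where e = "NodeE LeafE (Right (Var 0))"]) (auto dest: pt_env_size)

lemma pt_left: "pt N D Xi Y ==> pt N D Xi (%i. left (Y i))"
proof -
 assume Y: "pt N D Xi Y"
 have "pt N D Y (%i. left (Y i))"
 proof (rule pt_Assign[where e = "NodeE (Left (Left (Var 0))) (Right (Var 0))"])
  show "pb N D (%i. size (left (Y i)))"
   by (rule pb_le[OF pt_size[OF Y]]) (case_tac "Y i"; simp)
 qed (use pt_size[OF Y] in simp_all)
 then show ?thesis by (rule pt_comp[OF Y])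
qed

lemma pt_right: "pt N D Xi Y ==> pt N D Xi (%i. right (Y i))"
proof -
 assume Y: "pt N D Xi Y"
 have "pt N D Y (%i. right (Y i))"
 proof (rule pt_Assign[where e = "NodeE (Right (Left (Var 0))) (Right (Var 0))"])
  show "pb N D (%i. size (right (Y i)))"
   by (rule pb_le[OF pt_size[OF Y]]) (case_tac "Y i"; simp)
 qed (use pt_size[OF Y] in simp_all)
 then show ?thesis by (rule pt_comp[OF Y])
qed

text \<open>The environment is consumed by a computation, so it is duplicated first:
  \<open>P\<close> works on one copy while the other waits on the stack, and the result of
  \<open>P\<close> then changes places with that copy before \<open>Q\<close> runs.\<close>

lemma pt_Node:
 assumes "pt N D Xi Y" "pt N D Xi Z" shows "pt N D Xi (%i. Node (Y i) (Z i))"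
proof -
 obtain P T where T: "pb N D T" "\<And>i r. i \<in> D ==> \<exists>t\<le>T i. runs P (Node (Xi i) r) t (Node (Y i) r)"
  by (rule ptE[OF assms(1)]) blast
 obtain Q U where U: "pb N D U" "\<And>i r. i \<in> D ==> \<exists>t\<le>U i. runs Q (Node (Xi i) r) t (Node (Z i) r)"
  by (rule ptE[OF assms(2)]) blast
 let ?v = "Var 0"
 let ?e1 = "NodeE (Left ?v) ?v"
 let ?e2 = "NodeE (Left (Right ?v)) (NodeE (Left ?v) (Right (Right ?v)))"
 let ?e3 = "NodeE (NodeE (Left (Right ?v)) (Left ?v)) (Right (Right ?v))"
 let ?P = "Seq (Assign 0 ?e1) (Seq P (Seq (Assign 0 ?e2) (Seq Q (Assign 0 ?e3))))"
 show ?thesis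
 proof (rule ptI[where P = ?P and T = "%i. T i + U i + (expr_time ?e1 + expr_time ?e2 + expr_time ?e3 + 3)"])
  fix i r assume i: "i \<in> D"
  obtain t where t: "t \<le> T i" "runs P (Node (Xi i) (Node (Xi i) r)) t (Node (Y i) (Node (Xi i) r))"
   using T i by meson
  obtain u where u: "u \<le> U i" "runs Q (Node (Xi i) (Node (Y i) r)) u (Node (Z i) (Node (Y i) r))"
   using U i by meson
  have "runs ?P (Node (Xi i) r) (expr_time ?e1 + 1 + (t + (expr_time ?e2 + 1 + (u + (expr_time ?e3 + 1)))))
    (Node (Node (Y i) (Z i)) r)"
   by (rule runs_Seq[OF runs_Assign'] runs_Seq[OF t(2)] runs_Seq[OF u(2)] runs_Assign' | simp)+
  then show "\<exists>t\<le>T i + U i + (expr_time ?e1 + expr_time ?e2 + expr_time ?e3 + 3).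
    runs ?P (Node (Xi i) r) t (Node (Node (Y i) (Z i)) r)"
   by (rule ex_le_runs) (use t u in simp)
 next
  show "pb N D (%i. size (Node (Y i) (Z i)))"
   using pt_size[OF assms(1)] pt_size[OF assms(2)] by auto
 qed (insert T(1) U(1) pt_env_size[OF assms(1)], (assumption | rule pb_add pb_const)+)
qed

text \<open>A branch is required only on the instances that reach it. This is what lets partial
  operations such as \<open>hd\<close> and \<open>the\<close> be used behind a test. The bounds of
  the branches hold on complementary domains, and the sum of two powers covers both.\<close>

lemma pt_If_tree:
 assumes C: "pt N D Xi C" and Y: "pt N {i\<in>D. C i \<noteq> Leaf} Xi Y" and Z: "pt N {i\<in>D. C i = Leaf} Xi Z"
 shows "pt N D Xi (%i. if C i \<noteq> Leaf then Y i else Z i)"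
proof -
 let ?v = "Var 0"
 obtain R S where S: "pb N D S" "\<And>i r. i \<in> D ==> \<exists>t\<le>S i. runs R (Node (Xi i) r) t (Node (C i) r)"
  by (rule ptE[OF C]) blast
 obtain P T where T: "pb N {i\<in>D. C i \<noteq> Leaf} T"
  "\<And>i r. i \<in> {i\<in>D. C i \<noteq> Leaf} ==> \<exists>t\<le>T i. runs P (Node (Xi i) r) t (Node (Y i) r)"
  by (rule ptE[OF Y]) blast
 obtain Q U where U: "pb N {i\<in>D. C i = Leaf} U"
  "\<And>i r. i \<in> {i\<in>D. C i = Leaf} ==> \<exists>t\<le>U i. runs Q (Node (Xi i) r) t (Node (Z i) r)"
  by (rule ptE[OF Z]) blast
 define V where "V i = (if C i \<noteq> Leaf then T i else U i)" for i
 have V: "pb N D V"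
 proof -
  obtain a b where ab: "\<forall>i\<in>{i\<in>D. C i \<noteq> Leaf}. T i \<le> (N i + 2) ^ a"
   "\<forall>i\<in>{i\<in>D. C i = Leaf}. U i \<le> (N i + 2) ^ b"
   using T(1) U(1) unfolding pb_def by blast
  have "pb N D (%i. (N i + 2) ^ a + (N i + 2) ^ b)" by (intro pb_add pb_power pb_const pb_N)
  then show ?thesis
   by (rule pb_le) (use ab in \<open>auto simp: V_def intro: trans_le_add1 trans_le_add2\<close>)
 qed
 have sz: "pb N D (%i. size (if C i \<noteq> Leaf then Y i else Z i))"
 proof -
  obtain a b where ab: "\<forall>i\<in>{i\<in>D. C i \<noteq> Leaf}. size (Y i) \<le> (N i + 2) ^ a"
   "\<forall>i\<in>{i\<in>D. C i = Leaf}. size (Z i) \<le> (N i + 2) ^ b"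
   using pt_size[OF Y] pt_size[OF Z] unfolding pb_def by blast
  have "pb N D (%i. (N i + 2) ^ a + (N i + 2) ^ b)" by (intro pb_add pb_power pb_const pb_N)
  then show ?thesis
   by (rule pb_le) (use ab in \<open>auto intro: trans_le_add1 trans_le_add2\<close>)
 qed
 let ?e1 = "NodeE (Left ?v) ?v"
 let ?e2 = "Right ?v"
 let ?I = "If (Left ?v) (Seq (Assign 0 ?e2) P) (Seq (Assign 0 ?e2) Q)"
 let ?P = "Seq (Assign 0 ?e1) (Seq R ?I)"
 show ?thesis
 proof (rule ptI[where P = ?P and T = "%i. S i + V i + 20", OF pt_env_size[OF C] sz])
  fix i r assume i: "i \<in> D"
  obtain s where s: "s \<le> S i" "runs R (Node (Xi i) (Node (Xi i) r)) s (Node (C i) (Node (Xi i) r))"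
   using S i by meson
  have "\<exists>t\<le>V i. runs ?I (Node (C i) (Node (Xi i) r)) (expr_time (Left ?v) + 1 + (expr_time ?e2 + 1 + t))
    (Node (if C i \<noteq> Leaf then Y i else Z i) r)"
  proof (cases "C i = Leaf")
   case True
   then obtain t where "t \<le> V i" "runs Q (Node (Xi i) r) t (Node (Z i) r)"
    using U i by (auto simp: V_def)
   then show ?thesis using True
    by (intro exI[of _ t] conjI) (simp, rule runs_IfFalse, simp, rule runs_Seq[OF runs_Assign'], auto)
  next
   case False
   then obtain t where "t \<le> V i" "runs P (Node (Xi i) r) t (Node (Y i) r)"
    using T i by (auto simp: V_def)
   then show ?thesis using False
    by (intro exI[of _ t] conjI) (simp, rule runs_IfTrue, simp, rule runs_Seq[OF runs_Assign'], auto)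
  qed
  then obtain t where t: "t \<le> V i" "runs ?I (Node (C i) (Node (Xi i) r)) (expr_time (Left ?v) + 1 + (expr_time ?e2 + 1 + t))
    (Node (if C i \<noteq> Leaf then Y i else Z i) r)" by blast
  have "runs ?P (Node (Xi i) r) (expr_time ?e1 + 1 + (s + (expr_time (Left ?v) + 1 + (expr_time ?e2 + 1 + t))))
    (Node (if C i \<noteq> Leaf then Y i else Z i) r)"
   by (rule runs_Seq[OF runs_Assign'] runs_Seq[OF s(2)] t(2) | simp)+
  then show "\<exists>t\<le>S i + V i + 20. runs ?P (Node (Xi i) r) t (Node (if C i \<noteq> Leaf then Y i else Z i) r)"
   by (rule ex_le_runs) (use s t in simp)
 qed (use S V in \<open>intro pb_add pb_const\<close>)
qed

lemma length_le_size_enc_list: "length xs \<le> size (enc_list e xs)"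
 by (induction xs) auto

lemma size_enc_list_le:
 "(\<And>x. x \<in> set xs ==> size (e x) \<le> b) ==> size (enc_list e xs) \<le> length xs * (b + 1)"
proof (induction xs)
 case (Cons x xs)
 then have "size (e x) \<le> b" "size (enc_list e xs) \<le> length xs * (b + 1)" by auto
 then show ?case by simp
qed simp

lemma size_mem_enc_list: "x \<in> set xs ==> size (e x) \<le> size (enc_list e xs)"
 by (induction xs) auto

lemma pt_length_bound: "pt N D Xi (%i. enc_list e (xs i)) ==> pb N D (%i. length (xs i))"
 by (rule pb_le[OF pt_size]) (auto intro: length_le_size_enc_list)

text \<open>The body is analysed as a computation on enlarged instances \<open>(i, s, x)\<close>,
  with loop state \<open>s\<close> and list entry \<open>x\<close>; \<open>D'\<close> keeps those
  that satisfy the invariant at some index. The invariant has to bound the size of the state by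
  \<open>b\<close>: polynomially many polynomial-time steps could otherwise build exponentially
  large values. The premise \<open>step\<close> quantifies over every environment \<open>Y\<close>
  from which outer data, state and entry can be computed, so a body never depends on the layout of
  its environment.\<close>

lemma pt_fold:
 fixes Inv :: "'i \<Rightarrow> nat \<Rightarrow> 's \<Rightarrow> bool" and xs :: "'i \<Rightarrow> 'x list"
 assumes xs: "pt N D Xi (%i. enc_list e (xs i))" and s0: "pt N D Xi (%i. es (s0 i))"
  and Inv0: "\<And>i. i \<in> D ==> Inv i 0 (s0 i)"
  and Inv: "\<And>i j s. i \<in> D ==> j < length (xs i) ==> Inv i j s ==> Inv i (Suc j) (g i s (xs i ! j))"
  and sz: "pb N D b" "\<And>i j s. i \<in> D ==> j \<le> length (xs i) ==> Inv i j s ==> size (es s) \<le> b i"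
  and D': "D' = {(i, s, x). i \<in> D \<and> (\<exists>j<length (xs i). x = xs i ! j \<and> Inv i j s)}"
  and step: "\<And>Y. (\<And>A. pt N D Xi A ==> pt (on_fst N) D' Y (on_fst A)) ==>
    pt (on_fst N) D' Y Y ==>
    pt (on_fst N) D' Y (%z. es (fst (snd z))) ==>
    pt (on_fst N) D' Y (%z. e (snd (snd z))) ==>
    pt (on_fst N) D' Y (%z. es (g (fst z) (fst (snd z)) (snd (snd z))))"
 shows "pt N D Xi (%i. es (foldl (g i) (s0 i) (xs i)))"
proof -
 define E :: "('i \<times> 's \<times> 'x) \<Rightarrow> btree"
  where "E z = Node (Xi (fst z)) (Node (e (snd (snd z))) (es (fst (snd z))))" for z
 let ?N = "%z :: 'i \<times> 's \<times> 'x. N (fst z)"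
 let ?v = "Var 0"
 have szs: "pb ?N D' (%z. size (es (fst (snd z))))"
 proof (rule pb_le[OF pb_reindex[OF sz(1), where h = fst]])
  fix z assume "z \<in> D'"
  then obtain j where "fst z \<in> D" "j < length (xs (fst z))" "Inv (fst z) j (fst (snd z))"
   unfolding D' by auto
  then show "size (es (fst (snd z))) \<le> b (fst z)" using sz(2) less_imp_le by metis
 qed (auto simp: D')
 have szx: "pb ?N D' (%z. size (e (snd (snd z))))"
  by (rule pb_le[OF pb_reindex[OF pt_size[OF xs], where h = fst]])
   (auto simp: D' intro!: size_mem_enc_list)
 have szX: "pb ?N D' (%z. size (Xi (fst z)))"
  by (rule pb_reindex[OF pt_env_size[OF xs], where h = fst]) (auto simp: D')
 have szE: "pb ?N D' (%z. size (E z))" unfolding E_def using szs szx szX by auto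
 have stp: "pt ?N D' E (%z. es (g (fst z) (fst (snd z)) (snd (snd z))))"
 proof (rule step)
  fix A assume A: "pt N D Xi A"
  then have A': "pt ?N D' (on_fst Xi) (on_fst A)"
   by (rule pt_reindex) (auto simp: D')
  obtain P T where T: "pb ?N D' T"
   "\<And>i r. i \<in> D' ==> \<exists>t\<le>T i. runs P (Node (Xi (fst i)) r) t (Node (A (fst i)) r)"
   by (rule ptE[OF A']) blast
  let ?e = "NodeE (Left (Left ?v)) (Right ?v)"
  show "pt ?N D' E (on_fst A)"
  proof (rule ptI[where P = "Seq (Assign 0 ?e) P" and T = "%i. 10 + T i"])
   fix i r assume "i \<in> D'"
   then obtain t where t: "t \<le> T i" "runs P (Node (Xi (fst i)) r) t (Node (A (fst i)) r)"
    using T by meson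
   have "runs (Seq (Assign 0 ?e) P) (Node (E i) r) (expr_time ?e + 1 + t) (Node (A (fst i)) r)"
    by (rule runs_Seq[OF runs_Assign'], simp add: E_def, rule t)
   then show "\<exists>t\<le>10 + T i. runs (Seq (Assign 0 ?e) P) (Node (E i) r) t (Node (A (fst i)) r)"
    by (rule ex_le_runs) (use t in simp)
  qed (use T pt_size[OF A'] szE in auto)
 next
  show "pt ?N D' E (%z. es (fst (snd z)))"
   by (rule pt_Assign[where e = "NodeE (Right (Right (Left ?v))) (Right ?v)"])
    (use szs szE in \<open>auto simp: E_def\<close>)
  show "pt ?N D' E (%z. e (snd (snd z)))"
   by (rule pt_Assign[where e = "NodeE (Left (Right (Left ?v))) (Right ?v)"])
    (use szx szE in \<open>auto simp: E_def\<close>)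
  show "pt ?N D' E E" by (rule pt_id[OF szE])
 qed
 obtain P T where T: "pb ?N D' T"
   "\<And>i r. i \<in> D' ==> \<exists>t\<le>T i. runs P (Node (E i) r) t (Node (es (g (fst i) (fst (snd i)) (snd (snd i)))) r)"
  by (rule ptE[OF stp]) blast
 \<comment> \<open>\<open>T\<close> may depend on the loop state. The power of
   \<open>N (fst z)\<close> does not, so the length of the list times this power bounds all
   iterations together.\<close>
 obtain c where c: "\<And>z. z \<in> D' ==> T z \<le> (N (fst z) + 2) ^ c"
  using T(1) unfolding pb_def by auto
 obtain Q U where U: "pb N D U"
  "\<And>i r. i \<in> D ==> \<exists>t\<le>U i. runs Q (Node (Xi i) r) t (Node (enc_list e (xs i)) r)"
  by (rule ptE[OF xs]) blast
 obtain R V where V: "pb N D V"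
  "\<And>i r. i \<in> D ==> \<exists>t\<le>V i. runs R (Node (Xi i) r) t (Node (es (s0 i)) r)"
  by (rule ptE[OF s0]) blast
 let ?e1 = "NodeE (Left ?v) ?v"
 \<comment> \<open>At the loop head variable 0 holds, in this order, the state, the remaining list,
   the environment and the stack \<open>r\<close>. The test reads the remaining list;
   \<open>?e3\<close> assembles \<open>E\<close> from environment, entry and state, and leaves the
   tail of the list and the environment underneath.\<close>
 let ?L = "Left (Right ?v)" and ?x = "Left (Right (Right ?v))" and ?r = "Right (Right (Right ?v))"
 let ?e3 = "NodeE (NodeE ?x (NodeE (Left ?L) (Left ?v))) (NodeE (Right ?L) (NodeE ?x ?r))"
 let ?e4 = "NodeE (Left ?v) ?r"
 let ?e2 = "NodeE (Left (Right ?v)) (NodeE (Left ?v) (Right ?v))"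
 let ?B = "Seq (Assign 0 ?e3) P"
 let ?W = "While ?L ?B"
 let ?P = "Seq (Assign 0 ?e1) (Seq Q (Seq (Assign 0 ?e2) (Seq R (Seq ?W (Assign 0 ?e4)))))"
 let ?K = "%i. length (xs i) * ((N i + 2) ^ c + 50) + 50"
 have inv: "Inv i j (foldl (g i) (s0 i) (take j (xs i)))" if "i \<in> D" "j \<le> length (xs i)" for i j
  using that(2)
 proof (induction j)
  case (Suc j)
  then show ?case using Inv[OF that(1), of j] by (simp add: take_Suc_conv_app_nth)
 qed (simp add: Inv0 that)
 have loop: "\<exists>t\<le>length L * ((N i + 2) ^ c + 50) + 5.
    runs ?W (Node (es s) (Node (enc_list e L) (Node (Xi i) r))) t
        (Node (es (foldl (g i) s L)) (Node Leaf (Node (Xi i) r)))"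
  if "i \<in> D" "xs i = K @ L" "Inv i (length K) s" for i s K L r
  using that
 proof (induction L arbitrary: K s)
  case Nil
  show ?case by (rule exI[of _ "expr_time ?L + 1"], rule conjI, simp, simp only: foldl.simps enc_list.simps, rule runs_WhileFalse, simp)
 next
  case (Cons x L)
  have nth: "xs i ! length K = x" "length K < length (xs i)" using Cons.prems by auto
  have "(i, s, x) \<in> D'" using Cons.prems(1,3) nth unfolding D' by blast
  from T(2)[OF this] c[OF this] obtain t where
   t: "t \<le> (N i + 2) ^ c" "runs P (Node (E (i, s, x)) (Node (enc_list e L) (Node (Xi i) r))) t
      (Node (es (g i s x)) (Node (enc_list e L) (Node (Xi i) r)))"
   by (metis fst_conv snd_conv order_trans)
  have I: "Inv i (length (K @ [x])) (g i s x)"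
   using Inv[OF Cons.prems(1) nth(2) Cons.prems(3)] nth by simp
  from Cons.IH[of "K @ [x]" "g i s x"] Cons.prems I obtain u where
   u: "u \<le> length L * ((N i + 2) ^ c + 50) + 5"
     "runs ?W (Node (es (g i s x)) (Node (enc_list e L) (Node (Xi i) r))) u
        (Node (es (foldl (g i) (g i s x) L)) (Node Leaf (Node (Xi i) r)))"
   by auto
  have "runs ?B (Node (es s) (Node (enc_list e (x # L)) (Node (Xi i) r))) (expr_time ?e3 + 1 + t)
    (Node (es (g i s x)) (Node (enc_list e L) (Node (Xi i) r)))"
   by (rule runs_Seq[OF runs_Assign' t(2)]) (simp add: E_def)
  then have "runs ?W (Node (es s) (Node (enc_list e (x # L)) (Node (Xi i) r)))
    (expr_time ?L + 1 + (expr_time ?e3 + 1 + t) + u)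
    (Node (es (foldl (g i) (g i s x) L)) (Node Leaf (Node (Xi i) r)))"
   by (rule runs_WhileTrue[rotated, OF _ u(2)]) simp
  then show ?case
   by (unfold foldl.simps, rule ex_le_runs) (use t u in simp)
 qed
 show ?thesis
 proof (rule ptI[where P = ?P and T = "%i. U i + V i + ?K i"])
  fix i r assume i: "i \<in> D"
  let ?x = "Xi i" and ?Lt = "enc_list e (xs i)"
  obtain q where q: "q \<le> U i" "runs Q (Node ?x (Node ?x r)) q (Node ?Lt (Node ?x r))" using U i by meson
  obtain q' where q': "q' \<le> V i" "runs R (Node ?x (Node ?Lt (Node ?x r))) q' (Node (es (s0 i)) (Node ?Lt (Node ?x r)))"
   using V i by meson
  obtain t where t: "t \<le> length (xs i) * ((N i + 2) ^ c + 50) + 5"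
   "runs ?W (Node (es (s0 i)) (Node ?Lt (Node ?x r))) t
        (Node (es (foldl (g i) (s0 i) (xs i))) (Node Leaf (Node ?x r)))"
   using loop[OF i, of "[]" "xs i" "s0 i" r] Inv0 i by auto
  have "runs ?P (Node ?x r) (expr_time ?e1 + 1 + (q + (expr_time ?e2 + 1 + (q' + (t + (expr_time ?e4 + 1))))))
    (Node (es (foldl (g i) (s0 i) (xs i))) r)"
   by (rule runs_Seq[OF runs_Assign'] runs_Seq[OF q(2)] runs_Seq[OF q'(2)] runs_Seq[OF t(2)] runs_Assign' | simp)+
  then show "\<exists>t\<le>U i + V i + ?K i. runs ?P (Node ?x r) t (Node (es (foldl (g i) (s0 i) (xs i))) r)"
   by (rule ex_le_runs) (use t q q' in simp)
 next
  show "pb N D (%i. size (es (foldl (g i) (s0 i) (xs i))))"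
  proof (rule pb_le[OF sz(1)])
   fix i assume i: "i \<in> D"
   show "size (es (foldl (g i) (s0 i) (xs i))) \<le> b i"
    using sz(2)[OF i order_refl inv[OF i order_refl]] by simp
  qed
 qed (insert U(1) V(1) pt_length_bound[OF xs] pt_env_size[OF xs],
   (assumption | rule pb_add pb_mult pb_const pb_power pb_N)+)
qed

section \<open>Booleans, pairs, options and lists\<close>

definition eb :: "bool \<Rightarrow> btree" where
 "eb b = (if b then Node Leaf Leaf else Leaf)"

definition ep :: "('a \<Rightarrow> btree) \<Rightarrow> ('b \<Rightarrow> btree) \<Rightarrow> 'a \<times> 'b \<Rightarrow> btree" where
 "ep e1 e2 z = Node (e1 (fst z)) (e2 (snd z))"

definition eo :: "('a \<Rightarrow> btree) \<Rightarrow> 'a option \<Rightarrow> btree" where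
 "eo e z = (case z of None \<Rightarrow> Leaf | Some x \<Rightarrow> Node (e x) Leaf)"

lemma size_eb: "size (eb b) \<le> 1"
 by (simp add: eb_def)

lemma size_ep: "size (ep e1 e2 z) = size (e1 (fst z)) + size (e2 (snd z)) + 1"
 by (simp add: ep_def)

lemma pt_const: "pt N D Xi Xi ==> pt N D Xi (%_. c)"
 by (induction c) (auto intro: pt_Leaf pt_Node)

lemma pt_pair: "pt N D Xi (%i. e1 (a i)) ==> pt N D Xi (%i. e2 (b i)) ==> pt N D Xi (%i. ep e1 e2 (a i, b i))"
 by (simp add: ep_def pt_Node)

lemma pt_fst: "pt N D Xi (%i. ep e1 e2 (z i)) ==> pt N D Xi (%i. e1 (fst (z i)))"
 by (drule pt_left) (simp add: ep_def)

lemma pt_snd: "pt N D Xi (%i. ep e1 e2 (z i)) ==> pt N D Xi (%i. e2 (snd (z i)))"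
 by (drule pt_right) (simp add: ep_def)

lemma pt_bool: "pt N D Xi Xi ==> pt N D Xi (%_. eb b)"
 by (rule pt_const)

lemma pt_if:
 assumes "pt N D Xi (%i. eb (c i))"
  "pt N {i\<in>D. c i} Xi (%i. e (a i))" "pt N {i\<in>D. \<not> c i} Xi (%i. e (b i))"
 shows "pt N D Xi (%i. e (if c i then a i else b i))"
proof -
 have *: "(eb b = Leaf) = (\<not> b)" for b by (simp add: eb_def)
 have "pt N D Xi (%i. if eb (c i) \<noteq> Leaf then e (a i) else e (b i))"
  by (rule pt_If_tree) (use assms in \<open>simp_all add: *\<close>)
 then show ?thesis by (rule pt_cong) (simp add: *)
qed

lemma pt_if':
 assumes "pt N D Xi (%i. eb (c i))" "pt N D Xi (%i. e (a i))" "pt N D Xi (%i. e (b i))"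
 shows "pt N D Xi (%i. e (if c i then a i else b i))"
 by (rule pt_if[OF assms(1)]; rule pt_sub; (rule assms)?; auto)

lemma pt_not: "pt N D Xi (%i. eb (a i)) ==> pt N D Xi (%i. eb (\<not> a i))"
 by (rule pt_cong[OF pt_if'[where e = eb and a = "%_. False" and b = "%_. True"]])
  (auto intro: pt_bool pt_self)

lemma pt_conj: "pt N D Xi (%i. eb (a i)) ==> pt N D Xi (%i. eb (b i)) ==> pt N D Xi (%i. eb (a i \<and> b i))"
 by (rule pt_cong[OF pt_if'[where e = eb and c = a and a = b and b = "%_. False"]])
  (auto intro: pt_bool pt_self)

lemma pt_disj: "pt N D Xi (%i. eb (a i)) ==> pt N D Xi (%i. eb (b i)) ==> pt N D Xi (%i. eb (a i \<or> b i))"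
 by (rule pt_cong[OF pt_if'[where e = eb and c = a and a = "%_. True" and b = b]])
  (auto intro: pt_bool pt_self)

lemma pt_iff: "pt N D Xi (%i. eb (a i)) ==> pt N D Xi (%i. eb (b i)) ==> pt N D Xi (%i. eb (a i = b i))"
 by (rule pt_cong[OF pt_if'[where e = eb and c = a and a = b and b = "%i. \<not> b i"]])
  (auto intro: pt_not)

lemma pt_Nil: "pt N D Xi Xi ==> pt N D Xi (%_. enc_list e [])"
 by (simp add: pt_Leaf)

lemma pt_Cons: "pt N D Xi (%i. e (a i)) ==> pt N D Xi (%i. enc_list e (xs i)) ==> pt N D Xi (%i. enc_list e (a i # xs i))"
 by (simp add: pt_Node)

lemma pt_tl: "pt N D Xi (%i. enc_list e (xs i)) ==> pt N D Xi (%i. enc_list e (tl (xs i)))"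
 by (drule pt_right, erule pt_cong) (case_tac "xs i"; simp)

lemma pt_hd: "pt N D Xi (%i. enc_list e (xs i)) ==> (\<And>i. i \<in> D ==> xs i \<noteq> []) ==> pt N D Xi (%i. e (hd (xs i)))"
 by (drule pt_left, erule pt_cong) (case_tac "xs i"; force)

lemma pt_isLeaf: "pt N D Xi Y ==> pt N D Xi (%i. eb (Y i = Leaf))"
proof -
 assume Y: "pt N D Xi Y"
 have "pt N D Xi (%i. if Y i \<noteq> Leaf then eb False else eb True)"
  by (rule pt_If_tree[OF Y]) (auto intro!: pt_bool pt_sub[OF pt_self[OF Y]] intro: pt_self)
 then show ?thesis by (rule pt_cong) (simp add: eb_def)
qed

lemma pt_null: "pt N D Xi (%i. enc_list e (xs i)) ==> pt N D Xi (%i. eb (xs i = []))"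
 by (drule pt_isLeaf, erule pt_cong) (case_tac "xs i"; simp)

lemma pt_None: "pt N D Xi Xi ==> pt N D Xi (%_. eo e None)"
 by (simp add: eo_def pt_Leaf)

lemma pt_Some: "pt N D Xi (%i. e (a i)) ==> pt N D Xi (%i. eo e (Some (a i)))"
 by (auto simp: eo_def intro!: pt_Node pt_Leaf intro: pt_self)

lemma pt_is_None: "pt N D Xi (%i. eo e (a i)) ==> pt N D Xi (%i. eb (a i = None))"
 by (drule pt_isLeaf, erule pt_cong) (case_tac "a i"; simp add: eo_def)

lemma pt_the: "pt N D Xi (%i. eo e (a i)) ==> (\<And>i. i \<in> D ==> a i \<noteq> None) ==> pt N D Xi (%i. e (the (a i)))"
 by (drule pt_left, erule pt_cong) (case_tac "a i"; force simp: eo_def)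

lemma pt_ext:
 assumes szX: "pb N D (%i. size (Xi i))" and D': "\<And>z. z \<in> D' ==> fst z \<in> D"
  and sz: "pb (on_fst N) D' (%z. size (h z))"
 defines "Y \<equiv> %z. Node (Xi (fst z)) (h z)"
 shows "\<And>A. pt N D Xi A ==> pt (on_fst N) D' Y (on_fst A)"
  "pt (on_fst N) D' Y Y" "pt (on_fst N) D' Y h"
proof -
 let ?N = "%z. N (fst z)"
 have szX': "pb ?N D' (%z. size (Xi (fst z)))"
  by (rule pb_reindex[OF szX, where h = fst]) (auto simp: D')
 have szE: "pb ?N D' (%z. size (Y z))" unfolding Y_def using sz szX' by auto
 show Y: "pt ?N D' Y Y" by (rule pt_id[OF szE])
 show "pt ?N D' Y h" using pt_right[OF Y] by (simp add: Y_def)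
 have X': "pt ?N D' Y (on_fst Xi)" using pt_left[OF Y] by (simp add: Y_def)
 show "pt ?N D' Y (on_fst A)" if A: "pt N D Xi A" for A
  by (rule pt_comp[OF X' pt_reindex[OF A]]) (rule D')
qed

lemma size_enc_list: "size (enc_list e xs) = (\<Sum>x\<leftarrow>xs. size (e x) + 1)"
 by (induction xs) auto

lemma size_enc_list_append: "size (enc_list e (xs @ ys)) = size (enc_list e xs) + size (enc_list e ys)"
 by (simp add: size_enc_list)

lemma size_enc_list_rev: "size (enc_list e (rev xs)) = size (enc_list e xs)"
 by (induction xs) (simp_all add: size_enc_list_append)

lemma size_enc_list_take: "size (enc_list e (take n xs)) \<le> size (enc_list e xs)"
 by (metis append_take_drop_id le_add1 size_enc_list_append)

lemma size_enc_list_drop: "size (enc_list e (drop n xs)) \<le> size (enc_list e xs)"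
 by (metis append_take_drop_id le_add2 size_enc_list_append)

lemma take_Suc_nth: "j < length xs ==> take (Suc j) xs = take j xs @ [xs ! j]"
 by (rule take_Suc_conv_app_nth)

lemma foldl_rev_map: "foldl (%s x. f x # s) [] xs = rev (map f xs)"
 by (induction xs rule: rev_induct) auto

lemma foldl_rev_append: "foldl (%s x. x # s) ys xs = rev xs @ ys"
 by (induction xs arbitrary: ys) auto

lemma foldl_rev_concat: "foldl (%s x. rev x @ s) [] xs = rev (concat xs)"
 by (induction xs rule: rev_induct) auto

lemma pt_rev_append:
 assumes xs: "pt N D Xi (%i. enc_list e (xs i))" and ys: "pt N D Xi (%i. enc_list e (ys i))"
 shows "pt N D Xi (%i. enc_list e (rev (xs i) @ ys i))"
proof -
 have "pt N D Xi (%i. enc_list e (foldl (%s x. x # s) (ys i) (xs i)))"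
 proof (rule pt_fold[OF xs _ _ _ _ _ refl, where Inv = "%i j s. s = rev (take j (xs i)) @ ys i"
    and b = "%i. size (enc_list e (xs i)) + size (enc_list e (ys i))"])
  show "pb N D (%i. size (enc_list e (xs i)) + size (enc_list e (ys i)))"
   using pt_size[OF xs] pt_size[OF ys] by auto
 qed (auto simp: take_Suc_nth size_enc_list_append size_enc_list_rev size_enc_list_take ys intro: pt_Node)
 then show ?thesis by (simp add: foldl_rev_append)
qed

lemma pt_rev: "pt N D Xi (%i. enc_list e (xs i)) ==> pt N D Xi (%i. enc_list e (rev (xs i)))"
proof -
 assume xs: "pt N D Xi (%i. enc_list e (xs i))"
 show ?thesis using pt_rev_append[OF xs pt_Nil[OF pt_self[OF xs]]] by simp
qed

lemma pt_append: "pt N D Xi (%i. enc_list e (xs i)) ==> pt N D Xi (%i. enc_list e (ys i)) ==>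
  pt N D Xi (%i. enc_list e (xs i @ ys i))"
 by (drule pt_rev, drule pt_rev_append) auto

lemma pt_rev_concat:
 assumes xs: "pt N D Xi (%i. enc_list (enc_list e) (xs i))"
 shows "pt N D Xi (%i. enc_list e (rev (concat (xs i))))"
proof -
 have szc: "size (enc_list e (concat ys)) \<le> size (enc_list (enc_list e) ys)" for ys
  by (induction ys) (auto simp: size_enc_list_append)
 have "pt N D Xi (%i. enc_list e (foldl (%s x. rev x @ s) [] (xs i)))"
 proof (rule pt_fold[OF xs _ _ _ _ _ refl, where Inv = "%i j s. s = rev (concat (take j (xs i)))"
    and b = "%i. size (enc_list (enc_list e) (xs i))"])
  show "pt N D Xi (%i. enc_list e [])" by (rule pt_Nil[OF pt_self[OF xs]])
  show "size (enc_list e s) \<le> size (enc_list (enc_list e) (xs i))"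
   if "s = rev (concat (take j (xs i)))" for i j s
   using that szc[of "take j (xs i)"] size_enc_list_take[of "enc_list e" j "xs i"]
   by (simp add: size_enc_list_rev)
 qed (auto simp: take_Suc_nth pt_size[OF xs] intro: pt_rev_append)
 then show ?thesis by (simp add: foldl_rev_concat)
qed

lemma pt_concat:
 assumes xs: "pt N D Xi (%i. enc_list (enc_list e) (xs i))"
 shows "pt N D Xi (%i. enc_list e (concat (xs i)))"
 using pt_rev[OF pt_rev_concat[OF xs]] by simp

text \<open>The size bound that \<open>pt_fold\<close> asks for comes from the body itself:
  \<open>pt\<close> includes a polynomial bound on the size of the value, which applies to every
  entry. The result is consed up in reverse and reversed at the end.\<close>

lemma pt_map:
 fixes e :: "'x \<Rightarrow> btree" and D :: "'i set"
 assumes xs: "pt N D Xi (%i. enc_list e (xs i))"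
  and step: "\<And>Y. (\<And>A. pt N D Xi A ==> pt (on_fst N) {(i, x). i \<in> D \<and> x \<in> set (xs i)} Y (on_fst A)) ==>
    pt (on_fst N) {(i, x). i \<in> D \<and> x \<in> set (xs i)} Y Y ==>
    pt (on_fst N) {(i, x). i \<in> D \<and> x \<in> set (xs i)} Y (%z. e (snd z)) ==>
    pt (on_fst N) {(i, x). i \<in> D \<and> x \<in> set (xs i)} Y (%z. e' (f (fst z) (snd z)))"
 shows "pt N D Xi (%i. enc_list e' (map (f i) (xs i)))"
proof -
 let ?D = "{(i, x). i \<in> D \<and> x \<in> set (xs i)}" and ?N = "%z. N (fst z)"
 have sz: "pb ?N ?D (%z. size (e (snd z)))"
  by (rule pb_le[OF pb_reindex[OF pt_size[OF xs], where h = fst]]) (auto simp: size_mem_enc_list)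
 note ext = pt_ext[OF pt_env_size[OF xs] _ sz]
 let ?Y = "%z. Node (Xi (fst z)) (e (snd z))"
 have Q: "pt ?N ?D ?Y (%z. e' (f (fst z) (snd z)))"
  by (rule step) (rule ext; (assumption | force))+
 obtain c where c: "\<And>z. z \<in> ?D ==> size (e' (f (fst z) (snd z))) \<le> (N (fst z) + 2) ^ c"
  using pt_size[OF Q] unfolding pb_def by blast
 have "pt N D Xi (%i. enc_list e' (foldl (%s x. f i x # s) [] (xs i)))"
 proof (rule pt_fold[OF xs _ _ _ _ _ refl, where Inv = "%i j s. s = rev (map (f i) (take j (xs i)))"
    and b = "%i. length (xs i) * ((N i + 2) ^ c + 1)"])
  show "pt N D Xi (%i. enc_list e' [])" by (rule pt_Nil[OF pt_self[OF xs]])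
  show "pb N D (%i. length (xs i) * ((N i + 2) ^ c + 1))"
   using pt_length_bound[OF xs] by (intro pb_mult pb_add pb_power pb_N pb_const)
  show "size (enc_list e' s) \<le> length (xs i) * ((N i + 2) ^ c + 1)"
   if "i \<in> D" "j \<le> length (xs i)" "s = rev (map (f i) (take j (xs i)))" for i j s
  proof -
   have "size (enc_list e' s) \<le> length s * ((N i + 2) ^ c + 1)"
    by (rule size_enc_list_le) (use that c in \<open>auto dest!: in_set_takeD\<close>)
   also have "\<dots> \<le> length (xs i) * ((N i + 2) ^ c + 1)"
    using that by (intro mult_right_mono) auto
   finally show ?thesis .
  qed
 next
  fix Y
  let ?D3 = "{(i, s, x). i \<in> D \<and> (\<exists>j<length (xs i). x = xs i ! j \<and> s = rev (map (f i) (take j (xs i))))}"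
  assume lift: "\<And>A. pt N D Xi A ==> pt (on_fst N) ?D3 Y (on_fst A)"
   and s: "pt (on_fst N) ?D3 Y (%z. enc_list e' (fst (snd z)))"
   and x: "pt (on_fst N) ?D3 Y (%z. e (snd (snd z)))"
  have "pt (on_fst N) ?D3 Y (%z. e' (f (fst z) (snd (snd z))))"
  proof (rule pt_comp[OF pt_Node[OF lift[OF pt_self[OF xs]] x]])
   show "pt (on_fst N) ?D3 (%z. Node (Xi (fst z)) (e (snd (snd z)))) (%z. e' (f (fst z) (snd (snd z))))"
    using pt_reindex[OF Q, of ?D3 "%z. (fst z, snd (snd z))"] by force
  qed
  then show "pt (on_fst N) ?D3 Y (%z. enc_list e' (f (fst z) (snd (snd z)) # fst (snd z)))"
   by (rule pt_Cons[OF _ s])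
 qed (auto simp: take_Suc_nth)
 then have "pt N D Xi (%i. enc_list e' (rev (map (f i) (xs i))))" by (simp add: foldl_rev_map)
 from pt_rev[OF this] show ?thesis by simp
qed

lemma filter_conv_concat: "filter P xs = concat (map (%x. if P x then [x] else []) xs)"
 by (induction xs) auto

lemma pt_filter:
 fixes e :: "'x \<Rightarrow> btree" and D :: "'i set"
 assumes xs: "pt N D Xi (%i. enc_list e (xs i))"
  and step: "\<And>Y. (\<And>A. pt N D Xi A ==> pt (on_fst N) {(i, x). i \<in> D \<and> x \<in> set (xs i)} Y (on_fst A)) ==>
    pt (on_fst N) {(i, x). i \<in> D \<and> x \<in> set (xs i)} Y Y ==>
    pt (on_fst N) {(i, x). i \<in> D \<and> x \<in> set (xs i)} Y (%z. e (snd z)) ==>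
    pt (on_fst N) {(i, x). i \<in> D \<and> x \<in> set (xs i)} Y (%z. eb (P (fst z) (snd z)))"
 shows "pt N D Xi (%i. enc_list e (filter (P i) (xs i)))"
 unfolding filter_conv_concat
 by (rule pt_concat, rule pt_map[OF xs], rule pt_if', rule step) (assumption | rule pt_Cons pt_Nil)+

lemma pt_find:
 fixes e :: "'x \<Rightarrow> btree" and D :: "'i set"
 assumes xs: "pt N D Xi (%i. enc_list e (xs i))"
  and step: "\<And>Y. (\<And>A. pt N D Xi A ==> pt (on_fst N) {(i, x). i \<in> D \<and> x \<in> set (xs i)} Y (on_fst A)) ==>
    pt (on_fst N) {(i, x). i \<in> D \<and> x \<in> set (xs i)} Y Y ==>
    pt (on_fst N) {(i, x). i \<in> D \<and> x \<in> set (xs i)} Y (%z. e (snd z)) ==>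
    pt (on_fst N) {(i, x). i \<in> D \<and> x \<in> set (xs i)} Y (%z. eb (P (fst z) (snd z)))"
 shows "pt N D Xi (%i. eo e (find (P i) (xs i)))"
proof -
 have f: "find P xs = (if filter P xs = [] then None else Some (hd (filter P xs)))" for P and xs :: "'x list"
  by (induction xs) auto
 have F: "pt N D Xi (%i. enc_list e (filter (P i) (xs i)))" by (rule pt_filter[OF xs step])
 show ?thesis unfolding f
  by (rule pt_if, rule pt_null[OF F], rule pt_None, rule pt_sub[OF pt_self[OF F]], force,
    rule pt_Some, rule pt_hd, rule pt_sub[OF F], auto)
qed

lemma size_enc_list_zip:
 "size (enc_list (ep e1 e2) (zip xs ys)) \<le> size (enc_list e1 xs) + size (enc_list e2 ys)"
 by (induction xs ys rule: list_induct2') (auto simp: ep_def)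

lemma pt_zip:
 assumes xs: "pt N D Xi (%i. enc_list e1 (xs i))" and ys: "pt N D Xi (%i. enc_list e2 (ys i))"
  and len: "\<And>i. i \<in> D ==> length (xs i) = length (ys i)"
 shows "pt N D Xi (%i. enc_list (ep e1 e2) (zip (xs i) (ys i)))"
proof -
 let ?g = "%i (s :: 'c list \<times> ('b \<times> 'c) list) x. (tl (fst s), (x, hd (fst s)) # snd s)"
 have *: "foldl (?g i) (ys, zs) xs = (drop (length xs) ys, rev (zip xs ys) @ zs)"
  if "length xs = length ys" for i xs ys zs
  using that by (induction xs ys arbitrary: zs rule: list_induct2) auto
 have "pt N D Xi (%i. ep (enc_list e2) (enc_list (ep e1 e2)) (foldl (?g i) (ys i, []) (xs i)))"
 proof (rule pt_fold[OF xs _ _ _ _ _ refl, where Inv = "%i j s. s = (drop j (ys i), rev (zip (take j (xs i)) (take j (ys i))))"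
    and b = "%i. size (enc_list e2 (ys i)) + (size (enc_list e1 (xs i)) + size (enc_list e2 (ys i))) + 1"], goal_cases)
  case 1 show ?case by (intro pt_pair ys pt_Nil pt_self[OF ys])
 next
  case (3 i j s)
  then have j: "j < length (ys i)" using len by simp
  then show ?case using 3 by (simp add: take_Suc_nth drop_Suc hd_drop_conv_nth tl_drop)
 next
  case 4 show ?case using pt_size[OF xs] pt_size[OF ys] by (intro pb_add pb_const)
 next
  case (5 i j s)
  have "size (enc_list (ep e1 e2) (zip (take j (xs i)) (take j (ys i)))) \<le> size (enc_list e1 (xs i)) + size (enc_list e2 (ys i))"
   by (rule order_trans[OF size_enc_list_zip add_mono[OF size_enc_list_take size_enc_list_take]])
  then show ?case using 5 size_enc_list_drop[of e2 j "ys i"] by (simp add: size_ep size_enc_list_rev)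
 next
  case (6 Y)
  show ?case
   by (intro pt_pair pt_Cons pt_tl pt_hd 6(4) pt_fst[OF 6(3)] pt_snd[OF 6(3)]) (use len in auto)
 qed auto
 then have "pt N D Xi (%i. ep (enc_list e2) (enc_list (ep e1 e2)) (drop (length (xs i)) (ys i), rev (zip (xs i) (ys i))))"
  by (rule pt_cong) (simp add: * len)
 from pt_rev[OF pt_snd[OF this]] show ?thesis by simp
qed

section \<open>Binary arithmetic\<close>

fun bits :: "nat \<Rightarrow> bool list" where
 "bits n = (if n = 0 then [] else odd n # bits (n div 2))"

declare bits.simps [simp del]

lemma bits_0 [simp]: "bits 0 = []"
 by (simp add: bits.simps)

lemma enc_nat_bits: "enc_nat n = enc_list eb (bits n)"
proof (induction n rule: bits.induct)
 case (1 n)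
 then show ?case by (subst enc_nat.simps, subst bits.simps) (simp add: eb_def[symmetric])
qed

lemma enc_nat_0 [simp]: "enc_nat 0 = Leaf"
 by (simp add: enc_nat.simps)

lemma enc_nat_eq_Leaf [simp]: "enc_nat n = Leaf \<longleftrightarrow> n = 0"
 by (subst enc_nat.simps) simp

lemma right_enc_nat: "right (enc_nat n) = enc_nat (n div 2)"
 by (subst enc_nat.simps) simp

lemma left_enc_nat: "left (enc_nat n) = eb (odd n)"
 by (subst enc_nat.simps) (simp add: eb_def)

lemma enc_nat_double: "enc_nat (2 * n + of_bool b) = (if n = 0 \<and> \<not> b then Leaf else Node (eb b) (enc_nat n))"
 by (subst enc_nat.simps) (auto simp: eb_def)

lemma less_two_power_bits: "n < 2 ^ length (bits n)"
proof (induction n rule: bits.induct)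
 case (1 n)
 then show ?case by (subst bits.simps) (auto simp: less_eq_Suc_le; linarith)
qed

lemma two_power_bits_le: "n > 0 ==> 2 ^ length (bits n) \<le> 2 * n"
proof (induction n rule: bits.induct)
 case (1 n)
 show ?case
 proof (cases "n div 2 = 0")
  case True
  then have "n = 1" using 1(2) by linarith
  then show ?thesis by (simp add: bits.simps)
 next
  case False
  then have "2 ^ length (bits (n div 2)) \<le> 2 * (n div 2)" using 1 by simp
  then show ?thesis using 1(2) by (subst bits.simps) auto
 qed
qed

lemma length_bits_le: "n < 2 ^ k ==> length (bits n) \<le> k"
proof (cases "n = 0")
 case False
 assume "n < 2 ^ k"
 then have "(2::nat) ^ length (bits n) < 2 ^ Suc k" using two_power_bits_le[of n] False by simp
 then show ?thesis by (subst (asm) power_strict_increasing_iff) auto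
qed simp

lemma length_bits_le_size: "length (bits n) \<le> size (enc_nat n)"
 unfolding enc_nat_bits by (rule length_le_size_enc_list)

lemma size_enc_nat_le: "n < 2 ^ k ==> size (enc_nat n) \<le> 2 * k"
proof -
 assume "n < 2 ^ k"
 then have "length (bits n) \<le> k" by (rule length_bits_le)
 moreover have "size (enc_nat n) \<le> length (bits n) * (1 + 1)"
  unfolding enc_nat_bits by (rule size_enc_list_le) (rule size_eb)
 ultimately show ?thesis by simp
qed

lemma less_two_power_size: "n < 2 ^ size (enc_nat n)"
 by (rule less_le_trans[OF less_two_power_bits power_increasing[OF length_bits_le_size]]) simp

lemma size_enc_nat_mono: "m \<le> n ==> size (enc_nat m) \<le> 2 * size (enc_nat n)"
 by (rule size_enc_nat_le) (rule le_less_trans[OF _ less_two_power_size])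

lemma size_enc_nat_le_nat: "size (enc_nat n) \<le> 2 * n"
 by (rule size_enc_nat_le) (rule less_exp)

text \<open>Most significant bit first, the opposite of \<open>bits\<close>: consing output bits
  while reading an input from its low end leaves them in this order.\<close>

definition horner :: "bool list \<Rightarrow> nat" where
 "horner bs = foldl (%n b. 2 * n + of_bool b) 0 bs"

lemma horner_snoc: "horner (bs @ [b]) = 2 * horner bs + of_bool b"
 by (simp add: horner_def)

lemma horner_Cons: "horner (b # bs) = of_bool b * 2 ^ length bs + horner bs"
proof (induction bs rule: rev_induct)
 case (snoc x xs)
 then show ?case using horner_snoc[of "b # xs" x] by (simp add: horner_snoc)
qed (simp add: horner_def)

lemma horner_Nil [simp]: "horner [] = 0"
 by (simp add: horner_def)

lemma horner_less: "horner bs < 2 ^ length bs"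
 by (induction bs rule: rev_induct) (auto simp: horner_snoc)

lemma horner_rev_bits: "horner (rev (bits n)) = n"
proof (induction n rule: bits.induct)
 case (1 n)
 then show ?case by (subst bits.simps) (auto simp: horner_snoc)
qed

lemma nth_bits: "j < length (bits n) ==> bits n ! j = odd (n div 2 ^ j)"
proof (induction n arbitrary: j rule: bits.induct)
 case (1 n)
 then show ?case
  by (cases "n = 0"; cases j) (simp_all add: bits.simps[of n] div_mult2_eq)
qed

lemma pt_bits: "pt N D Xi (%i. enc_nat (a i)) ==> pt N D Xi (%i. enc_list eb (bits (a i)))"
 by (simp add: enc_nat_bits)

lemma pt_div2: "pt N D Xi (%i. enc_nat (a i)) ==> pt N D Xi (%i. enc_nat (a i div 2))"
 by (drule pt_right) (simp add: right_enc_nat)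

lemma pt_odd: "pt N D Xi (%i. enc_nat (a i)) ==> pt N D Xi (%i. eb (odd (a i)))"
 by (drule pt_left) (simp add: left_enc_nat)

lemma pt_is_0: "pt N D Xi (%i. enc_nat (a i)) ==> pt N D Xi (%i. eb (a i = 0))"
 by (drule pt_isLeaf) simp

lemma pt_nat_const: "pt N D Xi Xi ==> pt N D Xi (%_. enc_nat c)"
 by (rule pt_const)

lemma pt_double:
 assumes a: "pt N D Xi (%i. enc_nat (a i))" and b: "pt N D Xi (%i. eb (b i))"
 shows "pt N D Xi (%i. enc_nat (2 * a i + of_bool (b i)))"
proof -
 have "pt N D Xi (%i. (%x. x) (if a i = 0 \<and> \<not> b i then Leaf else Node (eb (b i)) (enc_nat (a i))))"
  by (rule pt_if') (intro pt_conj pt_is_0 pt_not a b pt_Leaf pt_self[OF a] pt_Node)+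
 then show ?thesis by (simp only: enc_nat_double)
qed

lemma pt_horner:
 assumes bs: "pt N D Xi (%i. enc_list eb (bs i))"
 shows "pt N D Xi (%i. enc_nat (horner (bs i)))"
 unfolding horner_def
proof (rule pt_fold[OF bs _ _ _ _ _ refl, where Inv = "%i j s. s < 2 ^ j" and b = "%i. 2 * length (bs i)"], goal_cases)
 case 1 show ?case by (intro pt_nat_const pt_self[OF bs])
next
 case 4 show ?case using pt_length_bound[OF bs] by auto
next
 case (5 i j s)
 then show ?case using size_enc_nat_le[of s j] by simp
next
 case (6 Y)
 show ?case by (intro pt_double 6)
qed auto

definition par3 :: "bool \<Rightarrow> bool \<Rightarrow> bool \<Rightarrow> bool" where
 "par3 x y c = ((x \<noteq> y) \<noteq> c)"

text \<open>One loop for addition and subtraction. Both produce the parity \<open>par3\<close> of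
  two bits and a carry, and they differ only in \<open>K\<close>, which is the carry
  \<open>maj\<close> or the borrow \<open>bor\<close>. The output has its most significant bit
  first.\<close>

fun ripple :: "(bool \<Rightarrow> bool \<Rightarrow> bool \<Rightarrow> bool) \<Rightarrow> nat \<Rightarrow> nat \<Rightarrow> nat \<Rightarrow> bool \<times> bool list" where
 "ripple K a b 0 = (False, [])"
| "ripple K a b (Suc n) = (let (c, out) = ripple K a b n; x = odd (a div 2 ^ n); y = odd (b div 2 ^ n)
   in (K x y c, par3 x y c # out))"

lemma length_ripple: "length (snd (ripple K a b n)) = n"
 by (induction n) (auto simp: Let_def split: prod.splits)

lemma pt_ripple:
 fixes K :: "bool \<Rightarrow> bool \<Rightarrow> bool \<Rightarrow> bool" and us :: "'i \<Rightarrow> 'x list"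
 assumes a: "pt N D Xi (%i. enc_nat (a i))" and b: "pt N D Xi (%i. enc_nat (b i))"
  and us: "pt N D Xi (%i. enc_list e (us i))"
  and K: "\<And>D' (Y :: ('i \<times> (nat \<times> nat \<times> bool \<times> bool list) \<times> 'x) \<Rightarrow> btree) x y z. pt (on_fst N) D' Y (%i. eb (x i)) ==>
    pt (on_fst N) D' Y (%i. eb (y i)) ==> pt (on_fst N) D' Y (%i. eb (z i)) ==>
    pt (on_fst N) D' Y (%i. eb (K (x i) (y i) (z i)))"
 shows "pt N D Xi (%i. ep eb (enc_list eb) (ripple K (a i) (b i) (length (us i))))"
proof -
 define g :: "(nat \<times> nat \<times> bool \<times> bool list) \<Rightarrow> 'x \<Rightarrow> (nat \<times> nat \<times> bool \<times> bool list)"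
  where "g = (%s _. (fst s div 2, fst (snd s) div 2, K (odd (fst s)) (odd (fst (snd s))) (fst (snd (snd s))),
   par3 (odd (fst s)) (odd (fst (snd s))) (fst (snd (snd s))) # snd (snd (snd s))))"
 let ?st = "%i j. (a i div 2 ^ j, b i div 2 ^ j, ripple K (a i) (b i) j)"
 have st: "g (?st i j) x = ?st i (Suc j)" for i j x
  by (auto simp: g_def split_beta Let_def div_mult2_eq[symmetric] mult.commute)
 have fold: "foldl g (?st i k) us = ?st i (k + length us)" for i k and us :: "'x list"
  by (induction us arbitrary: k) (simp_all only: foldl.simps st, simp_all)
 let ?es = "ep enc_nat (ep enc_nat (ep eb (enc_list eb)))"
 have "pt N D Xi (%i. ?es (foldl g (a i, b i, False, []) (us i)))"
 proof (rule pt_fold[OF us _ _ _ _ _ refl, where Inv = "%i j s. s = ?st i j"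
    and b = "%i. 2 * size (enc_nat (a i)) + 2 * size (enc_nat (b i)) + length (us i) * 2 + 4"], goal_cases)
  case 1 show ?case by (intro pt_pair a b pt_bool pt_Nil pt_self[OF a])
 next
  case (3 i j s) then show ?case by (simp only: st)
 next
  case 4 show ?case using pt_size[OF a] pt_size[OF b] pt_length_bound[OF us]
   by (intro pb_add pb_mult pb_const)
 next
  case (5 i j s)
  have "size (enc_nat (a i div 2 ^ j)) \<le> 2 * size (enc_nat (a i))"
   "size (enc_nat (b i div 2 ^ j)) \<le> 2 * size (enc_nat (b i))"
   by (intro size_enc_nat_mono div_le_dividend)+
  moreover have "size (enc_list eb (snd (ripple K (a i) (b i) j))) \<le> j * 2"
   using size_enc_list_le[of "snd (ripple K (a i) (b i) j)" eb 1] size_eb by (simp add: length_ripple)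
  moreover have "size (eb (fst (ripple K (a i) (b i) j))) \<le> 1" by (rule size_eb)
  ultimately show ?case using 5 by (simp add: size_ep)
 next
  case (6 Y)
  note s = pt_fst[OF 6(3)] pt_fst[OF pt_snd[OF 6(3)]] pt_fst[OF pt_snd[OF pt_snd[OF 6(3)]]]
   pt_snd[OF pt_snd[OF pt_snd[OF 6(3)]]]
  show ?case unfolding g_def par3_def by (intro pt_pair pt_div2 K pt_Cons pt_not pt_iff pt_odd s)
 qed auto
 moreover have "foldl g (a i, b i, False, []) (us i) = ?st i (length (us i))" for i
  using fold[of i 0] by simp
 ultimately have "pt N D Xi (%i. ?es (?st i (length (us i))))" by simp
 from pt_snd[OF pt_snd[OF this]] show ?thesis by simp
qed

definition maj :: "bool \<Rightarrow> bool \<Rightarrow> bool \<Rightarrow> bool" where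
 "maj x y c = (if x then y \<or> c else y \<and> c)"

definition bor :: "bool \<Rightarrow> bool \<Rightarrow> bool \<Rightarrow> bool" where
 "bor x y c = (if x then y \<and> c else y \<or> c)"

lemma div_pow_Suc: "(a::nat) div 2 ^ n = 2 * (a div 2 ^ Suc n) + of_bool (odd (a div 2 ^ n))"
proof -
 have "x = 2 * (x div 2) + of_bool (odd x)" for x :: nat by (cases "odd x") auto
 then show ?thesis by (simp only: power_Suc2 div_mult2_eq)
qed

text \<open>Schoolbook addition stopped after \<open>n\<close> columns: the untouched high parts are
  still to be added, and the carry stands in front of the bits written so far.\<close>

lemma ripple_maj:
 "a + b = (a div 2 ^ n + b div 2 ^ n) * 2 ^ n + horner (fst (ripple maj a b n) # snd (ripple maj a b n))"
proof (induction n)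
 case (Suc n)
 obtain c out where r: "ripple maj a b n = (c, out)" by fastforce
 have len: "length out = n" using length_ripple[of maj a b n] r by simp
 define x y A B where "x = odd (a div 2 ^ n)" "y = odd (b div 2 ^ n)"
  and AB: "A = a div 2 ^ Suc n" "B = b div 2 ^ Suc n"
 have "a div 2 ^ n = 2 * A + of_bool x" "b div 2 ^ n = 2 * B + of_bool y"
  unfolding AB x_y_def by (rule div_pow_Suc)+
 with Suc have "a + b = (2 * A + of_bool x + (2 * B + of_bool y)) * 2 ^ n + of_bool c * 2 ^ n + horner out"
  using r len by (simp add: horner_Cons)
 also have "\<dots> = (A + B) * 2 ^ Suc n + (of_bool (maj x y c) * 2 ^ Suc n + (of_bool (par3 x y c) * 2 ^ n + horner out))"
  by (auto simp: maj_def par3_def algebra_simps)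
 finally show ?case using r len by (simp add: horner_Cons Let_def x_y_def AB)
qed (simp add: horner_Cons)

text \<open>The borrow is moved to the left side and the high part of \<open>b\<close> with it, so
  that the invariant needs no subtraction of naturals.\<close>

lemma ripple_bor:
 "a + of_bool (fst (ripple bor a b n)) * 2 ^ n + (b div 2 ^ n) * 2 ^ n = b + (a div 2 ^ n) * 2 ^ n + horner (snd (ripple bor a b n))"
proof (induction n)
 case (Suc n)
 obtain c out where r: "ripple bor a b n = (c, out)" by fastforce
 have len: "length out = n" using length_ripple[of bor a b n] r by simp
 define x y A B where "x = odd (a div 2 ^ n)" "y = odd (b div 2 ^ n)"
  and AB: "A = a div 2 ^ Suc n" "B = b div 2 ^ Suc n"
 have AB': "a div 2 ^ n = 2 * A + of_bool x" "b div 2 ^ n = 2 * B + of_bool y"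
  unfolding AB x_y_def by (rule div_pow_Suc)+
 have "a + of_bool c * 2 ^ n + (2 * B + of_bool y) * 2 ^ n = b + (2 * A + of_bool x) * 2 ^ n + horner out"
  using Suc r unfolding AB'[symmetric] by simp
 then have "a + of_bool (bor x y c) * 2 ^ Suc n + B * 2 ^ Suc n
   = b + A * 2 ^ Suc n + (of_bool (par3 x y c) * 2 ^ n + horner out)"
  by (cases x; cases y; cases c) (simp_all add: bor_def par3_def algebra_simps)
 then show ?case using r len by (simp add: horner_Cons Let_def x_y_def AB)
qed simp

text \<open>The number of rounds of \<open>ripple\<close> has to be given as the length of a list;
  the concatenated bits of both operands are long enough for either.\<close>

lemma pt_fuel:
 assumes a: "pt N D Xi (%i. enc_nat (a i))" and b: "pt N D Xi (%i. enc_nat (b i))"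
 obtains us :: "'i \<Rightarrow> bool list" where "pt N D Xi (%i. enc_list eb (us i))"
  "\<And>i. a i < 2 ^ length (us i)" "\<And>i. b i < 2 ^ length (us i)"
proof
 show "pt N D Xi (%i. enc_list eb (bits (a i) @ bits (b i)))" by (intro pt_append pt_bits a b)
 show "a i < 2 ^ length (bits (a i) @ bits (b i))" for i
  by (rule less_le_trans[OF less_two_power_bits power_increasing]) auto
 show "b i < 2 ^ length (bits (a i) @ bits (b i))" for i
  by (rule less_le_trans[OF less_two_power_bits power_increasing]) auto
qed

lemma pt_add:
 assumes a: "pt N D Xi (%i. enc_nat (a i))" and b: "pt N D Xi (%i. enc_nat (b i))"
 shows "pt N D Xi (%i. enc_nat (a i + b i))"
proof -
 obtain us :: "'a \<Rightarrow> bool list" where us: "pt N D Xi (%i. enc_list eb (us i))"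
  and l: "\<And>i. a i < 2 ^ length (us i)" "\<And>i. b i < 2 ^ length (us i)"
  by (rule pt_fuel[OF a b]) blast
 let ?r = "%i. ripple maj (a i) (b i) (length (us i))"
 have r: "pt N D Xi (%i. ep eb (enc_list eb) (?r i))"
  by (rule pt_ripple[OF a b us], unfold maj_def, rule pt_if', assumption) (intro pt_conj pt_disj; assumption)+
 have "pt N D Xi (%i. enc_nat (horner (fst (?r i) # snd (?r i))))"
  by (intro pt_horner pt_Cons pt_fst[OF r] pt_snd[OF r])
 moreover have "horner (fst (?r i) # snd (?r i)) = a i + b i" for i
  using ripple_maj[of "a i" "b i" "length (us i)"] l[of i] by simp
 ultimately show ?thesis by simp
qed

text \<open>The last borrow tells whether \<open>a i < b i\<close>. If it is clear, the output bits
  are the difference; if it is set, the truncated difference is 0.\<close>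

lemma pt_sub_less:
 assumes a: "pt N D Xi (%i. enc_nat (a i))" and b: "pt N D Xi (%i. enc_nat (b i))"
 shows "pt N D Xi (%i. enc_nat (a i - b i))" "pt N D Xi (%i. eb (a i < b i))"
proof -
 obtain us :: "'a \<Rightarrow> bool list" where us: "pt N D Xi (%i. enc_list eb (us i))"
  and l: "\<And>i. a i < 2 ^ length (us i)" "\<And>i. b i < 2 ^ length (us i)"
  by (rule pt_fuel[OF a b]) blast
 let ?r = "%i. ripple bor (a i) (b i) (length (us i))"
 have r: "pt N D Xi (%i. ep eb (enc_list eb) (?r i))"
  by (rule pt_ripple[OF a b us], unfold bor_def, rule pt_if', assumption) (intro pt_conj pt_disj; assumption)+
 have eq: "a i + of_bool (fst (?r i)) * 2 ^ length (us i) = b i + horner (snd (?r i))" for i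
  using ripple_bor[of "a i" "b i" "length (us i)"] l by simp
 have lt: "horner (snd (?r i)) < 2 ^ length (us i)" for i
  using horner_less[of "snd (?r i)"] by (simp add: length_ripple)
 have aux: "c = (x < y) \<and> (if c then 0 else h) = x - y"
  if "x + of_bool c * p = y + h" "h < p" for x y h p :: nat and c
  using that by (cases c) auto
 have c: "fst (?r i) = (a i < b i)" for i
  by (rule conjunct1[OF aux[OF eq lt]])
 have d: "(if fst (?r i) then 0 else horner (snd (?r i))) = a i - b i" for i
  by (rule conjunct2[OF aux[OF eq lt]])
 show "pt N D Xi (%i. eb (a i < b i))" using pt_fst[OF r] by (simp add: c)
 have "pt N D Xi (%i. enc_nat (if fst (?r i) then 0 else horner (snd (?r i))))"
  by (intro pt_if'[where e = enc_nat] pt_horner pt_fst[OF r] pt_snd[OF r] pt_nat_const pt_self[OF r])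
 then show "pt N D Xi (%i. enc_nat (a i - b i))" by (simp only: d)
qed

lemmas pt_minus = pt_sub_less(1) and pt_less = pt_sub_less(2)

lemma pt_le:
 assumes "pt N D Xi (%i. enc_nat (a i))" "pt N D Xi (%i. enc_nat (b i))"
 shows "pt N D Xi (%i. eb (a i \<le> b i))"
 using pt_not[OF pt_less[OF assms(2,1)]] by (simp add: not_less)

lemma pt_eq:
 assumes "pt N D Xi (%i. enc_nat (a i))" "pt N D Xi (%i. enc_nat (b i))"
 shows "pt N D Xi (%i. eb (a i = b i))"
 using pt_conj[OF pt_le[OF assms] pt_le[OF assms(2,1)]] by (simp add: antisym_conv eq_iff[symmetric])

lemma pt_mult:
 assumes a: "pt N D Xi (%i. enc_nat (a i))" and b: "pt N D Xi (%i. enc_nat (b i))"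
 shows "pt N D Xi (%i. enc_nat (a i * b i))"
proof -
 let ?es = "ep enc_nat enc_nat"
 let ?g = "%(i::'a) s x. (if x then fst s + snd s else fst s, snd s + snd s :: nat)"
 let ?st = "%i j. (a i * (b i mod 2 ^ j), a i * 2 ^ j)"
 have st: "?g i (?st i j) (odd (b i div 2 ^ j)) = ?st i (Suc j)" for i j
 proof -
  have "b i mod 2 ^ Suc j = b i mod 2 ^ j + of_bool (odd (b i div 2 ^ j)) * 2 ^ j"
   by (simp add: mod_mult2_eq mult.commute[of 2] odd_iff_mod_2_eq_one)
  then show ?thesis by (simp add: algebra_simps)
 qed
 let ?B = "%i. size (enc_nat (a i)) + size (enc_nat (b i))"
 have bb: "pt N D Xi (%i. enc_list eb (bits (b i)))" by (rule pt_bits[OF b])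
 have "pt N D Xi (%i. ?es (foldl (?g i) (0, a i) (bits (b i))))"
 proof (rule pt_fold[OF bb _ _ _ _ _ refl, where Inv = "%i j s. s = ?st i j" and b = "%i. 4 * ?B i + 1"], goal_cases)
  case 1 show ?case by (intro pt_pair a pt_nat_const pt_self[OF a])
 next
  case (3 i j s)
  then show ?case by (simp only: nth_bits st)
 next
  case 4 show ?case using pt_size[OF a] pt_size[OF b] by (intro pb_add pb_mult pb_const)
 next
  case (5 i j s)
  have j: "j \<le> size (enc_nat (b i))" using 5 length_bits_le_size le_trans by blast
  have "a i * (b i mod 2 ^ j) < 2 ^ ?B i" unfolding power_add
   by (rule mult_strict_mono, rule less_two_power_size, rule le_less_trans[OF mod_less_eq_dividend less_two_power_size]) auto
  then have "size (enc_nat (a i * (b i mod 2 ^ j))) \<le> 2 * ?B i" by (rule size_enc_nat_le)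
  moreover have "a i * 2 ^ j < 2 ^ ?B i" unfolding power_add
   by (rule less_le_trans[OF mult_strict_right_mono[OF less_two_power_size] mult_left_mono[OF power_increasing[OF j]]]) auto
  then have "size (enc_nat (a i * 2 ^ j)) \<le> 2 * ?B i" by (rule size_enc_nat_le)
  ultimately show ?case using 5 by (simp add: size_ep)
 next
  case (6 Y)
  note s = pt_fst[OF 6(3)] pt_snd[OF 6(3)]
  show ?case by (intro pt_pair pt_if'[where e = enc_nat] pt_add s 6(4))
 qed auto
 moreover have f: "foldl (?g i) (?st i 0) (take j (bits (b i))) = ?st i j" if "j \<le> length (bits (b i))" for i j
  using that
 proof (induction j)
  case (Suc j)
  then show ?case by (simp only: take_Suc_nth foldl_append foldl.simps nth_bits st)
 qed simp
 then have "foldl (?g i) (0, a i) (bits (b i)) = ?st i (length (bits (b i)))" for i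
  using f[of "length (bits (b i))" i] by simp
 ultimately have "pt N D Xi (%i. ?es (?st i (length (bits (b i)))))" by simp
 from pt_fst[OF this] show ?thesis by (simp add: less_two_power_bits)
qed

text \<open>Long division from the top bit: the state is quotient and remainder of the number formed
  by the bits read. Appending a bit at most doubles the remainder and adds 1, so one comparison and
  one subtraction restore it.\<close>

lemma pt_divmod:
 assumes a: "pt N D Xi (%i. enc_nat (a i))" and t: "pt N D Xi (%i. enc_nat (t i))"
  and pos: "\<And>i. i \<in> D ==> t i > 0"
 shows "pt N D Xi (%i. ep enc_nat enc_nat (a i div t i, a i mod t i))"
proof -
 let ?es = "ep enc_nat enc_nat"
 let ?r = "%s x. 2 * snd s + of_bool x :: nat"
 let ?g = "%i s x. (2 * fst s + of_bool (t i \<le> ?r s x), if t i \<le> ?r s x then ?r s x - t i else ?r s x)"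
 let ?m = "%i j. horner (take j (rev (bits (a i))))"
 have st: "?g i (m div t i, m mod t i) x = ((2 * m + of_bool x) div t i, (2 * m + of_bool x) mod t i)"
  if "i \<in> D" for i m x
 proof -
  define q r where qr: "q = m div t i" "r = m mod t i"
  have m: "m = q * t i + r" and r: "r < t i" using pos[OF that] by (auto simp: qr)
  have e: "2 * m + of_bool x = (2 * r + of_bool x) + (2 * q) * t i" by (simp add: m)
  have lt: "2 * r + of_bool x < 2 * t i" using r by (cases x) auto
  have "(2 * r + of_bool x) div t i = of_bool (t i \<le> 2 * r + of_bool x)"
   "(2 * r + of_bool x) mod t i = (if t i \<le> 2 * r + of_bool x then 2 * r + of_bool x - t i else 2 * r + of_bool x)"
   using lt pos[OF that] by (auto simp: le_div_geq le_mod_geq)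
  then show ?thesis unfolding qr[symmetric] e using pos[OF that] by simp
 qed
 have bb: "pt N D Xi (%i. enc_list eb (rev (bits (a i))))" by (intro pt_rev pt_bits a)
 have m: "pt N D Xi (%i. ?es (foldl (?g i) (0, 0) (rev (bits (a i)))))"
 proof (rule pt_fold[OF bb _ _ _ _ _ refl, where Inv = "%i j s. s = (?m i j div t i, ?m i j mod t i)"
   and b = "%i. 4 * size (enc_nat (a i)) + 1"], goal_cases)
  case 1 show ?case by (intro pt_pair pt_nat_const pt_self[OF a])
 next
  case (3 i j s)
  show ?case unfolding 3(3) st[OF 3(1)] take_Suc_nth[OF 3(2)] horner_snoc by (rule refl)
 next
  case 4 show ?case using pt_size[OF a] by (intro pb_add pb_mult pb_const)
 next
  case (5 i j s)
  have m: "?m i j < 2 ^ size (enc_nat (a i))"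
   by (rule less_le_trans[OF horner_less power_increasing]) (use 5 length_bits_le_size[of "a i"] in auto)
  have "size (enc_nat (?m i j div t i)) \<le> 2 * size (enc_nat (a i))"
   "size (enc_nat (?m i j mod t i)) \<le> 2 * size (enc_nat (a i))"
   by (rule size_enc_nat_le[OF le_less_trans[OF _ m]]; simp)+
  then show ?case using 5 by (simp add: size_ep)
 next
  case (6 Y)
  note s = pt_fst[OF 6(3)] pt_snd[OF 6(3)]
  show ?case by (intro pt_pair pt_if'[where e = enc_nat] pt_double pt_minus pt_le s 6(4) 6(1)[OF t])
 qed auto
 moreover have f: "foldl (?g i) (0, 0) (take j (rev (bits (a i)))) = (?m i j div t i, ?m i j mod t i)"
  if "i \<in> D" "j \<le> length (bits (a i))" for i j
  using that
 proof (induction j)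
  case (Suc j)
  have lt: "j < length (rev (bits (a i)))" using Suc.prems by simp
  have IH: "foldl (?g i) (0, 0) (take j (rev (bits (a i)))) = (?m i j div t i, ?m i j mod t i)"
   using Suc by simp
  show ?case unfolding take_Suc_nth[OF lt] foldl_append foldl.simps IH st[OF that(1)] horner_snoc by (rule refl)
 qed simp
 then have f2: "foldl (?g i) (0, 0) (rev (bits (a i))) = (a i div t i, a i mod t i)" if "i \<in> D" for i
  using f[OF that order_refl] by (simp add: horner_rev_bits)
 show ?thesis by (rule pt_cong[OF m]) (simp only: f2)
qed

lemmas pt_div = pt_fst[OF pt_divmod, simplified] and pt_mod = pt_snd[OF pt_divmod, simplified]

lemma pt_dvd:
 assumes "pt N D Xi (%i. enc_nat (a i))" "pt N D Xi (%i. enc_nat (t i))" "\<And>i. i \<in> D ==> t i > 0"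
 shows "pt N D Xi (%i. eb (t i dvd a i))"
 using pt_is_0[OF pt_mod[OF assms]] by (simp add: dvd_eq_mod_eq_0)

lemma pt_upt_length:
 assumes xs: "pt N D Xi (%i. enc_list e (xs i))"
 shows "pt N D Xi (%i. enc_elem [0..<length (xs i)])"
proof -
 let ?es = "ep enc_nat (enc_elem)"
 let ?g = "%(i::'a) s (x::'b). (fst s + 1, fst s # snd s)"
 have fold: "foldl (?g i) (k, rev [0..<k]) ys = (k + length ys, rev [0..<k + length ys])" for i k ys
 proof (induction ys arbitrary: k)
  case (Cons y ys)
  from Cons[of "Suc k"] show ?case by simp
 qed simp
 have "pt N D Xi (%i. ?es (foldl (?g i) (0, []) (xs i)))"
 proof (rule pt_fold[OF xs _ _ _ _ _ refl, where Inv = "%i j s. s = (j, rev [0..<j])"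
   and b = "%i. 2 * length (xs i) + length (xs i) * (2 * length (xs i) + 1) + 1"], goal_cases)
  case 1 show ?case by (intro pt_pair pt_nat_const pt_Nil pt_self[OF xs])
 next
  case 4 show ?case using pt_length_bound[OF xs] by (intro pb_add pb_mult pb_const)
 next
  case (5 i j s)
  have "size (enc_elem (rev [0..<j])) \<le> length (rev [0..<j]) * (2 * length (xs i) + 1)"
   by (rule size_enc_list_le) (use 5 in \<open>auto intro!: order_trans[OF size_enc_nat_le_nat]\<close>)
  also have "\<dots> \<le> length (xs i) * (2 * length (xs i) + 1)" using 5 by (intro mult_right_mono) auto
  finally show ?case using 5 size_enc_nat_le_nat[of j] by (simp add: size_ep)
 next
  case (6 Y)
  note s = pt_fst[OF 6(3)] pt_snd[OF 6(3)]
  show ?case by (intro pt_pair pt_Cons pt_add s pt_nat_const 6(2))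
 qed auto
 moreover have "foldl (?g i) (0, []) (xs i) = (length (xs i), rev [0..<length (xs i)])" for i
  using fold[of 0 "xs i"] by simp
 ultimately have "pt N D Xi (%i. ?es (length (xs i), rev [0..<length (xs i)]))" by simp
 from pt_rev[OF pt_snd[OF this]] show ?thesis by simp
qed

lemma pt_length:
 assumes xs: "pt N D Xi (%i. enc_list e (xs i))"
 shows "pt N D Xi (%i. enc_nat (length (xs i)))"
proof -
 have "pt N D Xi (%i. enc_nat (if [0..<length (xs i)] = [] then 0 else hd (rev [0..<length (xs i)]) + 1))"
 proof (rule pt_if)
  show "pt N {i \<in> D. [0..<length (xs i)] \<noteq> []} Xi (%i. enc_nat (hd (rev [0..<length (xs i)]) + 1))"
   by (intro pt_add pt_hd pt_rev pt_sub[OF pt_upt_length[OF xs]] pt_nat_const pt_sub[OF pt_self[OF xs]]) auto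
 qed (rule pt_null[OF pt_upt_length[OF xs]], rule pt_nat_const, rule pt_sub[OF pt_self[OF xs]], simp)
 then show ?thesis by (rule pt_cong) (auto simp: hd_rev last_upt)
qed

lemma pt_enumerate:
 assumes xs: "pt N D Xi (%i. enc_list e (xs i))"
 shows "pt N D Xi (%i. enc_list (ep enc_nat e) (zip [0..<length (xs i)] (xs i)))"
 by (intro pt_zip pt_upt_length[OF xs] xs) auto

text \<open>A binary numeral may denote exponentially many indices. The range is therefore cut out
  of the index range of a list at hand that is long enough.\<close>

lemma pt_upt:
 assumes xs: "pt N D Xi (%i. enc_list e (xs i))" and d: "pt N D Xi (%i. enc_nat (d i))"
  and "\<And>i. i \<in> D ==> d i \<le> length (xs i)"
 shows "pt N D Xi (%i. enc_elem [0..<d i])"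
proof -
 have "pt N D Xi (%i. enc_elem (filter (%j. j < d i) [0..<length (xs i)]))"
  by (rule pt_filter[OF pt_upt_length[OF xs]], rule pt_less) (assumption | drule meta_spec[of _ "%i. enc_nat (d i)"], erule meta_mp, rule d)+
 moreover have "filter (%j. j < d) [0..<n] = [0..<d]" if "d \<le> n" for d n
  using that by (induction n) (auto simp: le_Suc_eq not_less intro!: filter_True)
 ultimately show ?thesis using assms(3) by (auto elim!: pt_cong)
qed

lemma pt_mem:
 assumes x: "pt N D Xi (%i. enc_nat (x i))" and xs: "pt N D Xi (%i. enc_elem (xs i))"
 shows "pt N D Xi (%i. eb (x i \<in> set (xs i)))"
proof -
 have "pt N D Xi (%i. eb (filter (%y. x i = y) (xs i) \<noteq> []))"
 proof (rule pt_not, rule pt_null, rule pt_filter[OF xs], goal_cases)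
  case (1 Y) show ?case by (intro pt_eq 1(1)[OF x] 1(3))
 qed
 then show ?thesis by (rule pt_cong) (auto simp: filter_empty_conv)
qed

lemma pt_eq_list:
 assumes "pt N D Xi (%i. enc_elem (xs i))" "pt N D Xi (%i. enc_elem (ys i))"
  "\<And>i. i \<in> D ==> length (xs i) = length (ys i)"
 shows "pt N D Xi (%i. eb (xs i = ys i))"
proof -
 have "pt N D Xi (%i. eb (filter (%z. fst z \<noteq> snd z) (zip (xs i) (ys i)) = []))"
 proof (rule pt_null, rule pt_filter[OF pt_zip[OF assms]], goal_cases)
  case (1 i) then show ?case .
 next
  case (2 Y) show ?case by (intro pt_not pt_eq pt_fst[OF 2(3)] pt_snd[OF 2(3)])
 qed
 moreover have "(filter (%z. fst z \<noteq> snd z) (zip xs ys) = []) = (xs = ys)" if "length xs = length ys" for xs ys :: "nat list"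
  using that by (induction xs ys rule: list_induct2) auto
 ultimately show ?thesis using assms(3) by (auto elim!: pt_cong)
qed

section \<open>Finite fields in coordinates\<close>

locale expl =
 fixes p k :: nat and F :: "nat list ring" (structure)
 assumes expl: "explicit_field p k F"

sublocale expl \<subseteq> field F
 using expl by (simp add: explicit_field_def)

context expl
begin

lemma carrier_iff: "x \<in> carrier F \<longleftrightarrow> length x = k \<and> set x \<subseteq> {..<p}"
 using expl by (simp add: explicit_field_def)

lemma add_eq: "x \<in> carrier F ==> y \<in> carrier F ==> x \<oplus> y = map2 (%a b. (a + b) mod p) x y"
 using expl by (simp add: explicit_field_def)

lemma k_pos: "k > 0"
proof (rule ccontr)
 assume "\<not> k > 0"
 then have "\<one> = []" "\<zero> = []" using carrier_iff[of \<one>] carrier_iff[of \<zero>] by auto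
 then show False using one_not_zero by simp
qed

lemma p_pos: "p > 0"
proof (rule ccontr)
 assume "\<not> p > 0"
 then have "length \<one> = k" "set \<one> \<subseteq> {}" using carrier_iff[of \<one>] one_closed by auto
 then show False using k_pos by simp
qed

text \<open>The list is idempotent under the coordinatewise addition, and the only idempotent of a
  group is its neutral element.\<close>

lemma zero_eq: "\<zero> = replicate k 0"
proof -
 let ?z = "replicate k 0"
 have z: "?z \<in> carrier F" using p_pos by (auto simp: carrier_iff)
 have "?z \<oplus> ?z = ?z" using add_eq[OF z z] by (auto intro!: nth_equalityI)
 then show ?thesis using z by (metis add.r_cancel_one')
qed

lemma p_gt_1: "p > 1"
proof (rule ccontr)
 assume "\<not> p > 1"
 then have "length \<one> = k" "\<forall>t\<in>set \<one>. t = 0" using carrier_iff[of \<one>] one_closed by auto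
 then have "\<one> = replicate k 0" by (auto intro!: nth_equalityI)
 then show False using one_not_zero zero_eq by simp
qed

lemma finite_carrier: "finite (carrier F)"
proof -
 have "carrier F = {x. set x \<subseteq> {..<p} \<and> length x = k}" using carrier_iff by blast
 then show ?thesis using finite_lists_length_eq[of "{..<p}" k] by simp
qed

lemma order_eq: "order F = p ^ k"
proof -
 have "carrier F = {x. set x \<subseteq> {..<p} \<and> length x = k}" using carrier_iff by blast
 then show ?thesis using card_lists_length_eq[of "{..<p}" k] by (simp add: order_def)
qed

lemma nth_less: "x \<in> carrier F ==> i < k ==> x ! i < p"
 using carrier_iff[of x] by (metis in_mono lessThan_iff nth_mem)

lemma add_nth: "x \<in> carrier F ==> y \<in> carrier F ==> i < k ==> (x \<oplus> y) ! i = (x ! i + y ! i) mod p"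
 using add_eq carrier_iff by simp

lemma add_pow_nth: "x \<in> carrier F ==> i < k ==> ([n] \<cdot> x) ! i = (n * x ! i) mod p" for n :: nat
 by (induction n) (simp_all add: zero_eq add_nth add.nat_pow_Suc mod_simps algebra_simps)

lemma eqI: "x \<in> carrier F ==> y \<in> carrier F ==> (\<And>i. i < k ==> x ! i = y ! i) ==> x = y"
 by (rule nth_equalityI) (auto simp: carrier_iff)

lemma add_pow_p: "x \<in> carrier F ==> [p] \<cdot> x = \<zero>"
 by (rule eqI, simp, simp, simp add: add_pow_nth zero_eq)

text \<open>Adding \<open>x\<close> to itself \<open>p\<close> times gives zero in each coordinate.
  Negation, which is not among the given data, thereby becomes a multiple of
  \<open>x\<close>.\<close>

lemma a_inv_eq: "x \<in> carrier F ==> \<ominus> x = [(p - 1)] \<cdot> x"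
proof -
 assume x: "x \<in> carrier F"
 have "[(p - 1)] \<cdot> x \<oplus> x = [(Suc (p - 1))] \<cdot> x" using x by (simp add: add.nat_pow_Suc)
 also have "\<dots> = \<zero>" using add_pow_p[OF x] p_pos by simp
 finally show ?thesis using x by (simp add: minus_equality)
qed

text \<open>A fold in list order, which is literally what a loop computes;
  \<open>lsum_finsum\<close> connects it to sums over sets.\<close>

definition lsum :: "nat list list \<Rightarrow> nat list" where
 "lsum xs = foldl (\<oplus>) \<zero> xs"

lemma lsum_Nil [simp]: "lsum [] = \<zero>"
 by (simp add: lsum_def)

lemma lsum_snoc [simp]: "lsum (xs @ [x]) = lsum xs \<oplus> x"
 by (simp add: lsum_def)

lemma lsum_closed [simp]: "set xs \<subseteq> carrier F ==> lsum xs \<in> carrier F"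
 by (induction xs rule: rev_induct) auto

lemma lsum_append: "set xs \<subseteq> carrier F ==> set ys \<subseteq> carrier F ==> lsum (xs @ ys) = lsum xs \<oplus> lsum ys"
proof (induction ys rule: rev_induct)
 case (snoc y ys)
 then show ?case by (simp flip: append_assoc add: a_assoc)
qed simp

lemma lsum_Cons [simp]: "x \<in> carrier F ==> set xs \<subseteq> carrier F ==> lsum (x # xs) = x \<oplus> lsum xs"
 using lsum_append[of "[x]" xs] by (simp add: lsum_def)

lemma lsum_map_distrib:
 "(\<And>x. x \<in> set xs ==> f x \<in> carrier F) ==> a \<in> carrier F ==> a \<otimes> lsum (map f xs) = lsum (map (%x. a \<otimes> f x) xs)"
proof (induction xs)
 case (Cons x xs)
 moreover have "set (map f xs) \<subseteq> carrier F" "set (map (%x. a \<otimes> f x) xs) \<subseteq> carrier F" using Cons.prems by auto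
 ultimately show ?case by (simp add: r_distr)
qed simp

lemma lsum_map_add:
 "(\<And>x. x \<in> set xs ==> f x \<in> carrier F) ==> (\<And>x. x \<in> set xs ==> g x \<in> carrier F) ==>
  lsum (map (%x. f x \<oplus> g x) xs) = lsum (map f xs) \<oplus> lsum (map g xs)"
proof (induction xs)
 case (Cons x xs)
 moreover have "set (map f xs) \<subseteq> carrier F" "set (map g xs) \<subseteq> carrier F" "set (map (%x. f x \<oplus> g x) xs) \<subseteq> carrier F"
  using Cons.prems by auto
 ultimately show ?case by (simp add: a_ac)
qed simp

lemma lsum_zero: "(\<And>x. x \<in> set xs ==> x = \<zero>) ==> lsum xs = \<zero>"
proof (induction xs rule: rev_induct)
 case (snoc x xs)
 then have "x = \<zero>" "lsum xs = \<zero>" by auto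
 then show ?case by simp
qed simp

lemma lsum_finsum: "distinct xs ==> (\<And>x. x \<in> set xs ==> f x \<in> carrier F) ==> lsum (map f xs) = (\<Oplus>x\<in>set xs. f x)"
proof (induction xs)
 case (Cons x xs)
 then have "set (map f xs) \<subseteq> carrier F" by auto
 with Cons show ?case by (simp add: finsum_insert Pi_def)
qed simp

lemma unit_carrier [simp]: "i < k ==> unit_coords k i \<in> carrier F"
 using p_gt_1 by (auto simp: carrier_iff unit_coords_def dest!: set_update_subset_insert[THEN subsetD])

lemma unit_nth: "i < k ==> l < k ==> unit_coords k i ! l = (if l = i then 1 else 0)"
 by (simp add: unit_coords_def nth_list_update)

lemma basis_expansion:
 assumes x: "x \<in> carrier F"
 shows "x = lsum (map (%i. [(x ! i)] \<cdot> unit_coords k i) [0..<k])"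
proof (rule eqI[OF x])
 have c: "set (map (%i. [(x ! i)] \<cdot> unit_coords k i) [0..<n]) \<subseteq> carrier F" if "n \<le> k" for n
  using that by auto
 then show "lsum (map (%i. [(x ! i)] \<cdot> unit_coords k i) [0..<k]) \<in> carrier F" by simp
 fix l assume l: "l < k"
 have "lsum (map (%i. [(x ! i)] \<cdot> unit_coords k i) [0..<n]) ! l = (if l < n then x ! l else 0)" if "n \<le> k" for n
  using that
 proof (induction n)
  case (Suc n)
  have *: "lsum (map (%i. [(x ! i)] \<cdot> unit_coords k i) [0..<n]) \<in> carrier F" using c[of n] Suc.prems by simp
  show ?case using Suc l nth_less[OF x l]
   by (auto simp: add_nth[OF *] add_pow_nth unit_nth less_Suc_eq)
 qed (simp add: zero_eq l)
 then show "x ! l = lsum (map (%i. [(x ! i)] \<cdot> unit_coords k i) [0..<k]) ! l" using l by simp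
qed

text \<open>Bilinearity over the prime field, applied to the coordinate expansions of both factors.
  The right-hand side is written as the nested loop over the structure constants that a program can
  run.\<close>

lemma mult_expansion:
 assumes x: "x \<in> carrier F" and y: "y \<in> carrier F"
 shows "x \<otimes> y = lsum (map (%(a, row). [a] \<cdot> lsum (map (%(b, c). [b] \<cdot> c) (zip y row))) (zip x (structure_constants k F)))"
proof -
 let ?u = "unit_coords k"
 have len: "length x = k" "length y = k" using x y carrier_iff by auto
 have z: "zip x (structure_constants k F) = map (%i. (x ! i, map (%j. ?u i \<otimes> ?u j) [0..<k])) [0..<k]"
  using len by (auto simp: structure_constants_def intro!: nth_equalityI)
 have z': "zip y (map (%j. ?u i \<otimes> ?u j) [0..<k]) = map (%j. (y ! j, ?u i \<otimes> ?u j)) [0..<k]" for i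
  using len by (auto intro!: nth_equalityI)
 have row: "lsum (map (%j. [(y ! j)] \<cdot> (?u i \<otimes> ?u j)) [0..<k]) = ?u i \<otimes> y" if i: "i < k" for i
 proof -
  have "?u i \<otimes> y = ?u i \<otimes> lsum (map (%j. [(y ! j)] \<cdot> ?u j) [0..<k])" using basis_expansion[OF y] by simp
  also have "\<dots> = lsum (map (%j. ?u i \<otimes> [(y ! j)] \<cdot> ?u j) [0..<k])"
   by (rule lsum_map_distrib) (use i in auto)
  also have "\<dots> = lsum (map (%j. [(y ! j)] \<cdot> (?u i \<otimes> ?u j)) [0..<k])"
   by (rule arg_cong[of _ _ lsum]) (use i in \<open>auto simp: add_pow_rdistr\<close>)
  finally show ?thesis by simp
 qed
 have "x \<otimes> y = y \<otimes> x" using x y by (rule m_comm)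
 also have "\<dots> = y \<otimes> lsum (map (%i. [(x ! i)] \<cdot> ?u i) [0..<k])" using basis_expansion[OF x] by simp
 also have "\<dots> = lsum (map (%i. y \<otimes> [(x ! i)] \<cdot> ?u i) [0..<k])"
  by (rule lsum_map_distrib) (use y in auto)
 also have "\<dots> = lsum (map (%i. [(x ! i)] \<cdot> (?u i \<otimes> y)) [0..<k])"
  by (rule arg_cong[of _ _ lsum]) (use y in \<open>auto simp: add_pow_rdistr m_comm\<close>)
 also have "\<dots> = lsum (map (%(a, row). [a] \<cdot> lsum (map (%(b, c). [b] \<cdot> c) (zip y row))) (zip x (structure_constants k F)))"
  unfolding z by (rule arg_cong[of _ _ lsum]) (auto simp: z' row o_def)
 finally show ?thesis .
qed

lemma pow_order: "x \<in> carrier F ==> x \<noteq> \<zero> ==> x [^] (p ^ k - 1) = \<one>"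
proof -
 assume x: "x \<in> carrier F" "x \<noteq> \<zero>"
 interpret M: group "Multiplicative_Group.mult_of F" by (rule field_mult_group)
 have "x [^]\<^bsub>Multiplicative_Group.mult_of F\<^esub> order (Multiplicative_Group.mult_of F) = \<one>\<^bsub>Multiplicative_Group.mult_of F\<^esub>"
  by (rule M.pow_order_eq_1) (use x in auto)
 moreover have "order (Multiplicative_Group.mult_of F) = p ^ k - 1"
  using order_eq finite_carrier by (simp add: order_def)
 ultimately show ?thesis by (simp add: Multiplicative_Group.nat_pow_mult_of)
qed

lemma order_ge_2: "p ^ k \<ge> 2"
 using p_gt_1 k_pos self_le_power[of p k] by linarith

lemma sc_hd: "structure_constants k F \<noteq> []" "hd (structure_constants k F) \<noteq> []"
 "hd (hd (structure_constants k F)) = unit_coords k 0 \<otimes> unit_coords k 0"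
proof -
 obtain n where "[0..<k] = 0 # n" using k_pos by (metis upt_conv_Cons)
 then show "structure_constants k F \<noteq> []" "hd (structure_constants k F) \<noteq> []"
   "hd (hd (structure_constants k F)) = unit_coords k 0 \<otimes> unit_coords k 0"
  by (simp_all add: structure_constants_def)
qed

text \<open>The square of the first basis vector is an explicit nonzero element contained in the
  input. Neither 0 nor 1 is given, and both are computed from this element.\<close>

lemma sc_hd_nonzero: "hd (hd (structure_constants k F)) \<in> carrier F" "hd (hd (structure_constants k F)) \<noteq> \<zero>"
proof -
 have "unit_coords k 0 ! 0 \<noteq> \<zero> ! 0" using unit_nth[of 0 0] k_pos zero_eq by simp
 then have "unit_coords k 0 \<noteq> \<zero>" by auto
 then show "hd (hd (structure_constants k F)) \<noteq> \<zero>" using k_pos integral[of "unit_coords k 0" "unit_coords k 0"] unfolding sc_hd by auto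
 show "hd (hd (structure_constants k F)) \<in> carrier F" using k_pos unfolding sc_hd by simp
qed

end

lemma expl_iff: "expl p k F \<longleftrightarrow> explicit_field p k F"
 by (simp add: expl_def)

section \<open>Field arithmetic in polynomial time\<close>

definition fld :: "('i \<Rightarrow> nat) \<Rightarrow> 'i set \<Rightarrow> ('i \<Rightarrow> btree) \<Rightarrow> ('i \<Rightarrow> nat) \<Rightarrow> ('i \<Rightarrow> nat) \<Rightarrow> ('i \<Rightarrow> nat list ring) \<Rightarrow> bool" where
 "fld N D Xi p k F \<longleftrightarrow> (\<forall>i\<in>D. expl (p i) (k i) (F i)) \<and> pt N D Xi (%i. enc_nat (p i)) \<and>
   pt N D Xi (%i. enc_list (enc_vec) (structure_constants (k i) (F i)))"

lemma fldD:
 assumes "fld N D Xi p k F"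
 shows "\<And>i. i \<in> D ==> expl (p i) (k i) (F i)" "pt N D Xi (%i. enc_nat (p i))"
  "pt N D Xi (%i. enc_list (enc_vec) (structure_constants (k i) (F i)))" "pt N D Xi Xi"
 using assms by (auto simp: fld_def intro: pt_self)

lemma fld_lift:
 assumes "fld N D Xi p k F" "\<And>A. pt N D Xi A ==> pt (on_fst N) D' Y (on_fst A)" "\<And>z. z \<in> D' ==> fst z \<in> D"
 shows "fld (on_fst N) D' Y (on_fst p) (on_fst k) (on_fst F)"
 using assms by (auto simp: fld_def)

lemma fld_sub: "fld N D Xi p k F ==> D' \<subseteq> D ==> fld N D' Xi p k F"
 by (auto simp: fld_def intro: pt_sub)

text \<open>An element is a list of \<open>k\<close> coordinates below \<open>p\<close>, and the
  table of structure constants has \<open>k\<close> rows. With this bound, membership in the carrier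
  is all that a loop invariant has to say about the size of a field element.\<close>

lemma fld_sz:
 assumes "fld N D Xi p k F"
 obtains b where "pb N D b" "\<And>i x. i \<in> D ==> x \<in> carrier (F i) ==> size (enc_elem x) \<le> b i"
  "\<And>i. i \<in> D ==> k i \<le> b i"
proof -
 let ?sc = "%i. enc_list (enc_vec) (structure_constants (k i) (F i))"
 let ?b = "%i. size (?sc i) * (2 * size (enc_nat (p i)) + 1)"
 have k: "k i \<le> size (?sc i)" for i
  using length_le_size_enc_list[of "structure_constants (k i) (F i)" "enc_vec"] by (simp add: structure_constants_def)
 have pb: "pb N D ?b"
  using pt_size[OF fldD(3)[OF assms]] pt_size[OF fldD(2)[OF assms]] by (intro pb_mult pb_add pb_const)
 have le: "size (enc_elem x) \<le> ?b i" if i: "i \<in> D" and x: "x \<in> carrier (F i)" for i x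
 proof -
  interpret expl "p i" "k i" "F i" by (rule fldD(1)[OF assms i])
  have "a \<le> p i" if "a \<in> set x" for a using that x carrier_iff[of x] by auto
  then have "size (enc_elem x) \<le> length x * (2 * size (enc_nat (p i)) + 1)"
   by (intro size_enc_list_le size_enc_nat_mono)
  also have "\<dots> \<le> ?b i" using x carrier_iff[of x] k[of i] by (intro mult_right_mono) auto
  finally show ?thesis .
 qed
 have "k i \<le> ?b i" for i by (rule le_trans[OF k]) simp
 from that[OF pb le this] show thesis .
qed

definition ptF :: "('i \<Rightarrow> nat) \<Rightarrow> 'i set \<Rightarrow> ('i \<Rightarrow> btree) \<Rightarrow> ('i \<Rightarrow> nat list ring) \<Rightarrow> ('i \<Rightarrow> nat list) \<Rightarrow> bool" where
 "ptF N D Xi F x \<longleftrightarrow> pt N D Xi (%i. enc_elem (x i)) \<and> (\<forall>i\<in>D. x i \<in> carrier (F i))"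

lemma ptFI: "pt N D Xi (%i. enc_elem (x i)) ==> (\<And>i. i \<in> D ==> x i \<in> carrier (F i)) ==> ptF N D Xi F x"
 by (simp add: ptF_def)

lemma ptFD: "ptF N D Xi F x ==> pt N D Xi (%i. enc_elem (x i))" "ptF N D Xi F x ==> i \<in> D ==> x i \<in> carrier (F i)"
 by (simp_all add: ptF_def)

lemma ptF_cong: "ptF N D Xi F x ==> (\<And>i. i \<in> D ==> x i = y i) ==> ptF N D Xi F y"
 by (auto simp: ptF_def elim: pt_cong)

lemma ptF_sub: "ptF N D Xi F x ==> D' \<subseteq> D ==> ptF N D' Xi F x"
 by (auto simp: ptF_def intro: pt_sub)

lemma ptF_lift:
 assumes "ptF N D Xi F x" "\<And>A. pt N D Xi A ==> pt (on_fst N) D' Y (on_fst A)" "\<And>z. z \<in> D' ==> fst z \<in> D"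
 shows "ptF (on_fst N) D' Y (on_fst F) (on_fst x)"
 using assms by (auto simp: ptF_def)

lemma ptF_if: "pt N D Xi (%i. eb (c i)) ==> ptF N D Xi F x ==> ptF N D Xi F y ==> ptF N D Xi F (%i. if c i then x i else y i)"
 by (auto simp: ptF_def intro: pt_if'[where e = enc_elem])

lemma ptF_zero:
 assumes f: "fld N D Xi p k F"
 shows "ptF N D Xi F (%i. \<zero>\<^bsub>F i\<^esub>)"
proof (rule ptFI)
 let ?x = "%i. hd (hd (structure_constants (k i) (F i)))"
 have x: "pt N D Xi (%i. enc_elem (?x i))"
  by (intro pt_hd fldD(3)[OF f]) (use expl.sc_hd[OF fldD(1)[OF f]] in auto)
 have "pt N D Xi (%i. enc_elem (map (%_. 0) (?x i)))"
  by (rule pt_map[OF x], rule pt_nat_const)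
 then show "pt N D Xi (%i. enc_elem (\<zero>\<^bsub>F i\<^esub>))"
 proof (rule pt_cong)
  fix i assume i: "i \<in> D"
  interpret expl "p i" "k i" "F i" by (rule fldD(1)[OF f i])
  show "enc_elem (map (%_. 0) (?x i)) = enc_elem \<zero>\<^bsub>F i\<^esub>"
   using sc_hd_nonzero(1) carrier_iff[of "?x i"] by (simp add: zero_eq map_replicate_const)
 qed
 fix i assume i: "i \<in> D"
 interpret expl "p i" "k i" "F i" by (rule fldD(1)[OF f i])
 show "\<zero>\<^bsub>F i\<^esub> \<in> carrier (F i)" by simp
qed

lemma ptF_add:
 assumes f: "fld N D Xi p k F" and x: "ptF N D Xi F x" and y: "ptF N D Xi F y"
 shows "ptF N D Xi F (%i. x i \<oplus>\<^bsub>F i\<^esub> y i)"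
proof (rule ptFI)
 have z: "pt N D Xi (%i. enc_list (ep enc_nat enc_nat) (zip (x i) (y i)))"
 proof (intro pt_zip ptFD(1)[OF x] ptFD(1)[OF y])
  fix i assume i: "i \<in> D"
  interpret expl "p i" "k i" "F i" by (rule fldD(1)[OF f i])
  show "length (x i) = length (y i)" using ptFD(2)[OF x i] ptFD(2)[OF y i] carrier_iff by simp
 qed
 have "pt N D Xi (%i. enc_elem (map (%z. if p i \<le> fst z + snd z then fst z + snd z - p i else fst z + snd z) (zip (x i) (y i))))"
 proof (rule pt_map[OF z], goal_cases)
  case (1 Y)
  show ?case by (intro pt_if'[where e = enc_nat] pt_le pt_add pt_minus 1(1)[OF fldD(2)[OF f]] pt_fst[OF 1(3)] pt_snd[OF 1(3)])
 qed
 then show "pt N D Xi (%i. enc_elem (x i \<oplus>\<^bsub>F i\<^esub> y i))"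
 proof (rule pt_cong)
  fix i assume i: "i \<in> D"
  interpret expl "p i" "k i" "F i" by (rule fldD(1)[OF f i])
  have "(if p i \<le> a + b then a + b - p i else a + b) = (a + b) mod p i" if "(a, b) \<in> set (zip (x i) (y i))" for a b
  proof -
   have "a < p i" "b < p i" using that set_zip_leftD[OF that] set_zip_rightD[OF that]
    ptFD(2)[OF x i] ptFD(2)[OF y i] carrier_iff by auto
   then show ?thesis by (auto simp: mod_if)
  qed
  then show "enc_elem (map (%z. if p i \<le> fst z + snd z then fst z + snd z - p i else fst z + snd z) (zip (x i) (y i)))
    = enc_elem (x i \<oplus>\<^bsub>F i\<^esub> y i)"
   by (auto simp: add_eq[OF ptFD(2)[OF x i] ptFD(2)[OF y i]] split_beta intro!: arg_cong[of _ _ enc_elem])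
 qed
 fix i assume i: "i \<in> D"
 interpret expl "p i" "k i" "F i" by (rule fldD(1)[OF f i])
 show "x i \<oplus>\<^bsub>F i\<^esub> y i \<in> carrier (F i)" using ptFD(2)[OF x i] ptFD(2)[OF y i] by simp
qed

text \<open>Double-and-add and square-and-multiply in one: \<open>pw i m\<close> is the
  \<open>m\<close>-fold operand and \<open>acc i m\<close> the start value combined with it. After
  \<open>j\<close> bits of \<open>n i\<close> the state is \<open>acc i (n i mod 2 ^ j)\<close> and
  \<open>pw i (2 ^ j)\<close>. The free start value \<open>a\<close> allows powers before a neutral
  element has been computed.\<close>

lemma ptF_iterate:
 assumes f: "fld N D Xi p k F" and n: "pt N D Xi (%i. enc_nat (n i))"
  and a: "ptF N D Xi F a" and b: "ptF N D Xi F b"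
  and op: "\<And>D' Y. fld (on_fst N) D' Y (on_fst p) (on_fst k) (on_fst F) ==>
    (\<And>x y. ptF (on_fst N) D' Y (on_fst F) x ==> ptF (on_fst N) D' Y (on_fst F) y ==>
    ptF (%z :: 'i \<times> (nat list \<times> nat list) \<times> bool. N (fst z)) D' Y (on_fst F) (%z. op (fst z) (x z) (y z)))"
  and pw: "\<And>i m. i \<in> D ==> pw i (m + m) = op i (pw i m) (pw i m)"
  and acc: "\<And>i m m'. i \<in> D ==> acc i (m + m') = op i (acc i m) (pw i m')"
  and st: "\<And>i. i \<in> D ==> acc i 0 = a i" "\<And>i. i \<in> D ==> pw i 1 = b i"
  and cl: "\<And>i m. i \<in> D ==> acc i m \<in> carrier (F i)" "\<And>i m. i \<in> D ==> pw i m \<in> carrier (F i)"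
 shows "ptF N D Xi F (%i. acc i (n i))"
proof (rule ptFI)
 let ?es = "ep enc_elem enc_elem"
 let ?g = "%i s x. (if x then op i (fst s) (snd s) else fst s, op i (snd s) (snd s))"
 let ?st = "%i j. (acc i (n i mod 2 ^ j), pw i (2 ^ j))"
 have st': "?g i (?st i j) (odd (n i div 2 ^ j)) = ?st i (Suc j)" if i: "i \<in> D" for i j
 proof -
  have *: "n i mod 2 ^ Suc j = n i mod 2 ^ j + of_bool (odd (n i div 2 ^ j)) * 2 ^ j"
   by (simp add: mod_mult2_eq mult.commute[of 2] odd_iff_mod_2_eq_one)
  have "(2::nat) ^ Suc j = 2 ^ j + 2 ^ j" by simp
  then have "pw i (2 ^ Suc j) = op i (pw i (2 ^ j)) (pw i (2 ^ j))" using pw[OF i] by metis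
  then show ?thesis unfolding * by (cases "odd (n i div 2 ^ j)") (simp_all add: acc[OF i])
 qed
 obtain B where B: "pb N D B" "\<And>i x. i \<in> D ==> x \<in> carrier (F i) ==> size (enc_elem x) \<le> B i"
  by (rule fld_sz[OF f]) blast
 have bb: "pt N D Xi (%i. enc_list eb (bits (n i)))" by (rule pt_bits[OF n])
 have m: "pt N D Xi (%i. ?es (foldl (?g i) (a i, b i) (bits (n i))))"
 proof (rule pt_fold[OF bb _ _ _ _ _ refl, where Inv = "%i j s. s = ?st i j" and b = "%i. 2 * B i + 1"], goal_cases)
  case 1 show ?case by (intro pt_pair ptFD(1)[OF a] ptFD(1)[OF b])
 next
  case (2 i) then show ?case using st[OF 2] by simp
 next
  case (3 i j s)
  show ?case unfolding 3(3) nth_bits[OF 3(2)] st'[OF 3(1)] by (rule refl)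
 next
  case 4 show ?case using B(1) by (intro pb_add pb_mult pb_const)
 next
  case (5 i j s)
  then show ?case using B(2)[OF 5(1) cl(1)[OF 5(1)]] B(2)[OF 5(1) cl(2)[OF 5(1)]]
   by (auto simp: size_ep mult_2 intro!: add_mono)
 next
  case (6 Y)
  let ?D = "{(i, s, x). i \<in> D \<and> (\<exists>j<length (bits (n i)). x = bits (n i) ! j \<and> s = ?st i j)}"
  have f': "fld (on_fst N) ?D Y (on_fst p) (on_fst k) (on_fst F)"
   by (rule fld_lift[OF f 6(1)]) auto
  have s1: "ptF (on_fst N) ?D Y (on_fst F) (%z. fst (fst (snd z)))"
   by (rule ptFI, rule pt_fst[OF 6(3)]) (use cl in auto)
  have s2: "ptF (on_fst N) ?D Y (on_fst F) (%z. snd (fst (snd z)))"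
   by (rule ptFI, rule pt_snd[OF 6(3)]) (use cl in auto)
  show ?case by (rule pt_pair, rule ptFD(1)[OF ptF_if[OF 6(4) op[OF f' s1 s2] s1]], rule ptFD(1)[OF op[OF f' s2 s2]])
 qed
 have f: "foldl (?g i) (?st i 0) (take j (bits (n i))) = ?st i j" if "i \<in> D" "j \<le> length (bits (n i))" for i j
  using that
 proof (induction j)
  case (Suc j)
  then have j: "j < length (bits (n i))" and IH: "foldl (?g i) (?st i 0) (take j (bits (n i))) = ?st i j" by auto
  show ?case unfolding take_Suc_nth[OF j] foldl_append foldl.simps IH nth_bits[OF j] st'[OF that(1)] by (rule refl)
 qed simp
 have f2: "foldl (?g i) (a i, b i) (bits (n i)) = ?st i (length (bits (n i)))" if "i \<in> D" for i
  using f[OF that order_refl] st[OF that] by simp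
 have "pt N D Xi (%i. ?es (?st i (length (bits (n i)))))" by (rule pt_cong[OF m]) (simp only: f2)
 from pt_fst[OF this] show "pt N D Xi (%i. enc_elem (acc i (n i)))" by (simp add: less_two_power_bits)
qed (rule cl)

lemma ptF_smul:
 assumes f: "fld N D Xi p k F" and n: "pt N D Xi (%i. enc_nat (n i))" and x: "ptF N D Xi F x"
 shows "ptF N D Xi F (%i. [(n i)] \<cdot>\<^bsub>F i\<^esub> x i)"
proof (rule ptF_iterate[OF f n ptF_zero[OF f] x, where op = "%i. add (F i)" and pw = "%i m. [m] \<cdot>\<^bsub>F i\<^esub> x i" and acc = "%i m. [m] \<cdot>\<^bsub>F i\<^esub> x i"], goal_cases)
 case (1 D' Y x y) then show ?case by (rule ptF_add)
next
 case (2 i m)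
 interpret expl "p i" "k i" "F i" by (rule fldD(1)[OF f 2(1)])
 show ?case using ptFD(2)[OF x 2(1)] by (simp add: add.nat_pow_mult)
next
 case (3 i m m')
 interpret expl "p i" "k i" "F i" by (rule fldD(1)[OF f 3(1)])
 show ?case using ptFD(2)[OF x 3(1)] by (simp add: add.nat_pow_mult)
next
 case (4 i)
 interpret expl "p i" "k i" "F i" by (rule fldD(1)[OF f 4(1)])
 show ?case by simp
next
 case (5 i)
 interpret expl "p i" "k i" "F i" by (rule fldD(1)[OF f 5(1)])
 show ?case using ptFD(2)[OF x 5(1)] by simp
next
 case (6 i m)
 interpret expl "p i" "k i" "F i" by (rule fldD(1)[OF f 6(1)])
 show ?case using ptFD(2)[OF x 6(1)] by simp
next
 case (7 i m)
 interpret expl "p i" "k i" "F i" by (rule fldD(1)[OF f 7(1)])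
 show ?case using ptFD(2)[OF x 7(1)] by simp
qed

lemma ptF_lsum:
 assumes f: "fld N D Xi p k F" and xs: "pt N D Xi (%i. enc_vec (xs i))"
  and cl: "\<And>i. i \<in> D ==> set (xs i) \<subseteq> carrier (F i)"
 shows "ptF N D Xi F (%i. expl.lsum (F i) (xs i))"
proof (rule ptFI)
 obtain B where B: "pb N D B" "\<And>i x. i \<in> D ==> x \<in> carrier (F i) ==> size (enc_elem x) \<le> B i"
  by (rule fld_sz[OF f]) blast
 have m: "pt N D Xi (%i. enc_elem (foldl (add (F i)) \<zero>\<^bsub>F i\<^esub> (xs i)))"
 proof (rule pt_fold[OF xs _ _ _ _ _ refl, where Inv = "%i j s. s \<in> carrier (F i)" and b = B], goal_cases)
  case 1 show ?case by (rule ptFD(1)[OF ptF_zero[OF f]])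
 next
  case (2 i)
  interpret expl "p i" "k i" "F i" by (rule fldD(1)[OF f 2])
  show ?case by simp
 next
  case (3 i j s)
  interpret expl "p i" "k i" "F i" by (rule fldD(1)[OF f 3(1)])
  show ?case using 3 cl[OF 3(1)] by (meson a_closed nth_mem subsetD)
 next
  case 4 show ?case by (rule B(1))
 next
  case (5 i j s) then show ?case using B(2) by blast
 next
  case (6 Y)
  have f': "fld (on_fst N) {(i, s, x). i \<in> D \<and> (\<exists>j<length (xs i). x = xs i ! j \<and> s \<in> carrier (F i))} Y (on_fst p) (on_fst k) (on_fst F)"
   by (rule fld_lift[OF f 6(1)]) auto
  show ?case
   by (rule ptFD(1)[OF ptF_add[OF f' ptFI[OF 6(3)] ptFI[OF 6(4)]]]) (use cl nth_mem in \<open>auto, blast\<close>)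
 qed
 then show "pt N D Xi (%i. enc_elem (expl.lsum (F i) (xs i)))"
  by (rule pt_cong) (simp add: expl.lsum_def[OF fldD(1)[OF f]])
 show "expl.lsum (F i) (xs i) \<in> carrier (F i)" if "i \<in> D" for i
  using expl.lsum_closed[OF fldD(1)[OF f that] cl[OF that]] .
qed

lemma ptF_mult:
 assumes f: "fld N D Xi p k F" and x: "ptF N D Xi F x" and y: "ptF N D Xi F y"
 shows "ptF N D Xi F (%i. x i \<otimes>\<^bsub>F i\<^esub> y i)"
proof -
 let ?sc = "%i. structure_constants (k i) (F i)"
 let ?row = "%i row. map (%z. [(fst z)] \<cdot>\<^bsub>F i\<^esub> snd z) (zip (y i) row)"
 let ?f = "%i z. [(fst z)] \<cdot>\<^bsub>F i\<^esub> expl.lsum (F i) (?row i (snd z))"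
 have len: "length (x i) = k i" "length (y i) = k i" "length (?sc i) = k i" if "i \<in> D" for i
  using ptFD(2)[OF x that] ptFD(2)[OF y that] expl.carrier_iff[OF fldD(1)[OF f that]] by (auto simp: structure_constants_def)
 have scrow: "length row = k i" "set row \<subseteq> carrier (F i)" if "i \<in> D" "row \<in> set (?sc i)" for i row
 proof -
  interpret expl "p i" "k i" "F i" by (rule fldD(1)[OF f that(1)])
  show "length row = k i" "set row \<subseteq> carrier (F i)" using that(2) by (auto simp: structure_constants_def)
 qed
 have rowcl: "set (?row i row) \<subseteq> carrier (F i)" if "i \<in> D" "row \<in> set (?sc i)" for i row
 proof -
  interpret expl "p i" "k i" "F i" by (rule fldD(1)[OF f that(1)])
  show ?thesis using scrow(2)[OF that] by (auto dest: set_zip_rightD)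
 qed
 have fcl: "?f i z \<in> carrier (F i)" if "i \<in> D" "z \<in> set (zip (x i) (?sc i))" for i z
 proof -
  interpret expl "p i" "k i" "F i" by (rule fldD(1)[OF f that(1)])
  have "snd z \<in> set (?sc i)" using that(2) by (auto simp: set_zip)
  from rowcl[OF that(1) this] show ?thesis by simp
 qed
 have z: "pt N D Xi (%i. enc_list (ep enc_nat (enc_vec)) (zip (x i) (?sc i)))"
  by (rule pt_zip[OF ptFD(1)[OF x] fldD(3)[OF f]]) (simp add: len)
 have m: "pt N D Xi (%i. enc_vec (map (?f i) (zip (x i) (?sc i))))"
 proof (rule pt_map[OF z], goal_cases)
  case (1 Y)
  let ?D = "{(i, z). i \<in> D \<and> z \<in> set (zip (x i) (?sc i))}"
  have f1: "fld (on_fst N) ?D Y (on_fst p) (on_fst k) (on_fst F)"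
   by (rule fld_lift[OF f 1(1)]) auto
  have mem: "snd (snd z) \<in> set (?sc (fst z))" if "z \<in> ?D" for z using that by (auto dest: set_zip_rightD)
  have z1: "pt (on_fst N) ?D Y (%z. enc_list (ep enc_nat enc_elem) (zip (y (fst z)) (snd (snd z))))"
  proof (rule pt_zip[OF 1(1)[OF ptFD(1)[OF y]] pt_snd[OF 1(3)]])
   show "length (y (fst z)) = length (snd (snd z))" if "z \<in> ?D" for z
    using scrow(1)[OF _ mem[OF that]] len(2) that by auto
  qed
  show ?case
  proof (rule ptFD(1)[OF ptF_smul[OF f1 pt_fst[OF 1(3)] ptF_lsum[OF f1]]])
   show "pt (on_fst N) ?D Y (%z. enc_vec (?row (fst z) (snd (snd z))))"
   proof (rule pt_map[OF z1], goal_cases)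
    case (1 Y2)
    let ?D2 = "{(i, x). i \<in> ?D \<and> x \<in> set (zip (y (fst i)) (snd (snd i)))}"
    have f2: "fld (%z. N (fst (fst z))) ?D2 Y2 (%z. p (fst (fst z))) (%z. k (fst (fst z))) (%z. F (fst (fst z)))"
     by (rule fld_lift[OF f1 1(1)]) auto
    show ?case
    proof (rule ptFD(1)[OF ptF_smul[OF f2 pt_fst[OF 1(3)] ptFI[OF pt_snd[OF 1(3)]]]])
     show "snd (snd z) \<in> carrier (F (fst (fst z)))" if "z \<in> ?D2" for z
      using that by (auto dest!: set_zip_rightD intro: subsetD[OF scrow(2)])
    qed
   qed
   show "set (?row (fst z) (snd (snd z))) \<subseteq> carrier (F (fst z))" if "z \<in> ?D" for z
    by (rule rowcl[OF _ mem[OF that]]) (use that in auto)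
  qed
 qed
 have "ptF N D Xi F (%i. expl.lsum (F i) (map (?f i) (zip (x i) (?sc i))))"
  by (rule ptF_lsum[OF f m]) (use fcl in auto)
 then show ?thesis
 proof (rule ptF_cong)
  fix i assume i: "i \<in> D"
  interpret expl "p i" "k i" "F i" by (rule fldD(1)[OF f i])
  show "lsum (map (?f i) (zip (x i) (?sc i))) = x i \<otimes>\<^bsub>F i\<^esub> y i"
   unfolding mult_expansion[OF ptFD(2)[OF x i] ptFD(2)[OF y i]]
   by (simp add: case_prod_unfold)
 qed
qed

text \<open>The power starts from an arbitrary \<open>a\<close>, because 1 itself is obtained
  through this lemma.\<close>

lemma ptF_pow_from:
 assumes f: "fld N D Xi p k F" and n: "pt N D Xi (%i. enc_nat (n i))" and a: "ptF N D Xi F a" and x: "ptF N D Xi F x"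
 shows "ptF N D Xi F (%i. a i \<otimes>\<^bsub>F i\<^esub> x i [^]\<^bsub>F i\<^esub> n i)"
proof (rule ptF_iterate[OF f n a x, where op = "%i a b. a \<otimes>\<^bsub>F i\<^esub> b" and pw = "%i m. x i [^]\<^bsub>F i\<^esub> m"
   and acc = "%i m. a i \<otimes>\<^bsub>F i\<^esub> x i [^]\<^bsub>F i\<^esub> m"], goal_cases)
 case (1 D' Y x y) then show ?case by (rule ptF_mult)
next
 case (2 i m)
 interpret expl "p i" "k i" "F i" by (rule fldD(1)[OF f 2(1)])
 show ?case using ptFD(2)[OF x 2(1)] by (simp add: nat_pow_mult)
next
 case (3 i m m')
 interpret expl "p i" "k i" "F i" by (rule fldD(1)[OF f 3(1)])
 show ?case using ptFD(2)[OF x 3(1)] ptFD(2)[OF a 3(1)] by (simp add: nat_pow_mult[symmetric] m_assoc)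
next
 case (4 i)
 interpret expl "p i" "k i" "F i" by (rule fldD(1)[OF f 4(1)])
 show ?case using ptFD(2)[OF a 4(1)] by simp
next
 case (5 i)
 interpret expl "p i" "k i" "F i" by (rule fldD(1)[OF f 5(1)])
 show ?case using ptFD(2)[OF x 5(1)] by simp
next
 case (6 i m)
 interpret expl "p i" "k i" "F i" by (rule fldD(1)[OF f 6(1)])
 show ?case using ptFD(2)[OF x 6(1)] ptFD(2)[OF a 6(1)] by simp
next
 case (7 i m)
 interpret expl "p i" "k i" "F i" by (rule fldD(1)[OF f 7(1)])
 show ?case using ptFD(2)[OF x 7(1)] by simp
qed

lemma pt_field_order:
 assumes f: "fld N D Xi p k F"
 shows "pt N D Xi (%i. enc_nat (p i ^ k i))"
proof -
 let ?sc = "%i. structure_constants (k i) (F i)"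
 obtain B where B: "pb N D B" "\<And>i. i \<in> D ==> k i \<le> B i"
  by (rule fld_sz[OF f]) blast
 have len: "length (?sc i) = k i" for i by (simp add: structure_constants_def)
 have m: "pt N D Xi (%i. enc_nat (foldl (%s _. s * p i) 1 (?sc i)))"
 proof (rule pt_fold[OF fldD(3)[OF f] _ _ _ _ _ refl, where Inv = "%i j s. s = p i ^ j"
    and b = "%i. 2 * (size (enc_nat (p i)) * B i + 1)"], goal_cases)
  case 1 show ?case by (rule pt_nat_const[OF fldD(4)[OF f]])
 next
  case 4 show ?case using B(1) pt_size[OF fldD(2)[OF f]] by (intro pb_add pb_mult pb_const)
 next
  case (5 i j s)
  have "p i ^ j \<le> (2 ^ size (enc_nat (p i))) ^ j" by (rule power_mono[OF less_imp_le[OF less_two_power_size]]) simp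
  also have "\<dots> \<le> 2 ^ (size (enc_nat (p i)) * B i)" unfolding power_mult[symmetric]
   by (rule power_increasing) (use 5 B(2)[OF 5(1)] len in auto)
  also have "\<dots> < 2 ^ (size (enc_nat (p i)) * B i + 1)" by simp
  finally show ?case using 5 size_enc_nat_le by blast
 next
  case (6 Y) show ?case by (intro pt_mult 6(3) 6(1)[OF fldD(2)[OF f]])
 qed auto
 moreover have "foldl (%s _. s * q) a xs = a * q ^ length xs" for q a :: nat and xs :: "nat list list list"
  by (induction xs arbitrary: a) auto
 ultimately show ?thesis by (simp add: len)
qed

text \<open>For a nonzero element \<open>x\<close> of the field with \<open>q = p ^ k\<close>
  elements, \<open>x * x ^ (q - 2)\<close> is 1; such an \<open>x\<close> is read off the structure
  constants.\<close>

lemma ptF_one: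
 assumes f: "fld N D Xi p k F"
 shows "ptF N D Xi F (%i. \<one>\<^bsub>F i\<^esub>)"
proof -
 let ?x = "%i. hd (hd (structure_constants (k i) (F i)))"
 have "pt N D Xi (%i. enc_elem (?x i))"
  by (intro pt_hd fldD(3)[OF f]) (use expl.sc_hd[OF fldD(1)[OF f]] in auto)
 then have x: "ptF N D Xi F ?x" by (rule ptFI) (use expl.sc_hd_nonzero[OF fldD(1)[OF f]] in auto)
 have "pt N D Xi (%i. enc_nat (p i ^ k i - 2))"
  by (intro pt_minus pt_field_order[OF f] pt_nat_const fldD(4)[OF f])
 from ptF_pow_from[OF f this x x] show ?thesis
 proof (rule ptF_cong)
  fix i assume i: "i \<in> D"
  interpret expl "p i" "k i" "F i" by (rule fldD(1)[OF f i])
  have "?x i \<otimes>\<^bsub>F i\<^esub> ?x i [^]\<^bsub>F i\<^esub> (p i ^ k i - 2) = ?x i [^]\<^bsub>F i\<^esub> (Suc (p i ^ k i - 2))"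
   using sc_hd_nonzero by (simp only: nat_pow_Suc2)
  also have "Suc (p i ^ k i - 2) = p i ^ k i - 1" using order_ge_2 by simp
  finally show "?x i \<otimes>\<^bsub>F i\<^esub> ?x i [^]\<^bsub>F i\<^esub> (p i ^ k i - 2) = \<one>\<^bsub>F i\<^esub>"
   using pow_order[OF sc_hd_nonzero] by simp
 qed
qed

lemma ptF_pow:
 assumes f: "fld N D Xi p k F" and n: "pt N D Xi (%i. enc_nat (n i))" and x: "ptF N D Xi F x"
 shows "ptF N D Xi F (%i. x i [^]\<^bsub>F i\<^esub> n i)"
proof (rule ptF_cong[OF ptF_pow_from[OF f n ptF_one[OF f] x]])
 fix i assume i: "i \<in> D"
 interpret expl "p i" "k i" "F i" by (rule fldD(1)[OF f i])
 show "\<one>\<^bsub>F i\<^esub> \<otimes>\<^bsub>F i\<^esub> x i [^]\<^bsub>F i\<^esub> n i = x i [^]\<^bsub>F i\<^esub> n i" using ptFD(2)[OF x i] by simp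
qed

lemma ptF_minus:
 assumes f: "fld N D Xi p k F" and x: "ptF N D Xi F x" and y: "ptF N D Xi F y"
 shows "ptF N D Xi F (%i. x i \<ominus>\<^bsub>F i\<^esub> y i)"
proof -
 have "pt N D Xi (%i. enc_nat (p i - 1))" by (intro pt_minus fldD(2)[OF f] pt_nat_const fldD(4)[OF f])
 from ptF_add[OF f x ptF_smul[OF f this y]] show ?thesis
 proof (rule ptF_cong)
  fix i assume i: "i \<in> D"
  interpret expl "p i" "k i" "F i" by (rule fldD(1)[OF f i])
  show "x i \<oplus>\<^bsub>F i\<^esub> [(p i - 1)] \<cdot>\<^bsub>F i\<^esub> y i = x i \<ominus>\<^bsub>F i\<^esub> y i"
   using a_inv_eq[OF ptFD(2)[OF y i]] by (simp add: a_minus_def)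
 qed
qed

lemma ptF_eq:
 assumes f: "fld N D Xi p k F" and x: "ptF N D Xi F x" and y: "ptF N D Xi F y"
 shows "pt N D Xi (%i. eb (x i = y i))"
proof (rule pt_eq_list[OF ptFD(1)[OF x] ptFD(1)[OF y]])
 fix i assume i: "i \<in> D"
 interpret expl "p i" "k i" "F i" by (rule fldD(1)[OF f i])
 show "length (x i) = length (y i)" using ptFD(2)[OF x i] ptFD(2)[OF y i] carrier_iff by simp
qed

section \<open>Linear dependencies by Gaussian elimination\<close>

lemma in_set_tl: "x \<in> set (tl xs) ==> x \<in> set xs"
 by (cases xs) auto

context expl
begin

text \<open>Separates the first row with nonzero head from the others. An empty first component
  means that no pivot exists, which is unambiguous because all rows are nonempty.\<close>

definition pick :: "nat list list list \<Rightarrow> nat list list \<times> nat list list list" where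
 "pick rows = foldl (%s row. if hd row = \<zero> \<or> fst s \<noteq> [] then (fst s, row # snd s) else (row, snd s)) ([], []) rows"

text \<open>Rows are cross-multiplied instead of divided by the pivot, so no inverse is computed.
  The head would become zero and is dropped.\<close>

definition elim_row :: "nat list list \<Rightarrow> nat list list \<Rightarrow> nat list list" where
 "elim_row piv row = (if piv = [] then tl row
   else map (%z. (hd piv \<otimes> fst z) \<ominus> (hd row \<otimes> snd z)) (zip (tl row) (tl piv)))"

definition elim_col :: "nat list list list \<Rightarrow> nat list list list" where
 "elim_col rows = map (elim_row (fst (pick rows))) (snd (pick rows))"

definition unit_row :: "nat \<Rightarrow> nat \<Rightarrow> nat list list" where
 "unit_row n j = map (%j'. if j' = j then \<one> else \<zero>) [0..<n]"

text \<open>Every vector is extended by a unit row that records how the row was combined. Once all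
  columns of the vectors are eliminated only the records are left, and any of them is a dependency.
  The list \<open>hd vs\<close> is folded over for its length alone, one round per column.\<close>

definition nullvec :: "nat list list list \<Rightarrow> nat list list" where
 "nullvec vs = hd (foldl (%rows _. elim_col rows)
   (map (%z. snd z @ unit_row (length vs) (fst z)) (zip [0..<length vs] vs)) (hd vs))"

lemma pick_cases:
 assumes "\<forall>r\<in>set rows. r \<noteq> []"
 shows "((\<forall>r\<in>set rows. hd r = \<zero>) \<and> pick rows = ([], rev rows)) \<or>
  (\<exists>as piv bs. rows = as @ piv # bs \<and> hd piv \<noteq> \<zero> \<and> pick rows = (piv, rev (as @ bs)))"
 using assms
proof (induction rows rule: rev_induct)
 case (snoc r rows)
 let ?g = "%s row. if hd row = \<zero> \<or> fst s \<noteq> [] then (fst s, row # snd s) else (row, snd s)"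
 have p: "pick (rows @ [r]) = ?g (pick rows) r" by (simp add: pick_def)
 have "r \<noteq> []" "\<forall>r\<in>set rows. r \<noteq> []" using snoc.prems by auto
 from snoc.IH[OF this(2)] show ?case
 proof (elim disjE exE conjE)
  assume a: "\<forall>r\<in>set rows. hd r = \<zero>" "pick rows = ([], rev rows)"
  show ?thesis
  proof (cases "hd r = \<zero>")
   case True then show ?thesis using a p by simp
  next
   case False
   then have "rows @ [r] = rows @ r # [] \<and> hd r \<noteq> \<zero> \<and> pick (rows @ [r]) = (r, rev (rows @ []))" using a p by simp
   then show ?thesis by blast
  qed
 next
  fix as piv bs assume a: "rows = as @ piv # bs" "hd piv \<noteq> \<zero>" "pick rows = (piv, rev (as @ bs))"
  then have "piv \<noteq> []" using snoc.prems by auto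
  then have "rows @ [r] = as @ piv # (bs @ [r]) \<and> hd piv \<noteq> \<zero> \<and> pick (rows @ [r]) = (piv, rev (as @ (bs @ [r])))"
   using a p by simp
  then show ?thesis by blast
 qed
qed (simp add: pick_def)

lemma elim_col_shape:
 assumes rows: "\<And>r. r \<in> set rows ==> length r = Suc L \<and> set r \<subseteq> carrier F"
 shows "\<And>r. r \<in> set (elim_col rows) ==> length r = L \<and> set r \<subseteq> carrier F"
  "length (elim_col rows) \<le> length rows"
proof -
 have ne: "\<forall>r\<in>set rows. r \<noteq> []" using rows by fastforce
 have pk: "fst (pick rows) \<in> insert [] (set rows)" "set (snd (pick rows)) \<subseteq> set rows" "length (snd (pick rows)) \<le> length rows"
  using pick_cases[OF ne] by auto
 then show "length (elim_col rows) \<le> length rows" by (simp add: elim_col_def)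
 fix r assume "r \<in> set (elim_col rows)"
 then obtain x where x: "x \<in> set (snd (pick rows))" "r = elim_row (fst (pick rows)) x"
  unfolding elim_col_def by auto
 then have xr: "length x = Suc L" "set x \<subseteq> carrier F" using pk(2) rows[of x] by auto
 show "length r = L \<and> set r \<subseteq> carrier F"
 proof (cases "fst (pick rows) = []")
  case True
  then show ?thesis using xr x(2) by (auto simp: elim_row_def dest: in_set_tl)
 next
  case False
  then have pr: "length (fst (pick rows)) = Suc L" "set (fst (pick rows)) \<subseteq> carrier F" using pk(1) rows by auto
  have "hd x \<in> carrier F" "hd (fst (pick rows)) \<in> carrier F"
   using xr pr by (metis Suc_length_conv list.sel(1) list.set_intros(1) subsetD)+
  moreover have "a \<in> carrier F \<and> b \<in> carrier F" if "(a, b) \<in> set (zip (tl x) (tl (fst (pick rows))))" for a b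
   using that xr pr by (meson set_zip_leftD set_zip_rightD in_set_tl subsetD)
  ultimately show ?thesis using False xr pr unfolding x(2) elim_row_def by fastforce
 qed
qed

definition dot :: "nat list list list \<Rightarrow> nat list list \<Rightarrow> nat \<Rightarrow> nat list" where
 "dot vs cf l = lsum (map (%j. cf ! j \<otimes> vs ! j ! l) [0..<length vs])"

definition row_of :: "nat list list list \<Rightarrow> nat \<Rightarrow> nat \<Rightarrow> nat list list \<Rightarrow> nat list list" where
 "row_of vs M t cf = map (dot vs cf) [t..<M] @ cf"

text \<open>An entry \<open>(j, cf)\<close> is the record of a surviving row together with the index
  \<open>j\<close> of the vector it started as. The record is nonzero at its own index and zero at
  those of the other survivors; this keeps it nonzero under later combinations. The length condition
  says that each column costs at most one row.\<close>

definition elim_inv :: "nat list list list \<Rightarrow> nat \<Rightarrow> nat \<Rightarrow> (nat \<times> nat list list) list \<Rightarrow> bool" where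
 "elim_inv vs M t cs \<longleftrightarrow> length vs \<le> length cs + t \<and> distinct (map fst cs) \<and>
   (\<forall>(j, cf)\<in>set cs. j < length vs \<and> length cf = length vs \<and> set cf \<subseteq> carrier F \<and> cf ! j \<noteq> \<zero> \<and>
    (\<forall>l<t. dot vs cf l = \<zero>) \<and> (\<forall>j'\<in>set (map fst cs). j' \<noteq> j \<longrightarrow> cf ! j' = \<zero>))"

context
 fixes vs :: "nat list list list" and M :: nat
 assumes vs: "\<And>v. v \<in> set vs ==> length v = M \<and> set v \<subseteq> carrier F"
begin

lemma vs_nth [simp]: "j < length vs ==> l < M ==> vs ! j ! l \<in> carrier F"
proof -
 assume "j < length vs" "l < M"
 then have "vs ! j \<in> set vs" by simp
 from vs[OF this] nth_mem[of l "vs ! j"] show ?thesis using \<open>l < M\<close> by auto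
qed

lemma dot_closed [simp]: "length cf = length vs ==> set cf \<subseteq> carrier F ==> l < M ==> dot vs cf l \<in> carrier F"
 unfolding dot_def by (rule lsum_closed) (auto intro!: m_closed simp: subset_iff)

lemma dot_lin:
 assumes a: "a \<in> carrier F" "b \<in> carrier F" and c: "length c = length vs" "set c \<subseteq> carrier F"
  and c': "length c' = length vs" "set c' \<subseteq> carrier F" and l: "l < M"
 shows "dot vs (map (%z. (a \<otimes> fst z) \<ominus> (b \<otimes> snd z)) (zip c c')) l = (a \<otimes> dot vs c l) \<ominus> (b \<otimes> dot vs c' l)"
proof -
 have cl: "c ! j \<in> carrier F" "c' ! j \<in> carrier F" if "j < length vs" for j
  using c c' that by (auto simp: subset_iff)
 have "dot vs (map (%z. (a \<otimes> fst z) \<ominus> (b \<otimes> snd z)) (zip c c')) l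
   = lsum (map (%j. a \<otimes> (c ! j \<otimes> vs ! j ! l) \<oplus> (\<ominus> b) \<otimes> (c' ! j \<otimes> vs ! j ! l)) [0..<length vs])"
  unfolding dot_def
 proof (intro arg_cong[of _ _ lsum] map_cong refl)
  fix j assume "j \<in> set [0..<length vs]"
  then have j: "j < length vs" by simp
  have "((a \<otimes> x) \<ominus> (b \<otimes> y)) \<otimes> w = a \<otimes> (x \<otimes> w) \<oplus> (\<ominus> b) \<otimes> (y \<otimes> w)"
   if "x \<in> carrier F" "y \<in> carrier F" "w \<in> carrier F" for x y w
   using that a by algebra
  from this[OF cl[OF j] vs_nth[OF j l]]
  show "map (%z. (a \<otimes> fst z) \<ominus> (b \<otimes> snd z)) (zip c c') ! j \<otimes> vs ! j ! l =
    a \<otimes> (c ! j \<otimes> vs ! j ! l) \<oplus> (\<ominus> b) \<otimes> (c' ! j \<otimes> vs ! j ! l)"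
   using j c c' by simp
 qed
 also have "\<dots> = lsum (map (%j. a \<otimes> (c ! j \<otimes> vs ! j ! l)) [0..<length vs]) \<oplus> lsum (map (%j. (\<ominus> b) \<otimes> (c' ! j \<otimes> vs ! j ! l)) [0..<length vs])"
  by (rule lsum_map_add) (use a cl l in auto)
 also have "\<dots> = a \<otimes> dot vs c l \<oplus> (\<ominus> b) \<otimes> dot vs c' l"
  unfolding dot_def by (subst (1 2) lsum_map_distrib) (use a cl l in auto)
 also have "\<dots> = (a \<otimes> dot vs c l) \<ominus> (b \<otimes> dot vs c' l)"
  using a dot_closed[OF c l] dot_closed[OF c' l] by algebra
 finally show ?thesis .
qed

lemma row_of_Suc: "t < M ==> row_of vs M t cf = dot vs cf t # row_of vs M (Suc t) cf"
 by (simp add: row_of_def upt_conv_Cons)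

text \<open>Without a pivot all rows vanish in column \<open>t\<close> already, and only their order
  changes. With a pivot, that row is given up, and each other record is combined with the pivot
  record \<open>cf0\<close> so that column \<open>t\<close> cancels.\<close>

lemma elim_step:
 assumes inv: "elim_inv vs M t cs" and t: "t < M"
 shows "\<exists>cs'. elim_inv vs M (Suc t) cs' \<and>
   elim_col (map (%c. row_of vs M t (snd c)) cs) = map (%c. row_of vs M (Suc t) (snd c)) cs'"
proof -
 let ?r = "%c. row_of vs M t (snd c)" and ?r' = "%c. row_of vs M (Suc t) (snd c)"
 have ne: "\<forall>r\<in>set (map ?r cs). r \<noteq> []" using t by (auto simp: row_of_Suc)
 have props: "j < length vs" "length cf = length vs" "set cf \<subseteq> carrier F" "cf ! j \<noteq> \<zero>" "\<And>l. l < t ==> dot vs cf l = \<zero>"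
   "\<And>j'. j' \<in> set (map fst cs) ==> j' \<noteq> j ==> cf ! j' = \<zero>" if "(j, cf) \<in> set cs" for j cf
  using inv that unfolding elim_inv_def by fast+
 have dist: "distinct (map fst cs)" and len: "length vs \<le> length cs + t" using inv unfolding elim_inv_def by auto
 from pick_cases[OF ne] show ?thesis
 proof (elim disjE exE conjE)
  assume z: "\<forall>r\<in>set (map ?r cs). hd r = \<zero>" and p: "pick (map ?r cs) = ([], rev (map ?r cs))"
  have "elim_inv vs M (Suc t) (rev cs)"
   unfolding elim_inv_def
  proof (intro conjI ballI, goal_cases)
   case 1 show ?case using len by simp
  next
   case 2 show ?case using dist by (simp add: rev_map[symmetric])
  next
   case (3 c)
   obtain j cf where c: "c = (j, cf)" by fastforce
   have m: "(j, cf) \<in> set cs" using 3 c by simp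
   have "?r (j, cf) \<in> set (map ?r cs)" unfolding set_map using m by (rule imageI)
   then have "hd (?r (j, cf)) = \<zero>" by (rule bspec[OF z])
   then have "dot vs cf t = \<zero>" using t by (simp add: row_of_Suc)
   then have "\<forall>l<Suc t. dot vs cf l = \<zero>" using props(5)[OF m] by (simp add: less_Suc_eq)
   moreover have "\<forall>j'\<in>set (map fst (rev cs)). j' \<noteq> j \<longrightarrow> cf ! j' = \<zero>"
    using props(6)[OF m] by simp
   ultimately show ?case unfolding c prod.case using props(1-4)[OF m] by blast
  qed
  moreover have "elim_col (map ?r cs) = map ?r' (rev cs)"
   using p t by (simp add: elim_col_def elim_row_def rev_map row_of_Suc)
  ultimately show ?thesis by blast
 next
  fix as piv bs assume e: "map ?r cs = as @ piv # bs" and h: "hd piv \<noteq> \<zero>" and p: "pick (map ?r cs) = (piv, rev (as @ bs))"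
  obtain as' c0 bs' where cs: "cs = as' @ c0 # bs'" "as = map ?r as'" "piv = ?r c0" "bs = map ?r bs'"
   using e by (auto simp: map_eq_append_conv map_eq_Cons_conv)
  define \<alpha> where "\<alpha> = dot vs (snd c0) t"
  obtain j0 cf0 where c0: "c0 = (j0, cf0)" by fastforce
  have c0': "(j0, cf0) \<in> set cs" using cs c0 by simp
  have \<alpha>: "\<alpha> \<noteq> \<zero>" "\<alpha> \<in> carrier F" "piv = \<alpha> # ?r' c0"
   using h cs t props(2,3)[OF c0'] c0 by (auto simp: \<alpha>_def row_of_Suc)
  define cmb where "cmb cf = map (%z. (\<alpha> \<otimes> fst z) \<ominus> (dot vs cf t \<otimes> snd z)) (zip cf cf0)" for cf
  define cs' where "cs' = map (%c. (fst c, cmb (snd c))) (rev (as' @ bs'))"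
  have fst_cs': "map fst cs' = rev (map fst (as' @ bs'))" by (simp add: cs'_def o_def rev_map)
  have mem: "(j, cf) \<in> set cs" "j \<noteq> j0" if "(j, cf) \<in> set (as' @ bs')" for j cf
   using that dist cs c0 by (auto simp: rev_image_eqI)
  have cmb_nth: "cmb cf ! i = (\<alpha> \<otimes> cf ! i) \<ominus> (dot vs cf t \<otimes> cf0 ! i)" if "(j, cf) \<in> set cs" "i < length vs" for j cf i
   using props(2)[OF that(1)] props(2)[OF c0'] that(2) by (simp add: cmb_def)
  have cl: "cf ! i \<in> carrier F" if "(j, cf) \<in> set cs" "i < length vs" for j cf i
   using props(2,3)[OF that(1)] that(2) by (metis nth_mem subsetD)
  have dcl: "dot vs cf l \<in> carrier F" if "(j, cf) \<in> set cs" "l < M" for j cf l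
   using props(2,3)[OF that(1)] that(2) by simp
  have cmb_dot: "dot vs (cmb cf) l = (\<alpha> \<otimes> dot vs cf l) \<ominus> (dot vs cf t \<otimes> dot vs cf0 l)" if "(j, cf) \<in> set cs" "l < M" for j cf l
   unfolding cmb_def by (rule dot_lin) (use props(2,3)[OF that(1)] props(2,3)[OF c0'] \<alpha> that t in auto)
  have "elim_inv vs M (Suc t) cs'"
   unfolding elim_inv_def
  proof (intro conjI ballI, goal_cases)
   case 1 show ?case using len cs by (simp add: cs'_def)
  next
   case 2 show ?case unfolding fst_cs' using dist cs by auto
  next
   case (3 c')
   then obtain j cf where c': "c' = (j, cmb cf)" and m: "(j, cf) \<in> set (as' @ bs')" by (auto simp: cs'_def)
   note mm = mem[OF m]
   \<comment> \<open>The pivot record vanishes at the index of every other survivor, so the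
     combination merely scales \<open>cf ! j\<close> by the nonzero \<open>\<alpha>\<close>.\<close>
   have j0: "cf0 ! j = \<zero>" using props(6)[OF c0', of j] mm by force
   have 1: "length (cmb cf) = length vs" using props(2)[OF mm(1)] props(2)[OF c0'] by (simp add: cmb_def)
   have 2: "set (cmb cf) \<subseteq> carrier F"
   proof
    fix x assume "x \<in> set (cmb cf)"
    then obtain a b where ab: "(a, b) \<in> set (zip cf cf0)" "x = (\<alpha> \<otimes> a) \<ominus> (dot vs cf t \<otimes> b)"
     unfolding cmb_def by auto
    have "a \<in> carrier F" "b \<in> carrier F"
     using set_zip_leftD[OF ab(1)] set_zip_rightD[OF ab(1)] props(3)[OF mm(1)] props(3)[OF c0'] by auto
    then show "x \<in> carrier F" unfolding ab(2) using \<alpha>(2) dcl[OF mm(1) t] by simp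
   qed
   have 3: "cmb cf ! j \<noteq> \<zero>"
   proof -
    have "cmb cf ! j = \<alpha> \<otimes> cf ! j"
     unfolding cmb_nth[OF mm(1) props(1)[OF mm(1)]] j0
     using \<alpha> cl[OF mm(1) props(1)[OF mm(1)]] dcl[OF mm(1) t] by (simp add: minus_eq)
    then show ?thesis
     using integral[OF _ \<alpha>(2) cl[OF mm(1) props(1)[OF mm(1)]]] \<alpha>(1) props(4)[OF mm(1)] by metis
   qed
   have 4: "dot vs (cmb cf) l = \<zero>" if "l < Suc t" for l
   proof -
    have lM: "l < M" using that t by simp
    have "dot vs (cmb cf) l = (\<alpha> \<otimes> dot vs cf l) \<ominus> (dot vs cf t \<otimes> dot vs cf0 l)"
     by (rule cmb_dot[OF mm(1) lM])
    also have "\<dots> = \<zero>"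
    proof (cases "l = t")
     case True
     have "\<alpha> = dot vs cf0 t" by (simp add: \<alpha>_def c0)
     then show ?thesis using True dcl[OF mm(1) t] \<alpha>(2) by (simp add: m_comm r_right_minus_eq)
    next
     case False
     then show ?thesis using that props(5)[OF mm(1), of l] props(5)[OF c0', of l] \<alpha> dcl[OF mm(1) t] by (simp add: minus_eq)
    qed
    finally show ?thesis .
   qed
   have 5: "cmb cf ! j' = \<zero>" if j': "j' \<in> set (map fst cs')" "j' \<noteq> j" for j'
   proof -
    have "j' \<in> fst ` set (as' @ bs')" using j'(1) unfolding fst_cs' by auto
    then obtain w where w: "w \<in> set (as' @ bs')" "fst w = j'" unfolding image_iff by metis
    define cf' where "cf' = snd w"
    have m': "(j', cf') \<in> set (as' @ bs')" using w unfolding cf'_def by (metis prod.collapse)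
    note mm' = mem[OF m']
    have mf: "j' \<in> set (map fst cs)" using mm'(1) by force
    have "cf ! j' = \<zero>" "cf0 ! j' = \<zero>"
     using props(6)[OF mm(1) mf j'(2)] props(6)[OF c0' mf mm'(2)] by auto
    then show ?thesis unfolding cmb_nth[OF mm(1) props(1)[OF mm'(1)]]
     using \<alpha> dcl[OF mm(1) t] by (simp add: minus_eq)
   qed
   show ?case using 1 2 3 4 5 props(1)[OF mm(1)] by (simp add: c')
  qed
  moreover have "elim_col (map ?r cs) = map ?r' cs'"
  proof -
   have er0: "elim_row piv (?r (j, cf)) = row_of vs M (Suc t) (cmb cf)" if m: "(j, cf) \<in> set (as' @ bs')" for j cf
   proof -
    note mm = mem[OF m]
    have "map (%z. (\<alpha> \<otimes> fst z) \<ominus> (dot vs cf t \<otimes> snd z)) (zip (map (dot vs cf) [Suc t..<M]) (map (dot vs cf0) [Suc t..<M]))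
     = map (dot vs (cmb cf)) [Suc t..<M]"
     using cmb_dot[OF mm(1)] by (simp add: zip_map_map zip_same_conv_map)
    then show ?thesis using \<alpha> t
     by (simp add: elim_row_def row_of_Suc c0) (simp add: row_of_def cmb_def)
   qed
   have er: "elim_row piv (?r c) = row_of vs M (Suc t) (cmb (snd c))" if "c \<in> set (rev (as' @ bs'))" for c
   proof -
    have "(fst c, snd c) \<in> set (as' @ bs')" using that by auto
    from er0[OF this] show ?thesis by simp
   qed
   have "map (%c. elim_row piv (?r c)) (rev (as' @ bs')) = map (%c. row_of vs M (Suc t) (cmb (snd c))) (rev (as' @ bs'))"
    by (rule map_cong[OF refl]) (rule er)
   then show ?thesis unfolding elim_col_def p cs'_def cs(2,4) by (simp add: rev_map o_def)
  qed
  ultimately show ?thesis by blast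
 qed
qed

lemma elim_steps:
 assumes "elim_inv vs M 0 cs" "length us \<le> M"
 shows "\<exists>cs'. elim_inv vs M (length us) cs' \<and>
   foldl (%rows _. elim_col rows) (map (%c. row_of vs M 0 (snd c)) cs) us = map (%c. row_of vs M (length us) (snd c)) cs'"
 using assms(2)
proof (induction us rule: rev_induct)
 case (snoc u us)
 then obtain cs' where cs': "elim_inv vs M (length us) cs'"
   "foldl (%rows _. elim_col rows) (map (%c. row_of vs M 0 (snd c)) cs) us = map (%c. row_of vs M (length us) (snd c)) cs'"
  by auto
 from elim_step[OF cs'(1)] snoc.prems cs'(2) show ?case by auto
qed (use assms in auto)

lemma dot_unit:
 assumes "j < length vs" "l < M"
 shows "dot vs (unit_row (length vs) j) l = vs ! j ! l"
proof -
 have "lsum (map (%j'. (if j' = j then \<one> else \<zero>) \<otimes> vs ! j' ! l) [0..<n]) = (if j < n then vs ! j ! l else \<zero>)"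
  if "n \<le> length vs" for n
  using that assms by (induction n) (auto simp: less_Suc_eq)
 note * = this[of "length vs"]
 have "dot vs (unit_row (length vs) j) l = lsum (map (%j'. (if j' = j then \<one> else \<zero>) \<otimes> vs ! j' ! l) [0..<length vs])"
  unfolding dot_def by (intro arg_cong[of _ _ lsum] map_cong refl) (simp add: unit_row_def)
 then show ?thesis using * assms by simp
qed

text \<open>At most one row is lost for each of the \<open>M\<close> columns, and there are more
  than \<open>M\<close> rows at the start, so a row survives. The last claim makes the
  \<open>hd\<close> in \<open>nullvec\<close> meaningful.\<close>

lemma nullvec:
 assumes "length vs > M"
 shows "length (nullvec vs) = length vs" "set (nullvec vs) \<subseteq> carrier F" "\<exists>j<length vs. nullvec vs ! j \<noteq> \<zero>"
  "\<And>l. l < M ==> dot vs (nullvec vs) l = \<zero>"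
  "foldl (%rows _. elim_col rows)
   (map (%z. snd z @ unit_row (length vs) (fst z)) (zip [0..<length vs] vs)) (hd vs) \<noteq> []"
proof -
 let ?n = "length vs"
 define cs where "cs = map (%j. (j, unit_row ?n j)) [0..<?n]"
 have "elim_inv vs M 0 cs"
  unfolding elim_inv_def by (auto simp: cs_def o_def unit_row_def)
 moreover have hd: "length (hd vs) = M" using assms vs[of "hd vs"] by (cases vs) auto
 ultimately obtain cs' where cs': "elim_inv vs M M cs'"
  "foldl (%rows _. elim_col rows) (map (%c. row_of vs M 0 (snd c)) cs) (hd vs) = map (%c. row_of vs M M (snd c)) cs'"
  using elim_steps[of cs "hd vs"] by auto
 have "map (%z. snd z @ unit_row ?n (fst z)) (zip [0..<?n] vs) = map (%c. row_of vs M 0 (snd c)) cs"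
 proof -
  have "map (dot vs (unit_row ?n i)) [0..<M] = vs ! i" if "i < ?n" for i
   using that vs[of "vs ! i"] by (auto intro!: nth_equalityI simp: dot_unit)
  then have "row_of vs M 0 (unit_row ?n i) = vs ! i @ unit_row ?n i" if "i < ?n" for i
   using that by (simp add: row_of_def)
  then show ?thesis unfolding cs_def by (intro nth_equalityI) simp_all
 qed
 note me = this
 then have nv: "nullvec vs = hd (map snd cs')" using cs'(2) by (simp add: nullvec_def row_of_def)
 have "cs' \<noteq> []" using cs'(1) assms by (auto simp: elim_inv_def)
 then obtain c cs2 where c': "cs' = c # cs2" by (cases cs') auto
 obtain j cf where "c = (j, cf)" by fastforce
 then have c: "(j, cf) \<in> set cs'" "nullvec vs = cf" using nv c' by auto
 show "foldl (%rows _. elim_col rows)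
   (map (%z. snd z @ unit_row ?n (fst z)) (zip [0..<?n] vs)) (hd vs) \<noteq> []"
  unfolding me cs'(2) c' by simp
 from c cs'(1) show "length (nullvec vs) = length vs" "set (nullvec vs) \<subseteq> carrier F" "\<exists>j<length vs. nullvec vs ! j \<noteq> \<zero>"
  "\<And>l. l < M ==> dot vs (nullvec vs) l = \<zero>"
  unfolding elim_inv_def by fast+
qed

end

end

lemma pt_pick:
 assumes f: "fld N D Xi p k F" and rows: "pt N D Xi (%i. enc_list (enc_vec) (rows i))"
  and cl: "\<And>i r. i \<in> D ==> r \<in> set (rows i) ==> r \<noteq> [] \<and> set r \<subseteq> carrier (F i)"
 shows "pt N D Xi (%i. ep (enc_vec) (enc_list (enc_vec)) (expl.pick (F i) (rows i)))"
proof -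
 let ?er = "enc_vec"
 let ?S = "%i. size (enc_list ?er (rows i))"
 let ?g = "%i s row. if hd row = \<zero>\<^bsub>F i\<^esub> \<or> fst s \<noteq> [] then (fst s, row # snd s) else (row, snd s)"
 let ?Inv = "%i j s. fst s \<in> insert [] (set (rows i)) \<and> set (snd s) \<subseteq> set (rows i) \<and> length (snd s) \<le> j"
 have m: "pt N D Xi (%i. ep ?er (enc_list ?er) (foldl (?g i) ([], []) (rows i)))"
 proof (rule pt_fold[OF rows _ _ _ _ _ refl, where Inv = ?Inv and b = "%i. ?S i + length (rows i) * (?S i + 1) + 1"], goal_cases)
  case 1 show ?case by (intro pt_pair pt_Nil fldD(4)[OF f])
 next
  case (3 i j s) then show ?case using nth_mem[OF 3(2)] by auto
 next
  case 4 show ?case using pt_size[OF rows] pt_length_bound[OF rows] by (intro pb_add pb_mult pb_const)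
 next
  case (5 i j s)
  have "size (?er (fst s)) \<le> ?S i" using 5 by (auto dest: size_mem_enc_list[of _ _ ?er])
  moreover have "size (enc_list ?er (snd s)) \<le> length (snd s) * (?S i + 1)"
   by (rule size_enc_list_le) (use 5 in \<open>auto dest: size_mem_enc_list[of _ _ ?er]\<close>)
  moreover have "\<dots> \<le> length (rows i) * (?S i + 1)" using 5 by (intro mult_right_mono) auto
  ultimately show ?case by (simp add: size_ep)
 next
  case (6 Y)
  let ?D = "{(i, s, x). i \<in> D \<and> (\<exists>j<length (rows i). x = rows i ! j \<and> ?Inv i j s)}"
  have f': "fld (on_fst N) ?D Y (on_fst p) (on_fst k) (on_fst F)"
   by (rule fld_lift[OF f 6(1)]) auto
  have cl': "snd (snd z) \<noteq> [] \<and> set (snd (snd z)) \<subseteq> carrier (F (fst z))" if z: "z \<in> ?D" for z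
  proof -
   have "fst z \<in> D" "snd (snd z) \<in> set (rows (fst z))" using z by auto
   then show ?thesis by (rule cl)
  qed
  have h: "ptF (on_fst N) ?D Y (on_fst F) (%z. hd (snd (snd z)))"
  proof (rule ptFI, rule pt_hd, rule 6(4))
   fix z assume z: "z \<in> ?D"
   show "snd (snd z) \<noteq> []" using cl'[OF z] by simp
   then show "hd (snd (snd z)) \<in> carrier (F (fst z))" using cl'[OF z] hd_in_set by blast
  qed
  show ?case
   by (rule pt_if'[where e = "ep ?er (enc_list ?er)"])
    (rule pt_disj, rule ptF_eq[OF f' h ptF_zero[OF f']], rule pt_not, rule pt_null, rule pt_fst[OF 6(3)],
     rule pt_pair, rule pt_fst[OF 6(3)], rule pt_Cons, rule 6(4), rule pt_snd[OF 6(3)],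
     rule pt_pair, rule 6(4), rule pt_snd[OF 6(3)])
 qed auto
 then show ?thesis by (rule pt_cong) (simp add: expl.pick_def[OF fldD(1)[OF f]])
qed

lemma pt_elim_col:
 assumes f: "fld N D Xi p k F" and rows: "pt N D Xi (%i. enc_list (enc_vec) (rows i))"
  and cl: "\<And>i r. i \<in> D ==> r \<in> set (rows i) ==> length r = Suc (L i) \<and> set r \<subseteq> carrier (F i)"
 shows "pt N D Xi (%i. enc_list (enc_vec) (expl.elim_col (F i) (rows i)))"
proof -
 let ?er = "enc_vec"
 have ne: "r \<noteq> [] \<and> set r \<subseteq> carrier (F i)" if "i \<in> D" "r \<in> set (rows i)" for i r using cl[OF that] by auto
 have pm: "fst (expl.pick (F i) (rows i)) \<in> insert [] (set (rows i))" "set (snd (expl.pick (F i) (rows i))) \<subseteq> set (rows i)"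
  if "i \<in> D" for i
  using expl.pick_cases[OF fldD(1)[OF f], of i "rows i"] ne[OF that] that by auto
 have pk: "pt N D Xi (%i. ep ?er (enc_list ?er) (expl.pick (F i) (rows i)))"
  by (rule pt_pick[OF f rows]) (rule ne)
 show ?thesis
 proof (rule pt_cong[OF pt_map[OF pt_snd[OF pk], where f = "%i. expl.elim_row (F i) (fst (expl.pick (F i) (rows i)))" and e' = "enc_vec"]], goal_cases)
  case (1 Y)
  note Y = 1(1) and x = 1(3)
  let ?D = "{(i, x). i \<in> D \<and> x \<in> set (snd (expl.pick (F i) (rows i)))}"
  let ?N = "%z :: 'a \<times> nat list list. N (fst z)"
  let ?piv = "%z. fst (expl.pick (F (fst z)) (rows (fst z)))"
  let ?D1 = "{z \<in> ?D. ?piv z \<noteq> []}"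
  have f1: "fld ?N ?D1 Y (on_fst p) (on_fst k) (on_fst F)"
   by (rule fld_sub[OF fld_lift[OF f Y]]) auto
  have piv: "pt ?N ?D Y (%z. ?er (?piv z))" by (rule Y[OF pt_fst[OF pk]])
  have piv1: "pt ?N ?D1 Y (%z. ?er (?piv z))" by (rule pt_sub[OF piv]) auto
  have x1: "pt ?N ?D1 Y (%z. ?er (snd z))" by (rule pt_sub[OF x]) auto
  have xc: "length (snd z) = Suc (L (fst z))" "set (snd z) \<subseteq> carrier (F (fst z))" if z: "z \<in> ?D" for z
  proof -
   have D: "fst z \<in> D" and "snd z \<in> set (snd (expl.pick (F (fst z)) (rows (fst z))))" using z by auto
   then have "snd z \<in> set (rows (fst z))" using pm(2)[OF D] by blast
   then show "length (snd z) = Suc (L (fst z))" "set (snd z) \<subseteq> carrier (F (fst z))" using cl[OF D] by auto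
  qed
  have pc: "length (?piv z) = Suc (L (fst z))" "set (?piv z) \<subseteq> carrier (F (fst z))" if "z \<in> ?D1" for z
   using that pm(1)[of "fst z"] cl[of "fst z" "?piv z"] by auto
  have hd_in: "hd w \<in> C" if "length w = Suc n" "set w \<subseteq> C" for w :: "nat list list" and n C
   using that by (cases w) auto
  have hx: "ptF ?N ?D1 Y (on_fst F) (%z. hd (snd z))"
  proof (rule ptFI, rule pt_hd, rule x1)
   fix z assume "z \<in> ?D1"
   then have z: "z \<in> ?D" by simp
   show "snd z \<noteq> []" "hd (snd z) \<in> carrier (F (fst z))" using xc[OF z] hd_in[OF xc[OF z]] by auto
  qed
  have hp: "ptF ?N ?D1 Y (on_fst F) (%z. hd (?piv z))"
  proof (rule ptFI, rule pt_hd, rule piv1)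
   fix z assume z: "z \<in> ?D1"
   show "?piv z \<noteq> []" "hd (?piv z) \<in> carrier (F (fst z))" using pc[OF z] hd_in[OF pc[OF z]] by auto
  qed
  have zz: "pt ?N ?D1 Y (%z. enc_list (ep enc_elem enc_elem) (zip (tl (snd z)) (tl (?piv z))))"
  proof (intro pt_zip pt_tl x1 piv1)
   fix z assume z: "z \<in> ?D1"
   then have z': "z \<in> ?D" by simp
   show "length (tl (snd z)) = length (tl (?piv z))" using xc(1)[OF z'] pc(1)[OF z] by simp
  qed
  have zc: "fst w \<in> carrier (F (fst z))" "snd w \<in> carrier (F (fst z))"
   if z: "z \<in> ?D1" and w: "w \<in> set (zip (tl (snd z)) (tl (?piv z)))" for z w
  proof -
   obtain a b where ab: "w = (a, b)" by fastforce
   have z': "z \<in> ?D" using z by simp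
   have "a \<in> set (snd z)" "b \<in> set (?piv z)" using w unfolding ab
    by (meson set_zip_leftD set_zip_rightD in_set_tl)+
   then show "fst w \<in> carrier (F (fst z))" "snd w \<in> carrier (F (fst z))"
    using xc(2)[OF z'] pc(2)[OF z] ab by auto
  qed
  let ?c = "%z w. (hd (?piv z) \<otimes>\<^bsub>F (fst z)\<^esub> fst w) \<ominus>\<^bsub>F (fst z)\<^esub> (hd (snd z) \<otimes>\<^bsub>F (fst z)\<^esub> snd w)"
  have "pt ?N ?D1 Y (%z. ?er (map (?c z) (zip (tl (snd z)) (tl (?piv z)))))"
  proof (rule pt_map[OF zz], goal_cases)
   case (1 Y2)
   let ?D2 = "{(z, w). z \<in> ?D1 \<and> w \<in> set (zip (tl (snd z)) (tl (?piv z)))}"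
   have f2: "fld (%z. ?N (fst z)) ?D2 Y2 (%z. p (fst (fst z))) (%z. k (fst (fst z))) (%z. F (fst (fst z)))"
    by (rule fld_lift[OF f1 1(1)]) auto
   have w1: "ptF (%z. ?N (fst z)) ?D2 Y2 (%z. F (fst (fst z))) (%z. fst (snd z))"
   proof (rule ptFI, rule pt_fst[OF 1(3)])
    fix z assume "z \<in> ?D2"
    then have a: "fst z \<in> ?D1" and b: "snd z \<in> set (zip (tl (snd (fst z))) (tl (?piv (fst z))))" by auto
    show "fst (snd z) \<in> carrier (F (fst (fst z)))" by (rule zc[OF a b])
   qed
   have w2: "ptF (%z. ?N (fst z)) ?D2 Y2 (%z. F (fst (fst z))) (%z. snd (snd z))"
   proof (rule ptFI, rule pt_snd[OF 1(3)])
    fix z assume "z \<in> ?D2"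
    then have a: "fst z \<in> ?D1" and b: "snd z \<in> set (zip (tl (snd (fst z))) (tl (?piv (fst z))))" by auto
    show "snd (snd z) \<in> carrier (F (fst (fst z)))" by (rule zc[OF a b])
   qed
   have h1: "ptF (%z. ?N (fst z)) ?D2 Y2 (%z. F (fst (fst z))) (%z. hd (?piv (fst z)))"
    by (rule ptF_lift[OF hp 1(1)]) auto
   have h2: "ptF (%z. ?N (fst z)) ?D2 Y2 (%z. F (fst (fst z))) (%z. hd (snd (fst z)))"
    by (rule ptF_lift[OF hx 1(1)]) auto
   show ?case by (rule ptFD(1)[OF ptF_minus[OF f2 ptF_mult[OF f2 h1 w1] ptF_mult[OF f2 h2 w2]]])
  qed
  then have a: "pt ?N {z \<in> ?D. \<not> ?piv z = []} Y (%z. ?er (map (?c z) (zip (tl (snd z)) (tl (?piv z)))))" by simp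
  have b: "pt ?N ?D Y (%z. ?er (if ?piv z = [] then tl (snd z) else map (?c z) (zip (tl (snd z)) (tl (?piv z)))))"
   by (rule pt_if[where e = ?er, OF pt_null[OF piv] _ a], rule pt_tl, rule pt_sub[OF x]) auto
  show ?case
   by (rule pt_cong[OF b]) (auto simp: expl.elim_row_def[OF fldD(1)[OF f]])
 next
  case (2 i) show ?case by (simp add: expl.elim_col_def[OF fldD(1)[OF f 2]])
 qed
qed

lemma pt_unit_row:
 assumes f: "fld N D Xi p k F" and us: "pt N D Xi (%i. enc_list e (us i))" and j: "pt N D Xi (%i. enc_nat (j i))"
 shows "pt N D Xi (%i. enc_vec (expl.unit_row (F i) (length (us i)) (j i)))"
proof (rule pt_cong[OF pt_map[OF pt_upt_length[OF us], where f = "%i j'. if j' = j i then \<one>\<^bsub>F i\<^esub> else \<zero>\<^bsub>F i\<^esub>" and e' = enc_elem]], goal_cases)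
 case (1 Y)
 show ?case
  by (rule pt_if'[where e = enc_elem], rule pt_eq[OF 1(3) 1(1)[OF j]],
    rule 1(1)[OF ptFD(1)[OF ptF_one[OF f]]], rule 1(1)[OF ptFD(1)[OF ptF_zero[OF f]]])
next
 case (2 i) then show ?case by (simp add: expl.unit_row_def[OF fldD(1)[OF f 2]])
qed

lemma pt_nullvec:
 assumes f: "fld N D Xi p k F" and vs: "pt N D Xi (%i. enc_list (enc_vec) (vs i))"
  and cl: "\<And>i v. i \<in> D ==> v \<in> set (vs i) ==> length v = M i \<and> set v \<subseteq> carrier (F i)"
  and len: "\<And>i. i \<in> D ==> length (vs i) > M i"
 shows "pt N D Xi (%i. enc_vec (expl.nullvec (F i) (vs i)))"
proof -
 let ?er = "enc_vec"
 let ?n = "%i. length (vs i)"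
 let ?u = "%i. expl.unit_row (F i) (?n i)"
 let ?z = "%i. zip [0..<?n i] (vs i)"
 let ?r0 = "%i. map (%z. snd z @ ?u i (fst z)) (?z i)"
 let ?g = "%i rows (_ :: nat list). expl.elim_col (F i) rows"
 let ?Inv = "%i j rows. (\<forall>r\<in>set rows. length r = M i + ?n i - j \<and> set r \<subseteq> carrier (F i)) \<and> length rows \<le> ?n i"
 obtain B where B: "pb N D B" "\<And>i x. i \<in> D ==> x \<in> carrier (F i) ==> size (enc_elem x) \<le> B i"
  by (rule fld_sz[OF f]) blast
 have hdv: "hd (vs i) \<in> set (vs i)" if "i \<in> D" for i using len[OF that] by (cases "vs i") auto
 have hdl: "length (hd (vs i)) = M i" if "i \<in> D" for i using cl[OF that hdv[OF that]] by simp
 have h: "pt N D Xi (%i. ?er (hd (vs i)))" by (rule pt_hd[OF vs]) (use len in force)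
 have r0: "pt N D Xi (%i. enc_list ?er (?r0 i))"
 proof (rule pt_map[OF pt_enumerate[OF vs]], goal_cases)
  case (1 Y)
  let ?D = "{(i, z). i \<in> D \<and> z \<in> set (?z i)}"
  have f': "fld (on_fst N) ?D Y (on_fst p) (on_fst k) (on_fst F)"
   by (rule fld_lift[OF f 1(1)]) auto
  show ?case by (intro pt_append pt_snd[OF 1(3)] pt_unit_row[OF f' 1(1)[OF vs] pt_fst[OF 1(3)]])
 qed
 have m: "pt N D Xi (%i. enc_list ?er (foldl (?g i) (?r0 i) (hd (vs i))))"
 proof (rule pt_fold[OF h _ _ _ _ _ refl, where Inv = ?Inv and b = "%i. ?n i * ((M i + ?n i) * (B i + 1) + 1)"], goal_cases)
  case 1 show ?case by (rule r0)
 next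
  case (2 i)
  interpret expl "p i" "k i" "F i" by (rule fldD(1)[OF f 2])
  show ?case using cl[OF 2] by (auto simp: unit_row_def dest!: set_zip_rightD dest: cl[OF 2, THEN conjunct2, THEN subsetD])
 next
  case (3 i j s)
  interpret expl "p i" "k i" "F i" by (rule fldD(1)[OF f 3(1)])
  have j: "j < M i" using 3 hdl by simp
  have "r \<in> set s ==> length r = Suc (M i + ?n i - Suc j) \<and> set r \<subseteq> carrier (F i)" for r
   using 3(3) j by auto
  from elim_col_shape[OF this] 3(3) show ?case by force
 next
  case 4
  have "pb N D (%i. length (hd (vs i)))" by (rule pt_length_bound[OF h])
  then have "pb N D M" by (rule pb_le) (simp add: hdl)
  then show ?case using B(1) pt_length_bound[OF vs] by (intro pb_add pb_mult pb_const)
 next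
  case (5 i j s)
  have "size (?er r) \<le> (M i + ?n i) * (B i + 1)" if r: "r \<in> set s" for r
  proof -
   have "size (?er r) \<le> length r * (B i + 1)"
    by (rule size_enc_list_le) (use r 5 B(2) in blast)
   also have "\<dots> \<le> (M i + ?n i) * (B i + 1)" using r 5 by (intro mult_right_mono) auto
   finally show ?thesis .
  qed
  then have "size (enc_list ?er s) \<le> length s * ((M i + ?n i) * (B i + 1) + 1)" by (rule size_enc_list_le)
  also have "\<dots> \<le> ?n i * ((M i + ?n i) * (B i + 1) + 1)" using 5 by (intro mult_right_mono) auto
  finally show ?case .
 next
  case (6 Y)
  let ?D = "{(i, s, x). i \<in> D \<and> (\<exists>j<length (hd (vs i)). x = hd (vs i) ! j \<and> ?Inv i j s)}"
  have f': "fld (on_fst N) ?D Y (on_fst p) (on_fst k) (on_fst F)"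
   by (rule fld_lift[OF f 6(1)]) auto
  show ?case
  \<comment> \<open>The row length depends on the loop index, which is not part of the triple
    \<open>z\<close>; it is recovered from the first row of the current state.\<close>
  proof (rule pt_elim_col[OF f' 6(3), where L = "%z. length (hd (fst (snd z))) - 1"])
   fix z r assume z: "z \<in> ?D" and r: "r \<in> set (fst (snd z))"
   then obtain j where j: "fst z \<in> D" "j < M (fst z)" "?Inv (fst z) j (fst (snd z))" using hdl by auto
   have "hd (fst (snd z)) \<in> set (fst (snd z))" using r by (cases "fst (snd z)") auto
   then have "length (hd (fst (snd z))) = M (fst z) + ?n (fst z) - j" using j by blast
   moreover have "length r = M (fst z) + ?n (fst z) - j" "set r \<subseteq> carrier (F (fst z))" using j r by blast+
   ultimately show "length r = Suc (length (hd (fst (snd z))) - 1) \<and> set r \<subseteq> carrier (F (fst z))"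
    using j(2) by simp
  qed
 qed
 have "foldl (?g i) (?r0 i) (hd (vs i)) \<noteq> []" if "i \<in> D" for i
  by (rule expl.nullvec(5)[OF fldD(1)[OF f that] cl[OF that] len[OF that]])
 then show ?thesis
  by (intro pt_cong[OF pt_hd[OF m]]) (simp_all add: expl.nullvec_def[OF fldD(1)[OF f]])
qed

section \<open>Sifting through a tower of cyclic groups, and recognition of cosets of
  \<open>d\<close>-th powers\<close>

lemma find_SomeD: "find P xs = Some x ==> x \<in> set xs" "find P xs = Some x ==> P x"
 by (induction xs) (auto split: if_splits)

lemma find_uptD:
 assumes "find P [a..<b] = Some n"
 shows "a \<le> n" "n < b" "P n" "\<And>j. a \<le> j ==> j < n ==> \<not> P j"
proof -
 obtain i where i: "i < length [a..<b]" "P ([a..<b] ! i)" "n = [a..<b] ! i" "\<forall>j<i. \<not> P ([a..<b] ! j)"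
  using assms by (auto simp: find_Some_iff simp del: upt_Suc)
 then have n: "n = a + i" by simp
 show "a \<le> n" "n < b" "P n" using i n by simp_all
 fix j assume j: "a \<le> j" "j < n"
 then show "\<not> P j" using i(4)[rule_format, of "j - a"] i(1) n by simp
qed

context expl
begin

abbreviation "cnz \<equiv> carrier F - {\<zero>}"

lemma nz_mult [simp]: "x \<in> cnz ==> y \<in> cnz ==> x \<otimes> y \<in> cnz"
 using integral by auto

lemma nz_pow [simp]: "x \<in> cnz ==> x [^] (n::nat) \<in> cnz"
 by (induction n) (use integral in auto)

lemma nz_one [simp]: "\<one> \<in> cnz"
 by simp

text \<open>\<open>fst s\<close> is the element being sifted, and \<open>snd s\<close> collects the
  factors whose \<open>d\<close>-th powers have been multiplied into it. A pair
  \<open>(h, o')\<close> takes an element whose exponent divides that of the upper level down to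
  exponent \<open>o'\<close>. If no power of \<open>h\<close> fits, exponent 0 leaves the element as
  it is.\<close>

definition sift_step :: "nat \<Rightarrow> nat list \<times> nat list \<Rightarrow> nat list \<times> nat \<Rightarrow> nat list \<times> nat list" where
 "sift_step d s ho = (let r = find (%x. (fst s \<otimes> (fst ho [^] x) [^] d) [^] snd ho = \<one>) [0..<d];
   c = fst ho [^] (if r = None then 0 else the r) in (fst s \<otimes> c [^] d, snd s \<otimes> c))"

definition sift :: "nat \<Rightarrow> (nat list \<times> nat) list \<Rightarrow> nat list \<Rightarrow> nat list \<times> nat list" where
 "sift d tow \<delta> = foldl (sift_step d) (\<delta>, \<one>) tow"

text \<open>The index of the new level is the order of \<open>((h [^] d) [^] fst s)\<close>,
  searched among \<open>1..d\<close>. The pair is put in front, so that \<open>sift\<close> descends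
  from the largest exponent to \<open>B\<close>.\<close>

definition tower_step :: "nat \<Rightarrow> nat \<times> (nat list \<times> nat) list \<Rightarrow> nat list \<Rightarrow> nat \<times> (nat list \<times> nat) list" where
 "tower_step d s h = (let r = find (%n. ((h [^] d) [^] fst s) [^] n = \<one>) [1..<Suc d]
   in (fst s * (if r = None then 1 else the r), (h, fst s) # snd s))"

definition tower :: "nat \<Rightarrow> nat \<Rightarrow> nat list list \<Rightarrow> nat \<times> (nat list \<times> nat) list" where
 "tower d B hs = foldl (tower_step d) (B, []) hs"

text \<open>\<open>c \<otimes> \<alpha> [^] (d - 1)\<close> differs from the quotient of
  \<open>c\<close> by \<open>\<alpha>\<close> only by the \<open>d\<close>-th power of
  \<open>\<alpha>\<close>, so it tests the same coset without a division. How the returned factor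
  arises is shown in \<open>classify_sound\<close>.\<close>

definition classify :: "nat \<Rightarrow> nat \<Rightarrow> nat \<Rightarrow> (nat list \<times> nat) list \<Rightarrow> nat list list \<Rightarrow> nat list \<Rightarrow> (nat \<times> nat list) option" where
 "classify d B u tow C \<alpha> = (let r = find (%z. fst (sift d tow (snd z \<otimes> \<alpha> [^] (d - 1))) [^] B = \<one>) (zip [0..<length C] C)
   in if r = None then None else Some (fst (the r),
    (\<alpha> \<otimes> snd (sift d tow (snd (the r) \<otimes> \<alpha> [^] (d - 1)))) \<otimes> fst (sift d tow (snd (the r) \<otimes> \<alpha> [^] (d - 1))) [^] u))"

text \<open>The last two premises say that \<open>((h [^] d) [^] o')\<close> has order exactly
  \<open>n\<close>; the exponent of the group grows by this factor, which is at most
  \<open>d\<close>.\<close>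

inductive tower_ok :: "nat \<Rightarrow> nat \<Rightarrow> nat \<Rightarrow> (nat list \<times> nat) list \<Rightarrow> bool" for d B where
 base: "tower_ok d B B []"
| step: "tower_ok d B o' tow ==> h \<in> cnz ==> 1 \<le> n ==> n \<le> d ==> ((h [^] d) [^] o') [^] n = \<one> ==>
  (\<And>t. 0 < t ==> t < n ==> ((h [^] d) [^] o') [^] t \<noteq> \<one>) ==> tower_ok d B (o' * n) ((h, o') # tow)"

lemma card_roots_le: "n > 0 ==> card {x \<in> carrier F. x [^] (n::nat) = \<one>} \<le> n"
 using num_roots_le_deg[OF finite_carrier, of n] by simp

lemma pow_inj:
 assumes "\<theta> \<in> cnz" "\<And>t. 0 < t ==> t < n ==> \<theta> [^] (t::nat) \<noteq> \<one>"
 shows "inj_on (%x. \<theta> [^] x) {..<n}"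
proof -
 have "x = y" if "x \<le> y" "y < n" "\<theta> [^] x = \<theta> [^] y" for x y
 proof (rule ccontr)
  assume "x \<noteq> y"
  then have t: "0 < y - x" "y - x < n" using that by auto
  have "\<theta> [^] x \<otimes> \<theta> [^] (y - x) = \<theta> [^] x \<otimes> \<one>"
  proof -
   have "\<theta> [^] x \<otimes> \<theta> [^] (y - x) = \<theta> [^] (x + (y - x))" using assms(1) by (intro nat_pow_mult) auto
   then show ?thesis using that assms(1) by simp
  qed
  moreover have "\<theta> [^] x \<noteq> \<zero>" using nz_pow[OF assms(1), of x] by blast
  ultimately have "\<theta> [^] (y - x) = \<one>"
   using assms(1) by (subst (asm) m_lcancel) auto
  then show False using assms(2)[OF t] by simp
 qed
 then show ?thesis unfolding inj_on_def by (metis lessThan_iff nat_le_linear)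
qed

text \<open>The first \<open>n\<close> powers of \<open>\<theta>\<close> are distinct roots of
  \<open>X ^ n - 1\<close>. A field has at most \<open>n\<close> such roots, so there are no
  others.\<close>

lemma root_is_power:
 assumes \<theta>: "\<theta> \<in> cnz" "\<theta> [^] n = \<one>" "\<And>t. 0 < t ==> t < n ==> \<theta> [^] (t::nat) \<noteq> \<one>" and n: "1 \<le> n"
  and \<eta>: "\<eta> \<in> carrier F" "\<eta> [^] n = \<one>"
 obtains x where "x < n" "\<eta> = \<theta> [^] x"
proof -
 let ?R = "{x \<in> carrier F. x [^] n = \<one>}"
 have sub: "(%x. \<theta> [^] x) ` {..<n} \<subseteq> ?R"
 proof (clarsimp, intro conjI)
  fix x :: nat
  show "\<theta> [^] x \<in> carrier F" using \<theta> by simp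
  have "(\<theta> [^] x) [^] n = (\<theta> [^] n) [^] x" using \<theta>(1) by (simp add: nat_pow_pow mult.commute)
  then show "(\<theta> [^] x) [^] n = \<one>" using \<theta>(2) by simp
 qed
 have "card ((%x. \<theta> [^] x) ` {..<n}) = n" using card_image[OF pow_inj[OF \<theta>(1,3)]] by simp
 moreover have "card ?R \<le> n" using card_roots_le[of n] n by simp
 moreover have "finite ?R" using finite_carrier by simp
 ultimately have "(%x. \<theta> [^] x) ` {..<n} = ?R" by (metis card_seteq sub)
 then have "\<eta> \<in> (%x. \<theta> [^] x) ` {..<n}" using \<eta> by auto
 then show thesis using that by auto
qed

lemma sift_step_eq:
 assumes "fst s \<in> cnz" "snd s \<in> cnz" "h \<in> cnz" "fst s = \<delta> \<otimes> snd s [^] d" "\<delta> \<in> cnz"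
 shows "fst (sift_step d s (h, o')) = \<delta> \<otimes> snd (sift_step d s (h, o')) [^] d"
  "fst (sift_step d s (h, o')) \<in> cnz" "snd (sift_step d s (h, o')) \<in> cnz"
proof -
 define c where "c = h [^] (if find (%x. (fst s \<otimes> (h [^] x) [^] d) [^] o' = \<one>) [0..<d] = None then 0
   else the (find (%x. (fst s \<otimes> (h [^] x) [^] d) [^] o' = \<one>) [0..<d]))"
 have c: "c \<in> cnz" unfolding c_def using assms(3) by (rule nz_pow)
 have e: "sift_step d s (h, o') = (fst s \<otimes> c [^] d, snd s \<otimes> c)" unfolding sift_step_def Let_def c_def by simp
 show "fst (sift_step d s (h, o')) \<in> cnz" "snd (sift_step d s (h, o')) \<in> cnz"
  unfolding e fst_conv snd_conv using assms(1,2) c by (intro nz_mult nz_pow; simp)+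
 have cc: "c \<in> carrier F" "snd s \<in> carrier F" "\<delta> \<in> carrier F" using c assms by auto
 show "fst (sift_step d s (h, o')) = \<delta> \<otimes> snd (sift_step d s (h, o')) [^] d"
  unfolding e fst_conv snd_conv assms(4) using cc by (simp add: nat_pow_distrib m_assoc)
qed

lemma sift_eq:
 assumes "\<delta> \<in> cnz" "fst ` set tow \<subseteq> cnz"
 shows "fst (sift d tow \<delta>) = \<delta> \<otimes> snd (sift d tow \<delta>) [^] d" "fst (sift d tow \<delta>) \<in> cnz" "snd (sift d tow \<delta>) \<in> cnz"
proof -
 have "fst (sift d tow \<delta>) = \<delta> \<otimes> snd (sift d tow \<delta>) [^] d \<and> fst (sift d tow \<delta>) \<in> cnz \<and> snd (sift d tow \<delta>) \<in> cnz"
  using assms(2)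
 proof (induction tow rule: rev_induct)
  case Nil show ?case using assms(1) by (simp add: sift_def)
 next
  case (snoc ho tow)
  have e: "sift d (tow @ [ho]) \<delta> = sift_step d (sift d tow \<delta>) (fst ho, snd ho)" by (simp add: sift_def)
  have h: "fst ho \<in> cnz" and IH: "fst (sift d tow \<delta>) = \<delta> \<otimes> snd (sift d tow \<delta>) [^] d"
   "fst (sift d tow \<delta>) \<in> cnz" "snd (sift d tow \<delta>) \<in> cnz"
   using snoc by auto
  show ?case unfolding e using sift_step_eq[OF IH(2,3) h IH(1) assms(1)] by blast
 qed
 then show "fst (sift d tow \<delta>) = \<delta> \<otimes> snd (sift d tow \<delta>) [^] d" "fst (sift d tow \<delta>) \<in> cnz" "snd (sift d tow \<delta>) \<in> cnz"
  by blast+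
qed

text \<open>For the top pair, \<open>\<eta> = fst s [^] o'\<close> is an \<open>n\<close>-th root of
  unity, and so is its inverse \<open>\<eta> [^] (n - 1)\<close>, which is then a power of
  \<open>\<theta>\<close> with exponent below \<open>n\<close>. That exponent lies in the searched
  range. Whichever exponent is found, the new element is killed by \<open>o'\<close>, and the rest
  of the tower continues from there.\<close>

lemma sift_complete:
 assumes "tower_ok d B o' tow" "fst s \<in> cnz" "snd s \<in> cnz" "fst s [^] o' = \<one>"
 shows "fst (foldl (sift_step d) s tow) [^] B = \<one>"
 using assms
proof (induction arbitrary: s rule: tower_ok.induct)
 case base then show ?case by simp
next
 case (step o' tow h n)
 define \<theta> where "\<theta> = (h [^] d) [^] o'"
 define \<eta> where "\<eta> = fst s [^] o'"
 have hc: "h \<in> carrier F" "fst s \<in> carrier F" using step.hyps step.prems by auto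
 have \<theta>: "\<theta> \<in> cnz" "\<theta> [^] n = \<one>" "\<And>t. 0 < t ==> t < n ==> \<theta> [^] t \<noteq> \<one>"
  unfolding \<theta>_def using step.hyps nz_pow by auto
 have \<eta>: "\<eta> \<in> carrier F" "\<eta> [^] n = \<one>" unfolding \<eta>_def using hc step.prems(3) by (auto simp: nat_pow_pow)
 have "(\<eta> [^] (n - 1)) [^] n = (\<eta> [^] n) [^] (n - 1)" using \<eta>(1) by (simp add: nat_pow_pow mult.commute)
 then have "(\<eta> [^] (n - 1)) [^] n = \<one>" using \<eta>(2) by simp
 then obtain x where x: "x < n" "\<eta> [^] (n - 1) = \<theta> [^] x"
  using root_is_power[OF \<theta> step.hyps(3), of "\<eta> [^] (n - 1)"] \<eta>(1) by auto
 have "(fst s \<otimes> (h [^] x) [^] d) [^] o' = \<eta> \<otimes> \<theta> [^] x"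
  using hc unfolding \<eta>_def \<theta>_def by (simp add: nat_pow_distrib nat_pow_pow mult.commute mult.left_commute)
 also have "\<dots> = \<eta> \<otimes> \<eta> [^] (n - 1)" using x by simp
 also have "\<dots> = \<eta> [^] Suc (n - 1)" using \<eta>(1) by (simp only: nat_pow_Suc2)
 also have "\<dots> = \<one>" using \<eta>(2) step.hyps(3) by simp
 finally have ex: "(fst s \<otimes> (h [^] x) [^] d) [^] o' = \<one>" .
 let ?r = "find (%x. (fst s \<otimes> (h [^] x) [^] d) [^] o' = \<one>) [0..<d]"
 have "x < d" using x(1) step.hyps(4) by simp
 then have "?r \<noteq> None" using ex unfolding find_None_iff by auto
 then obtain y where y: "?r = Some y" by blast
 then have y': "(fst s \<otimes> (h [^] y) [^] d) [^] o' = \<one>" by (auto simp: find_Some_iff)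
 have e: "sift_step d s (h, o') = (fst s \<otimes> (h [^] y) [^] d, snd s \<otimes> h [^] y)"
  unfolding sift_step_def Let_def using y by simp
 have "fst (foldl (sift_step d) (sift_step d s (h, o')) tow) [^] B = \<one>"
 proof (rule step.IH)
  show "fst (sift_step d s (h, o')) \<in> cnz" "snd (sift_step d s (h, o')) \<in> cnz"
   unfolding e fst_conv snd_conv using step.prems(1,2) step.hyps(2) by (intro nz_mult nz_pow; simp)+
  show "fst (sift_step d s (h, o')) [^] o' = \<one>" unfolding e fst_conv by (rule y')
 qed
 then show ?case by simp
qed

text \<open>Let \<open>\<delta> = C ! e \<otimes> \<alpha> [^] (d - 1)\<close>, and let
  \<open>\<sigma> = \<delta> \<otimes> c [^] d\<close> be its sifted form with
  \<open>\<sigma> [^] B = \<one>\<close>. Since \<open>u * d + 1\<close> is a multiple of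
  \<open>B\<close>, the \<open>d\<close>-th power of \<open>\<sigma> [^] u\<close> inverts
  \<open>\<sigma>\<close>. So \<open>\<delta>\<close> times the \<open>d\<close>-th power of
  \<open>c \<otimes> \<sigma> [^] u\<close> is 1, and multiplying by \<open>\<alpha>\<close> gives
  the factorization.\<close>

lemma classify_sound:
 assumes tow: "fst ` set tow \<subseteq> cnz" and C: "set C \<subseteq> cnz" and \<alpha>: "\<alpha> \<in> cnz" and d: "d > 0"
  and u: "u * d + 1 = B * s" and c: "classify d B u tow C \<alpha> = Some (e, \<gamma>)"
 shows "e < length C" "\<gamma> \<in> cnz" "\<alpha> = C ! e \<otimes> \<gamma> [^] d"
proof -
 let ?r = "find (%z. fst (sift d tow (snd z \<otimes> \<alpha> [^] (d - 1))) [^] B = \<one>) (zip [0..<length C] C)"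
 obtain z where z: "?r = Some z" using c unfolding classify_def Let_def by (cases ?r) auto
 let ?S = "sift d tow (snd z \<otimes> \<alpha> [^] (d - 1))"
 have e: "e = fst z" "\<gamma> = (\<alpha> \<otimes> snd ?S) \<otimes> fst ?S [^] u" using c z unfolding classify_def Let_def by auto
 have zp: "fst ?S [^] B = \<one>" "z \<in> set (zip [0..<length C] C)" using find_SomeD[OF z] by blast+
 then show eC: "e < length C" unfolding e by (auto simp: set_zip)
 have sz: "snd z = C ! e" using zp(2) unfolding e by (auto simp: set_zip)
 have cz: "snd z \<in> cnz" using C eC sz by (auto simp: subset_iff)
 have "snd z \<otimes> \<alpha> [^] (d - 1) \<in> cnz" by (intro nz_mult nz_pow cz \<alpha>)
 note S = sift_eq[OF this tow]
 show "\<gamma> \<in> cnz" unfolding e by (intro nz_mult nz_pow S \<alpha>)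
 have car: "\<alpha> \<in> carrier F" "snd z \<in> carrier F" "fst ?S \<in> carrier F" "snd ?S \<in> carrier F" using \<alpha> cz S by auto
 have \<alpha>d: "\<alpha> [^] d = \<alpha> \<otimes> \<alpha> [^] (d - 1)" using d car(1) nat_pow_Suc2[of \<alpha> "d - 1"] by simp
 have "C ! e \<otimes> \<gamma> [^] d = snd z \<otimes> ((\<alpha> \<otimes> \<alpha> [^] (d - 1)) \<otimes> snd ?S [^] d \<otimes> (fst ?S [^] u) [^] d)"
  unfolding e(2) sz[symmetric] \<alpha>d[symmetric] using car by (simp add: nat_pow_distrib)
 also have "\<dots> = \<alpha> \<otimes> (((snd z \<otimes> \<alpha> [^] (d - 1)) \<otimes> snd ?S [^] d) \<otimes> (fst ?S [^] u) [^] d)"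
  using car by (simp add: m_ac)
 also have "\<dots> = \<alpha> \<otimes> (fst ?S \<otimes> (fst ?S [^] u) [^] d)" using S(1) by simp
 also have "fst ?S \<otimes> (fst ?S [^] u) [^] d = fst ?S [^] (u * d + 1)"
  using car by (simp add: nat_pow_pow m_comm)
 also have "\<dots> = (fst ?S [^] B) [^] s" unfolding u using car by (simp add: nat_pow_pow)
 also have "\<dots> = \<one>" using zp by simp
 finally show "\<alpha> = C ! e \<otimes> \<gamma> [^] d" using car by simp
qed

text \<open>If the power were 1, sifting would end in the group of exponent \<open>B\<close> and the
  entry \<open>C ! i\<close> would have been accepted. A refusal therefore certifies that the tested
  element is not killed by the exponent \<open>o'\<close> of the tower.\<close>

lemma classify_complete:
 assumes tow: "tower_ok d B o' tow" and C: "set C \<subseteq> cnz" and \<alpha>: "\<alpha> \<in> cnz"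
  and c: "classify d B u tow C \<alpha> = None" and i: "i < length C"
 shows "(C ! i \<otimes> \<alpha> [^] (d - 1)) [^] o' \<noteq> \<one>"
proof
 assume a: "(C ! i \<otimes> \<alpha> [^] (d - 1)) [^] o' = \<one>"
 have "find (%z. fst (sift d tow (snd z \<otimes> \<alpha> [^] (d - 1))) [^] B = \<one>) (zip [0..<length C] C) = None"
  using c unfolding classify_def Let_def by (auto split: if_splits)
 then have "\<forall>z\<in>set (zip [0..<length C] C). \<not> (fst (sift d tow (snd z \<otimes> \<alpha> [^] (d - 1))) [^] B = \<one>)"
  by (auto simp: find_None_iff)
 moreover have "(i, C ! i) \<in> set (zip [0..<length C] C)"
  unfolding in_set_conv_nth using i by (intro exI[of _ i]) simp
 ultimately have "fst (sift d tow (C ! i \<otimes> \<alpha> [^] (d - 1))) [^] B \<noteq> \<one>" by fastforce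
 moreover have "C ! i \<otimes> \<alpha> [^] (d - 1) \<in> cnz" by (intro nz_mult nz_pow \<alpha>) (use C i nth_mem in blast)
 then have "fst (sift d tow (C ! i \<otimes> \<alpha> [^] (d - 1))) [^] B = \<one>"
  unfolding sift_def by (intro sift_complete[OF tow]) (use a in auto)
 ultimately show False by simp
qed

lemma tower_snoc: "tower d B (hs @ [h]) = tower_step d (tower d B hs) h"
 by (simp add: tower_def)

text \<open>The condition on \<open>hs\<close> gives \<open>\<theta> [^] d = \<one>\<close> for each
  new generator, either because its \<open>d\<close>-th power came earlier or because it already
  lies at the bottom. So the search for the order of \<open>\<theta>\<close> among
  \<open>1..d\<close> succeeds.\<close>

lemma tower_props:
 assumes d: "d > 0" and B: "B dvd p ^ k - 1" "B > 0"
  and hs: "\<And>as h bs. hs = as @ h # bs ==> h \<in> cnz \<and> (h [^] d \<in> set as \<or> h [^] (d * B) = \<one>)"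
 shows "tower_ok d B (fst (tower d B hs)) (snd (tower d B hs)) \<and> B dvd fst (tower d B hs) \<and> fst (tower d B hs) dvd p ^ k - 1
  \<and> (\<forall>h\<in>set hs. h [^] (d * fst (tower d B hs)) = \<one>)"
 using hs
proof (induction hs rule: rev_induct)
 case Nil show ?case using B by (auto simp: tower_def intro: tower_ok.base)
next
 case (snoc h hs)
 let ?o = "fst (tower d B hs)"
 have IH: "tower_ok d B ?o (snd (tower d B hs))" "B dvd ?o" "?o dvd p ^ k - 1" "\<And>h. h \<in> set hs ==> h [^] (d * ?o) = \<one>"
  using snoc.IH[OF conjI] snoc.prems by (auto; metis append_Cons append_assoc)+
 have h: "h \<in> cnz" "h [^] d \<in> set hs \<or> h [^] (d * B) = \<one>" using snoc.prems[of hs h "[]"] by auto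
 then have hc: "h \<in> carrier F" by simp
 define \<theta> where "\<theta> = (h [^] d) [^] ?o"
 have \<theta>c: "\<theta> \<in> carrier F" "\<theta> \<in> cnz" unfolding \<theta>_def using h(1) nz_pow hc by auto
 have \<theta>d: "\<theta> [^] d = \<one>"
  using h(2)
 proof
  assume "h [^] d \<in> set hs"
  from IH(4)[OF this] show ?thesis unfolding \<theta>_def using hc by (simp add: nat_pow_pow mult_ac)
 next
  assume a: "h [^] (d * B) = \<one>"
  obtain w where w: "?o = B * w" using IH(2) unfolding dvd_def by blast
  have "\<theta> [^] d = (h [^] (d * B)) [^] (w * d)" unfolding \<theta>_def w using hc by (simp add: nat_pow_pow mult_ac)
  then show ?thesis using a by simp
 qed
 let ?r = "find (%n. \<theta> [^] n = \<one>) [1..<Suc d]"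
 have "?r \<noteq> None" using \<theta>d d by (auto simp: find_None_iff)
 then obtain n where n: "?r = Some n" by blast
 note fn = find_uptD[OF n]
 define i where "i = n - 1"
 have i: "i < d" "n = Suc i" "\<theta> [^] n = \<one>" using fn(1-3) by (auto simp: i_def)
 have min: "\<theta> [^] t \<noteq> \<one>" if "0 < t" "t < n" for t using fn(4)[of t] that by simp
 have e: "tower d B (hs @ [h]) = (?o * n, (h, ?o) # snd (tower d B hs))"
  unfolding tower_snoc tower_step_def Let_def using n by (simp add: \<theta>_def)
 have ok: "tower_ok d B (?o * n) ((h, ?o) # snd (tower d B hs))"
  by (rule tower_ok.step[OF IH(1) h(1)]) (use i min in \<open>auto simp: \<theta>_def\<close>)
 \<comment> \<open>With \<open>p ^ k - 1 = ?o * w\<close>, the element \<open>\<theta> [^] w\<close>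
   is a power of \<open>h [^] (p ^ k - 1)\<close> and hence 1, so the order \<open>n\<close> of
   \<open>\<theta>\<close> divides \<open>w\<close>.\<close>
 have dv: "?o * n dvd p ^ k - 1"
 proof -
  obtain w where w: "p ^ k - 1 = ?o * w" using IH(3) unfolding dvd_def by blast
  have "\<theta> [^] w = (h [^] (p ^ k - 1)) [^] d" unfolding \<theta>_def w using hc by (simp add: nat_pow_pow mult_ac)
  also have "\<dots> = \<one>" using pow_order[of h] h(1) by simp
  finally have "\<theta> [^] w = \<one>" .
  moreover have "\<theta> [^] w = (\<theta> [^] n) [^] (w div n) \<otimes> \<theta> [^] (w mod n)"
   using nat_pow_mult[OF \<theta>c(1), of "n * (w div n)" "w mod n"] nat_pow_pow[OF \<theta>c(1), of n "w div n"] by simp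
  ultimately have "\<theta> [^] (w mod n) = \<one>" using i(3) \<theta>c(1) by simp
  then have "w mod n = 0" using min[of "w mod n"] i(2) by (metis gr0I mod_less_divisor zero_less_Suc)
  then show ?thesis using w by auto
 qed
 have "h' [^] (d * (?o * n)) = \<one>" if "h' \<in> set (hs @ [h])" for h'
 proof (cases "h' \<in> set hs")
  case True
  then have "h' \<in> carrier F" using snoc.prems by (metis DiffD1 append_Cons append_assoc split_list)
  then have "h' [^] (d * (?o * n)) = (h' [^] (d * ?o)) [^] n" by (simp add: nat_pow_pow mult_ac)
  then show ?thesis using IH(4)[OF True] by simp
 next
  case False
  then have "h' = h" using that by auto
  then have "h' [^] (d * (?o * n)) = \<theta> [^] n" unfolding \<theta>_def using hc by (simp add: nat_pow_pow mult_ac)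
  then show ?thesis using i(3) by simp
 qed
 then show ?case unfolding e fst_conv snd_conv using ok dv IH(2) by auto
qed

lemma tower_fst_mono: "fst (tower d B hs) dvd fst (tower d B (hs @ hs'))"
 by (induction hs' rule: rev_induct) (auto simp: tower_snoc[of d B "hs @ _", simplified] tower_step_def Let_def)

text \<open>The iterated \<open>d\<close>-th powers of \<open>c\<close>, highest first, so that the
  \<open>d\<close>-th power of each entry precedes it. The head is killed by \<open>B\<close> if
  \<open>p ^ k - 1\<close> divides \<open>B * d ^ length js\<close>, which anchors the chain at the
  bottom of the tower.\<close>

definition chain :: "nat \<Rightarrow> 'z list \<Rightarrow> nat list \<Rightarrow> nat list list" where
 "chain d js c = foldl (%l _. (hd l) [^] d # l) [c] js"

lemma chain_eq: "c \<in> carrier F ==> chain d js c = map (%i. c [^] (d ^ (length js - i))) [0..<Suc (length js)]"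
proof (induction js rule: rev_induct)
 case Nil then show ?case by (simp add: chain_def)
next
 case (snoc j js)
 have "chain d (js @ [j]) c = hd (chain d js c) [^] d # chain d js c" by (simp add: chain_def)
 also have "chain d js c = map (%i. c [^] (d ^ (length js - i))) [0..<Suc (length js)]" by (rule snoc.IH[OF snoc.prems])
 also have "hd \<dots> [^] d = c [^] (d ^ Suc (length js))"
  using snoc.prems by (simp add: hd_map nat_pow_pow mult.commute del: upt_Suc)
 also have "c [^] (d ^ Suc (length js)) # map (%i. c [^] (d ^ (length js - i))) [0..<Suc (length js)]
   = map (%i. c [^] (d ^ (length (js @ [j]) - i))) [0..<Suc (length (js @ [j]))]"
  by (rule nth_equalityI) (auto simp: nth_Cons' simp del: upt_Suc)
 finally show ?case .
qed

lemma chain_last: "c \<in> carrier F ==> c \<in> set (chain d js c)"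
 unfolding chain_eq by (auto intro!: image_eqI[of _ _ "length js"])

lemma chain_ok:
 assumes c: "c \<in> cnz" and js: "p ^ k - 1 dvd B * d ^ length js"
  and e: "chain d js c = as @ h # bs"
 shows "h \<in> cnz \<and> (h [^] d \<in> set as \<or> h [^] (d * B) = \<one>)"
proof -
 have cc: "c \<in> carrier F" using c by simp
 let ?f = "%j. c [^] (d ^ (length js - j))"
 let ?i = "length as"
 have l: "length as < Suc (length js)" using arg_cong[OF e, of length] unfolding chain_eq[OF cc] by simp
 have h: "h = ?f ?i" using arg_cong[OF e, of "%l. l ! ?i"] l unfolding chain_eq[OF cc] by (simp del: upt_Suc)
 have "h \<in> cnz" unfolding h by (rule nz_pow[OF c])
 moreover have "h [^] d \<in> set as \<or> h [^] (d * B) = \<one>"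
 proof (cases ?i)
  case 0
  obtain w where w: "B * d ^ length js = (p ^ k - 1) * w" using js unfolding dvd_def by blast
  have "h [^] (d * B) = c [^] ((B * d ^ length js) * d)" unfolding h 0 using cc by (simp add: nat_pow_pow mult_ac)
  also have "\<dots> = (c [^] (p ^ k - 1)) [^] (w * d)" unfolding w using cc by (simp add: nat_pow_pow mult_ac)
  also have "\<dots> = \<one>" using pow_order[of c] c by simp
  finally show ?thesis by simp
 next
  case (Suc i)
  have "as ! i = ?f i" using arg_cong[OF e, of "%l. l ! i"] l Suc unfolding chain_eq[OF cc] by (simp del: upt_Suc add: nth_append)
  also have "?f i = h [^] d"
  proof -
   have "length js - i = Suc (length js - ?i)" using l Suc by simp
   then show ?thesis unfolding h using cc by (simp add: nat_pow_pow mult.commute)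
  qed
  finally show ?thesis using Suc by (metis lessI nth_mem)
 qed
 ultimately show ?thesis by simp
qed

text \<open>Pigeonhole: the \<open>d + 1\<close> values \<open>c [^] o'\<close> are roots of \<open>X [^] d = \<one>\<close>, so two of them agree.\<close>

lemma overflow_progress:
 assumes tow: "tower_ok d B o' tow" and d: "d > 0" and C: "set C \<subseteq> cnz" and len: "length C = d + 1"
  and inc: "\<And>j. j < length C ==> classify d B u tow (take j C) (C ! j) = None"
 shows "\<exists>c\<in>set C. c [^] (d * o') \<noteq> \<one>"
proof (rule ccontr)
 assume "\<not> ?thesis"
 then have all: "\<And>c. c \<in> set C ==> c [^] (d * o') = \<one>" by auto
 let ?R = "{x \<in> carrier F. x [^] d = \<one>}"
 let ?f = "%i. (C ! i) [^] o'"
 have Cn: "C ! i \<in> cnz" if "i < length C" for i using C nth_mem[OF that] by blast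
 have fr: "?f i \<in> ?R" if "i < length C" for i
  using all[OF nth_mem[OF that]] Cn[OF that] by (simp add: nat_pow_pow mult.commute)
 have "?f ` {..<length C} \<subseteq> ?R" using fr by auto
 then have "card (?f ` {..<length C}) \<le> card ?R" using finite_carrier by (intro card_mono) auto
 also have "\<dots> \<le> d" by (rule card_roots_le[OF d])
 finally have "\<not> inj_on ?f {..<length C}" using len by (auto dest: card_image)
 then obtain i j where ij: "i < j" "j < length C" "?f i = ?f j"
  unfolding inj_on_def by (metis lessThan_iff linorder_neqE_nat)
 have cc: "C ! i \<in> carrier F" "C ! j \<in> carrier F" using Cn[OF less_trans[OF ij(1,2)]] Cn[OF ij(2)] by simp_all
 have "(take j C ! i \<otimes> C ! j [^] (d - 1)) [^] o' \<noteq> \<one>"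
 proof (rule classify_complete[OF tow _ Cn[OF ij(2)] inc[OF ij(2)]])
  show "set (take j C) \<subseteq> cnz" using C set_take_subset[of j C] by blast
  show "i < length (take j C)" using ij by simp
 qed
 moreover have "(take j C ! i \<otimes> C ! j [^] (d - 1)) [^] o' = ?f i \<otimes> ?f j [^] (d - 1)"
  using ij(1) cc by (simp add: nat_pow_distrib nat_pow_pow mult.commute)
 moreover have "\<dots> = ?f j [^] Suc (d - 1)" unfolding ij(3) using cc by (simp only: nat_pow_Suc2 nat_pow_closed)
 moreover have "\<dots> = \<one>" using fr[OF ij(2)] d by simp
 ultimately show False by simp
qed

end

section \<open>The part of \<open>q - 1\<close> prime to \<open>d\<close>, and the exponent that
  inverts it modulo \<open>d\<close>\<close>

definition cop_part :: "nat \<Rightarrow> 'z list \<Rightarrow> nat \<Rightarrow> nat" where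
 "cop_part d js n = foldl (%B _. B div gcd B d) n js"

text \<open>A round divides by a divisor of \<open>d\<close>, so one factor \<open>d\<close> per
  round restores a multiple of \<open>n\<close>. As long as the number is not coprime to
  \<open>d\<close> that divisor is at least 2, so the number is halved at least; \<open>js\<close>
  serves as the counter of rounds.\<close>

lemma cop_part_props:
 assumes n: "n > 0" and d: "d > 0"
 shows "cop_part d js n > 0" "cop_part d js n dvd n" "n dvd cop_part d js n * d ^ length js"
  "coprime (cop_part d js n) d \<or> cop_part d js n * 2 ^ length js \<le> n"
proof -
 have "cop_part d js n > 0 \<and> cop_part d js n dvd n \<and> n dvd cop_part d js n * d ^ length js \<and>
  (coprime (cop_part d js n) d \<or> cop_part d js n * 2 ^ length js \<le> n)"
 proof (induction js rule: rev_induct)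
  case Nil then show ?case using n by (simp add: cop_part_def)
 next
  case (snoc j js)
  define B where "B = cop_part d js n"
  define g where "g = gcd B d"
  have IH: "B > 0" "B dvd n" "n dvd B * d ^ length js" "coprime B d \<or> B * 2 ^ length js \<le> n"
   using snoc unfolding B_def by auto
  have e: "cop_part d (js @ [j]) n = B div g" by (simp add: cop_part_def B_def g_def)
  have g: "g dvd B" "g dvd d" "g > 0" using d by (auto simp: g_def)
  then have Bg: "B = (B div g) * g" by simp
  have 1: "B div g > 0" using IH(1) g Bg by (metis gr0I mult_0)
  have 2: "B div g dvd n" using Bg IH(2) by (metis dvd_mult_left)
  have 3: "n dvd B div g * d ^ length (js @ [j])"
  proof -
   obtain w where w: "d = g * w" using g(2) unfolding dvd_def by blast
   have "B div g * d = (B div g * g) * w" using w by (simp only: mult.assoc)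
   then have "B div g * d = B * w" using g(1) by simp
   then have "B div g * (d * d ^ length js) = (B * w) * d ^ length js" by (simp only: mult.assoc[symmetric])
   moreover have "(B * w) * d ^ length js = (B * d ^ length js) * w" by (simp add: mult_ac)
   ultimately have "B * d ^ length js dvd B div g * (d * d ^ length js)" by (metis dvd_triv_left)
   then show ?thesis using IH(3) by (auto intro: dvd_trans)
  qed
  have 4: "coprime (B div g) d \<or> B div g * 2 ^ length (js @ [j]) \<le> n"
  proof (cases "coprime B d")
   case True
   then have "g = 1" by (simp add: g_def)
   then show ?thesis using True by simp
  next
   case False
   then have "g \<noteq> 1" unfolding g_def by (simp add: coprime_iff_gcd_eq_1)
   then have "2 \<le> g" using g(3) by simp
   then have "B div g * 2 \<le> B" using Bg by (metis mult_le_mono2)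
   then have "B div g * 2 * 2 ^ length js \<le> B * 2 ^ length js" by (rule mult_right_mono) simp
   moreover have "B * 2 ^ length js \<le> n" using IH(4) False by simp
   ultimately have "B div g * 2 * 2 ^ length js \<le> n" by (rule order_trans)
   then show ?thesis by (simp add: mult.assoc)
  qed
  show ?case unfolding e using 1 2 3 4 by simp
 qed
 then show "cop_part d js n > 0" "cop_part d js n dvd n" "n dvd cop_part d js n * d ^ length js"
  "coprime (cop_part d js n) d \<or> cop_part d js n * 2 ^ length js \<le> n" by blast+
qed

text \<open>Otherwise every round would have halved \<open>n\<close>, and a positive number below
  \<open>2 ^ length js\<close> does not admit that many halvings.\<close>

lemma cop_part_coprime: "n > 0 ==> d > 0 ==> n < 2 ^ length js ==> coprime (cop_part d js n) d"
 using cop_part_props(1,4)[of n d js]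
 by (metis One_nat_def Suc_leI le_less_trans mult_le_mono1 nat_mult_1 not_less_iff_gr_or_eq)

lemma unit_exponent:
 fixes d B :: nat
 assumes "coprime B d" "d > 0" "B > 0"
 shows "\<exists>s\<in>set [1..<Suc d]. d dvd B * s - 1"
\<comment> \<open>Below, the witness is the Bezout coefficient reduced modulo \<open>d\<close>; for
  \<open>d = 1\<close> it would be 0, which is outside the searched range.\<close>
proof (cases "d = 1")
 case True then show ?thesis by auto
next
 case False
 then have d: "d > 1" using assms by simp
 obtain x y where x: "B * x = d * y + 1"
  using bezout_nat[of B d] assms(1,3) by (auto simp: coprime_iff_gcd_eq_1)
 let ?s = "x mod d"
 have "(B * ?s) mod d = (B * x) mod d" by (rule mod_mult_right_eq)
 also have "\<dots> = 1 mod d" unfolding x by (rule mod_mult_self4)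
 finally have c: "(B * ?s) mod d = 1" using d by simp
 then have "?s \<noteq> 0" by (intro notI) simp
 moreover have "?s < d" using d by simp
 moreover have "d dvd B * ?s - 1" using dvd_minus_mod[of d "B * ?s"] c by simp
 ultimately show ?thesis by (intro bexI[of _ ?s]) auto
qed

section \<open>Parity of rearrangements of a label\<close>

text \<open>The list is read as the entries seen so far, latest first: the newest entry counts the
  larger ones before it. On the reverse of a list this is the parity of its number of
  inversions.\<close>

fun rpar :: "nat list \<Rightarrow> bool" where
 "rpar [] = False"
| "rpar (y # seen) = (rpar seen \<noteq> odd (length (filter (%z. z > y) seen)))"

text \<open>An entry of \<open>us\<close> looks only at the multiset of what follows it, and this is
  the same on both sides.\<close>

lemma rpar_append_cong:
 assumes "mset vs = mset ws" "rpar vs \<noteq> rpar ws"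
 shows "rpar (us @ vs) \<noteq> rpar (us @ ws)"
proof (induction us)
 case (Cons u us)
 have "mset (filter (%z. z > u) (us @ vs)) = mset (filter (%z. z > u) (us @ ws))"
  using assms(1) by simp
 then have L: "length (filter (%z. z > u) (us @ vs)) = length (filter (%z. z > u) (us @ ws))"
  by (metis size_mset)
 show ?case unfolding append_Cons rpar.simps L using Cons by blast
qed (use assms in simp)

lemma rpar_adjacent: "x \<noteq> y ==> rpar (us @ x # y # vs) \<noteq> rpar (us @ y # x # vs)"
proof (rule rpar_append_cong)
 assume "x \<noteq> y"
 then consider "x < y" "\<not> y < x" | "y < x" "\<not> x < y" by linarith
 then show "rpar (x # y # vs) \<noteq> rpar (y # x # vs)"
  by cases (cases "rpar vs"; cases "even (length (filter (%z. z > x) vs))";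
    cases "even (length (filter (%z. z > y) vs))"; simp)+
qed simp

text \<open>Exchanging \<open>x\<close> and \<open>y\<close> across \<open>m # ms\<close> amounts to
  moving \<open>x\<close> past \<open>m\<close>, exchanging across \<open>ms\<close>, and moving
  \<open>y\<close> back past \<open>m\<close>: three flips of the parity.\<close>

lemma rpar_swap:
 assumes "distinct (x # y # ms)"
 shows "rpar (us @ x # ms @ y # vs) \<noteq> rpar (us @ y # ms @ x # vs)"
 using assms
proof (induction ms arbitrary: us)
 case Nil then show ?case using rpar_adjacent[of x y us vs] by simp
next
 case (Cons m ms)
 have "rpar (us @ x # m # ms @ y # vs) \<noteq> rpar (us @ m # x # ms @ y # vs)"
  by (rule rpar_adjacent) (use Cons.prems in auto)
 moreover have "rpar ((us @ [m]) @ x # ms @ y # vs) \<noteq> rpar ((us @ [m]) @ y # ms @ x # vs)"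
  by (rule Cons.IH) (use Cons.prems in auto)
 moreover have "rpar (us @ m # y # ms @ x # vs) \<noteq> rpar (us @ y # m # ms @ x # vs)"
  by (rule rpar_adjacent) (use Cons.prems in auto)
 ultimately show ?case by auto
qed

lemma split_two:
 assumes "a \<in> set xs" "b \<in> set xs" "a \<noteq> b"
 shows "\<exists>us ms vs. xs = us @ a # ms @ b # vs \<or> xs = us @ b # ms @ a # vs"
proof -
 obtain us vs where s: "xs = us @ a # vs" using split_list[OF assms(1)] by blast
 then consider "b \<in> set us" | "b \<in> set vs" using assms by auto
 then show ?thesis
 proof cases
  case 1
  obtain us1 us2 where "us = us1 @ b # us2" using split_list[OF 1] by blast
  then have "xs = us1 @ b # us2 @ a # vs" using s by simp
  then show ?thesis by blast
 next
  case 2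
  obtain vs1 vs2 where "vs = vs1 @ b # vs2" using split_list[OF 2] by blast
  then have "xs = us @ a # vs1 @ b # vs2" using s by simp
  then show ?thesis by blast
 qed
qed

definition par :: "nat list \<Rightarrow> nat list \<Rightarrow> bool" where
 "par Ts f = rpar (rev (map (nth f) Ts))"

lemma par_swap:
 assumes a: "a \<in> set Ts" and b: "b \<in> set Ts" and ab: "a \<noteq> b" and dT: "distinct Ts" and len: "\<forall>t\<in>set Ts. t < length f"
  and df: "distinct (map (nth f) Ts)"
 shows "par Ts (f[a := f ! b, b := f ! a]) \<noteq> par Ts f"
proof -
 have main: "par Ts (f[a := f ! b, b := f ! a]) \<noteq> par Ts f"
  if T: "Ts = us @ a # ms @ b # vs" and ab: "a \<noteq> b" for a b us ms vs
 proof -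
  let ?g = "f[a := f ! b, b := f ! a]"
  have lt: "a < length f" "b < length f" using len T by auto
  have o: "map (nth ?g) ys = map (nth f) ys" if "a \<notin> set ys" "b \<notin> set ys" for ys
  proof (rule map_cong[OF refl])
   fix t assume "t \<in> set ys"
   then have "t \<noteq> a" "t \<noteq> b" using that by auto
   then show "?g ! t = f ! t" by simp
  qed
  have n: "?g ! a = f ! b" "?g ! b = f ! a" using lt ab by auto
  have d: "a \<notin> set us" "b \<notin> set us" "a \<notin> set ms" "b \<notin> set ms" "a \<notin> set vs" "b \<notin> set vs"
   using dT T ab by auto
  have "par Ts ?g = rpar (rev (map (nth f) us @ f ! b # map (nth f) ms @ f ! a # map (nth f) vs))"
   unfolding par_def T by (simp only: map_append list.map o[OF d(1,2)] o[OF d(3,4)] o[OF d(5,6)] n)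
  also have "\<dots> = rpar (rev (map (nth f) vs) @ f ! a # rev (map (nth f) ms) @ f ! b # rev (map (nth f) us))" by simp
  also have "\<dots> \<noteq> rpar (rev (map (nth f) vs) @ f ! b # rev (map (nth f) ms) @ f ! a # rev (map (nth f) us))"
   by (rule rpar_swap) (use df T in auto)
  finally show ?thesis unfolding par_def T by simp
 qed
 from split_two[OF a b ab] obtain us ms vs where "Ts = us @ a # ms @ b # vs \<or> Ts = us @ b # ms @ a # vs" by blast
 then show ?thesis
 proof
  assume "Ts = us @ a # ms @ b # vs" then show ?thesis using main ab by blast
 next
  assume "Ts = us @ b # ms @ a # vs"
  from main[OF this] ab show ?thesis by (simp add: list_update_swap)
 qed
qed

definition tuples :: "nat \<Rightarrow> nat \<Rightarrow> nat list set" where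
 "tuples d n = {f. length f = n \<and> set f \<subseteq> {..<d}}"

lemma finite_tuples: "finite (tuples d n)"
proof -
 have "tuples d n = {f. set f \<subseteq> {..<d} \<and> length f = n}" by (auto simp: tuples_def)
 then show ?thesis using finite_lists_length_eq[of "{..<d}" n] by simp
qed

definition firsts :: "nat list \<Rightarrow> nat list" where
 "firsts es = filter (%a. es ! a \<notin> set (take a es)) [0..<length es]"

text \<open>\<open>firsts es\<close> holds one position for each value of \<open>es\<close>. The
  values are permuted over these positions, and the remaining ones, which carry repetitions, stay
  fixed. All these labels have the same set of entries as \<open>es\<close>.\<close>

definition perms_of :: "nat list \<Rightarrow> nat list set" where
 "perms_of es = {f. length f = length es \<and> (\<forall>a<length es. a \<notin> set (firsts es) \<longrightarrow> f ! a = es ! a) \<and>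
   distinct (map (nth f) (firsts es)) \<and> set (map (nth f) (firsts es)) \<subseteq> set es}"

lemma firsts_snoc: "firsts (es @ [x]) = firsts es @ (if x \<in> set es then [] else [length es])"
proof -
 have "filter (%a. (es @ [x]) ! a \<notin> set (take a (es @ [x]))) [0..<length es] = firsts es"
  unfolding firsts_def by (rule filter_cong) (auto simp: nth_append)
 then show ?thesis by (simp add: firsts_def)
qed

lemma firsts_lt: "a \<in> set (firsts es) ==> a < length es"
 by (simp add: firsts_def)

lemma firsts_props: "distinct (firsts es)" "distinct (map (nth es) (firsts es))" "set (map (nth es) (firsts es)) = set es"
proof -
 show "distinct (firsts es)" by (simp add: firsts_def)
 have "distinct (map (nth es) (firsts es)) \<and> set (map (nth es) (firsts es)) = set es"
 proof (induction es rule: rev_induct)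
  case (snoc x es)
  have e: "map (nth (es @ [x])) (firsts es) = map (nth es) (firsts es)"
   by (rule map_cong) (auto simp: nth_append dest: firsts_lt)
  show ?case using snoc unfolding firsts_snoc map_append e by auto
 qed (simp add: firsts_def)
 then show "distinct (map (nth es) (firsts es))" "set (map (nth es) (firsts es)) = set es" by auto
qed

lemma self_in_perms: "es \<in> perms_of es"
 using firsts_props(2,3)[of es] by (simp add: perms_of_def)

lemma perms_of_set:
 assumes "f \<in> perms_of es"
 shows "set (map (nth f) (firsts es)) = set es" "set f = set es"
proof -
 have d: "distinct (map (nth f) (firsts es))" and s: "set (map (nth f) (firsts es)) \<subseteq> set es" and l: "length f = length es"
  and R: "\<And>a. a < length es ==> a \<notin> set (firsts es) ==> f ! a = es ! a"
  using assms by (auto simp: perms_of_def)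
 have "card (set (map (nth f) (firsts es))) = card (set es)"
  using distinct_card[OF d] distinct_card[OF firsts_props(2)[of es]] firsts_props(3)[of es] by simp
 then show e: "set (map (nth f) (firsts es)) = set es" using s by (metis List.finite_set card_subset_eq)
 show "set f = set es"
 proof
  show "set f \<subseteq> set es"
  proof
   fix y assume "y \<in> set f"
   then obtain a where a: "a < length es" "y = f ! a" using l by (auto simp: in_set_conv_nth)
   then show "y \<in> set es" using R[OF a(1)] e by (cases "a \<in> set (firsts es)") auto
  qed
  show "set es \<subseteq> set f" unfolding e[symmetric] using l firsts_lt by fastforce
 qed
qed

lemma perms_of_swap:
 assumes f: "f \<in> perms_of es" and a: "a \<in> set (firsts es)" and b: "b \<in> set (firsts es)" and ab: "a \<noteq> b"
 shows "f[a := f ! b, b := f ! a] \<in> perms_of es"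
proof -
 let ?g = "f[a := f ! b, b := f ! a]" and ?T = "firsts es"
 have d: "distinct (map (nth f) ?T)" and s: "set (map (nth f) ?T) \<subseteq> set es" and l: "length f = length es"
  and R: "\<And>t. t < length es ==> t \<notin> set ?T ==> f ! t = es ! t"
  using f by (auto simp: perms_of_def)
 have lt: "a < length f" "b < length f" using firsts_lt a b l by auto
 let ?\<tau> = "%t. if t = a then b else if t = b then a else t"
 have g: "?g ! t = f ! ?\<tau> t" for t using lt ab by (auto simp: nth_list_update)
 have inj: "inj_on (nth f) (set ?T)" using d by (simp add: distinct_map)
 have "inj_on (nth ?g) (set ?T)"
 proof (rule inj_onI)
  fix t t' assume t: "t \<in> set ?T" "t' \<in> set ?T" "?g ! t = ?g ! t'"
  have "?\<tau> t \<in> set ?T" "?\<tau> t' \<in> set ?T" using t a b by auto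
  then have "?\<tau> t = ?\<tau> t'" using inj_onD[OF inj t(3)[unfolded g]] by simp
  then show "t = t'" using ab by (auto split: if_splits)
 qed
 moreover have "?g ! t \<in> set es" if "t \<in> set ?T" for t using that s a b unfolding g by auto
 moreover have "?g ! t = es ! t" if "t < length es" "t \<notin> set ?T" for t using R[OF that] that a b unfolding g by auto
 ultimately show ?thesis using l firsts_props(1)[of es] by (auto simp: perms_of_def distinct_map)
qed

section \<open>Even and odd rearrangements have equal sums\<close>

context expl
begin

lemma finsum_swap:
 assumes "finite A" "finite B" "\<And>a b. a \<in> A ==> b \<in> B ==> h a b \<in> carrier F"
 shows "(\<Oplus>a\<in>A. \<Oplus>b\<in>B. h a b) = (\<Oplus>b\<in>B. \<Oplus>a\<in>A. h a b)"
 using assms(2,3)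
proof (induction B rule: finite_induct)
 case empty then show ?case using assms(1) by (simp add: finsum_zero)
next
 case (insert b B)
 have c: "(\<Oplus>b\<in>B. h a b) \<in> carrier F" if "a \<in> A" for a using insert.prems that by (intro finsum_closed) auto
 have "(\<Oplus>a\<in>A. \<Oplus>b\<in>insert b B. h a b) = (\<Oplus>a\<in>A. h a b \<oplus> (\<Oplus>b\<in>B. h a b))"
  using insert c by (intro finsum_cong') (auto simp: finsum_insert Pi_def)
 also have "\<dots> = (\<Oplus>a\<in>A. h a b) \<oplus> (\<Oplus>a\<in>A. \<Oplus>b\<in>B. h a b)"
  using insert.prems c by (intro finsum_addf) auto
 also have "(\<Oplus>a\<in>A. \<Oplus>b\<in>B. h a b) = (\<Oplus>b\<in>B. \<Oplus>a\<in>A. h a b)" using insert by auto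
 also have "(\<Oplus>a\<in>A. h a b) \<oplus> (\<Oplus>b\<in>B. \<Oplus>a\<in>A. h a b) = (\<Oplus>b\<in>insert b B. \<Oplus>a\<in>A. h a b)"
  using insert by (subst finsum_insert) (auto intro!: finsum_closed)
 finally show ?case .
qed

text \<open>Fix a suitable value \<open>x\<close> of \<open>es\<close>. The line through the
  position of \<open>x\<close> expresses \<open>c x \<otimes> U f\<close> as minus the sum of
  \<open>c y \<otimes> U (f[pos f x := y])\<close> over the other \<open>y\<close>. For
  \<open>y\<close> outside \<open>set es\<close> the term is zero by maximality. For
  \<open>y\<close> in \<open>set es\<close> the changed label has \<open>y\<close> at the positions
  of both \<open>x\<close> and \<open>y\<close>, so it is the same for \<open>f\<close> and for
  \<open>f\<close> with these two values exchanged, which has the other parity. Summed over all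
  rearrangements of one parity, the right-hand side therefore does not depend on the parity, and
  \<open>c x\<close> cancels.\<close>

lemma antisymmetric_sum:
 assumes d: "d > 0"
  and c: "\<And>e. e < d ==> c e \<in> carrier F - {\<zero>}"
  and U: "\<And>f. U f \<in> carrier F" "\<And>f. f \<in> tuples d d ==> f \<notin> S ==> U f = \<zero>"
  and line: "\<And>f a. f \<in> tuples d d ==> a < d ==> (\<Oplus>e\<in>{..<d}. c e \<otimes> U (f[a := e])) = \<zero>"
  and es: "es \<in> tuples d d" "\<And>f. f \<in> S ==> card (set f) \<le> card (set es)"
 shows "(\<Oplus>f\<in>{f\<in>perms_of es. par (firsts es) f}. U f) = (\<Oplus>f\<in>{f\<in>perms_of es. \<not> par (firsts es) f}. U f)"
proof -
 let ?T = "firsts es" and ?E = "set es"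
 have len: "length es = d" and E: "?E \<subseteq> {..<d}" using es(1) by (auto simp: tuples_def)
 have pt: "f \<in> tuples d d" if "f \<in> perms_of es" for f
  using perms_of_set(2)[OF that] that E len by (auto simp: tuples_def perms_of_def)
 have finP: "finite (perms_of es)" using finite_subset[OF _ finite_tuples[of d d]] pt by blast
 \<comment> \<open>Either all \<open>d\<close> values occur, and then there is no \<open>y\<close>
   outside \<open>?E\<close>; or some position repeats an earlier value, and this value is taken as
   \<open>x\<close>. In the second case overwriting \<open>pos f x\<close> does not remove
   \<open>x\<close> from the label.\<close>
 obtain x where x: "x \<in> ?E" and xR: "?E = {..<d} \<or> (\<exists>a<d. a \<notin> set ?T \<and> es ! a = x)"
 proof (cases "\<exists>a<d. a \<notin> set ?T")
  case True
  then obtain a where a: "a < d" "a \<notin> set ?T" by blast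
  show thesis by (rule that[of "es ! a"]) (use a len in auto)
 next
  case False
  then have "set ?T = {..<d}" using firsts_lt[of _ es] len by auto
  then have "card ?E = d" using firsts_props(1,2,3)[of es] by (metis card_lessThan distinct_card length_map)
  then have "?E = {..<d}" using E by (metis card_lessThan card_subset_eq finite_lessThan)
  then show thesis using that[of 0] d by auto
 qed
 have xd: "x < d" using x E by auto
 have posex: "\<exists>a. a \<in> set ?T \<and> f ! a = y" if "f \<in> perms_of es" "y \<in> ?E" for f y
 proof -
  have "y \<in> nth f ` set ?T" using perms_of_set(1)[OF that(1)] that(2) by simp
  then show ?thesis by blast
 qed
 define pos where "pos f y = (SOME a. a \<in> set ?T \<and> f ! a = y)" for f :: "nat list" and y
 have pos: "pos f y \<in> set ?T" "f ! pos f y = y" if "f \<in> perms_of es" "y \<in> ?E" for f y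
  using someI_ex[OF posex[OF that]] unfolding pos_def by auto
 have pos_lt: "pos f y < d" if "f \<in> perms_of es" "y \<in> ?E" for f y using firsts_lt[OF pos(1)[OF that]] len by simp
 have pos_eq: "pos f y = a" if "f \<in> perms_of es" "a \<in> set ?T" "f ! a = y" for f y a
 proof -
  have y: "y \<in> ?E" using perms_of_set(1)[OF that(1)] that(2,3) by auto
  have "inj_on (nth f) (set ?T)" using that(1) by (simp add: perms_of_def distinct_map)
  then show ?thesis using pos[OF that(1) y] that(2,3) by (auto dest: inj_onD)
 qed
 define W where "W f y = c y \<otimes> U (f[pos f x := y])" for f y
 have Wc: "W f y \<in> carrier F" if "y < d" for f y using c[OF that] U(1) by (simp add: W_def)
 have fl: "length f = d" if "f \<in> perms_of es" for f using that len by (simp add: perms_of_def)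
 \<comment> \<open>The changed label still contains every value of \<open>?E\<close>, with
   \<open>x\<close> surviving at the repeated position \<open>b\<close>, and \<open>y\<close> in
   addition. It has more distinct entries than any label in \<open>S\<close>.\<close>
 have out: "U (f[pos f x := y]) = \<zero>" if f: "f \<in> perms_of es" and y: "y < d" "y \<notin> ?E" for f y
 proof (rule U(2))
  let ?a = "pos f x" and ?g = "f[pos f x := y]"
  obtain b where b: "b < d" "b \<notin> set ?T" "es ! b = x" using xR y by auto
  show gt: "?g \<in> tuples d d" using pt[OF f] y by (auto simp: tuples_def dest!: set_update_subset_insert[THEN subsetD])
  have ab: "?a \<noteq> b" using pos(1)[OF f x] b by auto
  have "insert y ?E \<subseteq> set ?g"
  proof
   fix z assume z: "z \<in> insert y ?E"
   show "z \<in> set ?g"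
   proof (cases "z = y")
    case True then show ?thesis using pos_lt[OF f x] fl[OF f] by (simp add: set_update_memI)
   next
    case False
    then have zE: "z \<in> ?E" using z by simp
    show ?thesis
    proof (cases "z = x")
     case True
     have "?g ! b = x" using ab b f len by (simp add: perms_of_def)
     then show ?thesis using True b fl[OF f] by (metis length_list_update nth_mem)
    next
     case False
     have "pos f z \<noteq> ?a" using pos(2)[OF f zE] pos(2)[OF f x] False by auto
     then have "?g ! pos f z = z" using pos(2)[OF f zE] by simp
     then show ?thesis using pos_lt[OF f zE] fl[OF f] by (metis length_list_update nth_mem)
    qed
   qed
  qed
  then have "card (insert y ?E) \<le> card (set ?g)" by (intro card_mono) auto
  then have "card ?E < card (set ?g)" using y by simp
  then show "?g \<notin> S" using es(2)[of ?g] by linarith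
 qed
 have Ef: "finite ?E" by simp
 have exp: "c x \<otimes> U f = \<ominus> (\<Oplus>y\<in>?E - {x}. W f y)" if f: "f \<in> perms_of es" for f
 proof -
  have fx: "f[pos f x := x] = f" using pos(2)[OF f x] by (metis list_update_id)
  have "\<zero> = (\<Oplus>e\<in>{..<d}. W f e)" using line[OF pt[OF f] pos_lt[OF f x]] by (simp add: W_def)
  also have "\<dots> = (\<Oplus>e\<in>?E. W f e)"
   by (rule add.finprod_mono_neutral_cong_right) (use E Wc out[OF f] c in \<open>auto simp: W_def\<close>)
  also have "\<dots> = (\<Oplus>e\<in>insert x (?E - {x}). W f e)" using x by (simp add: insert_absorb)
  also have "\<dots> = W f x \<oplus> (\<Oplus>y\<in>?E - {x}. W f y)" using E Wc xd by (subst finsum_insert) auto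
  finally have "W f x \<oplus> (\<Oplus>y\<in>?E - {x}. W f y) = \<zero>" by simp
  moreover have "(\<Oplus>y\<in>?E - {x}. W f y) \<in> carrier F" using E Wc by (intro finsum_closed) auto
  ultimately have "W f x = \<ominus> (\<Oplus>y\<in>?E - {x}. W f y)" using Wc[OF xd] by (metis minus_equality)
  then show ?thesis by (simp add: W_def fx)
 qed
 \<comment> \<open>Exchanges the values \<open>x\<close> and \<open>y\<close>. It is an involution,
   flips the parity and preserves \<open>W f y\<close>, so it matches the terms of the two parity
   classes.\<close>
 define \<phi> where "\<phi> y f = f[pos f x := y, pos f y := x]" for y f
 have phi: "\<phi> y f \<in> perms_of es" "par ?T (\<phi> y f) \<noteq> par ?T f" "\<phi> y (\<phi> y f) = f" "W (\<phi> y f) y = W f y"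
  if f: "f \<in> perms_of es" and y: "y \<in> ?E - {x}" for f y
 proof -
  let ?a = "pos f x" and ?b = "pos f y"
  have yE: "y \<in> ?E" "y \<noteq> x" using y by auto
  have a: "?a \<in> set ?T" "f ! ?a = x" "?a < length f" and b: "?b \<in> set ?T" "f ! ?b = y" "?b < length f"
   using pos[OF f x] pos[OF f yE(1)] pos_lt[OF f x] pos_lt[OF f yE(1)] fl[OF f] by auto
  have ab: "?a \<noteq> ?b" using a b yE by auto
  have e: "\<phi> y f = f[?a := f ! ?b, ?b := f ! ?a]" using a b by (simp add: \<phi>_def)
  show p: "\<phi> y f \<in> perms_of es" unfolding e by (rule perms_of_swap[OF f a(1) b(1) ab])
  show "par ?T (\<phi> y f) \<noteq> par ?T f" unfolding e
   by (rule par_swap[OF a(1) b(1) ab firsts_props(1)]) (use f len firsts_lt fl[OF f] in \<open>auto simp: perms_of_def\<close>)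
  have pb: "pos (\<phi> y f) x = ?b" by (rule pos_eq[OF p b(1)]) (use b in \<open>simp add: \<phi>_def\<close>)
  have pa: "pos (\<phi> y f) y = ?a" by (rule pos_eq[OF p a(1)]) (use a ab in \<open>simp add: \<phi>_def\<close>)
  have "(\<phi> y f)[?b := y] = f[?a := y]"
  proof -
   have "(\<phi> y f)[?b := y] = f[?a := y, ?b := y]" by (simp add: \<phi>_def)
   also have "\<dots> = f[?b := y, ?a := y]" using ab by (simp add: list_update_swap)
   also have "f[?b := y] = f" using b(2) by (metis list_update_id)
   finally show ?thesis .
  qed
  then show "W (\<phi> y f) y = W f y" unfolding W_def pb by simp
  have "\<phi> y (\<phi> y f) = (\<phi> y f)[?b := y, ?a := x]" by (simp only: \<phi>_def[of y "\<phi> y f"] pa pb)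
  also have "\<dots> = f[?a := y, ?a := x]" using \<open>(\<phi> y f)[?b := y] = f[?a := y]\<close> by simp
  also have "\<dots> = f" using a(2) by (metis list_update_id list_update_overwrite)
  finally show "\<phi> y (\<phi> y f) = f" .
 qed
 let ?P = "%s. {f\<in>perms_of es. par ?T f = s}"
 have finPs: "finite (?P s)" for s using finP by simp
 have flip: "(\<Oplus>f\<in>?P True. W f y) = (\<Oplus>f\<in>?P False. W f y)" if y: "y \<in> ?E - {x}" for y
 proof -
  have yd: "y < d" using y E by auto
  have im: "\<phi> y ` ?P True = ?P False"
  proof
   show "\<phi> y ` ?P True \<subseteq> ?P False" using phi(1,2)[OF _ y] by auto
   show "?P False \<subseteq> \<phi> y ` ?P True"
   proof
    fix f assume f: "f \<in> ?P False"
    then have "f = \<phi> y (\<phi> y f)" "\<phi> y f \<in> ?P True" using phi(1,2,3)[OF _ y] by auto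
    then show "f \<in> \<phi> y ` ?P True" by blast
   qed
  qed
  have inj: "inj_on (\<phi> y) (?P True)" by (rule inj_on_inverseI[of _ "\<phi> y"]) (use phi(3)[OF _ y] in auto)
  have "(\<Oplus>f\<in>?P False. W f y) = (\<Oplus>f\<in>\<phi> y ` ?P True. W f y)" using im by simp
  also have "\<dots> = (\<Oplus>f\<in>?P True. W (\<phi> y f) y)" by (rule finsum_reindex[OF _ inj]) (use Wc yd in auto)
  also have "\<dots> = (\<Oplus>f\<in>?P True. W f y)" by (rule finsum_cong') (use phi(4)[OF _ y] Wc yd in auto)
  finally show ?thesis by simp
 qed
 have neg: "(\<Oplus>f\<in>A. \<ominus> h f) = \<ominus> (\<Oplus>f\<in>A. h f)" if "finite A" "\<And>f. f \<in> A ==> h f \<in> carrier F" for A :: "nat list set" and h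
  using that
 proof (induction A rule: finite_induct)
  case (insert f A)
  have "(\<Oplus>f\<in>A. h f) \<in> carrier F" using insert.prems by (intro finsum_closed) auto
  then show ?case using insert by (simp add: finsum_insert Pi_def minus_add)
 qed simp
 have sum: "c x \<otimes> (\<Oplus>f\<in>?P s. U f) = \<ominus> (\<Oplus>y\<in>?E - {x}. \<Oplus>f\<in>?P s. W f y)" for s
 proof -
  have Wc': "W f y \<in> carrier F" if "y \<in> ?E - {x}" for f y using Wc that E by auto
  have "c x \<otimes> (\<Oplus>f\<in>?P s. U f) = (\<Oplus>f\<in>?P s. c x \<otimes> U f)"
   by (rule finsum_rdistr[OF finPs]) (use c[OF xd] U in auto)
  also have "\<dots> = (\<Oplus>f\<in>?P s. \<ominus> (\<Oplus>y\<in>?E - {x}. W f y))"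
   by (rule finsum_cong') (use exp Wc' in \<open>auto intro!: a_inv_closed finsum_closed\<close>)
  also have "\<dots> = \<ominus> (\<Oplus>f\<in>?P s. \<Oplus>y\<in>?E - {x}. W f y)"
   by (rule neg[OF finPs]) (use Wc' in \<open>auto intro!: finsum_closed\<close>)
  also have "(\<Oplus>f\<in>?P s. \<Oplus>y\<in>?E - {x}. W f y) = (\<Oplus>y\<in>?E - {x}. \<Oplus>f\<in>?P s. W f y)"
   by (rule finsum_swap[OF finPs]) (use Wc' in auto)
  finally show ?thesis .
 qed
 have "(\<Oplus>y\<in>?E - {x}. \<Oplus>f\<in>?P True. W f y) = (\<Oplus>y\<in>?E - {x}. \<Oplus>f\<in>?P False. W f y)"
  by (rule finsum_cong') (use flip Wc E in \<open>auto intro!: finsum_closed\<close>)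
 then have a: "c x \<otimes> (\<Oplus>f\<in>?P True. U f) = c x \<otimes> (\<Oplus>f\<in>?P False. U f)"
  unfolding sum by (rule arg_cong)
 have cl: "(\<Oplus>f\<in>?P s. U f) \<in> carrier F" for s using U by (intro finsum_closed) auto
 from m_lcancel[of "c x", OF _ _ cl[of True] cl[of False]] c[OF xd] a
 have "(\<Oplus>f\<in>?P True. U f) = (\<Oplus>f\<in>?P False. U f)" by blast
 then show ?thesis by simp
qed

end

section \<open>Polynomial time of towers and classification\<close>

text \<open>The list \<open>[0..<d i]\<close> is demanded besides the number \<open>d i\<close>: it
  is the range of the searches, and its size makes \<open>d\<close> itself, not just its number of
  digits, polynomially bounded.\<close>

definition ptT where
 "ptT N D Xi p k F d B u tow \<longleftrightarrow> fld N D Xi p k F \<and> pt N D Xi (%i. enc_nat (d i)) \<and>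
   pt N D Xi (%i. enc_elem [0..<d i]) \<and> pt N D Xi (%i. enc_nat (B i)) \<and> pt N D Xi (%i. enc_nat (u i)) \<and>
   pt N D Xi (%i. enc_list (ep enc_elem enc_nat) (tow i)) \<and> (\<forall>i\<in>D. fst ` set (tow i) \<subseteq> carrier (F i))"

lemma ptTD:
 assumes "ptT N D Xi p k F d B u tow"
 shows "fld N D Xi p k F" "pt N D Xi (%i. enc_nat (d i))"
  "pt N D Xi (%i. enc_elem [0..<d i])" "pt N D Xi (%i. enc_nat (B i))" "pt N D Xi (%i. enc_nat (u i))"
  "pt N D Xi (%i. enc_list (ep enc_elem enc_nat) (tow i))" "\<And>i. i \<in> D ==> fst ` set (tow i) \<subseteq> carrier (F i)"
 using assms by (auto simp: ptT_def)

lemma ptT_lift: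
 assumes "ptT N D Xi p k F d B u tow" "\<And>A. pt N D Xi A ==> pt (on_fst N) D' Y (on_fst A)" "\<And>z. z \<in> D' ==> fst z \<in> D"
 shows "ptT (on_fst N) D' Y (on_fst p) (on_fst k) (on_fst F) (on_fst d) (on_fst B) (on_fst u) (on_fst tow)"
 unfolding ptT_def
proof (intro conjI ballI)
 show "fld (on_fst N) D' Y (on_fst p) (on_fst k) (on_fst F)"
  by (rule fld_lift[OF ptTD(1)[OF assms(1)] assms(2,3)])
 show "fst ` set (tow (fst z)) \<subseteq> carrier (F (fst z))" if "z \<in> D'" for z
  by (rule ptTD(7)[OF assms(1) assms(3)[OF that]])
qed (rule assms(2), rule ptTD[OF assms(1)])+

lemma ptT_sub: "ptT N D Xi p k F d B u tow ==> D' \<subseteq> D ==> ptT N D' Xi p k F d B u tow"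
 unfolding ptT_def by (meson fld_sub pt_sub subsetD)

lemma pt_upt1: "pt N D Xi (%i. enc_elem [0..<d i]) ==> pt N D Xi (%i. enc_elem [1..<Suc (d i)])"
proof -
 assume ds: "pt N D Xi (%i. enc_elem [0..<d i])"
 have "pt N D Xi (%i. enc_elem (map (%x. x + 1) [0..<d i]))"
 proof (rule pt_map[OF ds], goal_cases)
  case (1 Y) show ?case by (intro pt_add 1(3) pt_nat_const 1(2))
 qed
 then show ?thesis by (simp add: map_Suc_upt)
qed

context expl
begin

lemma sift_step_carrier:
 assumes "fst s \<in> carrier F" "snd s \<in> carrier F" "fst ho \<in> carrier F"
 shows "fst (sift_step d s ho) \<in> carrier F" "snd (sift_step d s ho) \<in> carrier F"
 using assms by (simp_all add: sift_step_def Let_def)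

text \<open>A version for the time analysis, where the elements met are only known to be in the
  carrier.\<close>

lemma sift_carrier:
 assumes "\<delta> \<in> carrier F" "fst ` set tow \<subseteq> carrier F"
 shows "fst (sift d tow \<delta>) \<in> carrier F" "snd (sift d tow \<delta>) \<in> carrier F"
proof -
 have "fst (sift d tow \<delta>) \<in> carrier F \<and> snd (sift d tow \<delta>) \<in> carrier F" using assms(2)
 proof (induction tow rule: rev_induct)
  case (snoc ho tow)
  have "sift d (tow @ [ho]) \<delta> = sift_step d (sift d tow \<delta>) ho" by (simp add: sift_def)
  then show ?case using snoc sift_step_carrier[of "sift d tow \<delta>" ho] by auto
 qed (simp add: sift_def assms)
 then show "fst (sift d tow \<delta>) \<in> carrier F" "snd (sift d tow \<delta>) \<in> carrier F" by auto
qed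

end

abbreviation "ee \<equiv> ep enc_elem enc_elem"

lemma ptF_is_one:
 assumes f: "fld N D Xi p k F" and x: "ptF N D Xi F x"
 shows "pt N D Xi (%i. eb (x i = \<one>\<^bsub>F i\<^esub>))"
 by (rule ptF_eq[OF f x ptF_one[OF f]])

lemma pt_sift_step:
 assumes f: "fld N D Xi p k F" and d: "pt N D Xi (%i. enc_nat (d i))" and ds: "pt N D Xi (%i. enc_elem [0..<d i])"
  and s1: "ptF N D Xi F (%i. fst (s i))" and s2: "ptF N D Xi F (%i. snd (s i))"
  and h: "ptF N D Xi F (%i. fst (ho i))" and o': "pt N D Xi (%i. enc_nat (snd (ho i)))"
 shows "pt N D Xi (%i. ee (expl.sift_step (F i) (d i) (s i) (ho i)))"
proof -
 let ?r = "%i. find (%x. (fst (s i) \<otimes>\<^bsub>F i\<^esub> (fst (ho i) [^]\<^bsub>F i\<^esub> x) [^]\<^bsub>F i\<^esub> d i) [^]\<^bsub>F i\<^esub> snd (ho i) = \<one>\<^bsub>F i\<^esub>) [0..<d i]"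
 have r: "pt N D Xi (%i. eo enc_nat (?r i))"
 proof (rule pt_find[OF ds], goal_cases)
  case (1 Y)
  let ?D = "{(i, x). i \<in> D \<and> x \<in> set [0..<d i]}"
  have D: "\<And>z. z \<in> ?D ==> fst z \<in> D" by auto
  note l = ptF_lift[OF _ 1(1) D] and f' = fld_lift[OF f 1(1) D]
  show ?case
   by (rule ptF_is_one[OF f' ptF_pow[OF f' 1(1)[OF o'] ptF_mult[OF f' l[OF s1] ptF_pow[OF f' 1(1)[OF d] ptF_pow[OF f' 1(3) l[OF h]]]]]])
 qed
 let ?x = "%i. if ?r i = None then 0 else the (?r i)"
 have x: "pt N D Xi (%i. enc_nat (?x i))"
  by (rule pt_if[where e = enc_nat, OF pt_is_None[OF r]], rule pt_nat_const, rule pt_sub[OF fldD(4)[OF f]], force,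
    rule pt_the, rule pt_sub[OF r], auto)
 let ?c = "%i. fst (ho i) [^]\<^bsub>F i\<^esub> ?x i"
 have c: "ptF N D Xi F ?c" by (rule ptF_pow[OF f x h])
 have "pt N D Xi (%i. ee (fst (s i) \<otimes>\<^bsub>F i\<^esub> ?c i [^]\<^bsub>F i\<^esub> d i, snd (s i) \<otimes>\<^bsub>F i\<^esub> ?c i))"
  by (rule pt_pair, rule ptFD(1)[OF ptF_mult[OF f s1 ptF_pow[OF f d c]]], rule ptFD(1)[OF ptF_mult[OF f s2 c]])
 then show ?thesis by (rule pt_cong) (simp add: expl.sift_step_def[OF fldD(1)[OF f]] Let_def)
qed

lemma pt_sift:
 assumes T: "ptT N D Xi p k F d B u tow" and \<delta>: "ptF N D Xi F \<delta>"
 shows "ptF N D Xi F (%i. fst (expl.sift (F i) (d i) (tow i) (\<delta> i)))"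
  "ptF N D Xi F (%i. snd (expl.sift (F i) (d i) (tow i) (\<delta> i)))"
proof -
 note T' = ptTD[OF T]
 note f = T'(1)
 obtain b where b: "pb N D b" "\<And>i x. i \<in> D ==> x \<in> carrier (F i) ==> size (enc_elem x) \<le> b i"
  by (rule fld_sz[OF f]) blast
 let ?Inv = "%i (j :: nat) s. fst s \<in> carrier (F i) \<and> snd s \<in> carrier (F i)"
 have m: "pt N D Xi (%i. ee (foldl (expl.sift_step (F i) (d i)) (\<delta> i, \<one>\<^bsub>F i\<^esub>) (tow i)))"
 proof (rule pt_fold[OF T'(6) _ _ _ _ _ refl, where Inv = ?Inv and b = "%i. 2 * b i + 1"], goal_cases)
  case 1 show ?case by (rule pt_pair, rule ptFD(1)[OF \<delta>], rule ptFD(1)[OF ptF_one[OF f]])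
 next
  case (2 i) show ?case using ptFD(2)[OF \<delta> 2] ptFD(2)[OF ptF_one[OF f] 2] by simp
 next
  case (3 i j s)
  have "fst (tow i ! j) \<in> carrier (F i)" using T'(7)[OF 3(1)] nth_mem[OF 3(2)] by blast
  then show ?case using expl.sift_step_carrier[OF fldD(1)[OF f 3(1)]] 3(3) by blast
 next
  case 4 show ?case using b(1) by (intro pb_add pb_mult pb_const)
 next
  case (5 i j s)
  have "size (enc_elem (fst s)) \<le> b i" "size (enc_elem (snd s)) \<le> b i" using 5(3) b(2)[OF 5(1)] by blast+
  then show ?case by (simp add: size_ep)
 next
  case (6 Y)
  let ?D = "{(i, s, x). i \<in> D \<and> (\<exists>j<length (tow i). x = tow i ! j \<and> ?Inv i j s)}"
  have D: "\<And>z. z \<in> ?D ==> fst z \<in> D" by auto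
  note f' = fld_lift[OF f 6(1) D]
  have s1: "ptF (on_fst N) ?D Y (on_fst F) (%z. fst (fst (snd z)))"
   by (rule ptFI, rule pt_fst[OF 6(3)]) auto
  have s2: "ptF (on_fst N) ?D Y (on_fst F) (%z. snd (fst (snd z)))"
   by (rule ptFI, rule pt_snd[OF 6(3)]) auto
  have h: "ptF (on_fst N) ?D Y (on_fst F) (%z. fst (snd (snd z)))"
  proof (rule ptFI, rule pt_fst[OF 6(4)])
   fix z assume z: "z \<in> ?D"
   then have "snd (snd z) \<in> set (tow (fst z))" "fst z \<in> D" by auto
   then show "fst (snd (snd z)) \<in> carrier (F (fst z))" using T'(7) by blast
  qed
  show ?case by (rule pt_sift_step[OF f' 6(1)[OF T'(2)] 6(1)[OF T'(3)] s1 s2 h pt_snd[OF 6(4)]])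
 qed
 have e: "foldl (expl.sift_step (F i) (d i)) (\<delta> i, \<one>\<^bsub>F i\<^esub>) (tow i) = expl.sift (F i) (d i) (tow i) (\<delta> i)" if "i \<in> D" for i
  by (simp add: expl.sift_def[OF fldD(1)[OF f that]])
 have m': "pt N D Xi (%i. ee (expl.sift (F i) (d i) (tow i) (\<delta> i)))" by (rule pt_cong[OF m]) (simp add: e)
 show "ptF N D Xi F (%i. fst (expl.sift (F i) (d i) (tow i) (\<delta> i)))"
  by (rule ptFI, rule pt_fst[OF m'], rule expl.sift_carrier(1)[OF fldD(1)[OF f] ptFD(2)[OF \<delta>] T'(7)])
 show "ptF N D Xi F (%i. snd (expl.sift (F i) (d i) (tow i) (\<delta> i)))"
  by (rule ptFI, rule pt_snd[OF m'], rule expl.sift_carrier(2)[OF fldD(1)[OF f] ptFD(2)[OF \<delta>] T'(7)])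
qed

lemma pt_classify:
 assumes T: "ptT N D Xi p k F d B u tow" and C: "pt N D Xi (%i. enc_vec (C i))"
  and Cc: "\<And>i. i \<in> D ==> set (C i) \<subseteq> carrier (F i)" and \<alpha>: "ptF N D Xi F \<alpha>"
 shows "pt N D Xi (%i. eo (ep enc_nat enc_elem) (expl.classify (F i) (d i) (B i) (u i) (tow i) (C i) (\<alpha> i)))"
proof -
 note T' = ptTD[OF T]
 note f = T'(1)
 let ?zs = "%i. zip [0..<length (C i)] (C i)"
 let ?S = "%i c. expl.sift (F i) (d i) (tow i) (c \<otimes>\<^bsub>F i\<^esub> \<alpha> i [^]\<^bsub>F i\<^esub> (d i - 1))"
 let ?r = "%i. find (%z. fst (?S i (snd z)) [^]\<^bsub>F i\<^esub> B i = \<one>\<^bsub>F i\<^esub>) (?zs i)"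
 have d1: "pt N D Xi (%i. enc_nat (d i - 1))" by (intro pt_minus T' pt_nat_const fldD(4)[OF f])
 have r: "pt N D Xi (%i. eo (ep enc_nat enc_elem) (?r i))"
 proof (rule pt_find[OF pt_enumerate[OF C]], goal_cases)
  case (1 Y)
  let ?D = "{(i, x). i \<in> D \<and> x \<in> set (?zs i)}"
  have D: "\<And>z. z \<in> ?D ==> fst z \<in> D" by auto
  note l = ptF_lift[OF _ 1(1) D] and f' = fld_lift[OF f 1(1) D]
  have c: "ptF (on_fst N) ?D Y (on_fst F) (%z. snd (snd z))"
  proof (rule ptFI, rule pt_snd[OF 1(3)])
   fix z assume "z \<in> ?D"
   then have "snd (snd z) \<in> set (C (fst z))" "fst z \<in> D" by (auto dest: set_zip_rightD)
   then show "snd (snd z) \<in> carrier (F (fst z))" using Cc by blast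
  qed
  show ?case
   by (rule ptF_is_one[OF f' ptF_pow[OF f' 1(1)[OF T'(4)] pt_sift(1)[OF ptT_lift[OF T 1(1) D]
      ptF_mult[OF f' c ptF_pow[OF f' 1(1)[OF d1] l[OF \<alpha>]]]]]])
 qed
 let ?D1 = "{i \<in> D. ?r i \<noteq> None}"
 have sub: "?D1 \<subseteq> D" by blast
 note f1 = fld_sub[OF f sub] and T1 = ptT_sub[OF T sub]
 have the: "pt N ?D1 Xi (%i. ep enc_nat enc_elem (the (?r i)))"
  by (rule pt_the, rule pt_sub[OF r sub]) auto
 have c: "ptF N ?D1 Xi F (%i. snd (the (?r i)))"
 proof (rule ptFI, rule pt_snd[OF the])
  fix i assume i: "i \<in> ?D1"
  then obtain z where z: "?r i = Some z" by blast
  from find_SomeD(1)[OF z] have "snd z \<in> set (C i)" by (auto simp: set_zip)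
  then show "snd (the (?r i)) \<in> carrier (F i)" using z Cc i by auto
 qed
 note \<alpha>1 = ptF_sub[OF \<alpha> sub]
 have del: "ptF N ?D1 Xi F (%i. snd (the (?r i)) \<otimes>\<^bsub>F i\<^esub> \<alpha> i [^]\<^bsub>F i\<^esub> (d i - 1))"
  by (rule ptF_mult[OF f1 c ptF_pow[OF f1 pt_sub[OF d1 sub] \<alpha>1]])
 have \<gamma>: "ptF N ?D1 Xi F (%i. (\<alpha> i \<otimes>\<^bsub>F i\<^esub> snd (?S i (snd (the (?r i))))) \<otimes>\<^bsub>F i\<^esub> fst (?S i (snd (the (?r i)))) [^]\<^bsub>F i\<^esub> u i)"
  by (rule ptF_mult[OF f1 ptF_mult[OF f1 \<alpha>1 pt_sift(2)[OF T1 del]] ptF_pow[OF f1 pt_sub[OF T'(5) sub] pt_sift(1)[OF T1 del]]])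
 have "pt N D Xi (%i. eo (ep enc_nat enc_elem) (if ?r i = None then None else Some (fst (the (?r i)),
   (\<alpha> i \<otimes>\<^bsub>F i\<^esub> snd (?S i (snd (the (?r i))))) \<otimes>\<^bsub>F i\<^esub> fst (?S i (snd (the (?r i)))) [^]\<^bsub>F i\<^esub> u i)))"
  by (rule pt_if[where e = "eo (ep enc_nat enc_elem)", OF pt_is_None[OF r]], rule pt_None, rule pt_sub[OF fldD(4)[OF f]], force,
    rule pt_Some, rule pt_pair, rule pt_fst[OF the], rule ptFD(1)[OF \<gamma>])
 then show ?thesis by (rule pt_cong) (simp add: expl.classify_def[OF fldD(1)[OF f]] Let_def)
qed

text \<open>Each generator multiplies the exponent by at most \<open>d i\<close>, whether or not the
  search for an order succeeds. So all exponents stay below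
  \<open>B i * d i ^ length (hs i)\<close>, a number with polynomially many digits.\<close>

lemma pt_tower:
 assumes f: "fld N D Xi p k F" and d: "pt N D Xi (%i. enc_nat (d i))" and ds: "pt N D Xi (%i. enc_elem [0..<d i])"
  and B: "pt N D Xi (%i. enc_nat (B i))" and hs: "pt N D Xi (%i. enc_vec (hs i))"
  and hc: "\<And>i. i \<in> D ==> set (hs i) \<subseteq> carrier (F i)" and d0: "\<And>i. i \<in> D ==> d i > 0"
 shows "pt N D Xi (%i. ep enc_nat (enc_list (ep enc_elem enc_nat)) (expl.tower (F i) (d i) (B i) (hs i)))"
  "\<And>i. i \<in> D ==> fst ` set (snd (expl.tower (F i) (d i) (B i) (hs i))) \<subseteq> carrier (F i)"
proof -
 obtain b where b: "pb N D b" "\<And>i x. i \<in> D ==> x \<in> carrier (F i) ==> size (enc_elem x) \<le> b i"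
  by (rule fld_sz[OF f]) blast
 let ?es = "ep enc_nat (enc_list (ep enc_elem enc_nat))"
 let ?g = "%i. expl.tower_step (F i) (d i)"
 let ?M = "%i. B i * d i ^ length (hs i)"
 let ?Inv = "%i j s. fst s \<le> B i * d i ^ j \<and> length (snd s) \<le> j \<and> fst ` set (snd s) \<subseteq> carrier (F i) \<and> (\<forall>x\<in>set (snd s). snd x \<le> ?M i)"
 let ?sM = "%i. 2 * (size (enc_nat (B i)) + size (enc_nat (d i)) * length (hs i))"
 have szM: "size (enc_nat n) \<le> ?sM i" if "n \<le> ?M i" for n i
 proof -
  have "?M i \<le> B i * (2 ^ size (enc_nat (d i))) ^ length (hs i)"
   by (rule mult_le_mono2[OF power_mono[OF less_imp_le[OF less_two_power_size]]]) simp
  also have "\<dots> < 2 ^ size (enc_nat (B i)) * (2 ^ size (enc_nat (d i))) ^ length (hs i)"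
   by (rule mult_strict_right_mono[OF less_two_power_size]) simp
  finally have "n < 2 ^ (size (enc_nat (B i)) + size (enc_nat (d i)) * length (hs i))"
   using that by (simp add: power_add power_mult)
  then show ?thesis by (rule size_enc_nat_le)
 qed
 have Mj: "B i * d i ^ j \<le> ?M i" if "i \<in> D" "j \<le> length (hs i)" for i j
  by (rule mult_le_mono2[OF power_increasing]) (use that d0[OF that(1)] in simp_all)
 have inv: "?Inv i (Suc j) (?g i s (hs i ! j))" if i: "i \<in> D" and j: "j < length (hs i)" and s: "?Inv i j s" for i j s
 proof -
  interpret expl "p i" "k i" "F i" by (rule fldD(1)[OF f i])
  let ?r = "find (%n. ((hs i ! j [^]\<^bsub>F i\<^esub> d i) [^]\<^bsub>F i\<^esub> fst s) [^]\<^bsub>F i\<^esub> n = \<one>\<^bsub>F i\<^esub>) [1..<Suc (d i)]"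
  let ?n = "if ?r = None then 1 else the ?r"
  have n: "?n \<le> d i"
  proof (cases ?r)
   case None then show ?thesis using d0[OF i] by simp
  next
   case (Some a)
   from find_uptD(2)[OF this] show ?thesis unfolding Some by simp
  qed
  have e: "?g i s (hs i ! j) = (fst s * ?n, (hs i ! j, fst s) # snd s)" by (simp only: tower_step_def Let_def)
  have "fst s * ?n \<le> B i * d i ^ j * d i" using s n by (intro mult_mono) auto
  moreover have "hs i ! j \<in> carrier (F i)" using hc[OF i] nth_mem[OF j] by blast
  moreover have "fst s \<le> ?M i" by (rule order_trans[OF conjunct1[OF s] Mj[OF i less_imp_le[OF j]]])
  ultimately show ?thesis unfolding e using s by (simp add: mult_ac)
 qed
 have inv0: "?Inv i 0 (B i, [])" for i by simp
 have "?Inv i j (foldl (?g i) (B i, []) (take j (hs i)))" if i: "i \<in> D" and "j \<le> length (hs i)" for i j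
  using that(2)
 proof (induction j)
  case (Suc j)
  then have j: "j < length (hs i)" by simp
  have IH: "?Inv i j (foldl (?g i) (B i, []) (take j (hs i)))" by (rule Suc.IH) (use j in simp)
  show ?case unfolding take_Suc_nth[OF j] foldl_append foldl.simps by (rule inv[OF i j IH])
 qed (use inv0 in simp)
 from this[OF _ order_refl] show "fst ` set (snd (expl.tower (F i) (d i) (B i) (hs i))) \<subseteq> carrier (F i)" if "i \<in> D" for i
  using that by (simp add: expl.tower_def[OF fldD(1)[OF f that]])
 have m: "pt N D Xi (%i. ?es (foldl (?g i) (B i, []) (hs i)))"
 proof (rule pt_fold[OF hs _ _ _ _ _ refl, where Inv = ?Inv and b = "%i. ?sM i + length (hs i) * (b i + ?sM i + 2) + 1"], goal_cases)
  case 1 show ?case by (intro pt_pair B pt_Nil fldD(4)[OF f])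
 next
  case (2 i) show ?case by (rule inv0)
 next
  case (3 i j s) show ?case by (rule inv[OF 3])
 next
  case 4 show ?case using b(1) pt_size[OF B] pt_size[OF d] pt_length_bound[OF hs] by (intro pb_add pb_mult pb_const)
 next
  case (5 i j s)
  have 1: "size (enc_nat (fst s)) \<le> ?sM i" by (rule szM, rule order_trans[OF conjunct1[OF 5(3)] Mj[OF 5(1,2)]])
  have "size (enc_list (ep enc_elem enc_nat) (snd s)) \<le> length (snd s) * (b i + ?sM i + 1 + 1)"
  proof (rule size_enc_list_le)
   fix x assume x: "x \<in> set (snd s)"
   have "size (enc_elem (fst x)) \<le> b i" by (rule b(2)[OF 5(1)]) (use 5(3) x in blast)
   moreover have "size (enc_nat (snd x)) \<le> ?sM i" by (rule szM) (use 5(3) x in blast)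
   ultimately show "size (ep enc_elem enc_nat x) \<le> b i + ?sM i + 1" by (simp add: size_ep)
  qed
  also have "\<dots> \<le> length (hs i) * (b i + ?sM i + 2)" using 5 by (intro mult_mono) auto
  finally show ?case using 1 by (simp add: size_ep)
 next
  case (6 Y)
  let ?D = "{(i, s, x). i \<in> D \<and> (\<exists>j<length (hs i). x = hs i ! j \<and> ?Inv i j s)}"
  have D: "\<And>z. z \<in> ?D ==> fst z \<in> D" by auto
  note f' = fld_lift[OF f 6(1) D]
  have x: "ptF (on_fst N) ?D Y (on_fst F) (%z. snd (snd z))"
  proof (rule ptFI, rule 6(4))
   fix z assume "z \<in> ?D"
   then have "snd (snd z) \<in> set (hs (fst z))" "fst z \<in> D" by auto
   then show "snd (snd z) \<in> carrier (F (fst z))" using hc by blast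
  qed
  let ?r = "%z. find (%n. ((snd (snd z) [^]\<^bsub>F (fst z)\<^esub> d (fst z)) [^]\<^bsub>F (fst z)\<^esub> fst (fst (snd z))) [^]\<^bsub>F (fst z)\<^esub> n = \<one>\<^bsub>F (fst z)\<^esub>) [1..<Suc (d (fst z))]"
  have r: "pt (on_fst N) ?D Y (%z. eo enc_nat (?r z))"
  proof (rule pt_find[OF 6(1)[OF pt_upt1[OF ds]]], goal_cases)
   case (1 Y2)
   let ?D2 = "{(z, n). z \<in> ?D \<and> n \<in> set [1..<Suc (d (fst z))]}"
   have D2: "\<And>z. z \<in> ?D2 ==> fst z \<in> ?D" by auto
   note f2 = fld_lift[OF f' 1(1) D2]
   show ?case
    by (rule ptF_is_one[OF f2 ptF_pow[OF f2 1(3) ptF_pow[OF f2 1(1)[OF pt_fst[OF 6(3)]] ptF_pow[OF f2 1(1)[OF 6(1)[OF d]] ptF_lift[OF x 1(1) D2]]]]])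
  qed
  have n: "pt (on_fst N) ?D Y (%z. enc_nat (if ?r z = None then 1 else the (?r z)))"
   by (rule pt_if[where e = enc_nat, OF pt_is_None[OF r]], rule pt_nat_const, rule pt_sub[OF 6(2)], force,
    rule pt_the, rule pt_sub[OF r], auto)
  have "pt (on_fst N) ?D Y (%z. ?es (fst (fst (snd z)) * (if ?r z = None then 1 else the (?r z)), (snd (snd z), fst (fst (snd z))) # snd (fst (snd z))))"
   by (rule pt_pair, rule pt_mult[OF pt_fst[OF 6(3)] n], rule pt_Cons[OF _ pt_snd[OF 6(3)]], rule pt_pair, rule 6(4), rule pt_fst[OF 6(3)])
  then show ?case by (rule pt_cong) (simp add: expl.tower_step_def[OF fldD(1)[OF f D]] Let_def)
 qed
 then show "pt N D Xi (%i. ?es (expl.tower (F i) (d i) (B i) (hs i)))"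
  by (rule pt_cong) (simp add: expl.tower_def[OF fldD(1)[OF f]])
qed

lemma pt_chain:
 assumes f: "fld N D Xi p k F" and d: "pt N D Xi (%i. enc_nat (d i))" and js: "pt N D Xi (%i. enc_list e (js i))"
  and c: "ptF N D Xi F c"
 shows "pt N D Xi (%i. enc_vec (expl.chain (F i) (d i) (js i) (c i)))"
  "\<And>i. i \<in> D ==> set (expl.chain (F i) (d i) (js i) (c i)) \<subseteq> carrier (F i) \<and> length (expl.chain (F i) (d i) (js i) (c i)) = Suc (length (js i))"
proof -
 obtain b where b: "pb N D b" "\<And>i x. i \<in> D ==> x \<in> carrier (F i) ==> size (enc_elem x) \<le> b i"
  by (rule fld_sz[OF f]) blast
 let ?g = "%i l (_ :: 'b). (hd l) [^]\<^bsub>F i\<^esub> d i # l"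
 let ?Inv = "%i j l. set l \<subseteq> carrier (F i) \<and> length l = Suc j"
 have hd: "hd l \<in> carrier (F i)" if "?Inv i j l" for i j l using that by (cases l) auto
 have inv: "?Inv i (Suc j) (?g i l x)" if i: "i \<in> D" and l: "?Inv i j l" for i j l x
 proof -
  interpret expl "p i" "k i" "F i" by (rule fldD(1)[OF f i])
  show ?thesis using l hd[OF l] by simp
 qed
 show "set (expl.chain (F i) (d i) (js i) (c i)) \<subseteq> carrier (F i) \<and> length (expl.chain (F i) (d i) (js i) (c i)) = Suc (length (js i))"
  if i: "i \<in> D" for i
 proof -
  interpret expl "p i" "k i" "F i" by (rule fldD(1)[OF f i])
  have "c i \<in> carrier (F i)" by (rule ptFD(2)[OF c i])
  then show ?thesis using chain_eq[of "c i" "d i" "js i"] by auto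
 qed
 have m: "pt N D Xi (%i. enc_vec (foldl (?g i) [c i] (js i)))"
 proof (rule pt_fold[OF js _ _ _ _ _ refl, where Inv = ?Inv and b = "%i. (length (js i) + 1) * (b i + 1)"], goal_cases)
  case 1 show ?case by (intro pt_Cons ptFD(1)[OF c] pt_Nil fldD(4)[OF f])
 next
  case (2 i) show ?case using ptFD(2)[OF c 2] by simp
 next
  case (3 i j s) show ?case by (rule inv[OF 3(1,3)])
 next
  case 4 show ?case using b(1) pt_length_bound[OF js] by (intro pb_add pb_mult pb_const)
 next
  case (5 i j s)
  have "size (enc_vec s) \<le> length s * (b i + 1)"
   by (rule size_enc_list_le) (use 5(3) b(2)[OF 5(1)] in blast)
  also have "\<dots> \<le> (length (js i) + 1) * (b i + 1)" using 5 by (intro mult_right_mono) auto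
  finally show ?case .
 next
  case (6 Y)
  let ?D = "{(i, s, x). i \<in> D \<and> (\<exists>j<length (js i). x = js i ! j \<and> ?Inv i j s)}"
  have D: "\<And>z. z \<in> ?D ==> fst z \<in> D" by auto
  note f' = fld_lift[OF f 6(1) D]
  have h: "ptF (on_fst N) ?D Y (on_fst F) (%z. hd (fst (snd z)))"
  proof (rule ptFI, rule pt_hd, rule 6(3))
   fix z assume "z \<in> ?D"
   then obtain j where j: "?Inv (fst z) j (fst (snd z))" by auto
   show "fst (snd z) \<noteq> []" using j by auto
   show "hd (fst (snd z)) \<in> carrier (F (fst z))" by (rule hd[OF j])
  qed
  show ?case by (rule pt_Cons[OF ptFD(1)[OF ptF_pow[OF f' 6(1)[OF d] h]] 6(3)])
 qed
 then show "pt N D Xi (%i. enc_vec (expl.chain (F i) (d i) (js i) (c i)))"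
  by (rule pt_cong) (simp add: expl.chain_def[OF fldD(1)[OF f]])
qed

lemma last_filter_upt:
 assumes "P g" "1 \<le> g" "g \<le> d" "\<And>t. 1 \<le> t ==> t \<le> d ==> P t ==> t \<le> g"
 shows "last (filter P [1..<Suc d]) = g"
proof -
 have "[1..<Suc d] = [1..<g] @ g # [Suc g..<Suc d]" using assms(2,3) by (metis less_Suc_eq_le upt_add_eq_append upt_conv_Cons le_SucI le_iff_add order_refl le_Suc_eq)
 moreover have "filter P [Suc g..<Suc d] = []" unfolding filter_empty_conv
 proof
  fix t assume "t \<in> set [Suc g..<Suc d]"
  then have "1 \<le> t" "t \<le> d" "\<not> t \<le> g" using assms(2) by auto
  then show "\<not> P t" using assms(4) by blast
 qed
 ultimately show ?thesis using assms(1) by simp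
qed

text \<open>The gcd is the last common divisor in the range \<open>1..d i\<close>. Trial division is
  affordable, as this range is available as a list.\<close>

lemma pt_gcd:
 assumes a: "pt N D Xi (%i. enc_nat (a i))" and d: "pt N D Xi (%i. enc_nat (d i))" and ds: "pt N D Xi (%i. enc_elem [0..<d i])"
  and d0: "\<And>i. i \<in> D ==> d i > 0"
 shows "pt N D Xi (%i. enc_nat (gcd (a i) (d i)))"
proof -
 let ?fl = "%i. filter (%t. t dvd a i \<and> t dvd d i) [1..<Suc (d i)]"
 have "pt N D Xi (%i. enc_elem (?fl i))"
 proof (rule pt_filter[OF pt_upt1[OF ds]], goal_cases)
  case (1 Y) show ?case by (intro pt_conj pt_dvd 1(3) 1(1)[OF a] 1(1)[OF d]) auto
 qed
 then have "pt N D Xi (%i. enc_nat (hd (rev (?fl i))))"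
 proof (rule pt_hd[OF pt_rev])
  fix i assume "i \<in> D"
  then have "1 \<in> set (?fl i)" using d0[of i] by (simp del: upt_Suc)
  then have "?fl i \<noteq> []" by (metis empty_iff list.set(1))
  then show "rev (?fl i) \<noteq> []" by (simp only: rev_is_Nil_conv not_False_eq_True)
 qed
 then show ?thesis
 proof (rule pt_cong)
  fix i assume i: "i \<in> D"
  have "last (?fl i) = gcd (a i) (d i)"
   by (rule last_filter_upt) (use d0[OF i] in \<open>auto simp: Suc_leI intro: dvd_imp_le gcd_le2_nat\<close>)
  then show "enc_nat (hd (rev (?fl i))) = enc_nat (gcd (a i) (d i))" by (simp add: hd_rev)
 qed
qed

lemma pt_cop_part:
 assumes n: "pt N D Xi (%i. enc_nat (n i))" and d: "pt N D Xi (%i. enc_nat (d i))" and ds: "pt N D Xi (%i. enc_elem [0..<d i])"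
  and js: "pt N D Xi (%i. enc_list e (js i))" and d0: "\<And>i. i \<in> D ==> d i > 0"
 shows "pt N D Xi (%i. enc_nat (cop_part (d i) (js i) (n i)))"
 unfolding cop_part_def
proof (rule pt_fold[OF js _ _ _ _ _ refl, where Inv = "%i j s. s \<le> n i" and b = "%i. 2 * size (enc_nat (n i))"], goal_cases)
 case 1 show ?case by (rule n)
next
 case (3 i j s) then show ?case by (meson div_le_dividend le_trans)
next
 case 4 show ?case using pt_size[OF n] by (intro pb_mult pb_const)
next
 case (5 i j s) then show ?case by (intro size_enc_nat_mono)
next
 case (6 Y)
 let ?D = "{(i, s, x). i \<in> D \<and> (\<exists>j<length (js i). x = js i ! j \<and> s \<le> n i)}"
 have D: "d (fst z) > 0" if "z \<in> ?D" for z using that d0 by auto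
 show ?case by (rule pt_div[OF 6(3) pt_gcd[OF 6(3) 6(1)[OF d] 6(1)[OF ds] D]]) (use D in auto)
qed auto

section \<open>Blocks, merging, and the values attached to labels\<close>

text \<open>A member consists of the index of an input vector, its multiplier and its label. A block
  carries its members together with the vector of their sums, sorted by label and coordinate in the
  order of \<open>keys\<close>.\<close>

type_synonym member = "nat \<times> nat list \<times> nat list"
type_synonym block = "member list \<times> nat list list"

context expl
begin

text \<open>The list \<open>C\<close> may grow to \<open>d + 1\<close> entries, one too many. From
  then on the run is going to be discarded, and the answer \<open>(0, \<one>)\<close> for an
  unrecognized coefficient is a mere placeholder.\<close>

definition dec where
 "dec d B u tow C \<alpha> = (let r = classify d B u tow C \<alpha> in
   if \<alpha> = \<zero> then (C, None) else if r \<noteq> None then (C, r)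
   else if length C \<le> d then (C @ [\<alpha>], Some (length C, \<one>)) else (C, Some (0, \<one>)))"

definition decs where
 "decs d B u tow C \<alpha>s = foldl (%s \<alpha>. (fst (dec d B u tow (fst s) \<alpha>), snd s @ [snd (dec d B u tow (fst s) \<alpha>)])) (C, []) \<alpha>s"

definition new_members :: "(nat \<times> nat list) option \<Rightarrow> block \<Rightarrow> member list" where
 "new_members o' b = (if o' = None then [] else
   map (%x. (fst x, fst (snd x) \<otimes> snd (the o'), fst (the o') # snd (snd x))) (fst b))"

definition new_part :: "nat \<Rightarrow> nat \<Rightarrow> (nat \<times> nat list) option \<Rightarrow> block \<Rightarrow> nat list list" where
 "new_part d e o' b = (if o' = None then map (%_. \<zero>) (snd b) else if fst (the o') = e
   then map (%x. snd (the o') [^] d \<otimes> x) (snd b) else map (%_. \<zero>) (snd b))"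

definition vadd :: "nat list list \<Rightarrow> nat list list \<Rightarrow> nat list list" where
 "vadd x y = map (%z. fst z \<oplus> snd z) (zip x y)"

definition merge_blocks where
 "merge_blocks d B u tow C bs = (let z = decs d B u tow C (nullvec (map snd bs)); ws = zip (snd z) bs in
  (fst z, (concat (map (%w. new_members (fst w) (snd w)) ws),
       concat (map (%e. foldl (%s w. vadd s (new_part d e (fst w) (snd w))) (map (%_. \<zero>) (snd (hd bs))) ws) [0..<d]))))"

text \<open>The group size is read off the blocks: one more than the dimension of their vectors,
  which forces a dependency. An incomplete last group is dropped.\<close>

definition chunks :: "block list \<Rightarrow> block list list" where
 "chunks bs = rev (snd (foldl (%s b. if length (fst s) = length (snd b) then ([], rev (b # fst s) # snd s) else (b # fst s, snd s)) ([], []) bs))"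

definition level_step where
 "level_step d B u tow s ch = (fst (merge_blocks d B u tow (fst s) ch), snd s @ [snd (merge_blocks d B u tow (fst s) ch)])"

definition level where
 "level d B u tow s = foldl (level_step d B u tow) (fst s, []) (chunks (snd s))"

definition init_blocks :: "nat list list list \<Rightarrow> block list" where
 "init_blocks vs = map (%z. ([(Suc (fst z), \<one>, [])], snd z)) (zip [0..<length vs] vs)"

definition run_levels where
 "run_levels d B u tow vs = foldl (%s (_ :: nat). level d B u tow s) ([], init_blocks vs) [0..<d]"

text \<open>Coordinate \<open>l\<close> of the sum \<open>U\<close> that belongs to the label
  \<open>\<tau>\<close>.\<close>

definition mval :: "nat \<Rightarrow> (nat \<Rightarrow> nat \<Rightarrow> nat list) \<Rightarrow> member list \<Rightarrow> nat list \<Rightarrow> nat \<Rightarrow> nat list" where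
 "mval d v ms \<tau> l = lsum (map (%x. fst (snd x) [^] d \<otimes> v (fst x) l) (filter (%x. snd (snd x) = \<tau>) ms))"

text \<open>The newest label entry varies slowest, as in the concatenation of parts in
  \<open>merge_blocks\<close>, so that merged vectors are again listed in this order.\<close>

primrec keys :: "nat \<Rightarrow> nat \<Rightarrow> nat \<Rightarrow> (nat list \<times> nat) list" where
 "keys d m 0 = map (%l. ([], l)) [1..<m + 1]"
| "keys d m (Suc i) = concat (map (%e. map (%\<kappa>. (e # fst \<kappa>, snd \<kappa>)) (keys d m i)) [0..<d])"

lemma length_keys: "length (keys d m i) = d ^ i * m"
proof (induction i)
 case (Suc i)
 have "length (concat (map (%e. map (h e) xs) es)) = length es * length xs" for h :: "nat \<Rightarrow> nat list \<times> nat \<Rightarrow> nat list \<times> nat" and xs es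
  by (induction es) auto
 then show ?case using Suc by (simp only: keys.simps length_upt) simp
qed simp

lemma keys_mem: "(\<tau>, l) \<in> set (keys d m i) \<longleftrightarrow> length \<tau> = i \<and> set \<tau> \<subseteq> {..<d} \<and> l \<in> {1..m}"
proof (induction i arbitrary: \<tau>)
 case (Suc i)
 have c: "(e # \<tau>', l) \<in> set (keys d m (Suc i)) \<longleftrightarrow> e < d \<and> (\<tau>', l) \<in> set (keys d m i)" for e \<tau>'
 proof
  assume "(e # \<tau>', l) \<in> set (keys d m (Suc i))"
  then obtain x \<kappa> where "x < d" "\<kappa> \<in> set (keys d m i)" "(e # \<tau>', l) = (x # fst \<kappa>, snd \<kappa>)" by auto
  then show "e < d \<and> (\<tau>', l) \<in> set (keys d m i)" by (cases \<kappa>) simp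
 next
  assume a: "e < d \<and> (\<tau>', l) \<in> set (keys d m i)"
  have "(e # \<tau>', l) \<in> set (map (%\<kappa>. (e # fst \<kappa>, snd \<kappa>)) (keys d m i))"
   unfolding set_map by (rule image_eqI[of _ _ "(\<tau>', l)"]) (use a in simp_all)
  then show "(e # \<tau>', l) \<in> set (keys d m (Suc i))" unfolding keys.simps set_concat using a by fastforce
 qed
 have n: "([], l) \<notin> set (keys d m (Suc i))" by auto
 show ?case
 proof (cases \<tau>)
  case Nil then show ?thesis using n by simp
 next
  case (Cons e \<tau>') then show ?thesis unfolding Cons c Suc by auto
 qed
qed auto

lemma chunks_props:
 assumes "\<And>b. b \<in> set bs ==> length (snd b) = n"
 shows "\<exists>rest. bs = concat (chunks bs) @ rest \<and> length rest \<le> n" "\<And>ch. ch \<in> set (chunks bs) ==> length ch = n + 1"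
proof -
 let ?f = "%bs. foldl (%s b. if length (fst s) = length (snd b) then ([], rev (b # fst s) # snd s) else (b # fst s, snd s)) ([], []) bs"
 have "bs = concat (rev (snd (?f bs))) @ rev (fst (?f bs)) \<and> length (fst (?f bs)) \<le> n \<and> (\<forall>ch\<in>set (snd (?f bs)). length ch = n + 1)"
  using assms
 proof (induction bs rule: rev_induct)
  case (snoc b bs)
  let ?s = "?f bs"
  have IH: "bs = concat (rev (snd ?s)) @ rev (fst ?s)" "length (fst ?s) \<le> n" "\<forall>ch\<in>set (snd ?s). length ch = n + 1"
   using snoc by auto
  have e: "?f (bs @ [b]) = (if length (fst ?s) = n then ([], rev (b # fst ?s) # snd ?s) else (b # fst ?s, snd ?s))"
  proof -
   have "length (snd b) = n" by (rule snoc.prems) simp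
   then show ?thesis unfolding foldl_append foldl.simps by simp
  qed
  have "bs @ [b] = (concat (rev (snd ?s)) @ rev (fst ?s)) @ [b]" by (rule arg_cong[OF IH(1), of "%x. x @ [b]"])
  also have "\<dots> = concat (rev (snd ?s)) @ rev (fst ?s) @ [b]" by (rule append_assoc)
  finally have "bs @ [b] = concat (rev (snd ?s)) @ rev (fst ?s) @ [b]" .
  then show ?case unfolding e using IH(2,3) by auto
 qed simp
 then show "\<exists>rest. bs = concat (chunks bs) @ rest \<and> length rest \<le> n" "\<And>ch. ch \<in> set (chunks bs) ==> length ch = n + 1"
  unfolding chunks_def by auto
qed

lemma chunks_count:
 assumes "\<And>b. b \<in> set bs ==> length (snd b) = n" "length bs \<ge> R * (n + 1)"
 shows "length (chunks bs) \<ge> R"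
proof -
 obtain rest where r: "bs = concat (chunks bs) @ rest" "length rest \<le> n" using chunks_props(1)[OF assms(1)] by blast
 have "length (concat (chunks bs)) = length (chunks bs) * (n + 1)"
  using chunks_props(2)[OF assms(1)] by (simp add: length_concat cong: map_cong) (simp add: sum_list_triv)
 then have "length bs \<le> length (chunks bs) * (n + 1) + n" using r by (metis add_left_mono length_append)
 then have "R * (n + 1) < (length (chunks bs) + 1) * (n + 1)" using assms(2) by simp
 then show ?thesis using mult_less_cancel2 by (metis Suc_eq_plus1 less_Suc_eq_le)
qed

lemma dec_carrier:
 assumes "set C \<subseteq> carrier F" "\<alpha> \<in> carrier F" "fst ` set tow \<subseteq> carrier F" "length C \<le> d + 1"
 shows "set (fst (dec d B u tow C \<alpha>)) \<subseteq> carrier F" "length (fst (dec d B u tow C \<alpha>)) \<le> d + 1"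
  "\<And>e g. snd (dec d B u tow C \<alpha>) = Some (e, g) ==> g \<in> carrier F \<and> e \<le> d"
  "prefix C (fst (dec d B u tow C \<alpha>))"
proof -
 show "set (fst (dec d B u tow C \<alpha>)) \<subseteq> carrier F" "length (fst (dec d B u tow C \<alpha>)) \<le> d + 1"
  "prefix C (fst (dec d B u tow C \<alpha>))"
  using assms by (auto simp: dec_def Let_def)
 have cl: "g \<in> carrier F \<and> e \<le> d" if c: "classify d B u tow C \<alpha> = Some (e, g)" for e g
 proof -
  let ?r = "find (%z. fst (sift d tow (snd z \<otimes> \<alpha> [^] (d - 1))) [^] B = \<one>) (zip [0..<length C] C)"
  obtain z where z: "?r = Some z" using c unfolding classify_def Let_def by (cases ?r) auto
  have zm: "z \<in> set (zip [0..<length C] C)" using find_SomeD(1)[OF z] .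
  then have "fst z < length C" "snd z \<in> carrier F" using assms(1) by (auto simp: set_zip subset_iff)
  then have "snd z \<otimes> \<alpha> [^] (d - 1) \<in> carrier F" using assms(2) by simp
  note S = sift_carrier[OF this assms(3)]
  show ?thesis using c z S assms(2,4) \<open>fst z < length C\<close> unfolding classify_def Let_def by auto
 qed
 show "g \<in> carrier F \<and> e \<le> d" if "snd (dec d B u tow C \<alpha>) = Some (e, g)" for e g
  using that cl assms(4) by (auto simp: dec_def Let_def split: if_splits)
qed

lemma lsum_swap:
 assumes "\<And>x y. x \<in> set xs ==> y \<in> set ys ==> h x y \<in> carrier F"
 shows "lsum (map (%x. lsum (map (h x) ys)) xs) = lsum (map (%y. lsum (map (%x. h x y) xs)) ys)"
 using assms
proof (induction xs)
 case Nil
 have "lsum (map (%y. \<zero>) ys) = \<zero>" by (rule lsum_zero) auto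
 then show ?case by simp
next
 case (Cons x xs)
 have c1: "lsum (map (%x. h x y) xs) \<in> carrier F" if "y \<in> set ys" for y
  using Cons.prems that by (intro lsum_closed) auto
 have c2: "lsum (map (h x') ys) \<in> carrier F" if "x' \<in> set (x # xs)" for x'
  by (rule lsum_closed) (use Cons.prems[OF that] in auto)
 have "lsum (map (%x. lsum (map (h x) ys)) (x # xs)) = lsum (map (h x) ys) \<oplus> lsum (map (%x. lsum (map (h x) ys)) xs)"
  unfolding list.map by (rule lsum_Cons) (use c2 in auto)
 also have "lsum (map (%x. lsum (map (h x) ys)) xs) = lsum (map (%y. lsum (map (%x. h x y) xs)) ys)"
  by (rule Cons.IH) (use Cons.prems in auto)
 also have "lsum (map (h x) ys) \<oplus> \<dots> = lsum (map (%y. h x y \<oplus> lsum (map (%x. h x y) xs)) ys)"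
  by (rule lsum_map_add[symmetric]) (use Cons.prems c1 in auto)
 also have "\<dots> = lsum (map (%y. lsum (map (%x. h x y) (x # xs))) ys)"
 proof (intro arg_cong[of _ _ lsum] map_cong refl)
  fix y assume y: "y \<in> set ys"
  show "h x y \<oplus> lsum (map (%x. h x y) xs) = lsum (map (%x. h x y) (x # xs))"
   unfolding list.map by (rule lsum_Cons[symmetric]) (use Cons.prems y in auto)
 qed
 finally show ?case .
qed

lemma lsum_delta: "e0 < n ==> x \<in> carrier F ==> lsum (map (%e. if e = e0 then x else \<zero>) [0..<n]) = x"
proof -
 assume x: "e0 < n" "x \<in> carrier F"
 have "lsum (map (%e. if e = e0 then x else \<zero>) [0..<n]) = (if e0 < n then x else \<zero>)"
  using x(2) by (induction n) (auto simp: less_Suc_eq)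
 then show ?thesis using x by simp
qed

lemma lsum_map_distrib2:
 "(\<And>x. x \<in> set xs ==> f x \<in> carrier F) ==> a \<in> carrier F ==> lsum (map f xs) \<otimes> a = lsum (map (%x. f x \<otimes> a) xs)"
proof -
 assume a: "\<And>x. x \<in> set xs ==> f x \<in> carrier F" "a \<in> carrier F"
 have "lsum (map f xs) \<in> carrier F" by (rule lsum_closed) (use a in auto)
 then have "lsum (map f xs) \<otimes> a = a \<otimes> lsum (map f xs)" using a(2) by (rule m_comm)
 also have "\<dots> = lsum (map (%x. a \<otimes> f x) xs)" by (rule lsum_map_distrib[OF a])
 also have "\<dots> = lsum (map (%x. f x \<otimes> a) xs)"
  by (intro arg_cong[of _ _ lsum] map_cong refl m_comm) (use a in auto)
 finally show ?thesis .
qed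

lemma lsum_cong: "(\<And>x. x \<in> set xs ==> f x = g x) ==> lsum (map f xs) = lsum (map g xs)"
 by (intro arg_cong[of _ _ lsum] map_cong refl)

text \<open>Each representative was refused by the test against those before it, with the tower in
  force. This is the history that \<open>overflow_progress\<close> exploits.\<close>

definition inc_list where
 "inc_list d B u tow C \<longleftrightarrow> (\<forall>j<length C. classify d B u tow (take j C) (C ! j) = None)"

definition rep_ok where
 "rep_ok d C \<alpha> o' \<longleftrightarrow> (\<exists>e g. o' = Some (e, g) \<and> e < length C \<and> g \<in> cnz \<and> \<alpha> = C ! e \<otimes> g [^] (d::nat))"

context
 fixes d :: nat and v :: "nat \<Rightarrow> nat \<Rightarrow> nat list" and m :: nat
begin

definition mem_ok :: "nat list list \<Rightarrow> nat \<Rightarrow> member list \<Rightarrow> bool" where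
 "mem_ok C i ms \<longleftrightarrow> (\<forall>x\<in>set ms. fst (snd x) \<in> cnz \<and> length (snd (snd x)) = i \<and> set (snd (snd x)) \<subseteq> {..<length C})"

text \<open>The label \<open>\<tau>\<close> ranges over all lists of length \<open>i\<close>. With
  entries outside the range of \<open>C\<close> both sides are trivial by \<open>mv_zero\<close>,
  except at the position \<open>a\<close>, which is overwritten.\<close>

definition lines :: "nat list list \<Rightarrow> nat \<Rightarrow> member list \<Rightarrow> bool" where
 "lines C i ms \<longleftrightarrow> (\<forall>a<i. \<forall>\<tau>. length \<tau> = i \<longrightarrow> (\<forall>l\<in>{1..m}. lsum (map (%e. C ! e \<otimes> mval d v ms (\<tau>[a := e]) l) [0..<length C]) = \<zero>))"

definition good :: "nat list list \<Rightarrow> nat \<Rightarrow> block \<Rightarrow> bool" where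
 "good C i b \<longleftrightarrow> fst b \<noteq> [] \<and> mem_ok C i (fst b) \<and> snd b = map (%\<kappa>. mval d v (fst b) (fst \<kappa>) (snd \<kappa>)) (keys d m i) \<and> lines C i (fst b)"

text \<open>Distributes a coefficient over the representatives: for
  \<open>\<alpha> = C ! e' \<otimes> g [^] d\<close> the sum of
  \<open>C ! e \<otimes> coef e\<close> over all \<open>e\<close> is \<open>\<alpha>\<close>, with
  the single nonzero term at \<open>e'\<close>.\<close>

definition coef :: "nat \<Rightarrow> (nat \<times> nat list) option \<Rightarrow> nat list" where
 "coef e o' = (if o' \<noteq> None \<and> fst (the o') = e then snd (the o') [^] d else \<zero>)"

definition o_ok :: "(nat \<times> nat list) option \<Rightarrow> bool" where
 "o_ok o' \<longleftrightarrow> (\<forall>e g. o' = Some (e, g) \<longrightarrow> g \<in> carrier F)"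

lemma mem_ok_carrier: "mem_ok C i ms ==> x \<in> set ms ==> fst (snd x) \<in> carrier F"
 by (auto simp: mem_ok_def)

lemma coef_closed: "o_ok o' ==> coef e o' \<in> carrier F"
 by (cases o') (auto simp: coef_def o_ok_def)

lemma mv_zero: "mem_ok C i ms ==> \<not> set \<tau> \<subseteq> {..<length C} ==> mval d v ms \<tau> l = \<zero>"
proof -
 assume a: "mem_ok C i ms" "\<not> set \<tau> \<subseteq> {..<length C}"
 then have "filter (%x. snd (snd x) = \<tau>) ms = []" unfolding filter_empty_conv mem_ok_def by blast
 then show ?thesis by (simp add: mval_def)
qed

end

lemma foldl_vadd:
 assumes "length s0 = n" "set s0 \<subseteq> carrier F" "\<And>w. w \<in> set ws ==> length (f w) = n \<and> set (f w) \<subseteq> carrier F"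
 shows "length (foldl (%s w. vadd s (f w)) s0 ws) = n \<and> (\<forall>t<n. foldl (%s w. vadd s (f w)) s0 ws ! t = s0 ! t \<oplus> lsum (map (%w. f w ! t) ws))"
 using assms(3)
proof (induction ws rule: rev_induct)
 case Nil
 have "s0 ! t \<in> carrier F" if "t < n" for t using assms that by (meson nth_mem subsetD)
 then show ?case using assms by simp
next
 case (snoc w ws)
 have c: "f w' ! t \<in> carrier F" if "w' \<in> set (ws @ [w])" "t < n" for w' t
  using snoc.prems[OF that(1)] that(2) by (metis nth_mem subsetD)
 have s0: "s0 ! t \<in> carrier F" if "t < n" for t using assms(1,2) that by (meson nth_mem subsetD)
 have l: "lsum (map (%w. f w ! t) ws) \<in> carrier F" if "t < n" for t
  by (rule lsum_closed) (use c that in auto)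
 have lw: "length (f w) = n" using snoc.prems by simp
 have fw: "f w ! t \<in> carrier F" if "t < n" for t by (rule c) (use that in auto)
 show ?case using snoc lw by (auto simp: vadd_def a_assoc s0 l fw)
qed

context
 fixes d :: nat and v :: "nat \<Rightarrow> nat \<Rightarrow> nat list" and m :: nat
 assumes v: "\<And>j l. v j l \<in> carrier F"
begin

lemma mv_terms:
 assumes "\<And>x. x \<in> set ms ==> fst (snd x) \<in> carrier F"
 shows "set (map (%x. fst (snd x) [^] d \<otimes> v (fst x) l) (filter P ms)) \<subseteq> carrier F"
 unfolding set_map image_subset_iff
proof
 fix x assume "x \<in> set (filter P ms)"
 then have "fst (snd x) \<in> carrier F" using assms by simp
 then show "fst (snd x) [^] d \<otimes> v (fst x) l \<in> carrier F" using v by (intro m_closed nat_pow_closed)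
qed

lemma mv_closed: "(\<And>x. x \<in> set ms ==> fst (snd x) \<in> carrier F) ==> mval d v ms \<tau> l \<in> carrier F"
 unfolding mval_def by (rule lsum_closed, rule mv_terms)

lemma mv_concat:
 assumes "\<And>ms x. ms \<in> set L ==> x \<in> set ms ==> fst (snd x) \<in> carrier F"
 shows "mval d v (concat L) \<tau> l = lsum (map (%ms. mval d v ms \<tau> l) L)"
 using assms
proof (induction L)
 case (Cons ms L)
 have c1: "fst (snd x) \<in> carrier F" if "x \<in> set ms" for x by (rule Cons.prems[of ms x]) (use that in simp_all)
 have c2: "fst (snd x) \<in> carrier F" if "x \<in> set (concat L)" for x
 proof -
  obtain ms' where "ms' \<in> set L" "x \<in> set ms'" using \<open>x \<in> set (concat L)\<close> unfolding set_concat by blast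
  then show ?thesis using Cons.prems[of ms' x] by simp
 qed
 have "mval d v (concat (ms # L)) \<tau> l = mval d v ms \<tau> l \<oplus> mval d v (concat L) \<tau> l"
  unfolding mval_def concat.simps filter_append map_append by (rule lsum_append; rule mv_terms; rule c1 c2; assumption)
 also have "mval d v (concat L) \<tau> l = lsum (map (%ms. mval d v ms \<tau> l) L)"
  by (rule Cons.IH) (rule Cons.prems, auto)
 also have "mval d v ms \<tau> l \<oplus> \<dots> = lsum (map (%ms. mval d v ms \<tau> l) (ms # L))"
  unfolding list.map
 proof (rule lsum_Cons[symmetric])
  show "mval d v ms \<tau> l \<in> carrier F" by (rule mv_closed) (rule c1)
  show "set (map (%ms. mval d v ms \<tau> l) L) \<subseteq> carrier F"
  proof
   fix y assume "y \<in> set (map (%ms. mval d v ms \<tau> l) L)"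
   then obtain ms' where ms': "ms' \<in> set L" "y = mval d v ms' \<tau> l" by auto
   show "y \<in> carrier F" unfolding ms'(2) by (rule mv_closed) (rule Cons.prems[of ms'], use ms'(1) in auto)
  qed
 qed
 finally show ?case .
qed (simp add: mval_def)

lemma mv_new:
 assumes "\<And>x. x \<in> set (fst b) ==> fst (snd x) \<in> carrier F" "o_ok o'"
 shows "mval d v (new_members o' b) (e # \<tau>) l = coef d e o' \<otimes> mval d v (fst b) \<tau> l"
proof (cases o')
 case None
 then show ?thesis using mv_closed[of "fst b"] assms(1) by (simp add: new_members_def coef_def mval_def)
next
 case (Some w)
 obtain e' g where w: "w = (e', g)" by fastforce
 have g: "g \<in> carrier F" using assms(2) Some w by (simp add: o_ok_def)
 show ?thesis
 proof (cases "e' = e")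
  case True
  have "filter (%x. snd (snd x) = e # \<tau>) (new_members o' b) =
   map (%x. (fst x, fst (snd x) \<otimes> g, e # snd (snd x))) (filter (%x. snd (snd x) = \<tau>) (fst b))"
   using True Some w by (simp add: new_members_def filter_map o_def)
  then have "mval d v (new_members o' b) (e # \<tau>) l =
   lsum (map (%x. (fst (snd x) \<otimes> g) [^] d \<otimes> v (fst x) l) (filter (%x. snd (snd x) = \<tau>) (fst b)))"
   by (simp add: mval_def o_def)
  also have "\<dots> = lsum (map (%x. g [^] d \<otimes> (fst (snd x) [^] d \<otimes> v (fst x) l)) (filter (%x. snd (snd x) = \<tau>) (fst b)))"
  proof (rule lsum_cong)
   fix x assume "x \<in> set (filter (%x. snd (snd x) = \<tau>) (fst b))"
   then have "fst (snd x) \<in> carrier F" using assms(1) by simp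
   then show "(fst (snd x) \<otimes> g) [^] d \<otimes> v (fst x) l = g [^] d \<otimes> (fst (snd x) [^] d \<otimes> v (fst x) l)"
    using g v[of "fst x" l] by (simp add: nat_pow_distrib m_ac)
  qed
  also have "\<dots> = g [^] d \<otimes> mval d v (fst b) \<tau> l"
   unfolding mval_def by (rule lsum_map_distrib[symmetric]) (use assms(1) g v in auto)
  finally show ?thesis using True Some w by (simp add: coef_def)
 next
  case False
  then have "filter (%x. snd (snd x) = e # \<tau>) (new_members o' b) = []"
   using Some w by (auto simp: new_members_def filter_empty_conv)
  then show ?thesis using False Some w mv_closed[of "fst b"] assms(1) by (simp add: coef_def mval_def)
 qed
qed

text \<open>A new representative adds terms for label entries that no member of the block carries,
  so the line sums only gain zeros. Blocks made earlier thus remain usable while \<open>C\<close>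
  grows.\<close>

lemma good_extend:
 assumes g: "good d v m C i b" and pre: "prefix C C'" and C': "set C' \<subseteq> carrier F"
 shows "good d v m C' i b"
proof -
 obtain C2 where C2: "C' = C @ C2" using pre by (auto simp: prefix_def)
 have mo: "mem_ok C i (fst b)" using g by (simp add: good_def)
 then have mo': "mem_ok C' i (fst b)" unfolding mem_ok_def C2 by fastforce
 have "lines d v m C' i (fst b)"
  unfolding lines_def
 proof (intro allI impI ballI)
  fix a l and \<tau> :: "nat list" assume a: "a < i" "length \<tau> = i" "l \<in> {1..m}"
  have z: "mval d v (fst b) (\<tau>[a := e]) l = \<zero>" if "e \<ge> length C" for e
   by (rule mv_zero[OF mo]) (use that a set_update_memI[of a \<tau> e] in auto)
  have c: "C' ! e \<otimes> mval d v (fst b) (\<tau>[a := e]) l \<in> carrier F" if "e < length C'" for e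
   using C' that mv_closed[OF mem_ok_carrier[OF mo]] by (intro m_closed) (auto simp: subset_iff)
  have up: "[0..<length C'] = [0..<length C] @ [length C..<length C']"
   using upt_add_eq_append[of 0 "length C" "length C2"] C2 by simp
  have "lsum (map (%e. C' ! e \<otimes> mval d v (fst b) (\<tau>[a := e]) l) [0..<length C'])
   = lsum (map (%e. C' ! e \<otimes> mval d v (fst b) (\<tau>[a := e]) l) [0..<length C]) \<oplus> lsum (map (%e. C' ! e \<otimes> mval d v (fst b) (\<tau>[a := e]) l) [length C..<length C'])"
   unfolding up map_append by (rule lsum_append) (use c C2 in auto)
  also have "lsum (map (%e. C' ! e \<otimes> mval d v (fst b) (\<tau>[a := e]) l) [length C..<length C']) = \<zero>"
  proof (rule lsum_zero)
   fix x assume "x \<in> set (map (%e. C' ! e \<otimes> mval d v (fst b) (\<tau>[a := e]) l) [length C..<length C'])"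
   then obtain e where e: "length C \<le> e" "e < length C'" "x = C' ! e \<otimes> mval d v (fst b) (\<tau>[a := e]) l" by auto
   have "C' ! e \<in> carrier F" using C' e(2) by auto
   then show "x = \<zero>" using e z by simp
  qed
  also have "lsum (map (%e. C' ! e \<otimes> mval d v (fst b) (\<tau>[a := e]) l) [0..<length C]) = lsum (map (%e. C ! e \<otimes> mval d v (fst b) (\<tau>[a := e]) l) [0..<length C])"
   by (rule lsum_cong) (simp add: C2 nth_append)
  also have "\<dots> = \<zero>" using g a by (simp add: good_def lines_def)
  finally show "lsum (map (%e. C' ! e \<otimes> mval d v (fst b) (\<tau>[a := e]) l) [0..<length C']) = \<zero>" by simp
 qed
 then show ?thesis using g mo' by (simp add: good_def)
qed

end

context
 fixes d B u s :: nat and tow :: "(nat list \<times> nat) list"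
 assumes tow: "fst ` set tow \<subseteq> cnz" and d: "d > 0" and us: "u * d + 1 = B * s"
begin

text \<open>A final length of at most \<open>d\<close> excludes the placeholder answer. What remains
  is a classified coefficient, or a coefficient that has become its own representative with factor
  1.\<close>

lemma dec_ok:
 assumes C: "set C \<subseteq> cnz" and \<alpha>: "\<alpha> \<in> carrier F" and inc: "inc_list d B u tow C"
 shows "set (fst (dec d B u tow C \<alpha>)) \<subseteq> cnz" "inc_list d B u tow (fst (dec d B u tow C \<alpha>))"
  "prefix C (fst (dec d B u tow C \<alpha>))" "snd (dec d B u tow C \<alpha>) = None \<longleftrightarrow> \<alpha> = \<zero>"
  "length (fst (dec d B u tow C \<alpha>)) \<le> d ==> \<alpha> \<noteq> \<zero> ==> rep_ok d (fst (dec d B u tow C \<alpha>)) \<alpha> (snd (dec d B u tow C \<alpha>))"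
proof -
 show "set (fst (dec d B u tow C \<alpha>)) \<subseteq> cnz" using C \<alpha> by (simp add: dec_def Let_def)
 have "inc_list d B u tow (C @ [\<alpha>])" if "classify d B u tow C \<alpha> = None"
  using inc that by (simp add: inc_list_def nth_append less_Suc_eq)
 then show "inc_list d B u tow (fst (dec d B u tow C \<alpha>))"
  by (cases "classify d B u tow C \<alpha> = None") (simp_all add: dec_def Let_def inc)
 show "prefix C (fst (dec d B u tow C \<alpha>))" by (simp add: dec_def Let_def)
 show "snd (dec d B u tow C \<alpha>) = None \<longleftrightarrow> \<alpha> = \<zero>" by (simp add: dec_def Let_def)
 show "rep_ok d (fst (dec d B u tow C \<alpha>)) \<alpha> (snd (dec d B u tow C \<alpha>))"
  if l: "length (fst (dec d B u tow C \<alpha>)) \<le> d" and a: "\<alpha> \<noteq> \<zero>"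
 proof (cases "classify d B u tow C \<alpha>")
  case None
  then have e: "dec d B u tow C \<alpha> = (C @ [\<alpha>], Some (length C, \<one>))" using l a by (auto simp: dec_def Let_def split: if_splits)
  show ?thesis unfolding e rep_ok_def using \<alpha> by simp
 next
  case (Some w)
  obtain e g where w: "w = (e, g)" by fastforce
  have e: "dec d B u tow C \<alpha> = (C, Some (e, g))" using a Some w by (simp add: dec_def)
  have "\<alpha> \<in> cnz" using \<alpha> a by simp
  from classify_sound[OF tow C this d us Some[unfolded w]] show ?thesis unfolding e rep_ok_def by simp
 qed
qed

lemma rep_ok_prefix: "rep_ok d C \<alpha> o' ==> prefix C C' ==> rep_ok d C' \<alpha> o'"
 unfolding rep_ok_def prefix_def by (auto simp: nth_append)

lemma decs_ok:
 assumes C: "set C \<subseteq> cnz" and \<alpha>s: "set \<alpha>s \<subseteq> carrier F" and inc: "inc_list d B u tow C"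
 shows "set (fst (decs d B u tow C \<alpha>s)) \<subseteq> cnz \<and> inc_list d B u tow (fst (decs d B u tow C \<alpha>s)) \<and>
  prefix C (fst (decs d B u tow C \<alpha>s)) \<and> length (snd (decs d B u tow C \<alpha>s)) = length \<alpha>s \<and>
  (\<forall>t<length \<alpha>s. (snd (decs d B u tow C \<alpha>s) ! t = None \<longleftrightarrow> \<alpha>s ! t = \<zero>) \<and>
   (length (fst (decs d B u tow C \<alpha>s)) \<le> d \<longrightarrow> \<alpha>s ! t \<noteq> \<zero> \<longrightarrow>
     rep_ok d (fst (decs d B u tow C \<alpha>s)) (\<alpha>s ! t) (snd (decs d B u tow C \<alpha>s) ! t)))"
 using \<alpha>s
proof (induction \<alpha>s rule: rev_induct)
 case Nil then show ?case using C inc by (simp add: decs_def)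
next
 case (snoc \<alpha> \<alpha>s)
 let ?z = "decs d B u tow C \<alpha>s"
 let ?w = "dec d B u tow (fst ?z) \<alpha>"
 have e: "decs d B u tow C (\<alpha>s @ [\<alpha>]) = (fst ?w, snd ?z @ [snd ?w])" by (simp add: decs_def)
 have IH: "set (fst ?z) \<subseteq> cnz" "inc_list d B u tow (fst ?z)" "prefix C (fst ?z)" "length (snd ?z) = length \<alpha>s"
  "\<And>t. t < length \<alpha>s ==> (snd ?z ! t = None \<longleftrightarrow> \<alpha>s ! t = \<zero>)"
  "\<And>t. t < length \<alpha>s ==> length (fst ?z) \<le> d ==> \<alpha>s ! t \<noteq> \<zero> ==> rep_ok d (fst ?z) (\<alpha>s ! t) (snd ?z ! t)"
  using snoc by auto
 have "\<alpha> \<in> carrier F" using snoc.prems by simp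
 note D = dec_ok[OF IH(1) this IH(2)]
 have len: "length (fst ?z) \<le> length (fst ?w)" using D(3) by (rule prefix_length_le)
 show ?case unfolding e fst_conv snd_conv
 proof (intro conjI allI impI)
  show "prefix C (fst ?w)" using IH(3) D(3) by (rule prefix_order.trans)
  show "length (snd ?z @ [snd ?w]) = length (\<alpha>s @ [\<alpha>])" using IH(4) by simp
  fix t assume t: "t < length (\<alpha>s @ [\<alpha>])"
  show "((snd ?z @ [snd ?w]) ! t = None) = ((\<alpha>s @ [\<alpha>]) ! t = \<zero>)"
  proof (cases "t < length \<alpha>s")
   case True
   then show ?thesis using IH(4) IH(5)[OF True] by (simp add: nth_append)
  next
   case False
   then have "t = length \<alpha>s" using t by simp
   then show ?thesis using D(4) IH(4) by (simp add: nth_append)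
  qed
  assume l: "length (fst ?w) \<le> d" "(\<alpha>s @ [\<alpha>]) ! t \<noteq> \<zero>"
  show "rep_ok d (fst ?w) ((\<alpha>s @ [\<alpha>]) ! t) ((snd ?z @ [snd ?w]) ! t)"
  proof (cases "t < length \<alpha>s")
   case True
   then have "rep_ok d (fst ?z) (\<alpha>s ! t) (snd ?z ! t)" using IH(6)[OF True] l len by (simp add: nth_append)
   from rep_ok_prefix[OF this D(3)] show ?thesis using True IH(4) by (simp add: nth_append)
  next
   case False
   then have "t = length \<alpha>s" using t by simp
   then show ?thesis using D(5) l IH(4) by (simp add: nth_append)
  qed
 qed (use D in auto)
qed

end

end

section \<open>Invariants of the merging rounds\<close>

text \<open>The input indices in use, in block order. They always form a subsequence of the initial
  range; this keeps them distinct and increasing, and it bounds the total number of members.\<close>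

definition jlist :: "block list \<Rightarrow> nat list" where
 "jlist bs = concat (map (%b. map fst (fst b)) bs)"

context expl
begin

text \<open>The part of the block invariant that survives an overflow of \<open>C\<close>. It
  permits label entries up to \<open>d\<close> and says nothing about sums, which suffices for
  counting blocks and bounding sizes.\<close>

definition shape :: "nat \<Rightarrow> nat \<Rightarrow> nat \<Rightarrow> block \<Rightarrow> bool" where
 "shape d m i b \<longleftrightarrow> length (snd b) = d ^ i * m \<and> set (snd b) \<subseteq> carrier F \<and>
   (\<forall>x\<in>set (fst b). fst (snd x) \<in> carrier F \<and> length (snd (snd x)) = i \<and> set (snd (snd x)) \<subseteq> {..d})"

lemma decs_carrier:
 assumes "set C \<subseteq> carrier F" "set \<alpha>s \<subseteq> carrier F" "fst ` set tow \<subseteq> carrier F" "length C \<le> d + 1"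
 shows "set (fst (decs d B u tow C \<alpha>s)) \<subseteq> carrier F \<and> length (fst (decs d B u tow C \<alpha>s)) \<le> d + 1 \<and>
  length (snd (decs d B u tow C \<alpha>s)) = length \<alpha>s \<and> prefix C (fst (decs d B u tow C \<alpha>s)) \<and>
  (\<forall>o'\<in>set (snd (decs d B u tow C \<alpha>s)). \<forall>e g. o' = Some (e, g) \<longrightarrow> g \<in> carrier F \<and> e \<le> d)"
 using assms(2)
proof (induction \<alpha>s rule: rev_induct)
 case Nil then show ?case using assms by (simp add: decs_def)
next
 case (snoc \<alpha> \<alpha>s)
 let ?z = "decs d B u tow C \<alpha>s"
 have e: "decs d B u tow C (\<alpha>s @ [\<alpha>]) = (fst (dec d B u tow (fst ?z) \<alpha>), snd ?z @ [snd (dec d B u tow (fst ?z) \<alpha>)])" by (simp add: decs_def)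
 have s: "set \<alpha>s \<subseteq> carrier F" "\<alpha> \<in> carrier F" using snoc.prems by auto
 note IH = snoc.IH[OF s(1)]
 have 1: "set (fst ?z) \<subseteq> carrier F" "length (fst ?z) \<le> d + 1" "prefix C (fst ?z)" using IH by blast+
 note D = dec_carrier[OF 1(1) s(2) assms(3) 1(2)]
 have 2: "prefix C (fst (dec d B u tow (fst ?z) \<alpha>))" by (rule prefix_order.trans[OF 1(3) D(4)])
 show ?case unfolding e fst_conv snd_conv using IH D(1,2,3) 2 by auto
qed

lemma new_part_eq:
 assumes "set (snd b) \<subseteq> carrier F" "o_ok o'"
 shows "new_part d e o' b = map (%x. coef d e o' \<otimes> x) (snd b)"
proof -
 have z: "map (%_. \<zero>) (snd b) = map (%x. \<zero> \<otimes> x) (snd b)"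
  by (rule map_cong[OF refl]) (use assms(1) in auto)
 show ?thesis by (cases o') (simp_all add: new_part_def coef_def z)
qed

lemma merge_vec:
 assumes bs: "\<And>b. b \<in> set bs ==> length (snd b) = M \<and> set (snd b) \<subseteq> carrier F" and os: "\<And>o'. o' \<in> set os ==> o_ok o'"
  and ne: "bs \<noteq> []"
 shows "foldl (%s w. vadd s (new_part d e (fst w) (snd w))) (map (%_. \<zero>) (snd (hd bs))) (zip os bs)
  = map (%t. lsum (map (%w. coef d e (fst w) \<otimes> snd (snd w) ! t) (zip os bs))) [0..<M]"
proof -
 let ?f = "%w. new_part d e (fst w) (snd w)"
 have hb: "length (snd (hd bs)) = M" using bs[OF hd_in_set[OF ne]] by (rule conjunct1)
 have w: "snd w \<in> set bs" "fst w \<in> set os" if "w \<in> set (zip os bs)" for w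
  using that unfolding in_set_zip by (metis nth_mem)+
 have np: "?f w = map (%x. coef d e (fst w) \<otimes> x) (snd (snd w))" if "w \<in> set (zip os bs)" for w
  by (rule new_part_eq) (use bs[OF w(1)[OF that]] os[OF w(2)[OF that]] in auto)
 have fl: "length (?f w) = M \<and> set (?f w) \<subseteq> carrier F" if "w \<in> set (zip os bs)" for w
  unfolding np[OF that] using bs[OF w(1)[OF that]] coef_closed[OF os[OF w(2)[OF that]]] by auto
 have z: "length (map (%_. \<zero>) (snd (hd bs))) = M" "set (map (%_. \<zero>) (snd (hd bs))) \<subseteq> carrier F" using hb by auto
 have FV: "length (foldl (%s w. vadd s (?f w)) (map (%_. \<zero>) (snd (hd bs))) (zip os bs)) = M \<and>
  (\<forall>t<M. foldl (%s w. vadd s (?f w)) (map (%_. \<zero>) (snd (hd bs))) (zip os bs) ! t =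
   map (%_. \<zero>) (snd (hd bs)) ! t \<oplus> lsum (map (%w. ?f w ! t) (zip os bs)))"
  by (rule foldl_vadd[OF z]) (rule fl)
 show ?thesis
 proof (rule nth_equalityI)
  show "length (foldl (%s w. vadd s (?f w)) (map (%_. \<zero>) (snd (hd bs))) (zip os bs)) = length (map (%t. lsum (map (%w. coef d e (fst w) \<otimes> snd (snd w) ! t) (zip os bs))) [0..<M])"
   using FV by simp
  fix t assume "t < length (foldl (%s w. vadd s (?f w)) (map (%_. \<zero>) (snd (hd bs))) (zip os bs))"
  then have t: "t < M" using FV by simp
  have cl: "lsum (map (%w. ?f w ! t) (zip os bs)) \<in> carrier F"
  proof (rule lsum_closed, rule)
   fix y assume "y \<in> set (map (%w. ?f w ! t) (zip os bs))"
   then obtain w where "w \<in> set (zip os bs)" "y = ?f w ! t" by auto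
   then show "y \<in> carrier F" using fl[of w] t nth_mem[of t "?f w"] by auto
  qed
  have "foldl (%s w. vadd s (?f w)) (map (%_. \<zero>) (snd (hd bs))) (zip os bs) ! t = \<zero> \<oplus> lsum (map (%w. ?f w ! t) (zip os bs))"
   using FV t hb by simp
  also have "\<dots> = lsum (map (%w. ?f w ! t) (zip os bs))" using cl by simp
  also have "\<dots> = lsum (map (%w. coef d e (fst w) \<otimes> snd (snd w) ! t) (zip os bs))"
  proof (rule lsum_cong)
   fix w assume w': "w \<in> set (zip os bs)"
   show "?f w ! t = coef d e (fst w) \<otimes> snd (snd w) ! t" unfolding np[OF w'] using bs[OF w(1)[OF w']] t by simp
  qed
  finally show "foldl (%s w. vadd s (?f w)) (map (%_. \<zero>) (snd (hd bs))) (zip os bs) ! t =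
    map (%t. lsum (map (%w. coef d e (fst w) \<otimes> snd (snd w) ! t) (zip os bs))) [0..<M] ! t" using t by simp
 qed
qed

lemma merge_shape:
 assumes C: "set C \<subseteq> carrier F" "length C \<le> d + 1" and tow: "fst ` set tow \<subseteq> carrier F"
  and bs: "\<And>b. b \<in> set bs ==> shape d m i b" and len: "length bs = d ^ i * m + 1"
 shows "set (fst (merge_blocks d B u tow C bs)) \<subseteq> carrier F" "length (fst (merge_blocks d B u tow C bs)) \<le> d + 1"
  "prefix C (fst (merge_blocks d B u tow C bs))" "shape d m (Suc i) (snd (merge_blocks d B u tow C bs))"
  "length (nullvec (map snd bs)) = length bs" "set (nullvec (map snd bs)) \<subseteq> carrier F"
proof -
 let ?M = "d ^ i * m"
 let ?\<alpha>s = "nullvec (map snd bs)"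
 have vs: "length v = ?M \<and> set v \<subseteq> carrier F" if vv: "v \<in> set (map snd bs)" for v
  proof -
  obtain b where b: "b \<in> set bs" "v = snd b" using vv unfolding set_map by blast
  show ?thesis using bs[OF b(1)] unfolding shape_def b(2) by blast
 qed
 have l: "?M < length (map snd bs)" using len by simp
 show al: "length ?\<alpha>s = length bs" "set ?\<alpha>s \<subseteq> carrier F" using nullvec(1,2)[OF vs l] by simp_all
 let ?z = "decs d B u tow C ?\<alpha>s"
 note D = decs_carrier[OF C(1) al(2) tow C(2)]
 have e: "merge_blocks d B u tow C bs = (fst ?z, (concat (map (%w. new_members (fst w) (snd w)) (zip (snd ?z) bs)),
   concat (map (%e. foldl (%s w. vadd s (new_part d e (fst w) (snd w))) (map (%_. \<zero>) (snd (hd bs))) (zip (snd ?z) bs)) [0..<d])))"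
  by (simp add: merge_blocks_def Let_def)
 show "set (fst (merge_blocks d B u tow C bs)) \<subseteq> carrier F" "length (fst (merge_blocks d B u tow C bs)) \<le> d + 1"
  "prefix C (fst (merge_blocks d B u tow C bs))" unfolding e fst_conv using D by blast+
 have os: "o_ok o'" if "o' \<in> set (snd ?z)" for o' using D that unfolding o_ok_def by blast
 have bs': "length (snd b) = ?M \<and> set (snd b) \<subseteq> carrier F" if "b \<in> set bs" for b using bs[OF that] by (simp add: shape_def)
 have ne: "bs \<noteq> []" using len by auto
 have wz: "snd w \<in> set bs" "fst w \<in> set (snd ?z)" if "w \<in> set (zip (snd ?z) bs)" for w
  using that unfolding in_set_zip by (metis nth_mem)+
 let ?row = "%e. map (%t. lsum (map (%w. coef d e (fst w) \<otimes> snd (snd w) ! t) (zip (snd ?z) bs))) [0..<?M]"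
 have vec: "snd (snd (merge_blocks d B u tow C bs)) = concat (map ?row [0..<d])"
 proof -
  have "foldl (%s w. vadd s (new_part d e (fst w) (snd w))) (map (%_. \<zero>) (snd (hd bs))) (zip (snd ?z) bs) = ?row e" for e
   by (rule merge_vec[OF _ _ ne]) (rule bs', assumption, rule os, assumption)
  then show ?thesis unfolding e snd_conv by simp
 qed
 have "length (concat (map ?row es)) = length es * ?M" for es by (induction es) auto
 then have 1: "length (snd (snd (merge_blocks d B u tow C bs))) = d ^ Suc i * m" unfolding vec by simp
 have "lsum (map (%w. coef d e (fst w) \<otimes> snd (snd w) ! t) (zip (snd ?z) bs)) \<in> carrier F" if "t < ?M" for e t
 proof (rule lsum_closed, rule)
  fix y assume "y \<in> set (map (%w. coef d e (fst w) \<otimes> snd (snd w) ! t) (zip (snd ?z) bs))"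
  then obtain w where w: "w \<in> set (zip (snd ?z) bs)" "y = coef d e (fst w) \<otimes> snd (snd w) ! t" by auto
  have "snd (snd w) ! t \<in> carrier F" using bs'[OF wz(1)[OF w(1)]] that nth_mem[of t "snd (snd w)"] by auto
  then show "y \<in> carrier F" unfolding w(2) using coef_closed[OF os[OF wz(2)[OF w(1)]]] by simp
 qed
 then have 2: "set (snd (snd (merge_blocks d B u tow C bs))) \<subseteq> carrier F" unfolding vec by auto
 have 3: "\<forall>x\<in>set (fst (snd (merge_blocks d B u tow C bs))). fst (snd x) \<in> carrier F \<and> length (snd (snd x)) = Suc i \<and> set (snd (snd x)) \<subseteq> {..d}"
 proof
  fix x assume "x \<in> set (fst (snd (merge_blocks d B u tow C bs)))"
  then obtain w where w: "w \<in> set (zip (snd ?z) bs)" "x \<in> set (new_members (fst w) (snd w))" unfolding e by auto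
  then obtain e' g y where g: "fst w = Some (e', g)" "y \<in> set (fst (snd w))" "x = (fst y, fst (snd y) \<otimes> g, e' # snd (snd y))"
   unfolding new_members_def by (cases "fst w") auto
  have "g \<in> carrier F \<and> e' \<le> d" using D wz(2)[OF w(1)] g(1) by metis
  moreover have "fst (snd y) \<in> carrier F \<and> length (snd (snd y)) = i \<and> set (snd (snd y)) \<subseteq> {..d}"
   using bs[OF wz(1)[OF w(1)]] g(2) unfolding shape_def by blast
  ultimately show "fst (snd x) \<in> carrier F \<and> length (snd (snd x)) = Suc i \<and> set (snd (snd x)) \<subseteq> {..d}" unfolding g(3) by simp
 qed
 show "shape d m (Suc i) (snd (merge_blocks d B u tow C bs))" unfolding shape_def using 1 2 3 by blast
qed

lemma merge_subseq:
 assumes "length (nullvec (map snd bs)) = length bs"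
 shows "subseq (map fst (fst (snd (merge_blocks d B u tow C bs)))) (jlist bs)"
proof -
 have len: "length (snd (decs d B u tow C \<alpha>s)) = length \<alpha>s" for \<alpha>s
  by (induction \<alpha>s rule: rev_induct) (simp_all add: decs_def)
 have "subseq (map fst (concat (map (%w. new_members (fst w) (snd w)) (zip os bs)))) (jlist bs)" if "length os = length bs" for os
  using that
 proof (induction os bs rule: list_induct2)
  case (Cons o' os b bs)
  have "subseq (map fst (new_members o' b)) (map fst (fst b))"
  proof (cases o')
   case (Some w)
   have "map fst (new_members o' b) = map fst (fst b)" unfolding Some new_members_def by simp
   then show ?thesis by simp
  qed (simp add: new_members_def)
  then show ?case using Cons.IH by (simp add: jlist_def list_emb_append_mono)
 qed (simp add: jlist_def)
 from this[of "snd (decs d B u tow C (nullvec (map snd bs)))"] show ?thesis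
  using len[of "nullvec (map snd bs)"] assms by (simp add: merge_blocks_def Let_def)
qed

context
 fixes d B u s :: nat and tow :: "(nat list \<times> nat) list" and v :: "nat \<Rightarrow> nat \<Rightarrow> nat list" and m :: nat
 assumes tow: "fst ` set tow \<subseteq> cnz" and d: "d > 0" and us: "u * d + 1 = B * s" and v: "\<And>j l. v j l \<in> carrier F"
begin

text \<open>At the new first position the line sum over \<open>e\<close> reassembles each
  coefficient of the dependency from its representative, and what is left is the dependency itself.
  At an older position the factor \<open>coef\<close> for the fixed first entry comes out, and each
  merged block contributes its own line. Some coefficient is nonzero, so the new block has
  members.\<close>

lemma merge_good:
 assumes C: "set C \<subseteq> cnz" and inc: "inc_list d B u tow C"
  and bs: "\<And>b. b \<in> set bs ==> good d v m C i b" and len: "length bs = d ^ i * m + 1"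
  and le: "length (fst (merge_blocks d B u tow C bs)) \<le> d"
 shows "good d v m (fst (merge_blocks d B u tow C bs)) (Suc i) (snd (merge_blocks d B u tow C bs))"
proof -
 let ?M = "d ^ i * m"
 let ?mv = "mval d v"
 define \<alpha>s where "\<alpha>s = nullvec (map snd bs)"
 define z where "z = decs d B u tow C \<alpha>s"
 define C' where "C' = fst z"
 define os where "os = snd z"
 define ws where "ws = zip os bs"
 define ms where "ms = concat (map (%w. new_members (fst w) (snd w)) ws)"
 have e: "merge_blocks d B u tow C bs = (C', (ms,
   concat (map (%e. foldl (%s w. vadd s (new_part d e (fst w) (snd w))) (map (%_. \<zero>) (snd (hd bs))) ws) [0..<d])))"
  by (simp add: merge_blocks_def Let_def \<alpha>s_def z_def C'_def os_def ws_def ms_def)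
 have le': "length C' \<le> d" using le unfolding e by simp
 have bsM: "length x = ?M \<and> set x \<subseteq> carrier F" if xx: "x \<in> set (map snd bs)" for x
 proof -
  obtain b where b: "b \<in> set bs" "x = snd b" using xx unfolding set_map by blast
  have mo: "mem_ok C i (fst b)" and vec: "snd b = map (%\<kappa>. ?mv (fst b) (fst \<kappa>) (snd \<kappa>)) (keys d m i)"
   using bs[OF b(1)] unfolding good_def by blast+
  have "?mv (fst b) \<tau> l \<in> carrier F" for \<tau> l by (rule mv_closed[OF v]) (rule mem_ok_carrier[OF mo])
  then show ?thesis unfolding b(2) vec by (auto simp: length_keys)
 qed
 have lM: "?M < length (map snd bs)" using len by simp
 note nv = nullvec[OF bsM lM, folded \<alpha>s_def]
 have al: "length \<alpha>s = length bs" "set \<alpha>s \<subseteq> carrier F" using nv(1,2) by simp_all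
 note D = decs_ok[OF tow d us C al(2) inc, folded z_def]
 have C': "set C' \<subseteq> cnz" "prefix C C'" "length os = length bs" using D al(1) unfolding C'_def os_def by auto
 have onone: "os ! t = None \<longleftrightarrow> \<alpha>s ! t = \<zero>" and orep: "\<alpha>s ! t \<noteq> \<zero> ==> rep_ok d C' (\<alpha>s ! t) (os ! t)" if "t < length bs" for t
  using D le' that al(1) unfolding C'_def os_def by auto
 have C'c: "C' ! e \<in> carrier F" if "e < length C'" for e using C'(1) nth_mem[OF that] by blast
 have good': "good d v m C' i b" if "b \<in> set bs" for b
  by (rule good_extend[OF v bs[OF that] C'(2)]) (use C'(1) in auto)
 have mo: "mem_ok C' i (fst b)" if "b \<in> set bs" for b using good'[OF that] by (simp add: good_def)
 have wt: "\<exists>t<length bs. w = (os ! t, bs ! t)" if "w \<in> set ws" for w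
  using that C'(3) unfolding ws_def by (auto simp: set_zip)
 have wb: "snd w \<in> set bs" if "w \<in> set ws" for w using wt[OF that] by auto
 have wo: "fst w = None \<or> (\<exists>e g. fst w = Some (e, g) \<and> e < length C' \<and> g \<in> cnz)" if w: "w \<in> set ws" for w
 proof -
  obtain t where t: "t < length bs" "w = (os ! t, bs ! t)" using wt[OF w] by blast
  show ?thesis using onone[OF t(1)] orep[OF t(1)] unfolding rep_ok_def t(2) by auto
 qed
 have ook: "o_ok (fst w)" if "w \<in> set ws" for w using wo[OF that] unfolding o_ok_def by auto
 have bc: "fst (snd x) \<in> carrier F" if "w \<in> set ws" "x \<in> set (fst (snd w))" for w x
  by (rule mem_ok_carrier[OF mo[OF wb[OF that(1)]] that(2)])
 have mvc: "?mv (fst (snd w)) \<tau> l \<in> carrier F" if "w \<in> set ws" for w \<tau> l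
  by (rule mv_closed[OF v]) (rule bc[OF that])
 have cc: "coef d e (fst w) \<in> carrier F" if "w \<in> set ws" for w e by (rule coef_closed[OF ook[OF that]])
 have nmem: "\<exists>e g y. fst w = Some (e, g) \<and> e < length C' \<and> g \<in> cnz \<and> y \<in> set (fst (snd w)) \<and> x = (fst y, fst (snd y) \<otimes> g, e # snd (snd y))"
  if w: "w \<in> set ws" and x: "x \<in> set (new_members (fst w) (snd w))" for w x
 proof -
  have "fst w \<noteq> None"
  proof
   assume "fst w = None"
   then show False using x by (simp add: new_members_def)
  qed
  then obtain e g where g: "fst w = Some (e, g)" "e < length C'" "g \<in> cnz" using wo[OF w] by metis
  obtain y where "y \<in> set (fst (snd w))" "x = (fst y, fst (snd y) \<otimes> g, e # snd (snd y))"
   using x unfolding g(1) new_members_def by (auto simp del: split_paired_All split_paired_Ex)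
  then show ?thesis using g by blast
 qed
 have newok: "fst (snd x) \<in> cnz \<and> length (snd (snd x)) = Suc i \<and> set (snd (snd x)) \<subseteq> {..<length C'}"
  if w: "w \<in> set ws" and x: "x \<in> set (new_members (fst w) (snd w))" for w x
 proof -
  obtain e g y where g: "fst w = Some (e, g)" "e < length C'" "g \<in> cnz" "y \<in> set (fst (snd w))" "x = (fst y, fst (snd y) \<otimes> g, e # snd (snd y))"
   using nmem[OF w x] by blast
  have y: "fst (snd y) \<in> cnz" "length (snd (snd y)) = i" "set (snd (snd y)) \<subseteq> {..<length C'}"
   using mo[OF wb[OF w]] g(4) unfolding mem_ok_def by blast+
  show ?thesis unfolding g(5) fst_conv snd_conv using nz_mult[OF y(1) g(3)] y(2,3) g(2) by simp
 qed
 have mem: "mem_ok C' (Suc i) ms" unfolding mem_ok_def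
 proof
  fix x assume "x \<in> set ms"
  then obtain w where "w \<in> set ws" "x \<in> set (new_members (fst w) (snd w))" unfolding ms_def by auto
  then show "fst (snd x) \<in> cnz \<and> length (snd (snd x)) = Suc i \<and> set (snd (snd x)) \<subseteq> {..<length C'}" by (rule newok)
 qed
 have mvms: "?mv ms (e # \<tau>) l = lsum (map (%w. coef d e (fst w) \<otimes> ?mv (fst (snd w)) \<tau> l) ws)" for e \<tau> l
 proof -
  have "?mv ms (e # \<tau>) l = lsum (map (%ms. ?mv ms (e # \<tau>) l) (map (%w. new_members (fst w) (snd w)) ws))"
   unfolding ms_def
  proof (rule mv_concat[OF v])
   fix n x assume "n \<in> set (map (%w. new_members (fst w) (snd w)) ws)" "x \<in> set n"
   then obtain w where "w \<in> set ws" "x \<in> set (new_members (fst w) (snd w))" by auto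
   from newok[OF this] show "fst (snd x) \<in> carrier F" by simp
  qed
  also have "\<dots> = lsum (map (%w. ?mv (new_members (fst w) (snd w)) (e # \<tau>) l) ws)" by (simp add: o_def)
  also have "\<dots> = lsum (map (%w. coef d e (fst w) \<otimes> ?mv (fst (snd w)) \<tau> l) ws)"
   by (rule lsum_cong, rule mv_new[OF v]) (rule bc, assumption, assumption, rule ook)
  finally show ?thesis .
 qed
 have bvec: "snd b = map (%\<kappa>. ?mv (fst b) (fst \<kappa>) (snd \<kappa>)) (keys d m i)" if "b \<in> set bs" for b
  using bs[OF that] by (simp add: good_def)
 have bnth: "snd b ! t = ?mv (fst b) (fst (keys d m i ! t)) (snd (keys d m i ! t))" if "b \<in> set bs" "t < ?M" for b t
  using that(2) by (simp add: bvec[OF that(1)] length_keys)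
 have ne: "bs \<noteq> []" using len by auto
 have vec: "snd (snd (merge_blocks d B u tow C bs)) = map (%\<kappa>. ?mv ms (fst \<kappa>) (snd \<kappa>)) (keys d m (Suc i))"
 proof -
  have row: "foldl (%s w. vadd s (new_part d e (fst w) (snd w))) (map (%_. \<zero>) (snd (hd bs))) ws
   = map (%\<kappa>. ?mv ms (e # fst \<kappa>) (snd \<kappa>)) (keys d m i)" for e
  proof -
   have osok: "o_ok o'" if o': "o' \<in> set os" for o'
   proof -
    obtain t where t: "t < length os" "o' = os ! t" using o' by (metis in_set_conv_nth)
    have "(os ! t, bs ! t) \<in> set ws" unfolding ws_def in_set_zip using t C'(3) by auto
    from ook[OF this] show ?thesis using t by simp
   qed
   have bs'': "length (snd b) = ?M \<and> set (snd b) \<subseteq> carrier F" if "b \<in> set bs" for b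
    by (rule bsM) (use that in simp)
   have "foldl (%s w. vadd s (new_part d e (fst w) (snd w))) (map (%_. \<zero>) (snd (hd bs))) ws
    = map (%t. lsum (map (%w. coef d e (fst w) \<otimes> snd (snd w) ! t) ws)) [0..<?M]"
    unfolding ws_def by (rule merge_vec[OF bs'' osok ne])
   also have "\<dots> = map (%t. ?mv ms (e # fst (keys d m i ! t)) (snd (keys d m i ! t))) [0..<?M]"
   proof (rule map_cong[OF refl])
    fix t assume t: "t \<in> set [0..<?M]"
    show "lsum (map (%w. coef d e (fst w) \<otimes> snd (snd w) ! t) ws) = ?mv ms (e # fst (keys d m i ! t)) (snd (keys d m i ! t))"
     unfolding mvms by (rule lsum_cong) (use bnth[OF wb] t in simp)
   qed
   also have "\<dots> = map (%\<kappa>. ?mv ms (e # fst \<kappa>) (snd \<kappa>)) (keys d m i)"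
    by (rule nth_equalityI) (simp_all add: length_keys)
   finally show ?thesis .
  qed
  show ?thesis unfolding e snd_conv row keys.simps map_concat map_map by (simp add: o_def)
 qed
 have null: "lsum (map (%w. f w \<otimes> ?mv (fst (snd w)) \<tau> l) ws) = \<zero>"
  if f: "\<And>t. t < length bs ==> f (os ! t, bs ! t) = \<alpha>s ! t" and \<tau>: "length \<tau> = i" "l \<in> {1..m}" for f \<tau> l
 proof (cases "set \<tau> \<subseteq> {..<d}")
  case True
  then have "(\<tau>, l) \<in> set (keys d m i)" using keys_mem \<tau> by blast
  then obtain t0 where t0: "t0 < ?M" "keys d m i ! t0 = (\<tau>, l)" unfolding in_set_conv_nth length_keys by blast
  have ws: "ws = map (%t. (os ! t, bs ! t)) [0..<length bs]" unfolding ws_def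
   by (rule nth_equalityI) (use C'(3) in auto)
  have "lsum (map (%w. f w \<otimes> ?mv (fst (snd w)) \<tau> l) ws) = lsum (map (%t. \<alpha>s ! t \<otimes> map snd bs ! t ! t0) [0..<length bs])"
   unfolding ws map_map
  proof (rule lsum_cong)
   fix t assume "t \<in> set [0..<length bs]"
   then have t: "t < length bs" by simp
   show "((%w. f w \<otimes> ?mv (fst (snd w)) \<tau> l) \<circ> (%t. (os ! t, bs ! t))) t = \<alpha>s ! t \<otimes> map snd bs ! t ! t0"
    using f[OF t] bnth[OF nth_mem[OF t] t0(1)] t0(2) t by simp
  qed
  also have "\<dots> = dot (map snd bs) \<alpha>s t0" by (simp add: dot_def)
  also have "\<dots> = \<zero>" by (rule nv(4)[OF _ t0(1)])
  finally show ?thesis .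
 next
  \<comment> \<open>Such a label has no coordinate in the block vectors, so the dependency says
    nothing about it. But no member carries it, because all entries of labels are below
    \<open>length C'\<close>, which is at most \<open>d\<close>.\<close>
  case False
  show ?thesis
  proof (rule lsum_zero)
   fix y assume "y \<in> set (map (%w. f w \<otimes> ?mv (fst (snd w)) \<tau> l) ws)"
   then obtain w where w: "w \<in> set ws" "y = f w \<otimes> ?mv (fst (snd w)) \<tau> l" by auto
   obtain t where t: "t < length bs" "w = (os ! t, bs ! t)" using wt[OF w(1)] by blast
   have "f w \<in> carrier F" unfolding t(2) f[OF t(1)] using al t(1) nth_mem[of t \<alpha>s] by auto
   moreover have "?mv (fst (snd w)) \<tau> l = \<zero>"
    by (rule mv_zero[OF mo[OF wb[OF w(1)]]]) (use False le' in auto)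
   ultimately show "y = \<zero>" unfolding w(2) by simp
  qed
 qed
 have lin: "lines d v m C' (Suc i) ms"
  unfolding lines_def
 proof (intro allI impI ballI)
  fix a l and \<tau> :: "nat list" assume a: "a < Suc i" "length \<tau> = Suc i" "l \<in> {1..m}"
  obtain e0 \<tau>' where \<tau>: "\<tau> = e0 # \<tau>'" "length \<tau>' = i" using a(2) by (cases \<tau>) auto
  show "lsum (map (%e. C' ! e \<otimes> ?mv ms (\<tau>[a := e]) l) [0..<length C']) = \<zero>"
  proof (cases a)
   case 0
   have "lsum (map (%e. C' ! e \<otimes> ?mv ms (\<tau>[a := e]) l) [0..<length C'])
    = lsum (map (%e. lsum (map (%w. (C' ! e \<otimes> coef d e (fst w)) \<otimes> ?mv (fst (snd w)) \<tau>' l) ws)) [0..<length C'])"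
   proof (rule lsum_cong)
    fix e assume "e \<in> set [0..<length C']"
    then have ec: "C' ! e \<in> carrier F" using C'c by simp
    have "C' ! e \<otimes> ?mv ms (\<tau>[a := e]) l = C' ! e \<otimes> lsum (map (%w. coef d e (fst w) \<otimes> ?mv (fst (snd w)) \<tau>' l) ws)"
     using 0 \<tau> mvms by simp
    also have "\<dots> = lsum (map (%w. C' ! e \<otimes> (coef d e (fst w) \<otimes> ?mv (fst (snd w)) \<tau>' l)) ws)"
     by (rule lsum_map_distrib[OF _ ec]) (rule m_closed[OF cc mvc])
    also have "\<dots> = lsum (map (%w. (C' ! e \<otimes> coef d e (fst w)) \<otimes> ?mv (fst (snd w)) \<tau>' l) ws)"
     by (rule lsum_cong) (rule m_assoc[symmetric, OF ec cc mvc])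
    finally show "C' ! e \<otimes> ?mv ms (\<tau>[a := e]) l = lsum (map (%w. (C' ! e \<otimes> coef d e (fst w)) \<otimes> ?mv (fst (snd w)) \<tau>' l) ws)" .
   qed
   also have "\<dots> = lsum (map (%w. lsum (map (%e. (C' ! e \<otimes> coef d e (fst w)) \<otimes> ?mv (fst (snd w)) \<tau>' l) [0..<length C'])) ws)"
    by (rule lsum_swap) (use C'c cc mvc in auto)
   also have "\<dots> = lsum (map (%w. lsum (map (%e. C' ! e \<otimes> coef d e (fst w)) [0..<length C']) \<otimes> ?mv (fst (snd w)) \<tau>' l) ws)"
    by (rule lsum_cong, rule lsum_map_distrib2[symmetric]) (use C'c cc mvc in auto)
   also have "\<dots> = \<zero>"
   proof (rule null[OF _ \<tau>(2) a(3)])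
    fix t assume t: "t < length bs"
    show "lsum (map (%e. C' ! e \<otimes> coef d e (fst (os ! t, bs ! t))) [0..<length C']) = \<alpha>s ! t"
    proof (cases "\<alpha>s ! t = \<zero>")
     case True
     then have "os ! t = None" using onone[OF t] by simp
     have "lsum (map (%e. C' ! e \<otimes> coef d e (fst (os ! t, bs ! t))) [0..<length C']) = \<zero>"
      by (rule lsum_zero) (use \<open>os ! t = None\<close> C'c in \<open>auto simp: coef_def\<close>)
     then show ?thesis using True by simp
    next
     case False
     obtain e g where eg: "os ! t = Some (e, g)" "e < length C'" "g \<in> cnz" "\<alpha>s ! t = C' ! e \<otimes> g [^] d"
      using orep[OF t False] unfolding rep_ok_def by blast
     have "lsum (map (%e'. C' ! e' \<otimes> coef d e' (fst (os ! t, bs ! t))) [0..<length C'])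
      = lsum (map (%e'. if e' = e then C' ! e \<otimes> g [^] d else \<zero>) [0..<length C'])"
      by (rule lsum_cong) (use eg C'c in \<open>auto simp: coef_def\<close>)
     also have "\<dots> = C' ! e \<otimes> g [^] d" by (rule lsum_delta[OF eg(2)]) (use eg(3) C'c[OF eg(2)] in simp)
     finally show ?thesis using eg(4) by simp
    qed
   qed
   finally show ?thesis .
  next
   case (Suc a')
   have upd: "\<tau>[a := e] = e0 # \<tau>'[a' := e]" for e using Suc \<tau> by simp
   have "lsum (map (%e. C' ! e \<otimes> ?mv ms (\<tau>[a := e]) l) [0..<length C'])
    = lsum (map (%e. lsum (map (%w. coef d e0 (fst w) \<otimes> (C' ! e \<otimes> ?mv (fst (snd w)) (\<tau>'[a' := e]) l)) ws)) [0..<length C'])"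
   proof (rule lsum_cong)
    fix e assume "e \<in> set [0..<length C']"
    then have ec: "C' ! e \<in> carrier F" using C'c by simp
    have "C' ! e \<otimes> ?mv ms (\<tau>[a := e]) l = C' ! e \<otimes> lsum (map (%w. coef d e0 (fst w) \<otimes> ?mv (fst (snd w)) (\<tau>'[a' := e]) l) ws)"
     unfolding upd mvms ..
    also have "\<dots> = lsum (map (%w. C' ! e \<otimes> (coef d e0 (fst w) \<otimes> ?mv (fst (snd w)) (\<tau>'[a' := e]) l)) ws)"
     by (rule lsum_map_distrib[OF _ ec]) (rule m_closed[OF cc mvc])
    also have "\<dots> = lsum (map (%w. coef d e0 (fst w) \<otimes> (C' ! e \<otimes> ?mv (fst (snd w)) (\<tau>'[a' := e]) l)) ws)"
     by (rule lsum_cong) (rule m_lcomm[OF ec cc mvc])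
    finally show "C' ! e \<otimes> ?mv ms (\<tau>[a := e]) l = lsum (map (%w. coef d e0 (fst w) \<otimes> (C' ! e \<otimes> ?mv (fst (snd w)) (\<tau>'[a' := e]) l)) ws)" .
   qed
   also have "\<dots> = lsum (map (%w. lsum (map (%e. coef d e0 (fst w) \<otimes> (C' ! e \<otimes> ?mv (fst (snd w)) (\<tau>'[a' := e]) l)) [0..<length C'])) ws)"
    by (rule lsum_swap) (use C'c cc mvc in auto)
   also have "\<dots> = \<zero>"
   proof (rule lsum_zero)
    fix y assume "y \<in> set (map (%w. lsum (map (%e. coef d e0 (fst w) \<otimes> (C' ! e \<otimes> ?mv (fst (snd w)) (\<tau>'[a' := e]) l)) [0..<length C'])) ws)"
    then obtain w where w: "w \<in> set ws" "y = lsum (map (%e. coef d e0 (fst w) \<otimes> (C' ! e \<otimes> ?mv (fst (snd w)) (\<tau>'[a' := e]) l)) [0..<length C'])" by auto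
    have "y = coef d e0 (fst w) \<otimes> lsum (map (%e. C' ! e \<otimes> ?mv (fst (snd w)) (\<tau>'[a' := e]) l) [0..<length C'])"
     unfolding w(2) by (rule lsum_map_distrib[symmetric]) (use C'c cc[OF w(1)] mvc[OF w(1)] in auto)
    also have "lsum (map (%e. C' ! e \<otimes> ?mv (fst (snd w)) (\<tau>'[a' := e]) l) [0..<length C']) = \<zero>"
     using good'[OF wb[OF w(1)]] Suc a \<tau>(2) unfolding good_def lines_def by auto
    finally show "y = \<zero>" using cc[OF w(1)] by simp
   qed
   finally show ?thesis .
  qed
 qed
 have "ms \<noteq> []"
 proof -
  obtain t where t: "t < length bs" "\<alpha>s ! t \<noteq> \<zero>" using nv(3) by auto
  have w: "(os ! t, bs ! t) \<in> set ws" unfolding ws_def in_set_zip using t C'(3) by auto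
  have "os ! t \<noteq> None" using onone[OF t(1)] t(2) by simp
  moreover have "fst (bs ! t) \<noteq> []" using bs[OF nth_mem[OF t(1)]] by (simp add: good_def)
  ultimately have ne: "new_members (os ! t) (bs ! t) \<noteq> []" by (simp add: new_members_def)
  have "set (new_members (os ! t) (bs ! t)) \<subseteq> set ms" unfolding ms_def using w by force
  then show ?thesis using ne by auto
 qed
 then show ?thesis unfolding good_def vec unfolding e fst_conv snd_conv using mem lin by simp
qed

end

end

context expl
begin

lemma jlist_append: "jlist (xs @ ys) = jlist xs @ jlist ys"
 by (simp add: jlist_def)

lemma level_chunks:
 assumes C: "set C \<subseteq> carrier F" "length C \<le> d + 1" and tow: "fst ` set tow \<subseteq> carrier F"
  and chs: "\<And>ch. ch \<in> set chs ==> length ch = d ^ i * m + 1 \<and> (\<forall>b\<in>set ch. shape d m i b)"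
 shows "set (fst (foldl (level_step d B u tow) (C, []) chs)) \<subseteq> carrier F \<and> length (fst (foldl (level_step d B u tow) (C, []) chs)) \<le> d + 1 \<and>
  prefix C (fst (foldl (level_step d B u tow) (C, []) chs)) \<and> length (snd (foldl (level_step d B u tow) (C, []) chs)) = length chs \<and>
  (\<forall>b\<in>set (snd (foldl (level_step d B u tow) (C, []) chs)). shape d m (Suc i) b) \<and>
  subseq (jlist (snd (foldl (level_step d B u tow) (C, []) chs))) (jlist (concat chs))"
 using chs
proof (induction chs rule: rev_induct)
 case Nil then show ?case using C by (simp add: jlist_def)
next
 case (snoc ch chs)
 let ?s = "foldl (level_step d B u tow) (C, []) chs"
 have IH: "set (fst ?s) \<subseteq> carrier F" "length (fst ?s) \<le> d + 1" "prefix C (fst ?s)" "length (snd ?s) = length chs"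
  "\<forall>b\<in>set (snd ?s). shape d m (Suc i) b" "subseq (jlist (snd ?s)) (jlist (concat chs))"
  using snoc by auto
 have ch: "length ch = d ^ i * m + 1" "\<And>b. b \<in> set ch ==> shape d m i b" using snoc.prems[of ch] by auto
 let ?w = "merge_blocks d B u tow (fst ?s) ch"
 have M: "set (fst ?w) \<subseteq> carrier F" "length (fst ?w) \<le> d + 1" "prefix (fst ?s) (fst ?w)" "shape d m (Suc i) (snd ?w)"
  "length (nullvec (map snd ch)) = length ch"
  using merge_shape[OF IH(1,2) tow _ ch(1)] ch(2) by blast+
 have e: "foldl (level_step d B u tow) (C, []) (chs @ [ch]) = (fst ?w, snd ?s @ [snd ?w])" by (simp add: level_step_def)
 have "subseq (jlist [snd ?w]) (jlist ch)" using merge_subseq[OF M(5)] by (simp add: jlist_def)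
 then have "subseq (jlist (snd ?s @ [snd ?w])) (jlist (concat (chs @ [ch])))"
  using IH(6) unfolding jlist_append concat_append by (simp add: list_emb_append_mono)
 moreover have "prefix C (fst ?w)" using IH(3) M(3) by (rule prefix_order.trans)
 ultimately show ?case unfolding e fst_conv snd_conv using IH M by simp
qed

lemma level_shape:
 assumes s: "set (fst s) \<subseteq> carrier F" "length (fst s) \<le> d + 1" and tow: "fst ` set tow \<subseteq> carrier F"
  and bs: "\<And>b. b \<in> set (snd s) ==> shape d m i b"
 shows "set (fst (level d B u tow s)) \<subseteq> carrier F" "length (fst (level d B u tow s)) \<le> d + 1"
  "\<And>b. b \<in> set (snd (level d B u tow s)) ==> shape d m (Suc i) b"
  "subseq (jlist (snd (level d B u tow s))) (jlist (snd s))"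
  "length (snd s) \<ge> R * (d ^ i * m + 1) ==> length (snd (level d B u tow s)) \<ge> R"
  "length (snd (level d B u tow s)) \<le> length (snd s)"
proof -
 have l: "length (snd b) = d ^ i * m" if "b \<in> set (snd s)" for b using bs[OF that] by (simp add: shape_def)
 obtain rest where r: "snd s = concat (chunks (snd s)) @ rest" using chunks_props(1)[OF l] by blast
 have ch: "length ch = d ^ i * m + 1 \<and> (\<forall>b\<in>set ch. shape d m i b)" if c: "ch \<in> set (chunks (snd s))" for ch
 proof
  show "length ch = d ^ i * m + 1" by (rule chunks_props(2)[OF l]) (use c in auto)
  show "\<forall>b\<in>set ch. shape d m i b"
  proof
   fix b assume "b \<in> set ch"
   then have "b \<in> set (concat (chunks (snd s)) @ rest)" using c by auto
   then show "shape d m i b" using bs r by simp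
  qed
 qed
 note L = level_chunks[OF s tow ch, of "chunks (snd s)", folded level_def, simplified]
 show "set (fst (level d B u tow s)) \<subseteq> carrier F" "length (fst (level d B u tow s)) \<le> d + 1" using L by auto
 show "\<And>b. b \<in> set (snd (level d B u tow s)) ==> shape d m (Suc i) b" using L by auto
 have "subseq (jlist (snd (level d B u tow s))) (jlist (concat (chunks (snd s))))" using L by auto
 also have "subseq \<dots> (jlist (snd s))"
  by (subst (2) r, unfold jlist_append) (simp add: subseq_rev_drop_many)
 finally show "subseq (jlist (snd (level d B u tow s))) (jlist (snd s))" .
 have len: "length (snd (level d B u tow s)) = length (chunks (snd s))" using L by auto
 show "length (snd s) \<ge> R * (d ^ i * m + 1) ==> length (snd (level d B u tow s)) \<ge> R"
  unfolding len by (rule chunks_count[OF l])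
 have "length (chunks (snd s)) \<le> length (concat (chunks (snd s)))"
 proof -
  have "\<forall>ch\<in>set chs. length ch \<ge> 1 ==> length chs \<le> length (concat chs)" for chs :: "block list list"
   by (induction chs) auto
  moreover have "\<forall>ch\<in>set (chunks (snd s)). length ch \<ge> 1" using ch by force
  ultimately show ?thesis by blast
 qed
 also have "\<dots> \<le> length (snd s)" by (subst (2) r) simp
 finally show "length (snd (level d B u tow s)) \<le> length (snd s)" unfolding len .
qed

lemma init_shape:
 assumes "\<And>w. w \<in> set vs ==> length w = m \<and> set w \<subseteq> carrier F"
 shows "b \<in> set (init_blocks vs) ==> shape d m 0 b"
proof -
 assume "b \<in> set (init_blocks vs)"
 then obtain t where t: "t < length vs" "b = ([(Suc t, \<one>, [])], vs ! t)" by (auto simp: init_blocks_def set_zip)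
 show ?thesis using assms[OF nth_mem[OF t(1)]] unfolding t(2) shape_def by simp
qed

lemma jlist_init: "jlist (init_blocks vs) = [1..<length vs + 1]"
proof -
 have "jlist (init_blocks vs) = map (on_fst Suc) (zip [0..<length vs] vs)"
  unfolding init_blocks_def jlist_def by (simp add: o_def)
 also have "\<dots> = map Suc (map fst (zip [0..<length vs] vs))" by (simp only: map_map o_def)
 also have "\<dots> = [1..<length vs + 1]" by (simp del: upt_Suc add: map_Suc_upt)
 finally show ?thesis .
qed

definition run_prefix where
 "run_prefix d B u tow vs n = foldl (%s (_ :: nat). level d B u tow s) ([], init_blocks vs) [0..<n]"

lemma run_prefix_0: "run_prefix d B u tow vs 0 = ([], init_blocks vs)"
 and run_prefix_Suc: "run_prefix d B u tow vs (Suc n) = level d B u tow (run_prefix d B u tow vs n)"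
 by (simp_all add: run_prefix_def)

text \<open>Round \<open>n\<close> needs \<open>d ^ n * m + 1\<close> blocks for each new one, so
  the product of the factors of the rounds still to come bounds the number of blocks from below. At
  \<open>n = d\<close> this product is empty, which leaves at least one block.\<close>

lemma run_shape:
 assumes vs: "\<And>w. w \<in> set vs ==> length w = m \<and> set w \<subseteq> carrier F" and tow: "fst ` set tow \<subseteq> carrier F"
 shows "set (fst (run_prefix d B u tow vs n)) \<subseteq> carrier F \<and> length (fst (run_prefix d B u tow vs n)) \<le> d + 1 \<and>
  (\<forall>b\<in>set (snd (run_prefix d B u tow vs n)). shape d m n b) \<and>
  subseq (jlist (snd (run_prefix d B u tow vs n))) [1..<length vs + 1] \<and>
  length (snd (run_prefix d B u tow vs n)) \<le> length vs \<and>
  (n \<le> d \<longrightarrow> (\<Prod>l<d. d ^ l * m + 1) \<le> length vs \<longrightarrow> (\<Prod>l\<in>{n..<d}. d ^ l * m + 1) \<le> length (snd (run_prefix d B u tow vs n)))"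
proof (induction n)
 case 0
 show ?case unfolding run_prefix_0 fst_conv snd_conv jlist_init
 proof (intro conjI ballI impI)
  show "shape d m 0 b" if "b \<in> set (init_blocks vs)" for b by (rule init_shape[OF vs that])
 qed (simp_all add: init_blocks_def atLeast0LessThan del: upt_Suc)
next
 case (Suc n)
 let ?s = "run_prefix d B u tow vs n"
 have IH: "set (fst ?s) \<subseteq> carrier F" "length (fst ?s) \<le> d + 1" "\<And>b. b \<in> set (snd ?s) ==> shape d m n b"
  "subseq (jlist (snd ?s)) [1..<length vs + 1]" "length (snd ?s) \<le> length vs"
  "n \<le> d ==> (\<Prod>l<d. d ^ l * m + 1) \<le> length vs ==> (\<Prod>l\<in>{n..<d}. d ^ l * m + 1) \<le> length (snd ?s)"
  using Suc by blast+
 note L = level_shape[OF IH(1,2) tow IH(3), where B = B and u = u]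
 show ?case unfolding run_prefix_Suc
 proof (intro conjI ballI impI)
  show "subseq (jlist (snd (level d B u tow ?s))) [1..<length vs + 1]" by (rule subseq_order.trans[OF L(4) IH(4)])
  show "length (snd (level d B u tow ?s)) \<le> length vs" using L(6) IH(5) by simp
  assume n: "Suc n \<le> d" "(\<Prod>l<d. d ^ l * m + 1) \<le> length vs"
  have "(\<Prod>l\<in>{n..<d}. d ^ l * m + 1) = (\<Prod>l\<in>{Suc n..<d}. d ^ l * m + 1) * (d ^ n * m + 1)"
   using n(1) by (simp add: prod.atLeast_Suc_lessThan mult.commute)
  then show "(\<Prod>l\<in>{Suc n..<d}. d ^ l * m + 1) \<le> length (snd (level d B u tow ?s))"
   using IH(6) n by (intro L(5)) simp_all
 qed (use L in simp_all)
qed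

end

text \<open>The origin of \<open>G\<close>: each factor is at most \<open>d ^ l * (m + 1)\<close>,
  and the exponents \<open>l\<close> add up to \<open>d * (d - 1) div 2\<close>.\<close>

lemma prod_le_G: "0 < d ==> (\<Prod>l<d. d ^ l * m + 1) \<le> G d m"
proof -
 assume d: "0 < d"
 have "(\<Prod>l<d. d ^ l * m + 1) \<le> (\<Prod>l<d. d ^ l * (m + 1))"
  by (rule prod_mono) (use d in simp)
 also have "\<dots> = (\<Prod>l<d. d ^ l) * (m + 1) ^ d" unfolding prod.distrib by simp
 also have "\<dots> = d ^ (\<Sum>l<d. l) * (m + 1) ^ d" unfolding power_sum ..
 also have "(\<Sum>l<d. l) = d * (d - 1) div 2" using Sum_Ico_nat[of 0 d] by (simp add: atLeast0LessThan)
 finally show ?thesis by (simp add: G_def)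
qed

context expl
begin

context
 fixes d B u s :: nat and tow :: "(nat list \<times> nat) list" and v :: "nat \<Rightarrow> nat \<Rightarrow> nat list" and m :: nat
 assumes tow: "fst ` set tow \<subseteq> cnz" and d: "d > 0" and us: "u * d + 1 = B * s" and v: "\<And>j l. v j l \<in> carrier F"
begin

lemma merge_inc:
 assumes C: "set C \<subseteq> cnz" and inc: "inc_list d B u tow C" and al: "set (nullvec (map snd bs)) \<subseteq> carrier F"
 shows "set (fst (merge_blocks d B u tow C bs)) \<subseteq> cnz" "inc_list d B u tow (fst (merge_blocks d B u tow C bs))"
 using decs_ok[OF tow d us C al inc] by (simp_all add: merge_blocks_def Let_def)

text \<open>The list of representatives only grows. If it ends with at most \<open>d\<close> entries
  it never had more, so every merge on the way was sound; hence the conditional form of premise and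
  conclusion.\<close>

lemma level_chunks_good:
 assumes C: "set C \<subseteq> cnz" "length C \<le> d + 1" "inc_list d B u tow C"
  and chs: "\<And>ch. ch \<in> set chs ==> length ch = d ^ i * m + 1 \<and> (\<forall>b\<in>set ch. shape d m i b)"
  and gd: "\<And>b. length C \<le> d ==> b \<in> set (concat chs) ==> good d v m C i b"
 shows "set (fst (foldl (level_step d B u tow) (C, []) chs)) \<subseteq> cnz \<and> inc_list d B u tow (fst (foldl (level_step d B u tow) (C, []) chs)) \<and>
  (length (fst (foldl (level_step d B u tow) (C, []) chs)) \<le> d \<longrightarrow>
   (\<forall>b\<in>set (snd (foldl (level_step d B u tow) (C, []) chs)). good d v m (fst (foldl (level_step d B u tow) (C, []) chs)) (Suc i) b))"
 using chs gd
proof (induction chs rule: rev_induct)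
 case Nil then show ?case using C by simp
next
 case (snoc ch chs)
 let ?s = "foldl (level_step d B u tow) (C, []) chs"
 let ?w = "merge_blocks d B u tow (fst ?s) ch"
 have tc: "fst ` set tow \<subseteq> carrier F" and Cc: "set C \<subseteq> carrier F" using tow C(1) by auto
 have chs': "length ch' = d ^ i * m + 1 \<and> (\<forall>b\<in>set ch'. shape d m i b)" if "ch' \<in> set chs" for ch'
  by (rule snoc.prems(1)) (use that in simp)
 have LC: "length (fst ?s) \<le> d + 1" "prefix C (fst ?s)"
  using level_chunks[OF Cc C(2) tc chs'] by blast+
 have "good d v m C i b" if "length C \<le> d" "b \<in> set (concat chs)" for b
  by (rule snoc.prems(2)) (use that in auto)
 with snoc.IH[OF chs'] have IH: "set (fst ?s) \<subseteq> cnz" "inc_list d B u tow (fst ?s)"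
  "\<And>b. length (fst ?s) \<le> d ==> b \<in> set (snd ?s) ==> good d v m (fst ?s) (Suc i) b" by blast+
 have sc: "set (fst ?s) \<subseteq> carrier F" using IH(1) by blast
 have ch: "length ch = d ^ i * m + 1" "\<And>b. b \<in> set ch ==> shape d m i b" using snoc.prems(1)[of ch] by auto
 have M: "set (fst ?w) \<subseteq> carrier F" "prefix (fst ?s) (fst ?w)" "set (nullvec (map snd ch)) \<subseteq> carrier F"
  using merge_shape[OF sc LC(1) tc _ ch(1)] ch(2) by blast+
 note MI = merge_inc[OF IH(1,2) M(3)]
 have e: "foldl (level_step d B u tow) (C, []) (chs @ [ch]) = (fst ?w, snd ?s @ [snd ?w])" by (simp add: level_step_def)
 have "good d v m (fst ?w) (Suc i) b" if le: "length (fst ?w) \<le> d" and b: "b \<in> set (snd ?s @ [snd ?w])" for b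
 proof -
  have le': "length (fst ?s) \<le> d" using le prefix_length_le[OF M(2)] by simp
  then have le0: "length C \<le> d" using prefix_length_le[OF LC(2)] by simp
  show ?thesis
  proof (cases "b \<in> set (snd ?s)")
   case True
   show ?thesis by (rule good_extend[OF v IH(3)[OF le' True] M(2) M(1)])
  next
   case False
   then have bw: "b = snd ?w" using b by simp
   have "good d v m (fst ?s) i b'" if "b' \<in> set ch" for b'
    by (rule good_extend[OF v snoc.prems(2)[OF le0] LC(2) sc]) (use that in simp)
   then show ?thesis unfolding bw by (intro merge_good[OF tow d us v IH(1,2) _ ch(1) le])
  qed
 qed
 then show ?case unfolding e fst_conv snd_conv using MI by blast
qed

lemma run_good:
 assumes vs: "vs = map (%i. map (v i) [1..<m + 1]) [1..<n + 1]"
 shows "set (fst (run_prefix d B u tow vs i)) \<subseteq> cnz \<and> inc_list d B u tow (fst (run_prefix d B u tow vs i)) \<and>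
  (length (fst (run_prefix d B u tow vs i)) \<le> d \<longrightarrow>
   (\<forall>b\<in>set (snd (run_prefix d B u tow vs i)). good d v m (fst (run_prefix d B u tow vs i)) i b))"
proof (induction i)
 case 0
 have "good d v m [] 0 b" if b: "b \<in> set (init_blocks vs)" for b
 proof -
  obtain t where t: "t < length vs" "b = ([(Suc t, \<one>, [])], vs ! t)" using b by (auto simp: init_blocks_def set_zip)
  have "t < n" using t(1) by (simp add: vs del: upt_Suc)
  then have vt: "vs ! t = map (v (Suc t)) [1..<m + 1]" unfolding vs by (simp del: upt_Suc)
  have mv: "mval d v [(Suc t, \<one>, [])] [] l = v (Suc t) l" for l
   using v[of "Suc t" l] by (simp add: mval_def)
  have "map (%\<kappa>. mval d v [(Suc t, \<one>, [])] (fst \<kappa>) (snd \<kappa>)) (keys d m 0) = vs ! t"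
   unfolding vt keys.simps map_map by (simp add: mv o_def del: upt_Suc)
  then show ?thesis unfolding t(2) good_def mem_ok_def lines_def by simp
 qed
 then show ?case unfolding run_prefix_0 by (simp add: inc_list_def)
next
 case (Suc i)
 let ?s = "run_prefix d B u tow vs i"
 have tc: "fst ` set tow \<subseteq> carrier F" using tow by auto
 have w: "length w = m \<and> set w \<subseteq> carrier F" if "w \<in> set vs" for w using that v unfolding vs by (auto simp del: upt_Suc)
 have S: "length (fst ?s) \<le> d + 1" "\<And>b. b \<in> set (snd ?s) ==> shape d m i b"
  using run_shape[of vs m tow d B u i, OF w tc] by blast+
 have l: "length (snd b) = d ^ i * m" if "b \<in> set (snd ?s)" for b using S(2)[OF that] by (simp add: shape_def)
 obtain rest where r: "snd ?s = concat (chunks (snd ?s)) @ rest" using chunks_props(1)[OF l] by blast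
 have sub: "b \<in> set (snd ?s)" if "b \<in> set (concat (chunks (snd ?s)))" for b
  using that by (subst r) simp
 have ch: "length ch = d ^ i * m + 1 \<and> (\<forall>b\<in>set ch. shape d m i b)" if c: "ch \<in> set (chunks (snd ?s))" for ch
 proof
  show "length ch = d ^ i * m + 1" by (rule chunks_props(2)[OF l]) (use c in auto)
  show "\<forall>b\<in>set ch. shape d m i b"
  proof
   fix b assume "b \<in> set ch"
   then have "b \<in> set (concat (chunks (snd ?s)))" using c unfolding set_concat by blast
   then show "shape d m i b" by (rule S(2)[OF sub])
  qed
 qed
 show ?case unfolding run_prefix_Suc level_def
  by (rule level_chunks_good[OF _ S(1) _ ch]) (use Suc sub in auto)
qed

end

end

section \<open>Polynomial time of the merging rounds\<close>

abbreviation "enc_mem \<equiv> ep enc_nat (ep enc_elem enc_elem)"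
abbreviation "enc_blk \<equiv> ep (enc_list enc_mem) (enc_vec)"
abbreviation "enc_o \<equiv> eo (ep enc_nat enc_elem)"
abbreviation "enc_state \<equiv> ep (enc_vec) (enc_list enc_blk)"

lemma size_enc_o: "(\<And>e g. o' = Some (e, g) ==> e \<le> n \<and> size (enc_elem g) \<le> b) ==> size (enc_o o') \<le> 2 * n + b + 2"
proof (cases o')
 case (Some w)
 assume a: "\<And>e g. o' = Some (e, g) ==> e \<le> n \<and> size (enc_elem g) \<le> b"
 obtain e g where w: "w = (e, g)" by fastforce
 have "e \<le> n" "size (enc_elem g) \<le> b" using a Some w by auto
 moreover have "size (enc_nat e) \<le> 2 * n" using size_enc_nat_le_nat[of e] \<open>e \<le> n\<close> by simp
 ultimately show ?thesis unfolding Some w by (simp add: eo_def size_ep)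
qed (simp add: eo_def)

lemma pt_dec:
 assumes T: "ptT N D Xi p k F d B u tow" and C: "pt N D Xi (%i. enc_vec (C i))"
  and Cc: "\<And>i. i \<in> D ==> set (C i) \<subseteq> carrier (F i)" and \<alpha>: "ptF N D Xi F \<alpha>"
 shows "pt N D Xi (%i. ep (enc_vec) enc_o (expl.dec (F i) (d i) (B i) (u i) (tow i) (C i) (\<alpha> i)))"
proof -
 note T' = ptTD[OF T]
 note f = T'(1)
 note self = fldD(4)[OF f]
 note cl = pt_classify[OF T C Cc \<alpha>]
 let ?r = "%i. expl.classify (F i) (d i) (B i) (u i) (tow i) (C i) (\<alpha> i)"
 let ?E = "ep (enc_vec) enc_o"
 note len = pt_length[OF C]
 have cl': "pt N D Xi (%i. enc_o (?r i))" by (rule cl)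
 have one: "pt N D Xi (%i. enc_elem \<one>\<^bsub>F i\<^esub>)" by (rule ptFD(1)[OF ptF_one[OF f]])
 have z: "pt N D Xi (%i. eb (\<alpha> i = \<zero>\<^bsub>F i\<^esub>))" by (rule ptF_eq[OF f \<alpha> ptF_zero[OF f]])
 have "pt N D Xi (%i. ?E (if \<alpha> i = \<zero>\<^bsub>F i\<^esub> then (C i, None) else if ?r i = None then
   (if length (C i) \<le> d i then (C i @ [\<alpha> i], Some (length (C i), \<one>\<^bsub>F i\<^esub>)) else (C i, Some (0, \<one>\<^bsub>F i\<^esub>))) else (C i, ?r i)))"
  by (rule pt_if'[where e = ?E], rule z, rule pt_pair, rule C, rule pt_None, rule self,
    rule pt_if'[where e = ?E], rule pt_is_None, rule cl',
    rule pt_if'[where e = ?E], rule pt_le, rule len, rule T'(2),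
    rule pt_pair, rule pt_append, rule C, rule pt_Cons, rule ptFD(1)[OF \<alpha>], rule pt_Nil, rule self,
    rule pt_Some, rule pt_pair, rule len, rule one,
    rule pt_pair, rule C, rule pt_Some, rule pt_pair, rule pt_nat_const, rule self, rule one,
    rule pt_pair, rule C, rule cl')
 then show ?thesis
 proof (rule pt_cong, goal_cases)
  case (1 i)
  then show ?case by (cases "?r i = None") (auto simp: expl.dec_def[OF fldD(1)[OF f 1]] Let_def)
 qed
qed

lemma pt_decs:
 assumes T: "ptT N D Xi p k F d B u tow" and C: "pt N D Xi (%i. enc_vec (C i))"
  and Cc: "\<And>i. i \<in> D ==> set (C i) \<subseteq> carrier (F i) \<and> length (C i) \<le> d i + 1"
  and \<alpha>: "pt N D Xi (%i. enc_vec (\<alpha>s i))" and \<alpha>c: "\<And>i. i \<in> D ==> set (\<alpha>s i) \<subseteq> carrier (F i)"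
 shows "pt N D Xi (%i. ep (enc_vec) (enc_list enc_o) (expl.decs (F i) (d i) (B i) (u i) (tow i) (C i) (\<alpha>s i)))"
proof -
 note T' = ptTD[OF T]
 note f = T'(1)
 obtain b where b: "pb N D b" "\<And>i x. i \<in> D ==> x \<in> carrier (F i) ==> size (enc_elem x) \<le> b i"
  by (rule fld_sz[OF f]) blast
 have pd: "pb N D d" using pt_length_bound[OF T'(3)] by simp
 let ?dec = "%i. expl.dec (F i) (d i) (B i) (u i) (tow i)"
 let ?g = "%i s \<alpha>. (fst (?dec i (fst s) \<alpha>), snd s @ [snd (?dec i (fst s) \<alpha>)])"
 let ?Inv = "%i (j :: nat) s. set (fst s) \<subseteq> carrier (F i) \<and> length (fst s) \<le> d i + 1 \<and> length (snd s) = j \<and>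
   (\<forall>o'\<in>set (snd s). \<forall>e g. o' = Some (e, g) \<longrightarrow> g \<in> carrier (F i) \<and> e \<le> d i)"
 let ?b = "%i. (d i + 1) * (b i + 1) + length (\<alpha>s i) * (2 * d i + b i + 2 + 1) + 1"
 have "pt N D Xi (%i. ep (enc_vec) (enc_list enc_o) (foldl (?g i) (C i, []) (\<alpha>s i)))"
 proof (rule pt_fold[OF \<alpha> _ _ _ _ _ refl, where Inv = ?Inv and b = ?b], goal_cases)
  case 1 show ?case by (rule pt_pair, rule C, rule pt_Nil, rule fldD(4)[OF f])
 next
  case (2 i) show ?case using Cc[OF 2] by simp
 next
  case (3 i j s)
  have a: "\<alpha>s i ! j \<in> carrier (F i)" using \<alpha>c[OF 3(1)] nth_mem[OF 3(2)] by blast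
  have s: "set (fst s) \<subseteq> carrier (F i)" "length (fst s) \<le> d i + 1" using 3(3) by blast+
  note D = expl.dec_carrier[OF fldD(1)[OF f 3(1)] s(1) a T'(7)[OF 3(1)] s(2), where B = "B i" and u = "u i"]
  show ?case unfolding fst_conv snd_conv using D(1,2,3) 3(3) by auto
 next
  case 4 show ?case by (intro pb_add pb_mult pb_const pd b(1) pt_length_bound[OF \<alpha>])
 next
  case (5 i j s)
  have "size (enc_vec (fst s)) \<le> length (fst s) * (b i + 1)"
   by (rule size_enc_list_le) (use 5(3) b(2)[OF 5(1)] in blast)
  moreover have "\<dots> \<le> (d i + 1) * (b i + 1)" using 5(3) by (intro mult_le_mono1) blast
  moreover have "size (enc_list enc_o (snd s)) \<le> length (snd s) * (2 * d i + b i + 2 + 1)"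
  proof (rule size_enc_list_le, rule size_enc_o)
   fix o' e g assume "o' \<in> set (snd s)" "o' = Some (e, g)"
   then have "g \<in> carrier (F i)" "e \<le> d i" using 5(3) by blast+
   then show "e \<le> d i \<and> size (enc_elem g) \<le> b i" using b(2)[OF 5(1)] by blast
  qed
  moreover have "\<dots> \<le> length (\<alpha>s i) * (2 * d i + b i + 2 + 1)" using 5(2,3) by (intro mult_le_mono1) blast
  ultimately show ?case unfolding size_ep by linarith
 next
  case (6 Y)
  let ?D = "{(i, s, x). i \<in> D \<and> (\<exists>j<length (\<alpha>s i). x = \<alpha>s i ! j \<and> ?Inv i j s)}"
  have D: "\<And>z. z \<in> ?D ==> fst z \<in> D" by auto
  note T1 = ptT_lift[OF T 6(1) D]
  have c: "set (fst (fst (snd z))) \<subseteq> carrier (F (fst z))" if "z \<in> ?D" for z using that by auto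
  have a: "ptF (on_fst N) ?D Y (on_fst F) (%z. snd (snd z))"
  proof (rule ptFI, rule 6(4))
   fix z assume "z \<in> ?D"
   then have "snd (snd z) \<in> set (\<alpha>s (fst z))" "fst z \<in> D" by auto
   then show "snd (snd z) \<in> carrier (F (fst z))" using \<alpha>c by blast
  qed
  have de: "pt (on_fst N) ?D Y (%z. ep (enc_vec) enc_o (?dec (fst z) (fst (fst (snd z))) (snd (snd z))))"
   by (rule pt_dec[OF T1 pt_fst[OF 6(3)] c a])
  show ?case by (rule pt_pair, rule pt_fst[OF de], rule pt_append, rule pt_snd[OF 6(3)], rule pt_Cons, rule pt_snd[OF de], rule pt_Nil, rule 6(2))
 qed
 then show ?thesis by (rule pt_cong) (simp add: expl.decs_def[OF fldD(1)[OF f]])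
qed

lemma pt_new_members:
 assumes f: "fld N D Xi p k F" and o': "pt N D Xi (%i. enc_o (o' i))" and ms: "pt N D Xi (%i. enc_blk (b i))"
  and oc: "\<And>i e g. i \<in> D ==> o' i = Some (e, g) ==> g \<in> carrier (F i)"
  and bc: "\<And>i x. i \<in> D ==> x \<in> set (fst (b i)) ==> fst (snd x) \<in> carrier (F i)"
 shows "pt N D Xi (%i. enc_list enc_mem (expl.new_members (F i) (o' i) (b i)))"
proof -
 let ?D = "{i\<in>D. \<not> o' i = None}"
 have s: "?D \<subseteq> D" by blast
 note f' = fld_sub[OF f s]
 have th: "pt N ?D Xi (%i. ep enc_nat enc_elem (the (o' i)))" by (rule pt_the, rule pt_sub[OF o' s]) blast
 have g: "ptF N ?D Xi F (%i. snd (the (o' i)))"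
 proof (rule ptFI, rule pt_snd[OF th])
  fix i assume "i \<in> ?D"
  then show "snd (the (o' i)) \<in> carrier (F i)" using oc[of i "fst (the (o' i))" "snd (the (o' i))"] by simp
 qed
 have m: "pt N ?D Xi (%i. enc_list enc_mem (map (%x. (fst x, fst (snd x) \<otimes>\<^bsub>F i\<^esub> snd (the (o' i)), fst (the (o' i)) # snd (snd x))) (fst (b i))))"
 proof (rule pt_map[OF pt_fst[OF pt_sub[OF ms s]]], goal_cases)
  case (1 Y)
  let ?E = "{(i, x). i \<in> ?D \<and> x \<in> set (fst (b i))}"
  have D: "\<And>z. z \<in> ?E ==> fst z \<in> ?D" by auto
  have x: "ptF (on_fst N) ?E Y (on_fst F) (%z. fst (snd (snd z)))"
  proof (rule ptFI, rule pt_fst[OF pt_snd[OF 1(3)]])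
   fix z assume "z \<in> ?E"
   then have "fst z \<in> D" "snd z \<in> set (fst (b (fst z)))" by auto
   then show "fst (snd (snd z)) \<in> carrier (F (fst z))" by (rule bc)
  qed
  have gm: "ptF (on_fst N) ?E Y (on_fst F) (%z. fst (snd (snd z)) \<otimes>\<^bsub>F (fst z)\<^esub> snd (the (o' (fst z))))"
   by (rule ptF_mult[OF fld_lift[OF f' 1(1) D] x ptF_lift[OF g 1(1) D]])
  show ?case by (rule pt_pair, rule pt_fst[OF 1(3)], rule pt_pair, rule ptFD(1)[OF gm], rule pt_Cons, rule 1(1), rule pt_fst[OF th], rule pt_snd[OF pt_snd[OF 1(3)]])
 qed
 have "pt N D Xi (%i. enc_list enc_mem (if o' i = None then [] else
   map (%x. (fst x, fst (snd x) \<otimes>\<^bsub>F i\<^esub> snd (the (o' i)), fst (the (o' i)) # snd (snd x))) (fst (b i))))"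
  by (rule pt_if[where e = "enc_list enc_mem"], rule pt_is_None, rule o', rule pt_Nil, rule pt_sub[OF fldD(4)[OF f]], blast, rule m)
 then show ?thesis by (rule pt_cong) (simp add: expl.new_members_def[OF fldD(1)[OF f]])
qed

lemma pt_new_part:
 assumes f: "fld N D Xi p k F" and d: "pt N D Xi (%i. enc_nat (d i))" and e: "pt N D Xi (%i. enc_nat (e i))"
  and o': "pt N D Xi (%i. enc_o (o' i))" and ms: "pt N D Xi (%i. enc_blk (b i))"
  and oc: "\<And>i e g. i \<in> D ==> o' i = Some (e, g) ==> g \<in> carrier (F i)"
  and bc: "\<And>i. i \<in> D ==> set (snd (b i)) \<subseteq> carrier (F i)"
 shows "pt N D Xi (%i. enc_vec (expl.new_part (F i) (d i) (e i) (o' i) (b i)))"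
proof -
 let ?D = "{i\<in>D. \<not> o' i = None}"
 have s: "?D \<subseteq> D" by blast
 note f' = fld_sub[OF f s]
 have th: "pt N ?D Xi (%i. ep enc_nat enc_elem (the (o' i)))" by (rule pt_the, rule pt_sub[OF o' s]) blast
 have g: "ptF N ?D Xi F (%i. snd (the (o' i)))"
 proof (rule ptFI, rule pt_snd[OF th])
  fix i assume "i \<in> ?D"
  then show "snd (the (o' i)) \<in> carrier (F i)" using oc[of i "fst (the (o' i))" "snd (the (o' i))"] by simp
 qed
 note gp = ptF_pow[OF f' pt_sub[OF d s] g]
 have z: "pt N D Xi (%i. enc_vec (map (%_. \<zero>\<^bsub>F i\<^esub>) (snd (b i))))"
 proof (rule pt_map[OF pt_snd[OF ms]], goal_cases)
  case (1 Y)
  show ?case by (rule 1(1), rule ptFD(1)[OF ptF_zero[OF f]])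
 qed
 have m: "pt N ?D Xi (%i. enc_vec (map (%x. snd (the (o' i)) [^]\<^bsub>F i\<^esub> d i \<otimes>\<^bsub>F i\<^esub> x) (snd (b i))))"
 proof (rule pt_map[OF pt_snd[OF pt_sub[OF ms s]]], goal_cases)
  case (1 Y)
  let ?E = "{(i, x). i \<in> ?D \<and> x \<in> set (snd (b i))}"
  have D: "\<And>z. z \<in> ?E ==> fst z \<in> ?D" by auto
  have x: "ptF (on_fst N) ?E Y (on_fst F) (%z. snd z)"
  proof (rule ptFI, rule 1(3))
   fix z assume "z \<in> ?E"
   then have "fst z \<in> D" "snd z \<in> set (snd (b (fst z)))" by auto
   then show "snd z \<in> carrier (F (fst z))" using bc by blast
  qed
  show ?case by (rule ptFD(1)[OF ptF_mult[OF fld_lift[OF f' 1(1) D] ptF_lift[OF gp 1(1) D] x]])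
 qed
 have "pt N D Xi (%i. enc_vec (if o' i = None then map (%_. \<zero>\<^bsub>F i\<^esub>) (snd (b i)) else
   if fst (the (o' i)) = e i then map (%x. snd (the (o' i)) [^]\<^bsub>F i\<^esub> d i \<otimes>\<^bsub>F i\<^esub> x) (snd (b i)) else map (%_. \<zero>\<^bsub>F i\<^esub>) (snd (b i))))"
  by (rule pt_if[where e = "enc_vec"], rule pt_is_None, rule o', rule pt_sub[OF z], blast,
    rule pt_if'[where e = "enc_vec"], rule pt_eq, rule pt_fst[OF th], rule pt_sub[OF e s], rule m, rule pt_sub[OF z s])
 then show ?thesis by (rule pt_cong) (simp add: expl.new_part_def[OF fldD(1)[OF f]])
qed

lemma pt_vadd:
 assumes f: "fld N D Xi p k F" and x: "pt N D Xi (%i. enc_vec (x i))" and y: "pt N D Xi (%i. enc_vec (y i))"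
  and c: "\<And>i. i \<in> D ==> length (x i) = length (y i) \<and> set (x i) \<subseteq> carrier (F i) \<and> set (y i) \<subseteq> carrier (F i)"
 shows "pt N D Xi (%i. enc_vec (expl.vadd (F i) (x i) (y i)))"
proof -
 have zp: "pt N D Xi (%i. enc_list (ep enc_elem enc_elem) (zip (x i) (y i)))" by (rule pt_zip[OF x y]) (use c in blast)
 have "pt N D Xi (%i. enc_vec (map (%z. fst z \<oplus>\<^bsub>F i\<^esub> snd z) (zip (x i) (y i))))"
 proof (rule pt_map[OF zp], goal_cases)
  case (1 Y)
  let ?E = "{(i, w). i \<in> D \<and> w \<in> set (zip (x i) (y i))}"
  have D: "\<And>z. z \<in> ?E ==> fst z \<in> D" by auto
  have w: "fst (snd z) \<in> carrier (F (fst z)) \<and> snd (snd z) \<in> carrier (F (fst z))" if z: "z \<in> ?E" for z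
  proof -
   have "fst z \<in> D" "snd z \<in> set (zip (x (fst z)) (y (fst z)))" using z by auto
   then show ?thesis using c[of "fst z"] set_zip_leftD[of "fst (snd z)" "snd (snd z)"] set_zip_rightD[of "fst (snd z)" "snd (snd z)"] by auto
  qed
  have 2: "ptF (on_fst N) ?E Y (on_fst F) (%z. fst (snd z))" by (rule ptFI, rule pt_fst[OF 1(3)]) (use w in blast)
  have 3: "ptF (on_fst N) ?E Y (on_fst F) (%z. snd (snd z))" by (rule ptFI, rule pt_snd[OF 1(3)]) (use w in blast)
  show ?case by (rule ptFD(1)[OF ptF_add[OF fld_lift[OF f 1(1) D] 2 3]])
 qed
 then show ?thesis by (rule pt_cong) (simp add: expl.vadd_def[OF fldD(1)[OF f]])
qed

lemma pt_merge_blocks: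
 assumes T: "ptT N D Xi p k F d B u tow" and C: "pt N D Xi (%i. enc_vec (C i))"
  and Cc: "\<And>i. i \<in> D ==> set (C i) \<subseteq> carrier (F i) \<and> length (C i) \<le> d i + 1"
  and bs: "pt N D Xi (%i. enc_list enc_blk (bs i))"
  and sh: "\<And>i b. i \<in> D ==> b \<in> set (bs i) ==> expl.shape (F i) (d i) (m i) (l i) b"
  and len: "\<And>i. i \<in> D ==> length (bs i) = d i ^ l i * m i + 1"
 shows "pt N D Xi (%i. ep (enc_vec) enc_blk (expl.merge_blocks (F i) (d i) (B i) (u i) (tow i) (C i) (bs i)))"
proof -
 note T' = ptTD[OF T]
 note f = T'(1)
 note E = fldD(1)[OF f]
 obtain b where b: "pb N D b" "\<And>i x. i \<in> D ==> x \<in> carrier (F i) ==> size (enc_elem x) \<le> b i"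
  by (rule fld_sz[OF f]) blast
 define M where "M = (%i. d i ^ l i * m i)"
 have bsM: "length (snd b) = M i \<and> set (snd b) \<subseteq> carrier (F i)" if "i \<in> D" "b \<in> set (bs i)" for i b
  using sh[OF that] unfolding expl.shape_def[OF E[OF that(1)]] M_def by blast
 have bsm: "fst (snd x) \<in> carrier (F i)" if "i \<in> D" "b \<in> set (bs i)" "x \<in> set (fst b)" for i b x
  using sh[OF that(1,2)] that(3) unfolding expl.shape_def[OF E[OF that(1)]] by blast
 have vs: "pt N D Xi (%i. enc_list (enc_vec) (map snd (bs i)))"
 proof (rule pt_map[OF bs], goal_cases)
  case (1 Y) show ?case by (rule pt_snd[OF 1(3)])
 qed
 define \<alpha>s where "\<alpha>s = (%i. expl.nullvec (F i) (map snd (bs i)))"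
 have \<alpha>: "pt N D Xi (%i. enc_vec (\<alpha>s i))" unfolding \<alpha>s_def
 proof (rule pt_nullvec[OF f vs, where M = M])
  fix i v assume i: "i \<in> D" "v \<in> set (map snd (bs i))"
  obtain b where "b \<in> set (bs i)" "v = snd b" using i(2) unfolding set_map by blast
  then show "length v = M i \<and> set v \<subseteq> carrier (F i)" using bsM[OF i(1)] by blast
 qed (simp add: len M_def)
 have ac: "length (\<alpha>s i) = length (bs i)" "set (\<alpha>s i) \<subseteq> carrier (F i)" if i: "i \<in> D" for i
  unfolding \<alpha>s_def using expl.merge_shape(5,6)[OF E[OF i] _ _ T'(7)[OF i] sh[OF i] len[OF i], of "[]"] by simp_all
 define z where "z = (%i. expl.decs (F i) (d i) (B i) (u i) (tow i) (C i) (\<alpha>s i))"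
 have zp: "pt N D Xi (%i. ep (enc_vec) (enc_list enc_o) (z i))" unfolding z_def by (rule pt_decs[OF T C Cc \<alpha> ac(2)])
 have zc: "length (snd (z i)) = length (bs i)" "\<And>o' e g. o' \<in> set (snd (z i)) ==> o' = Some (e, g) ==> g \<in> carrier (F i)" if i: "i \<in> D" for i
  using expl.decs_carrier[OF E[OF i] _ ac(2)[OF i] T'(7)[OF i], of "C i" "d i" "B i" "u i"] Cc[OF i] ac(1)[OF i] unfolding z_def by metis+
 define ws where "ws = (%i. zip (snd (z i)) (bs i))"
 have wp: "pt N D Xi (%i. enc_list (ep enc_o enc_blk) (ws i))" unfolding ws_def
  by (rule pt_zip, rule pt_snd[OF zp], rule bs, rule zc(1))
 have ww: "snd w \<in> set (bs i)" "\<And>e g. fst w = Some (e, g) ==> g \<in> carrier (F i)" if i: "i \<in> D" "w \<in> set (ws i)" for i w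
 proof -
  have w: "(fst w, snd w) \<in> set (zip (snd (z i)) (bs i))" using i(2) unfolding ws_def by simp
  show "snd w \<in> set (bs i)" by (rule set_zip_rightD[OF w])
  show "g \<in> carrier (F i)" if "fst w = Some (e, g)" for e g by (rule zc(2)[OF i(1) set_zip_leftD[OF w] that])
 qed
 have mem: "pt N D Xi (%i. enc_list enc_mem (concat (map (%w. expl.new_members (F i) (fst w) (snd w)) (ws i))))"
 proof (rule pt_concat, rule pt_map[OF wp], goal_cases)
  case (1 Y)
  let ?E = "{(i, x). i \<in> D \<and> x \<in> set (ws i)}"
  have D: "\<And>z. z \<in> ?E ==> fst z \<in> D" by auto
  have D2: "\<And>z. z \<in> ?E ==> snd z \<in> set (ws (fst z))" by auto
  show ?case
  proof (rule pt_new_members[OF fld_lift[OF f 1(1) D] pt_fst[OF 1(3)] pt_snd[OF 1(3)]])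
   show "g \<in> carrier (F (fst z))" if "z \<in> ?E" "fst (snd z) = Some (e, g)" for z e g
    by (rule ww(2)[OF D[OF that(1)] D2[OF that(1)] that(2)])
   show "fst (snd x) \<in> carrier (F (fst z))" if "z \<in> ?E" "x \<in> set (fst (snd (snd z)))" for z x
    by (rule bsm[OF D[OF that(1)] ww(1)[OF D[OF that(1)] D2[OF that(1)]] that(2)])
  qed
 qed
 have ne: "bs i \<noteq> []" if "i \<in> D" for i using len[OF that] by auto
 have zv: "pt N D Xi (%i. enc_vec (map (%_. \<zero>\<^bsub>F i\<^esub>) (snd (hd (bs i)))))"
 proof (rule pt_map[OF pt_snd[OF pt_hd[OF bs ne]]], goal_cases)
  case (1 i) then show ?case .
 next
  case (2 Y) show ?case by (rule 2(1), rule ptFD(1)[OF ptF_zero[OF f]])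
 qed
 have hdM: "length (snd (hd (bs i))) = M i" if "i \<in> D" for i using bsM[OF that hd_in_set[OF ne[OF that]]] by (rule conjunct1)
 have pM: "pb N D M"
 proof -
  have "pb N D (%i. length (map (%_. \<zero>\<^bsub>F i\<^esub>) (snd (hd (bs i)))))" by (rule pt_length_bound[OF zv])
  then show ?thesis by (rule pb_le) (simp add: hdM)
 qed
 let ?row = "%i e. foldl (%s w. expl.vadd (F i) s (expl.new_part (F i) (d i) e (fst w) (snd w))) (map (%_. \<zero>\<^bsub>F i\<^esub>) (snd (hd (bs i)))) (ws i)"
 have vec: "pt N D Xi (%i. enc_vec (concat (map (?row i) [0..<d i])))"
 proof (rule pt_concat, rule pt_map[OF T'(3)], goal_cases)
  case (1 Y)
  let ?E = "{(i, x). i \<in> D \<and> x \<in> set [0..<d i]}"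
  have D: "\<And>z. z \<in> ?E ==> fst z \<in> D" by auto
  note f1 = fld_lift[OF f 1(1) D]
  let ?Inv = "%z (j :: nat) s. length s = M (fst z) \<and> set s \<subseteq> carrier (F (fst z))"
  have np: "length (expl.new_part (F i) (d i) e (fst w) (snd w)) = M i \<and> set (expl.new_part (F i) (d i) e (fst w) (snd w)) \<subseteq> carrier (F i)"
   if i: "i \<in> D" "w \<in> set (ws i)" for i e w
  proof -
   interpret ex: expl "p i" "k i" "F i" by (rule E[OF i(1)])
   note M = bsM[OF i(1) ww(1)[OF i]]
   show ?thesis
   proof (cases "fst w")
    case None then show ?thesis using M by (auto simp: ex.new_part_def)
   next
    case (Some y)
    have "snd y \<in> carrier (F i)" using ww(2)[OF i, of "fst y" "snd y"] Some by simp
    then show ?thesis using M Some by (auto simp: ex.new_part_def)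
   qed
  qed
  have va: "length (expl.vadd (F i) x y) = M i \<and> set (expl.vadd (F i) x y) \<subseteq> carrier (F i)"
   if i: "i \<in> D" and x: "length x = M i \<and> set x \<subseteq> carrier (F i)" and y: "length y = M i \<and> set y \<subseteq> carrier (F i)" for i x y
  proof -
   interpret ex: expl "p i" "k i" "F i" by (rule E[OF i])
   have c: "a \<in> carrier (F i) \<and> b \<in> carrier (F i)" if "(a, b) \<in> set (zip x y)" for a b
    using set_zip_leftD[OF that] set_zip_rightD[OF that] x y by blast
   show ?thesis unfolding ex.vadd_def using x y by (auto dest: c)
  qed
  have "pt (on_fst N) ?E Y (%z. enc_vec (foldl (%s w. expl.vadd (F (fst z)) s (expl.new_part (F (fst z)) (d (fst z)) (snd z) (fst w) (snd w)))
    (map (%_. \<zero>\<^bsub>F (fst z)\<^esub>) (snd (hd (bs (fst z))))) (ws (fst z))))"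
  proof (rule pt_fold[OF 1(1)[OF wp] _ _ _ _ _ refl, where Inv = ?Inv and b = "%z. M (fst z) * (b (fst z) + 1)"], goal_cases)
   case 1 show ?case by (rule \<open>\<And>A. pt N D Xi A ==> pt (on_fst N) ?E Y (on_fst A)\<close>[OF zv])
  next
   case (2 z)
   interpret ex: expl "p (fst z)" "k (fst z)" "F (fst z)" by (rule E[OF D[OF 2]])
   show ?case using hdM[OF D[OF 2]] by auto
  next
   case (3 z j s)
   show ?case by (rule va[OF D[OF 3(1)] 3(3) np[OF D[OF 3(1)] nth_mem[OF 3(2)]]])
  next
   case 4
   have "pb N D (%i. M i * (b i + 1))" by (intro pb_add pb_mult pb_const pM b(1))
   then show ?case by (rule pb_reindex) (rule D)
  next
   case (5 z j s)
   have "size (enc_vec s) \<le> length s * (b (fst z) + 1)"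
    by (rule size_enc_list_le) (use 5(3) b(2)[OF D[OF 5(1)]] in blast)
   then show ?case using 5(3) by simp
  next
   case (6 Y')
   let ?E' = "{(i, s, x). i \<in> ?E \<and> (\<exists>j<length (ws (fst i)). x = ws (fst i) ! j \<and> ?Inv i j s)}"
   have D1: "\<And>y. y \<in> ?E' ==> fst y \<in> ?E" by auto
   have D2: "fst (fst y) \<in> D" if "y \<in> ?E'" for y by (rule D[OF D1[OF that]])
   have D3: "snd (snd y) \<in> set (ws (fst (fst y)))" if "y \<in> ?E'" for y using that by auto
   have D4: "length (fst (snd y)) = M (fst (fst y)) \<and> set (fst (snd y)) \<subseteq> carrier (F (fst (fst y)))" if "y \<in> ?E'" for y using that by auto
   note f2 = fld_lift[OF f1 6(1) D1]
   have pp: "pt (%z. N (fst (fst z))) ?E' Y' (%z. enc_vec (expl.new_part (F (fst (fst z))) (d (fst (fst z))) (snd (fst z)) (fst (snd (snd z))) (snd (snd (snd z)))))"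
   proof (rule pt_new_part[OF f2 6(1)[OF 1(1)[OF T'(2)]] 6(1)[OF 1(3)] pt_fst[OF 6(4)] pt_snd[OF 6(4)]])
    show "g \<in> carrier (F (fst (fst y)))" if "y \<in> ?E'" "fst (snd (snd y)) = Some (e, g)" for y e g
     by (rule ww(2)[OF D2[OF that(1)] D3[OF that(1)] that(2)])
    show "set (snd (snd (snd (snd y)))) \<subseteq> carrier (F (fst (fst y)))" if "y \<in> ?E'" for y
     using bsM[OF D2[OF that] ww(1)[OF D2[OF that] D3[OF that]]] by (rule conjunct2)
   qed
   show ?case
   proof (rule pt_vadd[OF f2 6(3) pp])
    fix y assume y: "y \<in> ?E'"
    show "length (fst (snd y)) = length (expl.new_part (F (fst (fst y))) (d (fst (fst y))) (snd (fst y)) (fst (snd (snd y))) (snd (snd (snd y)))) \<and>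
     set (fst (snd y)) \<subseteq> carrier (F (fst (fst y))) \<and> set (expl.new_part (F (fst (fst y))) (d (fst (fst y))) (snd (fst y)) (fst (snd (snd y))) (snd (snd (snd y)))) \<subseteq> carrier (F (fst (fst y)))"
     using D4[OF y] np[OF D2[OF y] D3[OF y], of "snd (fst y)"] by simp
   qed
  qed
  then show ?case .
 qed
 have "pt N D Xi (%i. ep (enc_vec) enc_blk (fst (z i), (concat (map (%w. expl.new_members (F i) (fst w) (snd w)) (ws i)), concat (map (?row i) [0..<d i]))))"
  by (rule pt_pair, rule pt_fst[OF zp], rule pt_pair, rule mem, rule vec)
 then show ?thesis by (rule pt_cong) (simp add: expl.merge_blocks_def[OF E] Let_def z_def ws_def \<alpha>s_def)
qed

lemma pt_chunks:
 assumes f: "fld N D Xi p k F" and bs: "pt N D Xi (%i. enc_list enc_blk (bs i))"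
 shows "pt N D Xi (%i. enc_list (enc_list enc_blk) (expl.chunks (bs i)))"
proof -
 let ?E = "ep (enc_list enc_blk) (enc_list (enc_list enc_blk))"
 let ?g = "%s b. if length (fst s) = length (snd b) then ([], rev (b # fst s) # snd s) else (b # fst s, snd s)"
 \<comment> \<open>Closing a group costs one extra list node, at most once per block read; this is
   the summand \<open>j\<close>.\<close>
 let ?Inv = "%i j s. size (enc_list enc_blk (fst s)) + size (enc_list (enc_list enc_blk) (snd s)) \<le> size (enc_list enc_blk (take j (bs i))) + j"
 let ?b = "%i. size (enc_list enc_blk (bs i)) + length (bs i) + 1"
 have "pt N D Xi (%i. ?E (foldl ?g ([], []) (bs i)))"
 proof (rule pt_fold[OF bs _ _ _ _ _ refl, where Inv = ?Inv and b = ?b], goal_cases)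
  case 1 show ?case by (rule pt_pair; rule pt_Nil, rule pt_self[OF bs])
 next
  case (2 i) show ?case by simp
 next
  case (3 i j s)
  then show ?case by (simp add: take_Suc_nth size_enc_list_append size_enc_list_rev del: rev.simps)
 next
  case 4 show ?case by (intro pb_add pb_const pt_size[OF bs] pt_length_bound[OF bs])
 next
  case (5 i j s)
  then show ?case using size_enc_list_take[of enc_blk j "bs i"] by (simp add: size_ep)
 next
  case (6 Y)
  note s1 = pt_fst[OF 6(3)] and s2 = pt_snd[OF 6(3)]
  show ?case
   by (rule pt_if'[where e = ?E], rule pt_eq, rule pt_length, rule s1, rule pt_length, rule pt_snd[OF 6(4)],
     rule pt_pair, rule pt_Nil, rule 6(2), rule pt_Cons, rule pt_rev, rule pt_Cons, rule 6(4), rule s1, rule s2,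
     rule pt_pair, rule pt_Cons, rule 6(4), rule s1, rule s2)
 qed
 then have "pt N D Xi (%i. enc_list (enc_list enc_blk) (rev (snd (foldl ?g ([], []) (bs i)))))"
  by (intro pt_rev) (rule pt_snd)
 then show ?thesis by (rule pt_cong) (simp add: expl.chunks_def[OF fldD(1)[OF f]])
qed

lemma (in expl) chunk_shape:
 assumes "\<And>b. b \<in> set bs ==> shape d m i b" and c: "ch \<in> set (chunks bs)"
 shows "length ch = d ^ i * m + 1 \<and> (\<forall>b\<in>set ch. shape d m i b)"
proof
 have l: "length (snd b) = d ^ i * m" if "b \<in> set bs" for b using assms(1)[OF that] by (simp add: shape_def)
 show "length ch = d ^ i * m + 1" by (rule chunks_props(2)[OF l]) (use c in auto)
 obtain rest where r: "bs = concat (chunks bs) @ rest" using chunks_props(1)[OF l] by blast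
 show "\<forall>b\<in>set ch. shape d m i b"
 proof
  fix b assume "b \<in> set ch"
  then have "b \<in> set (concat (chunks bs) @ rest)" using c by auto
  then show "shape d m i b" using assms(1) r by simp
 qed
qed

lemma (in expl) jlist_chunks:
 assumes "\<And>b. b \<in> set bs ==> shape d m i b"
 shows "subseq (jlist (concat (take j (chunks bs)))) (jlist bs)"
proof -
 have l: "length (snd b) = d ^ i * m" if "b \<in> set bs" for b using assms(1)[OF that] by (simp add: shape_def)
 obtain rest where r: "bs = concat (chunks bs) @ rest" using chunks_props(1)[OF l] by blast
 have "concat (chunks bs) = concat (take j (chunks bs)) @ concat (drop j (chunks bs))"
  by (metis append_take_drop_id concat_append)
 then have "bs = concat (take j (chunks bs)) @ (concat (drop j (chunks bs)) @ rest)" using r by simp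
 then have "jlist bs = jlist (concat (take j (chunks bs))) @ jlist (concat (drop j (chunks bs)) @ rest)" by (metis jlist_append)
 then show ?thesis by (metis subseq_rev_drop_many subseq_order.order_refl)
qed

lemma jlist_block: "b \<in> set bs ==> length (fst b) \<le> length (jlist bs) \<and> (\<forall>x\<in>set (fst b). fst x \<in> set (jlist bs))"
proof -
 assume "b \<in> set bs"
 then obtain as cs where "bs = as @ b # cs" using split_list by fast
 then show ?thesis by (simp add: jlist_def)
qed

text \<open>The first summand is for \<open>d + 1\<close> representatives of size \<open>c\<close>.
  In the second, \<open>J\<close> bounds the number of blocks, the number of members of a block and
  the size of an index; \<open>i\<close> is the length of the labels, whose entries are at most
  \<open>d\<close>, and \<open>M\<close> is the dimension of the vectors.\<close>

definition blk_bound :: "nat \<Rightarrow> nat \<Rightarrow> nat \<Rightarrow> nat \<Rightarrow> nat \<Rightarrow> nat" where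
 "blk_bound J c i d M = (d + 1) * (c + 1) + J * (J * (J + c + i * (2 * d + 1) + 3) + M * (c + 1) + 2) + 1"

lemma blk_bound_mono: "i \<le> i' ==> M \<le> M' ==> blk_bound J c i d M \<le> blk_bound J c i' d M'"
 unfolding blk_bound_def by (intro add_le_mono mult_le_mono le_refl) simp_all

lemma pb_blk_bound: "pb N D J ==> pb N D c ==> pb N D l ==> pb N D d ==> pb N D M ==> pb N D (%i. blk_bound (J i) (c i) (l i) (d i) (M i))"
 unfolding blk_bound_def by (intro pb_add pb_mult pb_const)

text \<open>The input indices form a subsequence of \<open>js\<close>, so a block has at most as
  many members as \<open>js\<close> has entries, and every index is an entry of \<open>js\<close>.
  This is why merging does not blow up the state.\<close>

lemma (in expl) size_enc_state:
 assumes c: "\<And>x. x \<in> carrier F ==> size (enc_elem x) \<le> c"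
  and C: "set (fst s) \<subseteq> carrier F" "length (fst s) \<le> d + 1" and sh: "\<And>b. b \<in> set (snd s) ==> shape d m i b"
  and J: "length (snd s) \<le> J" "size (enc_elem js) \<le> J" and ss: "subseq (jlist (snd s)) js"
 shows "size (enc_state s) \<le> blk_bound J c i d (d ^ i * m)"
proof -
 have 1: "size (enc_vec (fst s)) \<le> (d + 1) * (c + 1)"
 proof -
  have "size (enc_vec (fst s)) \<le> length (fst s) * (c + 1)" by (rule size_enc_list_le) (use C c in blast)
  also have "\<dots> \<le> (d + 1) * (c + 1)" by (rule mult_le_mono1[OF C(2)])
  finally show ?thesis .
 qed
 have blk: "size (enc_blk b) \<le> J * (J + c + i * (2 * d + 1) + 3) + d ^ i * m * (c + 1) + 1" if b: "b \<in> set (snd s)" for b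
 proof -
  have S: "length (snd b) = d ^ i * m" "set (snd b) \<subseteq> carrier F"
   "\<And>x. x \<in> set (fst b) ==> fst (snd x) \<in> carrier F \<and> length (snd (snd x)) = i \<and> set (snd (snd x)) \<subseteq> {..d}"
   using sh[OF b] unfolding shape_def by blast+
  have l: "length (fst b) \<le> J" using jlist_block[OF b] list_emb_length[OF ss] length_le_size_enc_list[of js enc_nat] J(2) by linarith
  have j: "size (enc_nat (fst x)) \<le> J" if "x \<in> set (fst b)" for x
  proof -
   have "fst x \<in> set (jlist (snd s))" using jlist_block[OF b] that by blast
   then have "fst x \<in> set js" using list_emb_set[OF ss] by metis
   then show ?thesis using size_mem_enc_list[of "fst x" js enc_nat] J(2) by linarith
  qed
  have "size (enc_mem x) \<le> J + c + i * (2 * d + 1) + 2" if x: "x \<in> set (fst b)" for x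
  proof -
   have "size (enc_elem (snd (snd x))) \<le> length (snd (snd x)) * (2 * d + 1)"
   proof (rule size_enc_list_le)
    fix e assume "e \<in> set (snd (snd x))"
    then have "e \<le> d" using S(3)[OF x] by blast
    then show "size (enc_nat e) \<le> 2 * d" using size_enc_nat_le_nat[of e] by linarith
   qed
   then have "size (enc_elem (snd (snd x))) \<le> i * (2 * d + 1)" using S(3)[OF x] by simp
   moreover have "size (enc_elem (fst (snd x))) \<le> c" using S(3)[OF x] c by blast
   ultimately show ?thesis using j[OF x] unfolding size_ep by linarith
  qed
  then have "size (enc_list enc_mem (fst b)) \<le> length (fst b) * (J + c + i * (2 * d + 1) + 2 + 1)" by (rule size_enc_list_le)
  also have "\<dots> \<le> J * (J + c + i * (2 * d + 1) + 3)" using l by (intro mult_le_mono) simp_all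
  finally have 2: "size (enc_list enc_mem (fst b)) \<le> J * (J + c + i * (2 * d + 1) + 3)" .
  have "size (enc_vec (snd b)) \<le> length (snd b) * (c + 1)" by (rule size_enc_list_le) (use S(2) c in blast)
  then show ?thesis using 2 unfolding size_ep S(1) by linarith
 qed
 have "size (enc_list enc_blk (snd s)) \<le> length (snd s) * (J * (J + c + i * (2 * d + 1) + 3) + d ^ i * m * (c + 1) + 1 + 1)"
  by (rule size_enc_list_le) (rule blk)
 also have "\<dots> \<le> J * (J * (J + c + i * (2 * d + 1) + 3) + d ^ i * m * (c + 1) + 2)" using J(1) by (intro mult_le_mono) simp_all
 finally show ?thesis using 1 unfolding size_ep blk_bound_def by linarith
qed

lemma pt_jlist:
 assumes "pt N D Xi (%i. enc_list enc_blk (bs i))"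
 shows "pt N D Xi (%i. enc_elem (jlist (bs i)))"
 unfolding jlist_def
proof (rule pt_concat, rule pt_map[OF assms], goal_cases)
 case (1 Y)
 show ?case
 proof (rule pt_map[OF pt_fst[OF 1(3)]], goal_cases)
  case (1 Y') show ?case by (rule pt_fst[OF 1(3)])
 qed
qed

text \<open>The loop invariant is equality with the partial fold \<open>st i j\<close>; all size
  information about it then comes from \<open>level_chunks\<close>. The bound on the new dimension
  is a premise, because it is not polynomial in \<open>d\<close> and \<open>m\<close> alone.\<close>

lemma pt_level:
 assumes T: "ptT N D Xi p k F d B u tow" and s: "pt N D Xi (%i. enc_state (s i))"
  and sc: "\<And>i. i \<in> D ==> set (fst (s i)) \<subseteq> carrier (F i) \<and> length (fst (s i)) \<le> d i + 1"
  and sh: "\<And>i b. i \<in> D ==> b \<in> set (snd (s i)) ==> expl.shape (F i) (d i) (m i) (l i) b"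
  and l: "pb N D l" and M: "pb N D (%i. d i ^ Suc (l i) * m i)"
 shows "pt N D Xi (%i. enc_state (expl.level (F i) (d i) (B i) (u i) (tow i) (s i)))"
proof -
 note T' = ptTD[OF T]
 note f = T'(1)
 note E = fldD(1)[OF f]
 obtain c where c: "pb N D c" "\<And>i x. i \<in> D ==> x \<in> carrier (F i) ==> size (enc_elem x) \<le> c i"
  by (rule fld_sz[OF f]) blast
 have pd: "pb N D d" using pt_length_bound[OF T'(3)] by simp
 define chs where "chs = (%i. expl.chunks (snd (s i)))"
 have ch: "pt N D Xi (%i. enc_list (enc_list enc_blk) (chs i))" unfolding chs_def by (rule pt_chunks[OF f pt_snd[OF s]])
 have cs: "length y = d i ^ l i * m i + 1 \<and> (\<forall>b\<in>set y. expl.shape (F i) (d i) (m i) (l i) b)" if "i \<in> D" "y \<in> set (chs i)" for i y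
  by (rule expl.chunk_shape[OF E[OF that(1)] sh[OF that(1)]]) (use that(2) in \<open>simp_all add: chs_def\<close>)
 define st where "st = (%i j. foldl (expl.level_step (F i) (d i) (B i) (u i) (tow i)) (fst (s i), []) (take j (chs i)))"
 have lc: "set (fst (st i j)) \<subseteq> carrier (F i) \<and> length (fst (st i j)) \<le> d i + 1 \<and>
  length (snd (st i j)) \<le> length (chs i) \<and> (\<forall>b\<in>set (snd (st i j)). expl.shape (F i) (d i) (m i) (Suc (l i)) b) \<and>
  subseq (jlist (snd (st i j))) (jlist (snd (s i)))" if i: "i \<in> D" for i j
 proof -
  interpret ex: expl "p i" "k i" "F i" by (rule E[OF i])
  have C: "set (fst (s i)) \<subseteq> carrier (F i)" "length (fst (s i)) \<le> d i + 1" using sc[OF i] by blast+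
  have c1: "y \<in> set (take j (chs i)) ==> length y = d i ^ l i * m i + 1 \<and> (\<forall>b\<in>set y. ex.shape (d i) (m i) (l i) b)" for y
   using cs[OF i] in_set_takeD by fast
  have stj: "st i j = foldl (ex.level_step (d i) (B i) (u i) (tow i)) (fst (s i), []) (take j (chs i))" by (simp add: st_def)
  have L: "set (fst (st i j)) \<subseteq> carrier (F i) \<and> length (fst (st i j)) \<le> d i + 1 \<and>
   prefix (fst (s i)) (fst (st i j)) \<and> length (snd (st i j)) = length (take j (chs i)) \<and>
   (\<forall>b\<in>set (snd (st i j)). ex.shape (d i) (m i) (Suc (l i)) b) \<and> subseq (jlist (snd (st i j))) (jlist (concat (take j (chs i))))"
   unfolding stj by (rule ex.level_chunks[OF C T'(7)[OF i]]) (rule c1)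
  have "subseq (jlist (concat (take j (chs i)))) (jlist (snd (s i)))" unfolding chs_def by (rule ex.jlist_chunks[OF sh[OF i]])
  moreover have "subseq (jlist (snd (st i j))) (jlist (concat (take j (chs i))))" using L by (elim conjE)
  ultimately have "subseq (jlist (snd (st i j))) (jlist (snd (s i)))" by (rule subseq_order.trans[rotated])
  moreover have "length (take j (chs i)) \<le> length (chs i)" by simp
  ultimately show ?thesis using L by (elim conjE) (intro conjI; (assumption | simp))
 qed
 let ?ls = "%i. expl.level_step (F i) (d i) (B i) (u i) (tow i)"
 let ?J = "%i. size (enc_elem (jlist (snd (s i)))) + length (chs i)"
 let ?Inv = "%i j t. t = st i j"
 have "pt N D Xi (%i. enc_state (foldl (?ls i) (fst (s i), []) (chs i)))"
 proof (rule pt_fold[OF ch _ _ _ _ _ refl, where Inv = ?Inv and b = "%i. blk_bound (?J i) (c i) (Suc (l i)) (d i) (d i ^ Suc (l i) * m i)"], goal_cases)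
  case 1 show ?case by (rule pt_pair, rule pt_fst[OF s], rule pt_Nil, rule pt_self[OF s])
 next
  case (2 i) show ?case by (simp add: st_def)
 next
  case (3 i j t) then show ?case by (simp add: st_def take_Suc_nth)
 next
  case 4 show ?case by (intro pb_blk_bound pb_add pb_Suc c(1) l pd M pt_size[OF pt_jlist[OF pt_snd[OF s]]] pt_length_bound[OF ch])
 next
  case (5 i j t)
  show ?case unfolding 5(3)
   by (rule expl.size_enc_state[OF E[OF 5(1)] c(2)[OF 5(1)], where js = "jlist (snd (s i))"]) (use lc[OF 5(1), of j] in simp_all)
 next
  case (6 Y)
  let ?D = "{(i, t, x). i \<in> D \<and> (\<exists>j<length (chs i). x = chs i ! j \<and> ?Inv i j t)}"
  have D: "\<And>z. z \<in> ?D ==> fst z \<in> D" by auto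
  have D2: "snd (snd z) \<in> set (chs (fst z))" if "z \<in> ?D" for z using that by auto
  have D3: "\<exists>j. fst (snd z) = st (fst z) j" if "z \<in> ?D" for z using that by auto
  have mg: "pt (on_fst N) ?D Y (%z. ep (enc_vec) enc_blk (expl.merge_blocks (F (fst z)) (d (fst z)) (B (fst z)) (u (fst z)) (tow (fst z)) (fst (fst (snd z))) (snd (snd z))))"
  proof (rule pt_merge_blocks[OF ptT_lift[OF T 6(1) D] pt_fst[OF 6(3)] _ 6(4), where m = "%z. m (fst z)" and l = "%z. l (fst z)"])
   fix z assume z: "z \<in> ?D"
   obtain j where j: "fst (snd z) = st (fst z) j" using D3[OF z] by blast
   show "set (fst (fst (snd z))) \<subseteq> carrier (F (fst z)) \<and> length (fst (fst (snd z))) \<le> d (fst z) + 1"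
    unfolding j using lc[OF D[OF z], of j] by simp
   show "length (snd (snd z)) = d (fst z) ^ l (fst z) * m (fst z) + 1" using cs[OF D[OF z] D2[OF z]] by (rule conjunct1)
   show "expl.shape (F (fst z)) (d (fst z)) (m (fst z)) (l (fst z)) b" if "b \<in> set (snd (snd z))" for b
    using cs[OF D[OF z] D2[OF z]] that by blast
  qed
  have "pt (on_fst N) ?D Y (%z. enc_state (fst (expl.merge_blocks (F (fst z)) (d (fst z)) (B (fst z)) (u (fst z)) (tow (fst z)) (fst (fst (snd z))) (snd (snd z))),
    snd (fst (snd z)) @ [snd (expl.merge_blocks (F (fst z)) (d (fst z)) (B (fst z)) (u (fst z)) (tow (fst z)) (fst (fst (snd z))) (snd (snd z)))]))"
   by (rule pt_pair, rule pt_fst[OF mg], rule pt_append, rule pt_snd[OF 6(3)], rule pt_Cons, rule pt_snd[OF mg], rule pt_Nil, rule 6(2))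
  then show ?case by (rule pt_cong) (simp add: expl.level_step_def[OF E[OF D]])
 qed
 then show ?thesis by (rule pt_cong) (simp add: expl.level_def[OF E] chs_def)
qed

lemma pt_init_blocks:
 assumes f: "fld N D Xi p k F" and vs: "pt N D Xi (%i. enc_list (enc_vec) (vs i))"
 shows "pt N D Xi (%i. enc_list enc_blk (expl.init_blocks (F i) (vs i)))"
proof -
 have "pt N D Xi (%i. enc_list enc_blk (map (%z. ([(fst z + 1, \<one>\<^bsub>F i\<^esub>, [])], snd z)) (zip [0..<length (vs i)] (vs i))))"
 proof (rule pt_map[OF pt_enumerate[OF vs]], goal_cases)
  case (1 Y)
  show ?case
   by (rule pt_pair, rule pt_Cons, rule pt_pair, rule pt_add, rule pt_fst[OF 1(3)], rule pt_nat_const, rule 1(2),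
     rule pt_pair, rule 1(1), rule ptFD(1)[OF ptF_one[OF f]], rule pt_Nil, rule 1(2), rule pt_Nil, rule 1(2), rule pt_snd[OF 1(3)])
 qed
 then show ?thesis by (rule pt_cong) (simp add: expl.init_blocks_def[OF fldD(1)[OF f]])
qed

lemma pt_run_levels:
 assumes T: "ptT N D Xi p k F d B u tow" and vs: "pt N D Xi (%i. enc_list (enc_vec) (vs i))"
  and vc: "\<And>i w. i \<in> D ==> w \<in> set (vs i) ==> length w = m i \<and> set w \<subseteq> carrier (F i)"
  and d0: "\<And>i. i \<in> D ==> d i > 0" and M: "pb N D (%i. d i ^ d i * m i)"
 shows "pt N D Xi (%i. enc_state (expl.run_levels (F i) (d i) (B i) (u i) (tow i) (vs i)))"
proof -
 note T' = ptTD[OF T]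
 note f = T'(1)
 note E = fldD(1)[OF f]
 obtain c where c: "pb N D c" "\<And>i x. i \<in> D ==> x \<in> carrier (F i) ==> size (enc_elem x) \<le> c i"
  by (rule fld_sz[OF f]) blast
 have pd: "pb N D d" using pt_length_bound[OF T'(3)] by simp
 define st where "st = (%i j. expl.run_prefix (F i) (d i) (B i) (u i) (tow i) (vs i) j)"
 have S: "set (fst (st i j)) \<subseteq> carrier (F i) \<and> length (fst (st i j)) \<le> d i + 1 \<and> (\<forall>b\<in>set (snd (st i j)). expl.shape (F i) (d i) (m i) j b) \<and>
  subseq (jlist (snd (st i j))) [1..<length (vs i) + 1] \<and> length (snd (st i j)) \<le> length (vs i)" if "i \<in> D" for i j
  using expl.run_shape[OF E[OF that] vc[OF that] T'(7)[OF that], of "vs i" "d i" "B i" "u i" j] unfolding st_def by blast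
 let ?J = "%i. size (enc_elem [1..<length (vs i) + 1]) + length (vs i)"
 let ?Inv = "%i j t. t = st i j"
 have up: "pt N D Xi (%i. enc_elem [1..<length (vs i) + 1])" using pt_upt1[OF pt_upt_length[OF vs]] by simp
 have pw: "d i ^ j * m i \<le> d i ^ d i * m i" if "i \<in> D" "j \<le> d i" for i j
  using power_increasing[OF that(2), of "d i"] d0[OF that(1)] by simp
 have "pt N D Xi (%i. enc_state (foldl (%s (_ :: nat). expl.level (F i) (d i) (B i) (u i) (tow i) s) ([], expl.init_blocks (F i) (vs i)) [0..<d i]))"
 proof (rule pt_fold[OF T'(3) _ _ _ _ _ refl, where Inv = ?Inv and b = "%i. blk_bound (?J i) (c i) (d i) (d i) (d i ^ d i * m i)"], goal_cases)
  case 1 show ?case by (rule pt_pair, rule pt_Nil, rule pt_self[OF vs], rule pt_init_blocks[OF f vs])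
 next
  case (2 i) then show ?case unfolding st_def by (simp add: expl.run_prefix_0[OF E])
 next
  case (3 i j t) then show ?case unfolding st_def by (simp add: expl.run_prefix_Suc[OF E])
 next
  case 4 show ?case by (intro pb_blk_bound pb_add c(1) pd M pt_size[OF up] pt_length_bound[OF vs])
 next
  case (5 i j t)
  have j: "j \<le> d i" using 5(2) by simp
  have "size (enc_state (st i j)) \<le> blk_bound (?J i) (c i) j (d i) (d i ^ j * m i)"
   by (rule expl.size_enc_state[OF E[OF 5(1)] c(2)[OF 5(1)], where js = "[1..<length (vs i) + 1]"]) (use S[OF 5(1), of j] in \<open>simp_all del: upt_Suc\<close>)
  also have "\<dots> \<le> blk_bound (?J i) (c i) (d i) (d i) (d i ^ d i * m i)" by (rule blk_bound_mono[OF j pw[OF 5(1) j]])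
  finally show ?case unfolding 5(3) .
 next
  case (6 Y)
  let ?D = "{(i, t, x). i \<in> D \<and> (\<exists>j<length [0..<d i]. x = [0..<d i] ! j \<and> ?Inv i j t)}"
  have D: "\<And>z. z \<in> ?D ==> fst z \<in> D" by auto
  have D2: "snd (snd z) < d (fst z) \<and> fst (snd z) = st (fst z) (snd (snd z))" if "z \<in> ?D" for z using that by auto
  show ?case
  proof (rule pt_level[OF ptT_lift[OF T 6(1) D] 6(3), where m = "%z. m (fst z)" and l = "%z. snd (snd z)"])
   fix z assume z: "z \<in> ?D"
   have e: "fst (snd z) = st (fst z) (snd (snd z))" using D2[OF z] by blast
   note S' = S[OF D[OF z], of "snd (snd z)"]
   show "set (fst (fst (snd z))) \<subseteq> carrier (F (fst z)) \<and> length (fst (fst (snd z))) \<le> d (fst z) + 1"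
    unfolding e using S' by blast
   show "expl.shape (F (fst z)) (d (fst z)) (m (fst z)) (snd (snd z)) b" if "b \<in> set (snd (fst (snd z)))" for b
    using S' that unfolding e by blast
  next
   have "pb (on_fst N) ?D (on_fst d)" by (rule pb_reindex[OF pd D])
   then show "pb (on_fst N) ?D (%z. snd (snd z))" by (rule pb_le) (use D2 less_imp_le in blast)
   have "pb (on_fst N) ?D (%z. d (fst z) ^ d (fst z) * m (fst z))" by (rule pb_reindex[OF M D])
   then show "pb (on_fst N) ?D (%z. d (fst z) ^ Suc (snd (snd z)) * m (fst z))"
   proof (rule pb_le)
    fix z assume z: "z \<in> ?D"
    then have "Suc (snd (snd z)) \<le> d (fst z)" using D2[OF z] by simp
    then show "d (fst z) ^ Suc (snd (snd z)) * m (fst z) \<le> d (fst z) ^ d (fst z) * m (fst z)" by (rule pw[OF D[OF z]])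
   qed
  qed
 qed
 then show ?thesis by (rule pt_cong) (simp add: expl.run_levels_def[OF E])
qed

section \<open>Computable forms of the rearrangement notions, and the choice of the two index
  sets\<close>

definition flags :: "nat list \<Rightarrow> bool list" where
 "flags es = snd (foldl (%s x. (x # fst s, snd s @ [x \<notin> set (fst s)])) ([], []) es)"

definition tuple_rank :: "nat list \<Rightarrow> nat" where
 "tuple_rank es = length (filter (%b. b) (flags es))"

definition picked :: "nat list \<Rightarrow> nat list \<Rightarrow> nat list" where
 "picked es f = map snd (filter fst (zip (flags es) f))"

definition kept :: "nat list \<Rightarrow> nat list \<Rightarrow> nat list" where
 "kept es f = map snd (filter (%z. \<not> fst z) (zip (flags es) f))"

text \<open>Distinctness and inversion parity in one pass. The third component is the list of
  entries seen, in the order that \<open>rpar\<close> expects.\<close>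

definition stat :: "nat list \<Rightarrow> bool \<times> bool \<times> nat list" where
 "stat xs = foldl (%s y. (fst s \<and> y \<notin> set (snd (snd s)), \<not> (fst (snd s) = odd (length (filter (%z. y < z) (snd (snd s))))), y # snd (snd s))) (True, False, []) xs"

definition is_perm :: "nat list \<Rightarrow> nat list \<Rightarrow> bool" where
 "is_perm es f \<longleftrightarrow> fst (stat (picked es f)) \<and> filter (%x. x \<notin> set es) (picked es f) = [] \<and> kept es f = kept es es"

definition odd_perm :: "nat list \<Rightarrow> nat list \<Rightarrow> bool" where
 "odd_perm es f \<longleftrightarrow> fst (snd (stat (picked es f)))"

lemma flags_fold: "foldl (%s x. (x # fst s, snd s @ [x \<notin> set (fst s)])) ([], []) es = (rev es, map (%a. es ! a \<notin> set (take a es)) [0..<length es])"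
proof (induction es rule: rev_induct)
 case (snoc x es)
 have "map (%a. (es @ [x]) ! a \<notin> set (take a (es @ [x]))) [0..<length es] = map (%a. es ! a \<notin> set (take a es)) [0..<length es]"
  by (rule map_cong[OF refl]) (simp add: nth_append)
 then show ?case unfolding foldl_append foldl.simps snoc by simp
qed simp

lemma flags_eq: "flags es = map (%a. es ! a \<notin> set (take a es)) [0..<length es]"
 unfolding flags_def flags_fold by simp

lemma zip_flags: "length f = length es ==> zip (flags es) f = map (%a. (es ! a \<notin> set (take a es), f ! a)) [0..<length es]"
 by (rule nth_equalityI) (auto simp: flags_eq)

lemma picked_eq: "length f = length es ==> picked es f = map (nth f) (firsts es)"
 by (simp add: picked_def zip_flags filter_map o_def firsts_def)

lemma kept_eq: "length f = length es ==> kept es f = map (nth f) (filter (%a. es ! a \<in> set (take a es)) [0..<length es])"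
 by (simp add: kept_def zip_flags filter_map o_def)

lemma tuple_rank_eq: "tuple_rank es = card (set es)"
proof -
 have "tuple_rank es = length (map (nth es) (firsts es))" by (simp add: tuple_rank_def flags_eq filter_map o_def firsts_def)
 also have "\<dots> = card (set es)" using distinct_card[OF firsts_props(2)[of es]] unfolding firsts_props(3) by simp
 finally show ?thesis .
qed

lemma stat_eq: "stat xs = (distinct xs, rpar (rev xs), rev xs)"
proof (induction xs rule: rev_induct)
 case (snoc x xs)
 then have "stat (xs @ [x]) = (distinct xs \<and> x \<notin> set (rev xs), \<not> (rpar (rev xs) = odd (length (filter (%z. x < z) (rev xs)))), x # rev xs)"
  unfolding stat_def foldl_append foldl.simps by simp
 then show ?case by auto
qed (simp add: stat_def)

lemma is_perm_iff: "length f = length es ==> is_perm es f \<longleftrightarrow> f \<in> perms_of es"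
 by (auto simp: is_perm_def stat_eq picked_eq kept_eq perms_of_def filter_empty_conv firsts_def)

lemma odd_perm_eq: "length f = length es ==> odd_perm es f = par (firsts es) f"
 by (simp add: odd_perm_def stat_eq picked_eq par_def)

definition best_tuple :: "member list \<Rightarrow> nat list" where
 "best_tuple ms = foldl (%e x. if tuple_rank e < tuple_rank (snd (snd x)) then snd (snd x) else e) (snd (snd (hd ms))) ms"

lemma best_tuple_props:
 assumes "ms \<noteq> []"
 shows "best_tuple ms \<in> (%x. snd (snd x)) ` set ms" "x \<in> set ms ==> tuple_rank (snd (snd x)) \<le> tuple_rank (best_tuple ms)"
proof -
 let ?f = "%e0. foldl (%e x. if tuple_rank e < tuple_rank (snd (snd x)) then snd (snd x) else e) e0"
 have g: "?f e0 ms \<in> insert e0 ((%x. snd (snd x)) ` set ms) \<and> tuple_rank e0 \<le> tuple_rank (?f e0 ms) \<and> (\<forall>x\<in>set ms. tuple_rank (snd (snd x)) \<le> tuple_rank (?f e0 ms))"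
  for e0 and ms :: "member list"
 proof (induction ms rule: rev_induct)
  case (snoc x ms) then show ?case by auto
 qed simp
 have h: "snd (snd (hd ms)) \<in> (%x. snd (snd x)) ` set ms" by (rule rev_image_eqI[OF hd_in_set[OF assms] refl])
 show "best_tuple ms \<in> (%x. snd (snd x)) ` set ms"
  using g[of "snd (snd (hd ms))" ms, THEN conjunct1] unfolding best_tuple_def insert_absorb[OF h] .
 show "x \<in> set ms ==> tuple_rank (snd (snd x)) \<le> tuple_rank (best_tuple ms)"
  using g[of "snd (snd (hd ms))" ms, THEN conjunct2, THEN conjunct2] unfolding best_tuple_def by (rule bspec)
qed

text \<open>The equation between the two sums is symmetric, so the lists may change places; this is
  done when the odd list is empty, because \<open>I\<close> must not be.\<close>

definition select_members :: "member list \<Rightarrow> member list \<times> member list" where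
 "select_members ms = (let es = best_tuple ms; I = filter (%x. is_perm es (snd (snd x)) \<and> odd_perm es (snd (snd x))) ms;
   J = filter (%x. is_perm es (snd (snd x)) \<and> \<not> odd_perm es (snd (snd x))) ms in if I = [] then (J, I) else (I, J))"

context expl
begin

lemma lsum_partition:
 assumes A: "finite A" and t: "\<And>x. x \<in> set ms ==> t x \<in> carrier F"
 shows "(\<Oplus>f\<in>A. lsum (map t (filter (%x. g x = f) ms))) = lsum (map t (filter (%x. g x \<in> A) ms))"
 using t
proof (induction ms)
 case Nil show ?case by (simp add: finsum_zero)
next
 case (Cons x ms)
 have tx: "t x \<in> carrier F" by (rule Cons.prems) simp
 have r: "lsum (map t (filter P ms)) \<in> carrier F" and s: "set (map t (filter P ms)) \<subseteq> carrier F" for P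
  using Cons.prems by (auto intro!: lsum_closed)
 have e: "lsum (map t (filter P (x # ms))) = (if P x then t x else \<zero>) \<oplus> lsum (map t (filter P ms))" for P
  using lsum_Cons[OF tx s[of P]] r[of P] by simp
 have "(\<Oplus>f\<in>A. lsum (map t (filter (%x. g x = f) (x # ms)))) = (\<Oplus>f\<in>A. (if g x = f then t x else \<zero>) \<oplus> lsum (map t (filter (%x. g x = f) ms)))"
  unfolding e ..
 also have "\<dots> = (\<Oplus>f\<in>A. if g x = f then t x else \<zero>) \<oplus> (\<Oplus>f\<in>A. lsum (map t (filter (%x. g x = f) ms)))"
  by (rule finsum_addf) (use tx r in auto)
 also have "(\<Oplus>f\<in>A. lsum (map t (filter (%x. g x = f) ms))) = lsum (map t (filter (%x. g x \<in> A) ms))"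
  by (rule Cons.IH) (use Cons.prems in auto)
 also have "(\<Oplus>f\<in>A. if g x = f then t x else \<zero>) = (if g x \<in> A then t x else \<zero>)"
 proof (cases "g x \<in> A")
  case True
  show ?thesis using finsum_singleton[OF True A, of "%_. t x"] tx True by simp
 next
  case False
  have "(\<Oplus>f\<in>A. if g x = f then t x else \<zero>) = (\<Oplus>f\<in>A. \<zero>)" by (rule finsum_cong') (use False in auto)
  then show ?thesis using False by (simp add: finsum_zero)
 qed
 finally show ?case unfolding e .
qed

lemma finite_perms_of: "finite (perms_of es)"
proof (rule finite_subset)
 show "perms_of es \<subseteq> {f. set f \<subseteq> set es \<and> length f = length es}"
 proof
  fix f assume f: "f \<in> perms_of es"
  then have "length f = length es" by (simp add: perms_of_def)
  then show "f \<in> {f. set f \<subseteq> set es \<and> length f = length es}" using perms_of_set(2)[OF f] by simp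
 qed
qed (simp add: finite_lists_length_eq)

text \<open>\<open>antisymmetric_sum\<close> is applied to \<open>U f = mval d v ms f l\<close>,
  with the labels present as \<open>S\<close> and one of maximal rank as \<open>es\<close>. The
  member that carries \<open>es\<close> lies in one of the two lists, since \<open>es\<close> is a
  rearrangement of itself.\<close>

lemma select_ok:
 assumes v: "\<And>j l. v j l \<in> carrier F" and d: "d > 0" and g: "good d v m C d b" and C: "set C \<subseteq> cnz" "length C \<le> d"
 shows "fst (select_members (fst b)) \<noteq> []"
  "\<exists>P Q. select_members (fst b) = (filter P (fst b), filter Q (fst b)) \<and> (\<forall>x. \<not> (P x \<and> Q x))"
  "l \<in> {1..m} ==> lsum (map (%x. fst (snd x) [^] d \<otimes> v (fst x) l) (fst (select_members (fst b))))
    = lsum (map (%x. fst (snd x) [^] d \<otimes> v (fst x) l) (snd (select_members (fst b))))"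
proof -
 define ms where "ms = fst b"
 have ne: "ms \<noteq> []" and mo: "mem_ok C d ms" and li: "lines d v m C d ms" using g unfolding good_def ms_def by blast+
 define es where "es = best_tuple ms"
 let ?S = "(%x. snd (snd x)) ` set ms"
 have Sx: "length f = d \<and> set f \<subseteq> {..<length C}" if f: "f \<in> ?S" for f
 proof -
  obtain x where "x \<in> set ms" "f = snd (snd x)" using f by blast
  then show ?thesis using mo unfolding mem_ok_def by blast
 qed
 have es: "es \<in> ?S" "\<And>f. f \<in> ?S ==> card (set f) \<le> card (set es)"
  using best_tuple_props[OF ne] unfolding es_def tuple_rank_eq by auto
 have est: "es \<in> tuples d d" using Sx[OF es(1)] C(2) by (auto simp: tuples_def)
 have les: "length es = d" using Sx[OF es(1)] by blast
 let ?P = "%x. is_perm es (snd (snd x)) \<and> odd_perm es (snd (snd x))"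
 let ?Q = "%x. is_perm es (snd (snd x)) \<and> \<not> odd_perm es (snd (snd x))"
 have sel: "select_members ms = (if filter ?P ms = [] then (filter ?Q ms, filter ?P ms) else (filter ?P ms, filter ?Q ms))"
  by (simp add: select_members_def es_def Let_def)
 show "\<exists>P Q. select_members (fst b) = (filter P (fst b), filter Q (fst b)) \<and> (\<forall>x. \<not> (P x \<and> Q x))"
 proof (cases "filter ?P ms = []")
  case True
  show ?thesis by (rule exI[of _ ?Q], rule exI[of _ ?P]) (use True sel ms_def in auto)
 next
  case False
  show ?thesis by (rule exI[of _ ?P], rule exI[of _ ?Q]) (use False sel ms_def in auto)
 qed
 have pq: "filter ?P ms = filter (%x. snd (snd x) \<in> {f \<in> perms_of es. par (firsts es) f}) ms"
  "filter ?Q ms = filter (%x. snd (snd x) \<in> {f \<in> perms_of es. \<not> par (firsts es) f}) ms"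
 proof -
  have "is_perm es (snd (snd x)) = (snd (snd x) \<in> perms_of es) \<and> odd_perm es (snd (snd x)) = par (firsts es) (snd (snd x))" if "x \<in> set ms" for x
  proof -
   have "length (snd (snd x)) = length es" using Sx[of "snd (snd x)"] that les by simp
   then show ?thesis using is_perm_iff odd_perm_eq by blast
  qed
  then show "filter ?P ms = filter (%x. snd (snd x) \<in> {f \<in> perms_of es. par (firsts es) f}) ms"
   "filter ?Q ms = filter (%x. snd (snd x) \<in> {f \<in> perms_of es. \<not> par (firsts es) f}) ms"
   by (intro filter_cong[OF refl]; simp)+
 qed
 show "fst (select_members (fst b)) \<noteq> []"
 proof -
  obtain x where x: "x \<in> set ms" "es = snd (snd x)" using es(1) by blast
  have "is_perm es es" using is_perm_iff[of es es] self_in_perms by simp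
  then have "x \<in> set (filter ?P ms) \<or> x \<in> set (filter ?Q ms)" using x by simp
  then have "filter ?P ms \<noteq> [] \<or> filter ?Q ms \<noteq> []" by (metis empty_iff empty_set)
  then show ?thesis unfolding ms_def[symmetric] sel by simp
 qed
 assume l: "l \<in> {1..m}"
 let ?t = "%x. fst (snd x) [^] d \<otimes> v (fst x) l"
 have t: "?t x \<in> carrier F" if "x \<in> set ms" for x using mem_ok_carrier[OF mo that] v by (intro m_closed nat_pow_closed)
 let ?U = "%f. mval d v ms f l"
 \<comment> \<open>\<open>antisymmetric_sum\<close> asks for \<open>d\<close> nonzero coefficients,
   while \<open>C\<close> may be shorter. Any nonzero filler will do, because labels with an entry
   beyond \<open>C\<close> have value zero.\<close>
 let ?c = "%e. if e < length C then C ! e else \<one>"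
 have U: "?U f \<in> carrier F" for f by (rule mv_closed[OF v]) (rule mem_ok_carrier[OF mo])
 have Cc: "C ! e \<in> cnz" if "e < length C" for e using C(1) nth_mem[OF that] by blast
 have line: "(\<Oplus>e\<in>{..<d}. ?c e \<otimes> ?U (f[a := e])) = \<zero>" if f: "f \<in> tuples d d" "a < d" for f a
 proof -
  have lf: "length f = d" using f by (simp add: tuples_def)
  have cl: "?c e \<otimes> ?U (f[a := e]) \<in> carrier F" for e using Cc[of e] U by (intro m_closed) auto
  have z: "?U (f[a := e]) = \<zero>" if "e \<ge> length C" for e
   by (rule mv_zero[OF mo]) (use that set_update_memI[of a f e] f(2) lf in auto)
  have up: "[0..<d] = [0..<length C] @ [length C..<d]" using upt_add_eq_append[of 0 "length C" "d - length C"] C(2) by simp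
  have "(\<Oplus>e\<in>{..<d}. ?c e \<otimes> ?U (f[a := e])) = lsum (map (%e. ?c e \<otimes> ?U (f[a := e])) [0..<d])"
   using lsum_finsum[of "[0..<d]" "%e. ?c e \<otimes> ?U (f[a := e])"] cl by (simp add: atLeast0LessThan)
  also have "\<dots> = lsum (map (%e. ?c e \<otimes> ?U (f[a := e])) [0..<length C]) \<oplus> lsum (map (%e. ?c e \<otimes> ?U (f[a := e])) [length C..<d])"
   unfolding up map_append by (rule lsum_append; unfold set_map; rule image_subsetI; rule cl)
  also have "lsum (map (%e. ?c e \<otimes> ?U (f[a := e])) [length C..<d]) = \<zero>"
  proof (rule lsum_zero)
   fix x assume "x \<in> set (map (%e. ?c e \<otimes> ?U (f[a := e])) [length C..<d])"
   then obtain e where "length C \<le> e" "x = ?c e \<otimes> ?U (f[a := e])" by auto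
   then show "x = \<zero>" using z by simp
  qed
  also have "lsum (map (%e. ?c e \<otimes> ?U (f[a := e])) [0..<length C]) = lsum (map (%e. C ! e \<otimes> ?U (f[a := e])) [0..<length C])"
   by (rule lsum_cong) simp
  also have "\<dots> = \<zero>" using li f(2) lf l unfolding lines_def by blast
  finally show ?thesis by simp
 qed
 have "(\<Oplus>f\<in>{f\<in>perms_of es. par (firsts es) f}. ?U f) = (\<Oplus>f\<in>{f\<in>perms_of es. \<not> par (firsts es) f}. ?U f)"
 proof (rule antisymmetric_sum[where c = ?c and S = ?S, OF d])
  show "?c e \<in> carrier F - {\<zero>}" for e using Cc[of e] by auto
  show "?U f = \<zero>" if "f \<notin> ?S" for f
  proof -
   have "filter (%x. snd (snd x) = f) ms = []" using that by (auto simp: filter_empty_conv)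
   then show ?thesis by (simp add: mval_def)
  qed
 qed (use U line est es(2) in auto)
 moreover have "(\<Oplus>f\<in>A. ?U f) = lsum (map ?t (filter (%x. snd (snd x) \<in> A) ms))" if "finite A" for A
  unfolding mval_def by (rule lsum_partition[OF that t])
 ultimately have eq: "lsum (map ?t (filter ?P ms)) = lsum (map ?t (filter ?Q ms))"
  unfolding pq using finite_perms_of[of es] by simp
 have "lsum (map ?t (fst (select_members ms))) = lsum (map ?t (snd (select_members ms)))"
 proof (cases "filter ?P ms = []")
  case True
  then have e: "select_members ms = (filter ?Q ms, filter ?P ms)" unfolding sel by (rule if_P)
  show ?thesis unfolding e fst_conv snd_conv by (rule eq[symmetric])
 next
  case False
  then have e: "select_members ms = (filter ?P ms, filter ?Q ms)" unfolding sel by (rule if_not_P)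
  show ?thesis unfolding e fst_conv snd_conv by (rule eq)
 qed
 then show "lsum (map ?t (fst (select_members (fst b)))) = lsum (map ?t (snd (select_members (fst b))))"
  unfolding ms_def .
qed

section \<open>Restarts until \<open>d\<close> representatives suffice\<close>

text \<open>The first component holds the generators collected so far. The second is the member list
  of a successful run, with \<open>[]\<close> for none yet; once it is set, the state no longer
  changes.\<close>

definition search_step where
 "search_step d B u js vs s = (let R = run_levels d B u (snd (tower d B (fst s))) vs in
   if snd s = [] then (if length (fst R) \<le> d then (fst s, fst (hd (snd R))) else (fst s @ concat (map (chain d js) (fst R)), [])) else s)"

primrec search_n :: "nat \<Rightarrow> nat \<Rightarrow> nat \<Rightarrow> 'z list \<Rightarrow> nat list list list \<Rightarrow> nat \<Rightarrow> nat list list \<times> member list" where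
 "search_n d B u js vs 0 = ([], [])"
| "search_n d B u js vs (Suc n) = search_step d B u js vs (search_n d B u js vs n)"

lemma foldl_search: "foldl (%s _. search_step d B u js vs s) ([], []) xs = search_n d B u js vs (length xs)"
 by (induction xs rule: rev_induct) simp_all

lemma tower_heads: "fst ` set (snd (tower d B hs)) = set hs"
 by (induction hs rule: rev_induct) (simp_all add: tower_def tower_step_def Let_def)

lemma run_levels_prefix: "run_levels d B u tow vs = run_prefix d B u tow vs d"
 by (simp add: run_levels_def run_prefix_def)

lemma chains_props:
 assumes "set C \<subseteq> carrier F"
 shows "set (concat (map (chain d js) C)) \<subseteq> carrier F \<and> length (concat (map (chain d js) C)) = length C * Suc (length js)"
 using assms
proof (induction C)
 case (Cons c C)
 have "set (chain d js c) \<subseteq> carrier F \<and> length (chain d js c) = Suc (length js)" using Cons.prems by (auto simp: chain_eq)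
 then show ?case using Cons by simp
qed simp

text \<open>For the time analysis: at most \<open>d + 1\<close> chains are appended per attempt, and
  a result, if present, comes from a run over some tower of field elements, which is enough to bound
  its size.\<close>

lemma search_carrier:
 assumes vs: "\<And>w. w \<in> set vs ==> length w = m \<and> set w \<subseteq> carrier F" and d: "d > 0" and len: "(\<Prod>l<d. d ^ l * m + 1) \<le> length vs"
 shows "set (fst (search_n d B u js vs n)) \<subseteq> carrier F \<and> length (fst (search_n d B u js vs n)) \<le> n * ((d + 1) * Suc (length js)) \<and>
  (snd (search_n d B u js vs n) = [] \<or> (\<exists>hs. set hs \<subseteq> carrier F \<and>
    snd (search_n d B u js vs n) = fst (hd (snd (run_levels d B u (snd (tower d B hs)) vs)))))"
proof (induction n)
 case (Suc n)
 let ?s = "search_n d B u js vs n"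
 let ?R = "run_levels d B u (snd (tower d B (fst ?s))) vs"
 have hs: "set (fst ?s) \<subseteq> carrier F" and l: "length (fst ?s) \<le> n * ((d + 1) * Suc (length js))" using Suc by blast+
 have R: "set (fst ?R) \<subseteq> carrier F" "length (fst ?R) \<le> d + 1"
  using run_shape[OF vs, of vs "snd (tower d B (fst ?s))" d B u d] hs unfolding run_levels_prefix tower_heads by blast+
 have ch: "set (concat (map (chain d js) (fst ?R))) \<subseteq> carrier F" "length (concat (map (chain d js) (fst ?R))) \<le> (d + 1) * Suc (length js)"
  using chains_props[OF R(1), of d js] R(2) mult_le_mono1[OF R(2), of "Suc (length js)"] by simp_all
 show ?case
 proof (cases "snd ?s = []")
  case False
  then have e: "search_n d B u js vs (Suc n) = ?s" by (simp add: search_step_def Let_def)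
  have le: "length (fst ?s) \<le> Suc n * ((d + 1) * Suc (length js))" using l by (rule order.trans) (rule mult_le_mono1, simp)
  show ?thesis unfolding e using hs le Suc by (intro conjI) (assumption, assumption, elim conjE)
 next
  case True
  show ?thesis
  proof (cases "length (fst ?R) \<le> d")
   case r: True
   then have e: "search_n d B u js vs (Suc n) = (fst ?s, fst (hd (snd ?R)))" using True by (simp add: search_step_def Let_def)
   have "length (fst ?s) \<le> Suc n * ((d + 1) * Suc (length js))" using l by (rule order.trans) (rule mult_le_mono1, simp)
   then show ?thesis unfolding e fst_conv snd_conv using hs by blast
  next
   case False
   then have e: "search_n d B u js vs (Suc n) = (fst ?s @ concat (map (chain d js) (fst ?R)), [])" using True by (simp add: search_step_def Let_def)
   show ?thesis unfolding e fst_conv snd_conv using hs ch l by simp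
  qed
 qed
qed simp

text \<open>The condition under which \<open>tower_props\<close> accepts a list of generators. It
  refers only to what precedes an entry, so it is stable under concatenation.\<close>

definition chained where
 "chained d B hs \<longleftrightarrow> (\<forall>as h bs. hs = as @ h # bs \<longrightarrow> h \<in> cnz \<and> (h [^] (d :: nat) \<in> set as \<or> h [^] (d * B) = \<one>))"

lemma chained_append: "chained d B xs ==> chained d B ys ==> chained d B (xs @ ys)"
 unfolding chained_def
proof (intro allI impI)
 fix as h bs assume x: "\<forall>as h bs. xs = as @ h # bs \<longrightarrow> h \<in> cnz \<and> (h [^] d \<in> set as \<or> h [^] (d * B) = \<one>)"
  and y: "\<forall>as h bs. ys = as @ h # bs \<longrightarrow> h \<in> cnz \<and> (h [^] d \<in> set as \<or> h [^] (d * B) = \<one>)"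
  and e: "xs @ ys = as @ h # bs"
 from e obtain us where "xs = as @ us \<and> us @ ys = h # bs \<or> xs @ us = as \<and> ys = us @ h # bs" unfolding append_eq_append_conv2 by blast
 then show "h \<in> cnz \<and> (h [^] d \<in> set as \<or> h [^] (d * B) = \<one>)"
 proof
  assume a: "xs @ us = as \<and> ys = us @ h # bs"
  then have "h \<in> cnz \<and> (h [^] d \<in> set us \<or> h [^] (d * B) = \<one>)" using y by blast
  then show ?thesis using a by auto
 next
  assume a: "xs = as @ us \<and> us @ ys = h # bs"
  show ?thesis
  proof (cases us)
   case Nil
   then have "ys = [] @ h # bs" using a by simp
   then show ?thesis using y by fastforce
  next
   case (Cons h' us')
   then have "xs = as @ h # us'" using a by simp
   then show ?thesis using x by blast
  qed
 qed
qed

lemma chained_chains: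
 assumes "set C \<subseteq> cnz" "p ^ k - 1 dvd B * d ^ length js"
 shows "chained d B (concat (map (chain d js) C))"
 using assms(1)
proof (induction C)
 case Nil show ?case by (simp add: chained_def)
next
 case (Cons c C)
 have "c \<in> cnz" using Cons.prems by simp
 then have "chained d B (chain d js c)" unfolding chained_def using chain_ok[OF _ assms(2)] by blast
 then show ?case using Cons by (simp add: chained_append)
qed

lemma tower_chained:
 assumes "chained d B hs" and "d > 0" "B dvd p ^ k - 1" "B > 0"
 shows "tower_ok d B (fst (tower d B hs)) (snd (tower d B hs)) \<and> fst (tower d B hs) dvd p ^ k - 1
  \<and> (\<forall>h\<in>set hs. h [^] (d * fst (tower d B hs)) = \<one>)"
proof -
 have c: "h \<in> cnz \<and> (h [^] d \<in> set as \<or> h [^] (d * B) = \<one>)" if "hs = as @ h # bs" for as h bs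
  using assms(1) that unfolding chained_def by blast
 have "tower_ok d B (fst (tower d B hs)) (snd (tower d B hs)) \<and> B dvd fst (tower d B hs) \<and> fst (tower d B hs) dvd p ^ k - 1
  \<and> (\<forall>h\<in>set hs. h [^] (d * fst (tower d B hs)) = \<one>)"
  by (rule tower_props[OF assms(2-4)]) (rule c)
 then show ?thesis by blast
qed

text \<open>After a failed attempt some representative \<open>c\<close> satisfies
  \<open>c [^] (d * o) \<noteq> \<one>\<close> for the old exponent \<open>o\<close>, but equality
  for the new one, of which \<open>o\<close> is a divisor. The exponents therefore differ, and the
  quotient is at least 2. All of them divide \<open>p ^ k - 1 < 2 ^ length js\<close>, so
  \<open>length js\<close> attempts cannot all fail.\<close>

lemma search_found:
 assumes v: "\<And>j l. v j l \<in> carrier F" and vs: "vs = map (%i. map (v i) [1..<m + 1]) [1..<n + 1]"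
  and d: "d > 0" and n: "(\<Prod>l<d. d ^ l * m + 1) \<le> n"
  and B: "B > 0" "B dvd p ^ k - 1" "p ^ k - 1 dvd B * d ^ length js" and us: "u * d + 1 = B * s"
  and js: "p ^ k - 1 < 2 ^ length js"
 shows "\<exists>C w. set C \<subseteq> cnz \<and> length C \<le> d \<and> good d v m C d (snd (search_n d B u js vs (length js)), w) \<and>
   subseq (map fst (snd (search_n d B u js vs (length js)))) [1..<n + 1]"
proof -
 let ?found = "%ms. \<exists>C w. set C \<subseteq> cnz \<and> length C \<le> d \<and> good d v m C d (ms, w) \<and> subseq (map fst ms) [1..<n + 1]"
 have lv: "length vs = n" unfolding vs by (simp del: upt_Suc)
 have w: "length w = m \<and> set w \<subseteq> carrier F" if "w \<in> set vs" for w using that v unfolding vs by (auto simp del: upt_Suc)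
 have I: "(snd (search_n d B u js vs j) \<noteq> [] \<and> ?found (snd (search_n d B u js vs j))) \<or>
   (snd (search_n d B u js vs j) = [] \<and> chained d B (fst (search_n d B u js vs j)) \<and> 2 ^ j \<le> fst (tower d B (fst (search_n d B u js vs j))))" for j
 proof (induction j)
  case 0 show ?case using B(1) by (simp add: chained_def tower_def)
 next
  case (Suc j)
  let ?s = "search_n d B u js vs j"
  let ?tow = "snd (tower d B (fst ?s))"
  let ?o = "fst (tower d B (fst ?s))"
  let ?R = "run_levels d B u ?tow vs"
  show ?case
  proof (cases "snd ?s = []")
   case False
   then have "search_n d B u js vs (Suc j) = ?s" by (simp add: search_step_def Let_def)
   then show ?thesis using Suc False by simp
  next
   case True
   then have ch: "chained d B (fst ?s)" and o2: "2 ^ j \<le> ?o" using Suc by blast+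
   have ch': "h \<in> cnz \<and> (h [^] d \<in> set as \<or> h [^] (d * B) = \<one>)" if "fst ?s = as @ h # bs" for as h bs
    using ch that unfolding chained_def by blast
   have hs: "set (fst ?s) \<subseteq> cnz"
   proof
    fix h assume "h \<in> set (fst ?s)"
    then obtain as bs where "fst ?s = as @ h # bs" using split_list by fast
    then show "h \<in> cnz" using ch' by blast
   qed
   have tow: "fst ` set ?tow \<subseteq> cnz" using hs unfolding tower_heads .
   then have towc: "fst ` set ?tow \<subseteq> carrier F" by blast
   note TP = tower_chained[OF ch d B(2,1)]
   have RS: "length (fst ?R) \<le> d + 1 \<and> subseq (jlist (snd ?R)) [1..<length vs + 1] \<and>
     (\<Prod>l\<in>{d..<d}. d ^ l * m + 1) \<le> length (snd ?R)"
    using run_shape[OF w towc, of vs d B u d] n lv unfolding run_levels_prefix by (simp del: upt_Suc)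
   have RG: "set (fst ?R) \<subseteq> cnz" "inc_list d B u ?tow (fst ?R)"
     "length (fst ?R) \<le> d ==> b \<in> set (snd ?R) ==> good d v m (fst ?R) d b" for b
    using run_good[OF tow d us v vs, where i = d] unfolding run_levels_prefix by blast+
   show ?thesis
   proof (cases "length (fst ?R) \<le> d")
    case le: True
    have e: "snd (search_n d B u js vs (Suc j)) = fst (hd (snd ?R))" using True le by (simp add: search_step_def Let_def)
    have ne: "snd ?R \<noteq> []" using RS by auto
    have hm: "hd (snd ?R) \<in> set (snd ?R)" using ne by simp
    have g: "good d v m (fst ?R) d (fst (hd (snd ?R)), snd (hd (snd ?R)))" using RG(3)[OF le hm] by simp
    then have "fst (hd (snd ?R)) \<noteq> []" by (simp add: good_def)
    moreover have "subseq (map fst (fst (hd (snd ?R)))) [1..<n + 1]"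
    proof -
     obtain a rs where R: "snd ?R = a # rs" using ne by (meson list.exhaust)
     have j: "jlist (a # rs) = map fst (fst a) @ jlist rs" by (simp add: jlist_def)
     have "subseq (map fst (fst a)) (map fst (fst a) @ jlist rs)" by (rule subseq_rev_drop_many) (rule subseq_order.order_refl)
     then have 1: "subseq (map fst (fst (hd (snd ?R)))) (jlist (snd ?R))" unfolding R j list.sel .
     have 2: "subseq (jlist (snd ?R)) [1..<n + 1]" using RS unfolding lv by (elim conjE)
     show ?thesis by (rule subseq_order.trans[OF 1 2])
    qed
    ultimately show ?thesis unfolding e using RG(1) le g by blast
   next
    case False
    then have len: "length (fst ?R) = d + 1" using RS by simp
    let ?hs = "fst ?s @ concat (map (chain d js) (fst ?R))"
    have e: "search_n d B u js vs (Suc j) = (?hs, [])" using True False by (simp add: search_step_def Let_def)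
    have ch2: "chained d B ?hs" by (rule chained_append[OF ch chained_chains[OF RG(1) B(3)]])
    note TP2 = tower_chained[OF ch2 d B(2,1)]
    let ?o' = "fst (tower d B ?hs)"
    have tok: "tower_ok d B ?o ?tow" using TP by blast
    obtain c where c: "c \<in> set (fst ?R)" "c [^] (d * ?o) \<noteq> \<one>"
     using overflow_progress[OF tok d RG(1) len, of u] RG(2) unfolding inc_list_def by blast
    have "c \<in> set (chain d js c)" by (rule chain_last) (use RG(1) c(1) in blast)
    then have "c \<in> set ?hs" using c(1) by auto
    then have "c [^] (d * ?o') = \<one>" using TP2 by blast
    then have neq: "?o' \<noteq> ?o" using c(2) by auto
    obtain q where q: "?o' = ?o * q" using tower_fst_mono by blast
    have pos: "p ^ k - 1 > 0" using order_ge_2 by simp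
    have dv: "?o' dvd p ^ k - 1" using TP2 by blast
    have pos': "?o' > 0" by (rule dvd_pos_nat[OF pos dv])
    have "q \<noteq> 0" using q pos' by (metis mult_0_right less_irrefl)
    moreover have "q \<noteq> 1" using q neq by (metis mult.right_neutral)
    ultimately have q2: "2 \<le> q" by simp
    have "2 ^ j * 2 \<le> ?o * q" by (rule mult_le_mono[OF o2 q2])
    then have "2 ^ Suc j \<le> ?o'" unfolding q power_Suc by (simp only: mult.commute)
    then show ?thesis unfolding e fst_conv snd_conv using ch2 by blast
   qed
  qed
 qed
 show ?thesis
 proof (cases "snd (search_n d B u js vs (length js)) = []")
  case False then show ?thesis using I[of "length js"] by blast
 next
  case True
  let ?hs = "fst (search_n d B u js vs (length js))"
  have ch: "chained d B ?hs" "2 ^ length js \<le> fst (tower d B ?hs)" using True I[of "length js"] by blast+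
  have "fst (tower d B ?hs) dvd p ^ k - 1" using tower_chained[OF ch(1) d B(2,1)] by blast
  moreover have "p ^ k - 1 > 0" using order_ge_2 by simp
  ultimately have "fst (tower d B ?hs) \<le> p ^ k - 1" by (rule dvd_imp_le)
  then show ?thesis using ch(2) js by simp
 qed
qed

end

section \<open>Polynomial time of the selection and of the search\<close>

lemma pt_flags:
 assumes es: "pt N D Xi (%i. enc_elem (es i))"
 shows "pt N D Xi (%i. enc_list eb (flags (es i)))"
proof -
 let ?g = "%s x. (x # fst s, snd s @ [x \<notin> set (fst s)])"
 have "pt N D Xi (%i. ep enc_elem (enc_list eb) (foldl ?g ([], []) (es i)))"
 proof (rule pt_fold[OF es _ _ _ _ _ refl, where Inv = "%i j s. fst s = rev (take j (es i)) \<and> length (snd s) = j"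
    and b = "%i. size (enc_elem (es i)) + length (es i) * 2 + 1"], goal_cases)
  case 1 show ?case by (rule pt_pair; rule pt_Nil, rule pt_self[OF es])
 next
  case (2 i) show ?case by simp
 next
  case (3 i j s) then show ?case by (simp add: take_Suc_nth)
 next
  case 4 show ?case by (intro pb_add pb_mult pb_const pt_size[OF es] pt_length_bound[OF es])
 next
  case (5 i j s)
  have "size (enc_list eb (snd s)) \<le> length (snd s) * (1 + 1)" by (rule size_enc_list_le) (rule size_eb)
  moreover have "size (enc_elem (fst s)) \<le> size (enc_elem (es i))"
   using 5(3) size_enc_list_take[of enc_nat j "es i"] by (simp add: size_enc_list_rev)
  ultimately show ?case using 5 unfolding size_ep by simp
 next
  case (6 Y)
  show ?case by (rule pt_pair, rule pt_Cons, rule 6(4), rule pt_fst[OF 6(3)], rule pt_append, rule pt_snd[OF 6(3)], rule pt_Cons,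
    rule pt_not, rule pt_mem, rule 6(4), rule pt_fst[OF 6(3)], rule pt_Nil, rule 6(2))
 qed
 then show ?thesis unfolding flags_def by (rule pt_snd)
qed

lemma pt_tuple_rank:
 assumes es: "pt N D Xi (%i. enc_elem (es i))"
 shows "pt N D Xi (%i. enc_nat (tuple_rank (es i)))"
 unfolding tuple_rank_def
proof (rule pt_length, rule pt_filter[OF pt_flags[OF es]], goal_cases)
 case (1 Y) show ?case by (rule 1(3))
qed

context
 fixes N :: "'i \<Rightarrow> nat" and D Xi es f
 assumes es: "pt N D Xi (%i. enc_elem (es i))" and f: "pt N D Xi (%i. enc_elem (f i))"
  and len: "\<And>i. i \<in> D ==> length (f i) = length (es i)"
begin

lemma pt_flag_zip: "pt N D Xi (%i. enc_list (ep eb enc_nat) (zip (flags (es i)) (f i)))"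
 by (rule pt_zip[OF pt_flags[OF es] f]) (simp add: len flags_eq)

lemma pt_picked: "pt N D Xi (%i. enc_elem (picked (es i) (f i)))"
proof -
 have fl: "pt N D Xi (%i. enc_list (ep eb enc_nat) (filter fst (zip (flags (es i)) (f i))))"
 proof (rule pt_filter[OF pt_flag_zip], goal_cases)
  case (1 Y) show ?case by (rule pt_fst[OF 1(3)])
 qed
 show ?thesis unfolding picked_def
 proof (rule pt_map[OF fl], goal_cases)
  case (1 Y) show ?case by (rule pt_snd[OF 1(3)])
 qed
qed

lemma pt_kept: "pt N D Xi (%i. enc_elem (kept (es i) (f i)))"
proof -
 have fl: "pt N D Xi (%i. enc_list (ep eb enc_nat) (filter (%z. \<not> fst z) (zip (flags (es i)) (f i))))"
 proof (rule pt_filter[OF pt_flag_zip], goal_cases)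
  case (1 Y) show ?case by (rule pt_not[OF pt_fst[OF 1(3)]])
 qed
 show ?thesis unfolding kept_def
 proof (rule pt_map[OF fl], goal_cases)
  case (1 Y) show ?case by (rule pt_snd[OF 1(3)])
 qed
qed

end

lemma pt_stat:
 assumes xs: "pt N D Xi (%i. enc_elem (xs i))"
 shows "pt N D Xi (%i. ep eb (ep eb enc_elem) (stat (xs i)))"
 unfolding stat_def
proof (rule pt_fold[OF xs _ _ _ _ _ refl, where Inv = "%i j s. snd (snd s) = rev (take j (xs i))" and b = "%i. size (enc_elem (xs i)) + 4"], goal_cases)
 case 1 show ?case by (rule pt_pair, rule pt_bool, rule pt_self[OF xs], rule pt_pair, rule pt_bool, rule pt_self[OF xs], rule pt_Nil, rule pt_self[OF xs])
next
 case (2 i) show ?case by simp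
next
 case (3 i j s) then show ?case by (simp add: take_Suc_nth)
next
 case 4 show ?case by (intro pb_add pb_const pt_size[OF xs])
next
 case (5 i j s)
 have "size (enc_elem (snd (snd s))) \<le> size (enc_elem (xs i))"
  using 5(3) size_enc_list_take[of enc_nat j "xs i"] by (simp add: size_enc_list_rev)
 then show ?case using size_eb[of "fst s"] size_eb[of "fst (snd s)"] unfolding size_ep by linarith
next
 case (6 Y)
 note seen = pt_snd[OF pt_snd[OF 6(3)]]
 have "pt (on_fst N) {(i, s, x). i \<in> D \<and> (\<exists>j<length (xs i). x = xs i ! j \<and> snd (snd s) = rev (take j (xs i)))} Y
   (%z. enc_elem (filter (%y. snd (snd z) < y) (snd (snd (fst (snd z))))))"
 proof (rule pt_filter[OF seen], goal_cases)
  case (1 Y') show ?case by (rule pt_less, rule 1(1)[OF 6(4)], rule 1(3))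
 qed
 note fl = this
 show ?case
  by (rule pt_pair, rule pt_conj, rule pt_fst[OF 6(3)], rule pt_not, rule pt_mem, rule 6(4), rule seen,
    rule pt_pair, rule pt_not, rule pt_iff, rule pt_fst[OF pt_snd[OF 6(3)]], rule pt_odd, rule pt_length, rule fl,
    rule pt_Cons, rule 6(4), rule seen)
qed

lemma pt_is_perm:
 assumes es: "pt N D Xi (%i. enc_elem (es i))" and f: "pt N D Xi (%i. enc_elem (f i))"
  and len: "\<And>i. i \<in> D ==> length (f i) = length (es i)"
 shows "pt N D Xi (%i. eb (is_perm (es i) (f i)))" "pt N D Xi (%i. eb (odd_perm (es i) (f i)))"
proof -
 have pk: "pt N D Xi (%i. enc_elem (picked (es i) (f i)))" by (rule pt_picked[OF es f len])
 have k1: "pt N D Xi (%i. enc_elem (kept (es i) (f i)))" by (rule pt_kept[OF es f len])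
 have k2: "pt N D Xi (%i. enc_elem (kept (es i) (es i)))" by (rule pt_kept[OF es es refl])
 have fl: "pt N D Xi (%i. enc_elem (filter (%x. x \<notin> set (es i)) (picked (es i) (f i))))"
 proof (rule pt_filter[OF pk], goal_cases)
  case (1 Y) show ?case by (rule pt_not, rule pt_mem, rule 1(3), rule 1(1)[OF es])
 qed
 have l: "length (kept (es i) (f i)) = length (kept (es i) (es i))" if "i \<in> D" for i
  by (simp add: kept_eq[OF len[OF that]] kept_eq[OF refl])
 show "pt N D Xi (%i. eb (is_perm (es i) (f i)))" unfolding is_perm_def
  by (rule pt_conj, rule pt_fst[OF pt_stat[OF pk]], rule pt_conj, rule pt_null, rule fl, rule pt_eq_list, rule k1, rule k2, rule l)
 show "pt N D Xi (%i. eb (odd_perm (es i) (f i)))" unfolding odd_perm_def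
  by (rule pt_fst[OF pt_snd[OF pt_stat[OF pk]]])
qed

lemma pt_best_tuple:
 assumes ms: "pt N D Xi (%i. enc_list enc_mem (ms i))" and ne: "\<And>i. i \<in> D ==> ms i \<noteq> []"
 shows "pt N D Xi (%i. enc_elem (best_tuple (ms i)))"
 unfolding best_tuple_def
proof (rule pt_fold[OF ms _ _ _ _ _ refl, where Inv = "%i (j :: nat) s. s \<in> (%x. snd (snd x)) ` set (ms i)" and b = "%i. size (enc_list enc_mem (ms i))"], goal_cases)
 case 1
 have "pt N D Xi (%i. enc_mem (hd (ms i)))" by (rule pt_hd[OF ms ne])
 then show ?case by (rule pt_snd[OF pt_snd])
next
 case (2 i) show ?case by (rule rev_image_eqI[OF hd_in_set[OF ne[OF 2]] refl])
next
 case (3 i j s)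
 have "snd (snd (ms i ! j)) \<in> (%x. snd (snd x)) ` set (ms i)" by (rule rev_image_eqI[OF nth_mem[OF 3(2)] refl])
 then show ?case using 3(3) by simp
next
 case 4 show ?case by (rule pt_size[OF ms])
next
 case (5 i j s)
 obtain x where x: "x \<in> set (ms i)" "s = snd (snd x)" using 5(3) by blast
 have "size (enc_elem s) \<le> size (enc_mem x)" unfolding x(2) size_ep by simp
 also have "\<dots> \<le> size (enc_list enc_mem (ms i))" by (rule size_mem_enc_list[OF x(1)])
 finally show ?case .
next
 case (6 Y)
 note t = pt_snd[OF pt_snd[OF 6(4)]]
 show ?case by (rule pt_if'[where e = enc_elem], rule pt_less, rule pt_tuple_rank[OF 6(3)], rule pt_tuple_rank[OF t], rule t, rule 6(3))
qed

lemma pt_select_members: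
 assumes ms: "pt N D Xi (%i. enc_list enc_mem (ms i))" and ne: "\<And>i. i \<in> D ==> ms i \<noteq> []"
  and len: "\<And>i x. i \<in> D ==> x \<in> set (ms i) ==> length (snd (snd x)) = n i"
 shows "pt N D Xi (%i. ep (enc_list enc_mem) (enc_list enc_mem) (select_members (ms i)))"
proof -
 have es: "pt N D Xi (%i. enc_elem (best_tuple (ms i)))" by (rule pt_best_tuple[OF ms ne])
 have les: "length (best_tuple (ms i)) = n i" if "i \<in> D" for i
  using best_tuple_props(1)[OF ne[OF that]] len[OF that] by (metis imageE)
 have pq: "pt (on_fst N) {(i, x). i \<in> D \<and> x \<in> set (ms i)} Y (%z. eb (is_perm (best_tuple (ms (fst z))) (snd (snd (snd z)))))"
  "pt (on_fst N) {(i, x). i \<in> D \<and> x \<in> set (ms i)} Y (%z. eb (odd_perm (best_tuple (ms (fst z))) (snd (snd (snd z)))))"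
  if a: "pt (on_fst N) {(i, x). i \<in> D \<and> x \<in> set (ms i)} Y (%z. enc_elem (best_tuple (ms (fst z))))"
   and b: "pt (on_fst N) {(i, x). i \<in> D \<and> x \<in> set (ms i)} Y (%z. enc_mem (snd z))" for Y
 proof -
  have l: "length (snd (snd (snd z))) = length (best_tuple (ms (fst z)))" if z: "z \<in> {(i, x). i \<in> D \<and> x \<in> set (ms i)}" for z
  proof -
   have "fst z \<in> D" "snd z \<in> set (ms (fst z))" using z by auto
   then show ?thesis using les len by simp
  qed
  show "pt (on_fst N) {(i, x). i \<in> D \<and> x \<in> set (ms i)} Y (%z. eb (is_perm (best_tuple (ms (fst z))) (snd (snd (snd z)))))"
   by (rule pt_is_perm(1)[OF a pt_snd[OF pt_snd[OF b]] l])
  show "pt (on_fst N) {(i, x). i \<in> D \<and> x \<in> set (ms i)} Y (%z. eb (odd_perm (best_tuple (ms (fst z))) (snd (snd (snd z)))))"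
   by (rule pt_is_perm(2)[OF a pt_snd[OF pt_snd[OF b]] l])
 qed
 let ?P = "%i x. is_perm (best_tuple (ms i)) (snd (snd x)) \<and> odd_perm (best_tuple (ms i)) (snd (snd x))"
 let ?Q = "%i x. is_perm (best_tuple (ms i)) (snd (snd x)) \<and> \<not> odd_perm (best_tuple (ms i)) (snd (snd x))"
 have I: "pt N D Xi (%i. enc_list enc_mem (filter (?P i) (ms i)))"
 proof (rule pt_filter[OF ms], goal_cases)
  case (1 Y) show ?case by (rule pt_conj, rule pq(1)[OF 1(1)[OF es] 1(3)], rule pq(2)[OF 1(1)[OF es] 1(3)])
 qed
 have J: "pt N D Xi (%i. enc_list enc_mem (filter (?Q i) (ms i)))"
 proof (rule pt_filter[OF ms], goal_cases)
  case (1 Y) show ?case by (rule pt_conj, rule pq(1)[OF 1(1)[OF es] 1(3)], rule pt_not, rule pq(2)[OF 1(1)[OF es] 1(3)])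
 qed
 show ?thesis unfolding select_members_def Let_def
  by (rule pt_if'[where e = "ep (enc_list enc_mem) (enc_list enc_mem)"], rule pt_null, rule I, rule pt_pair, rule J, rule I, rule pt_pair, rule I, rule J)
qed

lemma (in expl) size_run_levels:
 assumes c: "\<And>x. x \<in> carrier F ==> size (enc_elem x) \<le> c"
  and vs: "\<And>w. w \<in> set vs ==> length w = m \<and> set w \<subseteq> carrier F" and tow: "fst ` set tow \<subseteq> carrier F"
  and len: "(\<Prod>l<d. d ^ l * m + 1) \<le> length vs"
 shows "snd (run_levels d B u tow vs) \<noteq> []"
  "size (enc_list enc_mem (fst (hd (snd (run_levels d B u tow vs))))) \<le>
   blk_bound (size (enc_elem [1..<length vs + 1]) + length vs) c d d (d ^ d * m)"
proof -
 let ?R = "run_levels d B u tow vs"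
 have S: "set (fst ?R) \<subseteq> carrier F" "length (fst ?R) \<le> d + 1" "\<forall>b\<in>set (snd ?R). shape d m d b" "subseq (jlist (snd ?R)) [1..<length vs + 1]"
  "length (snd ?R) \<le> length vs" "(\<Prod>l\<in>{d..<d}. d ^ l * m + 1) \<le> length (snd ?R)"
  using run_shape[OF vs tow, of vs d B u d] len unfolding run_levels_prefix by (simp_all del: upt_Suc)
 show ne: "snd ?R \<noteq> []" using S(6) by auto
 have "size (enc_list enc_mem (fst (hd (snd ?R)))) \<le> size (enc_blk (hd (snd ?R)))" unfolding size_ep by simp
 also have "\<dots> \<le> size (enc_list enc_blk (snd ?R))" by (rule size_mem_enc_list[OF hd_in_set[OF ne]])
 also have "\<dots> \<le> size (enc_state ?R)" unfolding size_ep by simp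
 also have "\<dots> \<le> blk_bound (size (enc_elem [1..<length vs + 1]) + length vs) c d d (d ^ d * m)"
  by (rule size_enc_state[OF c S(1,2) _ _ _ S(4)]) (use S(3,5) in auto)
 finally show "size (enc_list enc_mem (fst (hd (snd ?R)))) \<le> blk_bound (size (enc_elem [1..<length vs + 1]) + length vs) c d d (d ^ d * m)" .
qed

text \<open>Each attempt rebuilds the tower from the generators kept in the state. Their number
  grows by at most \<open>(d i + 1) * Suc (length (js i))\<close> per attempt, so the tower, and
  with it every attempt, stays polynomial.\<close>

lemma pt_search:
 assumes f: "fld N D Xi p k F" and d: "pt N D Xi (%i. enc_nat (d i))" and ds: "pt N D Xi (%i. enc_elem [0..<d i])"
  and B: "pt N D Xi (%i. enc_nat (B i))" and u: "pt N D Xi (%i. enc_nat (u i))"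
  and js: "pt N D Xi (%i. enc_list e (js i))" and vs: "pt N D Xi (%i. enc_list (enc_vec) (vs i))"
  and vc: "\<And>i w. i \<in> D ==> w \<in> set (vs i) ==> length w = m i \<and> set w \<subseteq> carrier (F i)"
  and d0: "\<And>i. i \<in> D ==> d i > 0" and M: "pb N D (%i. d i ^ d i * m i)"
  and len: "\<And>i. i \<in> D ==> (\<Prod>l<d i. d i ^ l * m i + 1) \<le> length (vs i)"
 shows "pt N D Xi (%i. ep (enc_vec) (enc_list enc_mem) (expl.search_n (F i) (d i) (B i) (u i) (js i) (vs i) (length (js i))))"
proof -
 note E = fldD(1)[OF f]
 obtain c where c: "pb N D c" "\<And>i x. i \<in> D ==> x \<in> carrier (F i) ==> size (enc_elem x) \<le> c i"
  by (rule fld_sz[OF f]) blast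
 have pd: "pb N D d" using pt_length_bound[OF ds] by simp
 have pL: "pb N D (%i. length (js i))" by (rule pt_length_bound[OF js])
 have up: "pt N D Xi (%i. enc_elem [1..<length (vs i) + 1])" using pt_upt1[OF pt_upt_length[OF vs]] by simp
 let ?J = "%i. size (enc_elem [1..<length (vs i) + 1]) + length (vs i)"
 let ?E = "ep (enc_vec) (enc_list enc_mem)"
 define st where "st = (%i j. expl.search_n (F i) (d i) (B i) (u i) (js i) (vs i) j)"
 let ?hb = "%i. length (js i) * ((d i + 1) * Suc (length (js i)))"
 let ?bb = "%i. blk_bound (?J i) (c i) (d i) (d i) (d i ^ d i * m i)"
 have S: "set (fst (st i j)) \<subseteq> carrier (F i) \<and> length (fst (st i j)) \<le> j * ((d i + 1) * Suc (length (js i))) \<and> size (enc_list enc_mem (snd (st i j))) \<le> ?bb i"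
  if i: "i \<in> D" for i j
 proof -
  interpret ex: expl "p i" "k i" "F i" by (rule E[OF i])
  have C: "set (fst (st i j)) \<subseteq> carrier (F i)" "length (fst (st i j)) \<le> j * ((d i + 1) * Suc (length (js i)))"
   "snd (st i j) = [] \<or> (\<exists>hs. set hs \<subseteq> carrier (F i) \<and> snd (st i j) = fst (hd (snd (ex.run_levels (d i) (B i) (u i) (snd (ex.tower (d i) (B i) hs)) (vs i)))))"
   using ex.search_carrier[OF vc[OF i] d0[OF i] len[OF i], of "B i" "u i" "js i" j] unfolding st_def by simp_all
  have "size (enc_list enc_mem (snd (st i j))) \<le> ?bb i"
  proof (cases "snd (st i j) = []")
   case True then show ?thesis by simp
  next
   case False
   then obtain hs where hs: "set hs \<subseteq> carrier (F i)" "snd (st i j) = fst (hd (snd (ex.run_levels (d i) (B i) (u i) (snd (ex.tower (d i) (B i) hs)) (vs i))))"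
    using C(3) by blast
   have t: "fst ` set (snd (ex.tower (d i) (B i) hs)) \<subseteq> carrier (F i)" unfolding ex.tower_heads by (rule hs(1))
   show ?thesis unfolding hs(2) by (rule ex.size_run_levels(2)[OF c(2)[OF i] vc[OF i] t len[OF i]])
  qed
  then show ?thesis using C(1,2) by blast
 qed
 let ?Inv = "%i j t. t = st i j"
 have "pt N D Xi (%i. ?E (foldl (%s _. expl.search_step (F i) (d i) (B i) (u i) (js i) (vs i) s) ([], []) (js i)))"
 proof (rule pt_fold[OF js _ _ _ _ _ refl, where Inv = ?Inv and b = "%i. ?hb i * (c i + 1) + ?bb i + 1"], goal_cases)
  case 1 show ?case by (rule pt_pair; rule pt_Nil, rule pt_self[OF js])
 next
  case (2 i) then show ?case unfolding st_def by (simp add: expl.search_n.simps[OF E])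
 next
  case (3 i j t) then show ?case unfolding st_def by (simp add: expl.search_n.simps[OF E])
 next
  case 4 show ?case by (intro pb_add pb_mult pb_const pb_Suc pb_blk_bound c(1) pd pL M pt_size[OF up] pt_length_bound[OF vs])
 next
  case (5 i j t)
  note Sj = S[OF 5(1), of j]
  have "size (enc_vec (fst (st i j))) \<le> length (fst (st i j)) * (c i + 1)"
   by (rule size_enc_list_le) (use Sj c(2)[OF 5(1)] in blast)
  also have "\<dots> \<le> ?hb i * (c i + 1)"
  proof (rule mult_le_mono1)
   have "length (fst (st i j)) \<le> j * ((d i + 1) * Suc (length (js i)))" using Sj by blast
   also have "\<dots> \<le> ?hb i" by (rule mult_le_mono1[OF 5(2)])
   finally show "length (fst (st i j)) \<le> ?hb i" .
  qed
  finally show ?case unfolding 5(3) size_ep using Sj by linarith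
 next
  case (6 Y)
  let ?D = "{(i, t, x). i \<in> D \<and> (\<exists>j<length (js i). x = js i ! j \<and> ?Inv i j t)}"
  have D: "\<And>z. z \<in> ?D ==> fst z \<in> D" by auto
  have hc: "set (fst (fst (snd z))) \<subseteq> carrier (F (fst z))" if z: "z \<in> ?D" for z
  proof -
   obtain j where "fst (snd z) = st (fst z) j" using z by auto
   then show ?thesis using S[OF D[OF z]] by simp
  qed
  note f' = fld_lift[OF f 6(1) D] and h' = pt_fst[OF 6(3)]
  have d0': "z \<in> ?D ==> d (fst z) > 0" for z by (rule d0[OF D])
  have towp: "pt (on_fst N) ?D Y (%z. ep enc_nat (enc_list (ep enc_elem enc_nat)) (expl.tower (F (fst z)) (d (fst z)) (B (fst z)) (fst (fst (snd z)))))"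
   by (rule pt_tower(1)[OF f' 6(1)[OF d] 6(1)[OF ds] 6(1)[OF B] h' hc d0'])
  have towc: "fst ` set (snd (expl.tower (F (fst z)) (d (fst z)) (B (fst z)) (fst (fst (snd z))))) \<subseteq> carrier (F (fst z))" if "z \<in> ?D" for z
   unfolding expl.tower_heads[OF E[OF D[OF that]]] by (rule hc[OF that])
  have f2: "fld (on_fst N) ?D Y (on_fst p) (on_fst k) (on_fst F)"
   by (rule fld_lift[OF f 6(1) D])
  have T: "ptT (on_fst N) ?D Y (on_fst p) (on_fst k) (on_fst F) (on_fst d) (on_fst B) (on_fst u)
    (%z. snd (expl.tower (F (fst z)) (d (fst z)) (B (fst z)) (fst (fst (snd z)))))"
   unfolding ptT_def
   by (intro conjI ballI, rule f2, rule 6(1)[OF d], rule 6(1)[OF ds], rule 6(1)[OF B], rule 6(1)[OF u], rule pt_snd[OF towp], rule towc)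
  let ?R = "%z. expl.run_levels (F (fst z)) (d (fst z)) (B (fst z)) (u (fst z)) (snd (expl.tower (F (fst z)) (d (fst z)) (B (fst z)) (fst (fst (snd z))))) (vs (fst z))"
  have R: "pt (on_fst N) ?D Y (%z. enc_state (?R z))"
  proof (rule pt_run_levels[OF T 6(1)[OF vs], where m = "%z. m (fst z)"])
   show "length w = m (fst z) \<and> set w \<subseteq> carrier (F (fst z))" if "z \<in> ?D" "w \<in> set (vs (fst z))" for z w by (rule vc[OF D[OF that(1)] that(2)])
   show "z \<in> ?D ==> d (fst z) > 0" for z by (rule d0')
   show "pb (on_fst N) ?D (%z. d (fst z) ^ d (fst z) * m (fst z))" by (rule pb_reindex[OF M D])
  qed
  have Rs: "set (fst (?R z)) \<subseteq> carrier (F (fst z)) \<and> snd (?R z) \<noteq> []" if z: "z \<in> ?D" for z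
  proof
   note Ez = E[OF D[OF z]]
   show "set (fst (?R z)) \<subseteq> carrier (F (fst z))"
    unfolding expl.run_levels_prefix[OF Ez] using expl.run_shape[OF Ez vc[OF D[OF z]] towc[OF z]] by blast
   show "snd (?R z) \<noteq> []" by (rule expl.size_run_levels(1)[OF Ez c(2)[OF D[OF z]] vc[OF D[OF z]] towc[OF z] len[OF D[OF z]]])
  qed
  have hd: "pt (on_fst N) ?D Y (%z. enc_blk (hd (snd (?R z))))"
   by (rule pt_hd[OF pt_snd[OF R]]) (use Rs in blast)
  have ch: "pt (on_fst N) ?D Y (%z. enc_list (enc_vec) (map (expl.chain (F (fst z)) (d (fst z)) (js (fst z))) (fst (?R z))))"
  proof (rule pt_map[OF pt_fst[OF R]], goal_cases)
   case (1 Y')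
   let ?D' = "{(i, x). i \<in> ?D \<and> x \<in> set (fst (?R i))}"
   have D1: "\<And>y. y \<in> ?D' ==> fst y \<in> ?D" by auto
   have x: "ptF (%z. N (fst (fst z))) ?D' Y' (%z. F (fst (fst z))) (%z. snd z)"
   proof (rule ptFI, rule 1(3))
    fix y assume y: "y \<in> ?D'"
    then have "snd y \<in> set (fst (?R (fst y)))" by auto
    then show "snd y \<in> carrier (F (fst (fst y)))" using Rs[OF D1[OF y]] by blast
   qed
   show ?case by (rule pt_chain(1)[OF fld_lift[OF f' 1(1) D1] 1(1)[OF 6(1)[OF d]] 1(1)[OF 6(1)[OF js]] x])
  qed
  have "pt (on_fst N) ?D Y (%z. ?E (if snd (fst (snd z)) = [] then
    (if length (fst (?R z)) \<le> d (fst z) then (fst (fst (snd z)), fst (hd (snd (?R z))))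
    else (fst (fst (snd z)) @ concat (map (expl.chain (F (fst z)) (d (fst z)) (js (fst z))) (fst (?R z))), [])) else fst (snd z)))"
   by (rule pt_if'[where e = ?E], rule pt_null, rule pt_snd[OF 6(3)], rule pt_if'[where e = ?E], rule pt_le, rule pt_length, rule pt_fst[OF R], rule 6(1)[OF d],
     rule pt_pair, rule h', rule pt_fst[OF hd], rule pt_pair, rule pt_append, rule h', rule pt_concat, rule ch, rule pt_Nil, rule 6(2), rule 6(3))
  then show ?case by (rule pt_cong) (simp add: expl.search_step_def[OF E[OF D]] Let_def)
 qed
 then show ?thesis by (rule pt_cong) (simp add: expl.foldl_search[OF E])
qed

section \<open>Assembling the algorithm\<close>

lemma enc_list_map: "(\<And>x. x \<in> set xs ==> e (g x) = e' x) ==> enc_list e (map g xs) = enc_list e' xs"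
 by (induction xs) simp_all

abbreviation "enc_fam \<equiv> enc_list (ep enc_nat enc_elem)"
abbreviation "family_of \<equiv> map (%x :: member. (fst x, fst (snd x)))"

context expl
begin

text \<open>The bits of \<open>p ^ k\<close> are used as a list of about log q entries, whose length
  counts rounds: here for the removal of common factors with \<open>d\<close>, in
  \<open>solution\<close> for the restarts and the lengths of the chains.\<close>

definition cop where "cop d = cop_part d (bits (p ^ k)) (p ^ k - 1)"

definition unit_find where "unit_find d = find (%s. d dvd cop d * s - 1) [1..<Suc d]"

definition solution where
 "solution d vs = snd (search_n d (cop d) ((cop d * the (unit_find d) - 1) div d) (bits (p ^ k)) vs (length (bits (p ^ k))))"

lemma parameters:
 assumes d: "d > 0"
 shows "cop d > 0" "cop d dvd p ^ k - 1" "p ^ k - 1 dvd cop d * d ^ length (bits (p ^ k))" "unit_find d \<noteq> None"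
  "(cop d * the (unit_find d) - 1) div d * d + 1 = cop d * the (unit_find d)" "p ^ k - 1 < 2 ^ length (bits (p ^ k))"
proof -
 have n: "p ^ k - 1 > 0" using order_ge_2 by simp
 show l: "p ^ k - 1 < 2 ^ length (bits (p ^ k))" using less_two_power_bits[of "p ^ k"] by linarith
 show c: "cop d > 0" "cop d dvd p ^ k - 1" "p ^ k - 1 dvd cop d * d ^ length (bits (p ^ k))"
  unfolding cop_def by (rule cop_part_props(1-3)[OF n d])+
 have cop: "coprime (cop d) d" unfolding cop_def by (rule cop_part_coprime[OF n d l])
 have ex: "\<exists>s\<in>set [1..<Suc d]. d dvd cop d * s - 1" by (rule unit_exponent[OF cop d c(1)])
 then show u: "unit_find d \<noteq> None" unfolding unit_find_def find_None_iff by blast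
 then obtain s where s: "unit_find d = Some s" by blast
 have "s \<in> set [1..<Suc d]" "d dvd cop d * s - 1" using find_SomeD[OF s[unfolded unit_find_def]] by blast+
 then have "(cop d * s - 1) div d * d = cop d * s - 1" "s > 0" by (simp_all del: upt_Suc)
 then show "(cop d * the (unit_find d) - 1) div d * d + 1 = cop d * the (unit_find d)" using c(1) s by simp
qed

lemma solution_found:
 assumes d: "d > 0" and v: "\<And>j l. v j l \<in> carrier F" and vs: "vs = map (%i. map (v i) [1..<m + 1]) [1..<G d m + 1]"
 obtains C w where "set C \<subseteq> cnz" "length C \<le> d" "good d v m C d (solution d vs, w)" "subseq (map fst (solution d vs)) [1..<G d m + 1]"
 using search_found[OF v vs d prod_le_G[OF d] parameters(1-3,5,6)[OF d]] unfolding solution_def by blast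

lemma solution_ok:
 assumes d: "d > 0" and vc: "\<forall>i\<in>{1..G d m}. \<forall>l\<in>{1..m}. v i l \<in> carrier F"
  and vs: "vs = map (%i. map (v i) [1..<m + 1]) [1..<G d m + 1]"
 shows "\<exists>I J \<gamma>. enc_output I J \<gamma> = ep enc_fam enc_fam (family_of (fst (select_members (solution d vs))), family_of (snd (select_members (solution d vs)))) \<and>
   is_solution F d m v I J \<gamma>" "solution d vs \<noteq> []" "x \<in> set (solution d vs) ==> length (snd (snd x)) = d"
proof -
 \<comment> \<open>The vectors are known to lie in the carrier only for indices in range, while the
   invariants speak of all indices; outside the range \<open>v\<close> is replaced by zero.\<close>
 define v' where "v' = (%j l. if j \<in> {1..G d m} \<and> l \<in> {1..m} then v j l else \<zero>)"
 have v': "v' j l \<in> carrier F" for j l using vc by (simp add: v'_def)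
 have vs': "vs = map (%i. map (v' i) [1..<m + 1]) [1..<G d m + 1]"
  unfolding vs by (intro map_cong refl) (auto simp: v'_def)
 define ms where "ms = solution d vs"
 obtain C w where C: "set C \<subseteq> cnz" "length C \<le> d" and g: "good d v' m C d (ms, w)" and ss: "subseq (map fst ms) [1..<G d m + 1]"
  unfolding ms_def by (rule solution_found[OF d v' vs'])
 have mo: "mem_ok C d ms" and ne: "ms \<noteq> []" using g unfolding good_def by simp_all
 show "solution d vs \<noteq> []" using ne unfolding ms_def .
 show "x \<in> set (solution d vs) ==> length (snd (snd x)) = d" using mo unfolding mem_ok_def ms_def by blast
 \<comment> \<open>As a subsequence of an increasing range the indices are distinct and sorted. So
   multipliers are functions of the index, the chosen sublists have disjoint index sets, and their
   order is the one that \<open>enc_family\<close> prescribes.\<close>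
 obtain S where S: "map fst ms = nths [1..<G d m + 1] S" using ss unfolding subseq_conv_nths by blast
 have dist: "distinct (map fst ms)" and sort: "sorted (map fst ms)" unfolding S by (rule distinct_nthsI, simp, rule sorted_nths, simp del: upt_Suc)
 have rng: "fst x \<in> {1..G d m}" if "x \<in> set ms" for x
 proof -
  have "fst x \<in> set (map fst ms)" using that by simp
  then have "fst x \<in> set [1..<G d m + 1]" unfolding S by (rule in_set_nthsD)
  then show ?thesis by (simp del: upt_Suc)
 qed
 define \<gamma> where "\<gamma> = (%j. fst (the (map_of ms j)))"
 have gam: "\<gamma> (fst x) = fst (snd x)" if "x \<in> set ms" for x
 proof -
  have "map_of ms (fst x) = Some (snd x)" using dist that by simp
  then show ?thesis by (simp add: \<gamma>_def)
 qed
 obtain P Q where PQ: "select_members ms = (filter P ms, filter Q ms)" "\<And>x. \<not> (P x \<and> Q x)"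
  using select_ok(2)[OF v' d g C] by auto
 have fam: "enc_family (fst ` set (filter R ms)) \<gamma> = enc_fam (family_of (filter R ms))" for R
 proof -
  have "sorted (map fst (filter R ms))" "distinct (map fst (filter R ms))"
   using sort dist by (simp_all add: sorted_filter distinct_map_filter)
  then have "sorted_list_of_set (set (map fst (filter R ms))) = map fst (filter R ms)"
   by (rule sorted_list_of_set.idem_if_sorted_distinct)
  then have e: "sorted_list_of_set (fst ` set (filter R ms)) = map fst (filter R ms)" unfolding set_map .
  have "enc_list (%i. Node (enc_nat i) (enc_elem (\<gamma> i))) (map fst (filter R ms)) = enc_list (%x. ep enc_nat enc_elem (fst x, fst (snd x))) (filter R ms)"
   by (rule enc_list_map) (simp add: gam ep_def)
  also have "\<dots> = enc_fam (family_of (filter R ms))" by (rule enc_list_map[symmetric]) (rule refl)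
  finally show ?thesis unfolding enc_family_def e .
 qed
 have sum: "(\<Oplus>j\<in>fst ` set (filter R ms). \<gamma> j [^] d \<otimes> v j l) = lsum (map (%x. fst (snd x) [^] d \<otimes> v' (fst x) l) (filter R ms))" if l: "l \<in> {1..m}" for R l
 proof -
  have t: "\<gamma> (fst x) [^] d \<otimes> v (fst x) l = fst (snd x) [^] d \<otimes> v' (fst x) l" if "x \<in> set ms" for x
   unfolding gam[OF that] using rng[OF that] l by (simp add: v'_def)
  have tc: "fst (snd x) [^] d \<otimes> v' (fst x) l \<in> carrier F" if "x \<in> set ms" for x
   using mem_ok_carrier[OF mo that] v' by (intro m_closed nat_pow_closed)
  have "lsum (map (%j. \<gamma> j [^] d \<otimes> v j l) (map fst (filter R ms))) = (\<Oplus>j\<in>set (map fst (filter R ms)). \<gamma> j [^] d \<otimes> v j l)"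
  proof (rule lsum_finsum)
   show "distinct (map fst (filter R ms))" using dist by (rule distinct_map_filter)
   fix j assume "j \<in> set (map fst (filter R ms))"
   then obtain x where x: "x \<in> set ms" "j = fst x" by auto
   show "\<gamma> j [^] d \<otimes> v j l \<in> carrier F" unfolding x(2) t[OF x(1)] by (rule tc[OF x(1)])
  qed
  then have "(\<Oplus>j\<in>fst ` set (filter R ms). \<gamma> j [^] d \<otimes> v j l) = lsum (map (%j. \<gamma> j [^] d \<otimes> v j l) (map fst (filter R ms)))" unfolding set_map by (rule sym)
  also have "\<dots> = lsum (map (%x. fst (snd x) [^] d \<otimes> v' (fst x) l) (filter R ms))"
   unfolding map_map by (rule lsum_cong) (simp add: t)
  finally show ?thesis .
 qed
 have sol: "is_solution F d m v (fst ` set (filter P ms)) (fst ` set (filter Q ms)) \<gamma>"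
  unfolding is_solution_def
 proof (intro conjI ballI)
  show "fst ` set (filter P ms) \<subseteq> {1..G d m}" "fst ` set (filter Q ms) \<subseteq> {1..G d m}" using rng by auto
  show "fst ` set (filter P ms) \<inter> fst ` set (filter Q ms) = {}"
  proof (rule ccontr)
   assume "fst ` set (filter P ms) \<inter> fst ` set (filter Q ms) \<noteq> {}"
   then obtain j where "j \<in> fst ` set (filter P ms)" "j \<in> fst ` set (filter Q ms)" by blast
   then obtain x y where xy: "x \<in> set (filter P ms)" "y \<in> set (filter Q ms)" "j = fst x" "j = fst y" by (elim imageE)
   have "inj_on fst (set ms)" using dist by (simp add: distinct_map)
   then have "x = y" using xy unfolding inj_on_def by simp
   then show False using xy(1,2) PQ(2)[of x] by simp
  qed
  have "filter P ms \<noteq> []" using select_ok(1)[OF v' d g C] PQ(1) by simp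
  then show "fst ` set (filter P ms) \<noteq> {}" unfolding image_is_empty set_empty .
  show "\<gamma> j \<in> carrier F - {\<zero>}" if j: "j \<in> fst ` set (filter P ms) \<union> fst ` set (filter Q ms)" for j
  proof -
   obtain x where x: "x \<in> set ms" "j = fst x" using j by auto
   have "fst (snd x) \<in> cnz" using mo x(1) unfolding mem_ok_def by blast
   then show ?thesis unfolding x(2) gam[OF x(1)] by simp
  qed
  show "(\<Oplus>i\<in>fst ` set (filter P ms). \<gamma> i [^] d \<otimes> v i l) = (\<Oplus>j\<in>fst ` set (filter Q ms). \<gamma> j [^] d \<otimes> v j l)" if l: "l \<in> {1..m}" for l
   unfolding sum[OF l] using select_ok(3)[OF v' d g C l] PQ(1) by simp
 qed
 have "enc_output (fst ` set (filter P ms)) (fst ` set (filter Q ms)) \<gamma> =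
   ep enc_fam enc_fam (family_of (fst (select_members ms)), family_of (snd (select_members ms)))"
  unfolding enc_output_def fam PQ(1) by (simp add: ep_def)
 with sol show "\<exists>I J \<gamma>. enc_output I J \<gamma> = ep enc_fam enc_fam (family_of (fst (select_members (solution d vs))), family_of (snd (select_members (solution d vs)))) \<and>
   is_solution F d m v I J \<gamma>" unfolding ms_def by blast
qed

lemma k_le_bits: "k \<le> length (bits (p ^ k))"
proof -
 have "(2 :: nat) ^ k \<le> p ^ k" by (rule power_mono) (use p_gt_1 in simp_all)
 also have "\<dots> < 2 ^ length (bits (p ^ k))" by (rule less_two_power_bits)
 finally show ?thesis by simp
qed

lemma size_elem: "x \<in> carrier F ==> size (enc_elem x) \<le> length (bits (p ^ k)) * (2 * length (bits (p ^ k)) + 1)"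
proof -
 assume x: "x \<in> carrier F"
 have "p ^ 1 \<le> p ^ k" by (rule power_increasing) (use k_pos p_gt_1 in simp_all)
 then have p: "p < 2 ^ length (bits (p ^ k))" using less_two_power_bits[of "p ^ k"] by simp
 have "size (enc_elem x) \<le> length x * (2 * length (bits (p ^ k)) + 1)"
 proof (rule size_enc_list_le, rule size_enc_nat_le)
  fix y assume "y \<in> set x"
  then have "y < p" using x carrier_iff by auto
  then show "y < 2 ^ length (bits (p ^ k))" using p by simp
 qed
 also have "\<dots> \<le> length (bits (p ^ k)) * (2 * length (bits (p ^ k)) + 1)" using x carrier_iff k_le_bits by (intro mult_le_mono1) simp
 finally show ?thesis .
qed

text \<open>Time is measured in \<open>G\<close> and log q, so the input itself has to be polynomial
  in these: \<open>k\<close> and the digits of \<open>p\<close> are bounded by the number of bits of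
  \<open>p ^ k\<close>.\<close>

lemma size_enc_input:
 assumes vc: "\<forall>i\<in>{1..G d m}. \<forall>l\<in>{1..m}. v i l \<in> carrier F" and L: "L = length (bits (p ^ k))"
 shows "size (enc_input p k F d m v) \<le> 2 * L + L * (L * (L * (2 * L + 1) + 1) + 1) + 2 * d + G d m * (m * (L * (2 * L + 1) + 1) + 1) + 3"
proof -
 have p: "size (enc_nat p) \<le> 2 * L"
 proof (rule size_enc_nat_le)
  have "p ^ 1 \<le> p ^ k" by (rule power_increasing) (use k_pos p_gt_1 in simp_all)
  then show "p < 2 ^ L" using less_two_power_bits[of "p ^ k"] unfolding L by simp
 qed
 have el: "size (enc_elem x) \<le> L * (2 * L + 1)" if "x \<in> carrier F" for x unfolding L by (rule size_elem[OF that])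
 have row: "size (enc_vec (map h [a..<b])) \<le> (b - a) * (L * (2 * L + 1) + 1)" if "\<And>j. j \<in> {a..<b} ==> h j \<in> carrier F" for h a b
 proof -
  have "size (enc_vec (map h [a..<b])) \<le> length (map h [a..<b]) * (L * (2 * L + 1) + 1)"
   by (rule size_enc_list_le) (use that el in auto)
  then show ?thesis by simp
 qed
 have sc: "size (enc_list (enc_vec) (structure_constants k F)) \<le> L * (L * (L * (2 * L + 1) + 1) + 1)"
 proof -
  have "size (enc_list (enc_vec) (structure_constants k F)) \<le> length (structure_constants k F) * (L * (L * (2 * L + 1) + 1) + 1)"
  proof (rule size_enc_list_le)
   fix xs assume "xs \<in> set (structure_constants k F)"
   then obtain i where i: "i < k" "xs = map (%j. unit_coords k i \<otimes> unit_coords k j) [0..<k]" unfolding structure_constants_def by auto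
   have "size (enc_vec xs) \<le> (k - 0) * (L * (2 * L + 1) + 1)" unfolding i(2) by (rule row) (use i(1) in simp)
   also have "\<dots> \<le> L * (L * (2 * L + 1) + 1)" using k_le_bits unfolding L by (intro mult_le_mono1) simp
   finally show "size (enc_vec xs) \<le> L * (L * (2 * L + 1) + 1)" .
  qed
  also have "\<dots> \<le> L * (L * (L * (2 * L + 1) + 1) + 1)" using k_le_bits unfolding L by (intro mult_le_mono1) (simp add: structure_constants_def)
  finally show ?thesis .
 qed
 have vv: "size (enc_list (enc_vec) (map (%i. map (%j. v i j) [1..<m + 1]) [1..<G d m + 1])) \<le> G d m * (m * (L * (2 * L + 1) + 1) + 1)"
 proof -
  have "size (enc_list (enc_vec) (map (%i. map (%j. v i j) [1..<m + 1]) [1..<G d m + 1])) \<le>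
    length (map (%i. map (%j. v i j) [1..<m + 1]) [1..<G d m + 1]) * (m * (L * (2 * L + 1) + 1) + 1)"
  proof (rule size_enc_list_le)
   fix xs assume "xs \<in> set (map (%i. map (%j. v i j) [1..<m + 1]) [1..<G d m + 1])"
   then obtain i where i': "i \<in> set [1..<G d m + 1]" "xs = map (%j. v i j) [1..<m + 1]" unfolding set_map by (elim imageE)
   have i: "i \<in> {1..G d m}" using i'(1) by (auto simp del: upt_Suc)
   have "size (enc_vec xs) \<le> (m + 1 - 1) * (L * (2 * L + 1) + 1)" unfolding i'(2) by (rule row) (use i vc in auto)
   then show "size (enc_vec xs) \<le> m * (L * (2 * L + 1) + 1)" by simp
  qed
  then show ?thesis by (simp del: upt_Suc)
 qed
 show ?thesis unfolding enc_input_def enc_field_def btree.size using p sc vv size_enc_nat_le_nat[of d] by linarith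
qed

end

text \<open>Everything has to be measured by \<open>G\<close>, also the final dimension
  \<open>d ^ d * m\<close>, which is not polynomial in \<open>d\<close> and \<open>m\<close>. It is
  \<open>d\<close> times \<open>d ^ (d - 1) * m\<close>. The latter is below the last factor of the
  product in \<open>prod_le_G\<close>, and the former is below \<open>G\<close> since
  \<open>d < 2 ^ d\<close>.\<close>

lemma d_less_G: "d > 0 ==> m > 0 ==> d < G d m" and m_less_G: "d > 0 ==> m > 0 ==> m < G d m"
 and dim_le_G: "d > 0 ==> m > 0 ==> d ^ d * m \<le> G d m * G d m"
proof -
 assume d: "d > 0" and m: "m > 0"
 have G: "(m + 1) ^ d \<le> G d m" unfolding G_def using d by simp
 have "d < 2 ^ d" by simp
 also have "(2 :: nat) ^ d \<le> (m + 1) ^ d" by (rule power_mono) (use m in simp_all)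
 finally show dG: "d < G d m" using G by simp
 have "(m + 1) ^ 1 \<le> (m + 1) ^ d" by (rule power_increasing) (use d in simp_all)
 then show "m < G d m" using G by simp
 obtain e where e: "d = Suc e" using d by (cases d) auto
 have "(%l. d ^ l * m + 1) e dvd (\<Prod>l<d. d ^ l * m + 1)" by (rule dvd_prodI) (use e in auto)
 then have "d ^ e * m + 1 \<le> (\<Prod>l<d. d ^ l * m + 1)" by (intro dvd_imp_le) simp_all
 also have "\<dots> \<le> G d m" by (rule prod_le_G[OF d])
 finally have "d ^ e * m \<le> G d m" by simp
 then have "d * (d ^ e * m) \<le> G d m * G d m" using dG by (intro mult_le_mono) simp_all
 moreover have "d ^ d * m = d * (d ^ e * m)" by (subst (2) e) simp
 ultimately show "d ^ d * m \<le> G d m * G d m" by (simp only:)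
qed

lemma pt_solution:
 fixes p k d m :: "'i \<Rightarrow> nat" and F :: "'i \<Rightarrow> nat list ring" and v :: "'i \<Rightarrow> nat \<Rightarrow> nat \<Rightarrow> nat list"
 defines "N \<equiv> %i. G (d i) (m i) + length (bits (p i ^ k i))"
  and "Xi \<equiv> %i. enc_input (p i) (k i) (F i) (d i) (m i) (v i)"
  and "vs \<equiv> %i. map (%j. map (v i j) [1..<m i + 1]) [1..<G (d i) (m i) + 1]"
 assumes H: "\<And>i. i \<in> D ==> expl (p i) (k i) (F i)" and d0: "\<And>i. i \<in> D ==> d i > 0" and m0: "\<And>i. i \<in> D ==> m i > 0"
  and vc: "\<And>i. i \<in> D ==> \<forall>j\<in>{1..G (d i) (m i)}. \<forall>l\<in>{1..m i}. v i j l \<in> carrier (F i)"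
 shows "pt N D Xi (%i. ep enc_fam enc_fam (family_of (fst (select_members (expl.solution (p i) (k i) (F i) (d i) (vs i)))),
   family_of (snd (select_members (expl.solution (p i) (k i) (F i) (d i) (vs i))))))"
proof -
 let ?G = "%i. G (d i) (m i)" and ?L = "%i. length (bits (p i ^ k i))"
 have pN: "pb N D N" by (rule pb_N)
 have pG: "pb N D ?G" by (rule pb_le[OF pN]) (simp add: N_def)
 have pL: "pb N D ?L" by (rule pb_le[OF pN]) (simp add: N_def)
 have pm: "pb N D m" by (rule pb_le[OF pG]) (use m_less_G d0 m0 less_imp_le in blast)
 have pd: "pb N D d" by (rule pb_le[OF pG]) (use d_less_G d0 m0 less_imp_le in blast)
 have "pb N D (%i. size (Xi i))"
 proof (rule pb_le)
  show "pb N D (%i. 2 * ?L i + ?L i * (?L i * (?L i * (2 * ?L i + 1) + 1) + 1) + 2 * d i + ?G i * (m i * (?L i * (2 * ?L i + 1) + 1) + 1) + 3)"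
   by (intro pb_add pb_mult pb_const pL pG pm pd)
 qed (use expl.size_enc_input[OF H vc refl] in \<open>simp add: Xi_def\<close>)
 then have self: "pt N D Xi Xi" by (rule pt_id)
 have f: "fld N D Xi p k F" unfolding fld_def
 proof (intro conjI ballI)
  show "pt N D Xi (%i. enc_nat (p i))" by (rule pt_cong[OF pt_left[OF pt_left[OF self]]]) (simp add: Xi_def enc_input_def enc_field_def)
  show "pt N D Xi (%i. enc_list (enc_vec) (structure_constants (k i) (F i)))"
   by (rule pt_cong[OF pt_right[OF pt_left[OF self]]]) (simp add: Xi_def enc_input_def enc_field_def)
 qed (rule H)
 have d: "pt N D Xi (%i. enc_nat (d i))" by (rule pt_cong[OF pt_left[OF pt_right[OF self]]]) (simp add: Xi_def enc_input_def)
 have vp: "pt N D Xi (%i. enc_list (enc_vec) (vs i))"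
  by (rule pt_cong[OF pt_right[OF pt_right[OF self]]]) (simp add: Xi_def enc_input_def vs_def del: upt_Suc)
 have lv: "length (vs i) = ?G i" for i by (simp add: vs_def del: upt_Suc)
 \<comment> \<open>The list of input vectors has length \<open>G\<close>, which exceeds
   \<open>d i\<close>, so it can serve as the ruler from which the range up to \<open>d i\<close> is
   cut.\<close>
 have ds: "pt N D Xi (%i. enc_elem [0..<d i])"
  by (rule pt_upt[OF vp d]) (unfold lv, rule less_imp_le, rule d_less_G[OF d0 m0])
 have q: "pt N D Xi (%i. enc_nat (p i ^ k i))" by (rule pt_field_order[OF f])
 note js = pt_bits[OF q]
 have q1: "pt N D Xi (%i. enc_nat (p i ^ k i - 1))" by (rule pt_minus, rule q, rule pt_nat_const, rule self)
 have B: "pt N D Xi (%i. enc_nat (expl.cop (p i) (k i) (d i)))"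
  by (rule pt_cong[OF pt_cop_part[OF q1 d ds js d0]]) (simp_all add: expl.cop_def[OF H])
 have uf: "pt N D Xi (%i. eo enc_nat (expl.unit_find (p i) (k i) (d i)))"
 proof -
  have "pt N D Xi (%i. eo enc_nat (find (%s. d i dvd expl.cop (p i) (k i) (d i) * s - 1) [1..<Suc (d i)]))"
  proof (rule pt_find[OF pt_upt1[OF ds]], goal_cases)
   case (1 Y)
   show ?case by (rule pt_dvd, rule pt_minus, rule pt_mult, rule 1(1)[OF B], rule 1(3), rule pt_nat_const, rule 1(2), rule 1(1)[OF d]) (use d0 in auto)
  qed
  then show ?thesis by (rule pt_cong) (simp add: expl.unit_find_def[OF H])
 qed
 have th: "pt N D Xi (%i. enc_nat (the (expl.unit_find (p i) (k i) (d i))))"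
  by (rule pt_the[OF uf]) (rule expl.parameters(4)[OF H d0])
 have u: "pt N D Xi (%i. enc_nat ((expl.cop (p i) (k i) (d i) * the (expl.unit_find (p i) (k i) (d i)) - 1) div d i))"
  by (rule pt_div, rule pt_minus, rule pt_mult, rule B, rule th, rule pt_nat_const, rule self, rule d, rule d0)
 have M: "pb N D (%i. d i ^ d i * m i)"
 proof (rule pb_le)
  show "pb N D (%i. ?G i * ?G i)" by (intro pb_mult pG)
 qed (use dim_le_G d0 m0 in blast)
 have vw: "length w = m i \<and> set w \<subseteq> carrier (F i)" if "i \<in> D" "w \<in> set (vs i)" for i w
  using that vc[OF that(1)] by (auto simp: vs_def simp del: upt_Suc)
 have pr: "(\<Prod>l<d i. d i ^ l * m i + 1) \<le> length (vs i)" if "i \<in> D" for i unfolding lv by (rule prod_le_G[OF d0[OF that]])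
 have ms: "pt N D Xi (%i. enc_list enc_mem (expl.solution (p i) (k i) (F i) (d i) (vs i)))"
  by (rule pt_cong[OF pt_snd[OF pt_search[OF f d ds B u js vp vw d0 M pr]]]) (simp_all add: expl.solution_def[OF H])
 have sel: "pt N D Xi (%i. ep (enc_list enc_mem) (enc_list enc_mem) (select_members (expl.solution (p i) (k i) (F i) (d i) (vs i))))"
 proof (rule pt_select_members[OF ms, where n = d])
  show "expl.solution (p i) (k i) (F i) (d i) (vs i) \<noteq> []" if "i \<in> D" for i
   by (rule expl.solution_ok(2)[OF H[OF that] d0[OF that] vc[OF that]]) (simp add: vs_def)
  show "length (snd (snd x)) = d i" if "i \<in> D" "x \<in> set (expl.solution (p i) (k i) (F i) (d i) (vs i))" for i x
   by (rule expl.solution_ok(3)[OF H[OF that(1)] d0[OF that(1)] vc[OF that(1)] _ that(2)]) (simp add: vs_def)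
 qed
 have fam: "pt N D Xi (%i. enc_fam (family_of (xs i)))" if xs: "pt N D Xi (%i. enc_list enc_mem (xs i))" for xs
 proof (rule pt_map[OF xs], goal_cases)
  case (1 Y) show ?case by (rule pt_pair, rule pt_fst[OF 1(3)], rule pt_fst[OF pt_snd[OF 1(3)]])
 qed
 show ?thesis by (rule pt_pair, rule fam[OF pt_fst[OF sel]], rule fam[OF pt_snd[OF sel]])
qed

lemma runs_wrap: "runs (Assign 0 (NodeE (Var 0) LeafE)) x 4 (Node x Leaf)"
 using runs_Assign'[of "NodeE (Var 0) LeafE" x "Node x Leaf"] by (simp add: numeral_eq_Suc)

lemma runs_unwrap: "runs (Assign 0 (Left (Var 0))) (Node y Leaf) 3 y"
 using runs_Assign'[of "Left (Var 0)" "Node y Leaf" y] by (simp add: numeral_eq_Suc)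

theorem theorem3:
  shows "\<exists>(P :: prog) (c :: nat).
    \<forall>(p :: nat) (k :: nat) (F :: nat list ring) (d :: nat) (m :: nat) (v :: nat \<Rightarrow> nat \<Rightarrow> nat list).
      explicit_field p k F \<and> d > 0 \<and> m > 0 \<and> d dvd order F - 1 \<and>
      (\<forall>i\<in>{1..G d m}. \<forall>l\<in>{1..m}. v i l \<in> carrier F) \<longrightarrow>
      (\<exists>I J \<gamma> t.
         computes_in P (enc_input p k F d m v) (enc_output I J \<gamma>) t \<and>
         real t \<le> real c * (real (G d m) + log 2 (real (order F))) ^ c \<and>
         is_solution F d m v I J \<gamma>)"
proof -
 let ?p = "%i :: nat \<times> nat \<times> nat list ring \<times> nat \<times> nat \<times> (nat \<Rightarrow> nat \<Rightarrow> nat list). fst i"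
 let ?k = "%i. fst (snd i)" and ?F = "%i. fst (snd (snd i))" and ?d = "%i. fst (snd (snd (snd i)))"
 let ?m = "%i. fst (snd (snd (snd (snd i))))" and ?v = "%i. snd (snd (snd (snd (snd i))))"
 let ?D = "{i. expl (?p i) (?k i) (?F i) \<and> ?d i > 0 \<and> ?m i > 0 \<and> (\<forall>j\<in>{1..G (?d i) (?m i)}. \<forall>l\<in>{1..?m i}. ?v i j l \<in> carrier (?F i))}"
 let ?N = "%i. G (?d i) (?m i) + length (bits (?p i ^ ?k i))"
 let ?X = "%i. enc_input (?p i) (?k i) (?F i) (?d i) (?m i) (?v i)"
 let ?s = "%i. select_members (expl.solution (?p i) (?k i) (?F i) (?d i) (map (%j. map (?v i j) [1..<?m i + 1]) [1..<G (?d i) (?m i) + 1]))"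
 let ?Y = "%i. ep enc_fam enc_fam (family_of (fst (?s i)), family_of (snd (?s i)))"
 have "pt ?N ?D ?X ?Y" by (rule pt_solution) blast+
 then obtain P T where T: "pb ?N ?D T" "\<And>i r. i \<in> ?D ==> \<exists>t\<le>T i. runs P (Node (?X i) r) t (Node (?Y i) r)"
  by (rule ptE) blast
 obtain c where c: "\<And>i. i \<in> ?D ==> T i \<le> (?N i + 2) ^ c" using T(1) unfolding pb_def by blast
 \<comment> \<open>The input is placed above an empty stack before \<open>P\<close> runs, and the
   stack is removed afterwards.\<close>
 let ?Q = "Seq (Assign 0 (NodeE (Var 0) LeafE)) (Seq P (Assign 0 (Left (Var 0))))"
 \<comment> \<open>Used both as factor and as exponent: 7 = 4 + 3 is the time for adding and
   removing the stack, \<open>4 ^ c\<close> comes from \<open>N4\<close>, and the summand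
   \<open>c\<close> makes the exponent at least \<open>c\<close>.\<close>
 let ?c = "7 + 4 ^ c + c"
 show ?thesis
 proof (rule exI[of _ ?Q], rule exI[of _ ?c], intro allI impI)
  fix p k :: nat and F d m v
  assume a: "explicit_field p k F \<and> d > 0 \<and> m > 0 \<and> d dvd order F - 1 \<and> (\<forall>i\<in>{1..G d m}. \<forall>l\<in>{1..m}. v i l \<in> carrier F)"
  define i where "i = (p, k, F, d, m, v)"
  interpret ex: expl p k F using a expl_iff by blast
  have iD: "i \<in> ?D" using a ex.expl_axioms by (simp add: i_def)
  obtain t where t: "t \<le> T i" "runs P (Node (?X i) Leaf) t (Node (?Y i) Leaf)" using T(2)[OF iD] by blast
  obtain I J \<gamma> where S: "enc_output I J \<gamma> = ?Y i" "is_solution F d m v I J \<gamma>"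
   using ex.solution_ok(1)[of d m v, OF _ _ refl] a unfolding i_def fst_conv snd_conv by blast
  have "runs ?Q (?X i) (4 + (t + 3)) (?Y i)" by (rule runs_Seq[OF runs_wrap runs_Seq[OF t(2) runs_unwrap]])
  then have "runs ?Q (enc_input p k F d m v) (4 + (t + 3)) (enc_output I J \<gamma>)" unfolding S(1) unfolding i_def fst_conv snd_conv .
  from this[unfolded runs_def] have comp: "computes_in ?Q (enc_input p k F d m v) (enc_output I J \<gamma>) (4 + (t + 3))"
   unfolding computes_in_def by (intro exI[of _ "st (enc_output I J \<gamma>)"] conjI) simp_all
  let ?x = "real (G d m) + log 2 (real (order F))"
  let ?L = "length (bits (p ^ k))"
  have q: "order F = p ^ k" "p ^ k \<ge> 2" by (rule ex.order_eq, rule ex.order_ge_2)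
  have G1: "1 \<le> G d m" using d_less_G[of d m] a by linarith
  have r: "2 \<le> real (p ^ k)" using of_nat_mono[OF q(2), where 'a = real] by simp
  have lg: "real ?L \<le> 1 + log 2 (real (p ^ k))"
  proof -
   have "(2 :: nat) ^ ?L \<le> 2 * p ^ k" by (rule two_power_bits_le) (use q(2) in linarith)
   then have "real (2 ^ ?L) \<le> real (2 * p ^ k)" by (rule of_nat_mono)
   then have pw: "2 powr real ?L \<le> 2 * real (p ^ k)" by (simp add: powr_realpow)
   have "real ?L \<le> log 2 (2 * real (p ^ k))" by (rule le_log_iff[THEN iffD2]) (use r pw in linarith)+
   also have "\<dots> = 1 + log 2 (real (p ^ k))" using ex.p_gt_1 by (simp add: log_mult)
   finally show ?thesis .
  qed
  have l0: "0 \<le> log 2 (real (p ^ k))" by (rule zero_le_log_cancel_iff[THEN iffD2]) (use r in linarith)+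
  have x1: "1 \<le> ?x" unfolding q(1) using G1 l0 by linarith
  \<comment> \<open>The bit length is at most 1 plus the logarithm, and the resulting constant 3 is
    at most \<open>3 * G d m\<close>.\<close>
  have N4: "real (G d m + ?L + 2) \<le> 4 * ?x" unfolding q(1) using lg l0 G1 by simp
  have "real t \<le> real (T i)" using t(1) by simp
  also have "\<dots> \<le> real ((G d m + ?L + 2) ^ c)" using c[OF iD] by (intro of_nat_mono) (simp add: i_def)
  also have "\<dots> = real (G d m + ?L + 2) ^ c" by simp
  also have "\<dots> \<le> (4 * ?x) ^ c" by (rule power_mono[OF N4]) simp
  also have "\<dots> = 4 ^ c * ?x ^ c" by (rule power_mult_distrib)
  also have "\<dots> \<le> 4 ^ c * ?x ^ ?c" by (intro mult_left_mono power_increasing x1) simp_all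
  finally have b: "real t \<le> 4 ^ c * ?x ^ ?c" .
  have h: "(7 + real c) * 1 \<le> (7 + real c) * ?x ^ ?c" by (rule mult_left_mono[OF one_le_power[OF x1]]) simp
  have "real (4 + (t + 3)) \<le> (7 + real c) * 1 + real t" by simp
  also have "\<dots> \<le> (7 + real c) * ?x ^ ?c + 4 ^ c * ?x ^ ?c" by (rule add_mono[OF h b])
  also have "\<dots> = real ?c * ?x ^ ?c" by (simp add: algebra_simps)
  finally have "real (4 + (t + 3)) \<le> real ?c * ?x ^ ?c" .
  with comp S(2) show "\<exists>I J \<gamma> t. computes_in ?Q (enc_input p k F d m v) (enc_output I J \<gamma>) t \<and>
     real t \<le> real ?c * ?x ^ ?c \<and> is_solution F d m v I J \<gamma>" by blast
 qed
qed

end
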